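(* Let $U,U'\subseteq M$ be open subsets of the globally hyperbolic spacetime $M$, and let $R\ge\frac12$. (i) We have the locality property $$\{\mathcal{A}_{\mathrm{cl}}(U),\mathcal{A}_{\mathrm{cl}}(U')\}_{\mathrm{cov}}=0\quad\text{and}\quad[\mathcal{A}(U),\mathcal{A}(U')]_{\star_{\mathrm{cov}}}=0$$ whenever $U$ and $U'$ are spacelike. (ii) For $U\subseteq U'$ we have $\mathcal{A}_{\mathrm{cl}}(U)\subseteq\mathcal{A}_{\mathrm{cl}}(U')$ and $\mathcal{A}(U)\subseteq\mathcal{A}(U')$. (iii) We have $\bigcup_{U\subseteq M\text{ open}}\mathcal{A}_{\mathrm{cl}}(U)=\mathcal{A}_{\mathrm{cl}}(M)$ and $\bigcup_{U\subseteq M\text{ open}}\mathcal{A}(U)=\mathcal{A}(M)$.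
   Context: Geometry. Everything is smooth. $(M,g)$ is a connected time-oriented Lorentz manifold of signature $(+,-,\ldots,-)$ which is globally hyperbolic (no closed causal curves, all diamonds $J_M^+(p)\cap J_M^-(q)$ compact, $J_M^\pm$ = causal future/past, $J_M(A)=J_M^+(A)\cup J_M^-(A)$). $U,U'$ are spacelike if $J_M(U)\cap U'=\emptyset$. $E\to M$ is a real vector bundle with non-degenerate fiber metric $h$ and metric connection $\nabla^E$, and $D=\Box^\nabla+B$ with $B=B^*\in\Gamma^\infty(\operatorname{End}(E))$ ($\Box^\nabla$ the d'Alembert operator of $\nabla^E$ and $g$, adjoint w.r.t. $h$). $\mu_g$ is the metric density, $h^{-1}$ the induced metric on $E^*$. $D^{\mathrm T}$ on $E^*$ is defined by $\int_M(D^{\mathrm T}\varphi)\cdot u\,\mu_g=\int_M\varphi\cdot(Du)\,\mu_g$. The Green operators $F_M^\pm\colon\Gamma_0^\infty(E^* )\to\Gamma^\infty(E^* )$ of $D^{\mathrm T}$ are the unique continuous linear maps with $D^{\mathrm T}F_M^\pm=\mathrm{id}=F_M^\pm D^{\mathrm T}$ on $\Gamma_0^\infty(E^* )$ and $\operatorname{supp}F_M^\pm\varphi\subseteq J_M^\pm(\operatorname{supp}\varphi)$; $F_M=F_M^+-F_M^-$. Algebra. $V_{\mathrm{cov}}=\Gamma_0^\infty(E^* )$ (LF topology, purely even), $\Lambda_{\mathrm{cov}}(\varphi,\psi)=\int_Mh^{-1}(F_M(\varphi),\psi)\,\mu_g$ (antisymmetric, continuous). $\mathrm{S}^\bullet(V)=\bigoplus_n\mathrm{S}^n(V)$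 with $\mathrm{S}^n(V)\subseteq V^{\otimes n}$ the symmetric tensors and product $\mu$ the symmetrized tensor product. $P_\Lambda(v_1\cdots v_n\otimes w_1\cdots w_m)=\sum_{k,\ell}\Lambda(v_k,w_\ell)\,v_1\cdots\widehat{v_k}\cdots v_n\otimes w_1\cdots\widehat{w_\ell}\cdots w_m$ (hats denote omission; zero if a factor is constant). $\{a,b\}_{\mathrm{cov}}=2\mu(P_{\Lambda_{\mathrm{cov}}}(a\otimes b))$ on $\mathrm{S}^\bullet(V_{\mathrm{cov}})$. $\mathcal{W}_R(V_{\mathrm{cov}}\otimes\mathbb{C},\star_{\mathrm{cov}})$ is $\mathrm{S}^\bullet(V_{\mathrm{cov}}\otimes\mathbb{C})$ with product $a\star_{\mathrm{cov}}b=\sum_k\frac1{k!}(\frac{\mathrm{i}\hbar}{2})^k\mu(P_{\Lambda_{\mathrm{cov}}}^k(a\otimes b))$, $\hbar\in\mathbb{R}$ ($\Lambda_{\mathrm{cov}}$ extended bilinearly), the complex conjugation as involution, and the topology of all seminorms $p_R(a)=\sum_np^n(a_n)n!^R$ ($p$ a continuous seminorm, $p^n$ its projective tensor power). $\langle\ker F_M\rangle\subseteq \mathrm{S}^\bullet(V_{\mathrm{cov}})$ is the ideal generated by $\ker F_M$; it is a Poisson ideal, and $\langle\ker F_M\rangle\otimes\mathbb{C}$ is a $^*$-ideal for $\star_{\mathrm{cov}}$. Local algebras. For non-empty open $U\subseteq M$, $\tilde{\mathcal{A}}_{\mathrm{cl}}(U)\subseteq \mathrm{S}^\bullet(V_{\mathrm{cov}})$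 is the unital Poisson subalgebra, and $\tilde{\mathcal{A}}(U)\subseteq\mathcal{W}_R(V_{\mathrm{cov}}\otimes\mathbb{C},\star_{\mathrm{cov}})$ the unital $^*$-subalgebra, generated by those $\varphi\in\Gamma_0^\infty(E^* )$ with $\operatorname{supp}\varphi\subseteq U$. For $U=\emptyset$ these are the scalar multiples of the unit. $\mathcal{A}_{\mathrm{cl}}(U)$ and $\mathcal{A}(U)$ are their images in $\mathrm{S}^\bullet(V_{\mathrm{cov}})/\langle\ker F_M\rangle$ and $\mathcal{W}_R(V_{\mathrm{cov}}\otimes\mathbb{C},\star_{\mathrm{cov}})/(\langle\ker F_M\rangle\otimes\mathbb{C})$, respectively, with the induced bracket and product. *)

theory Defs
  imports
    "HOL-Analysis.Analysis"
    "HOL-Algebra.QuotRing"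
    "HOL-Algebra.Module"
    "HOL-Combinatorics.Permutations"
    "HOL-Library.Function_Algebras"
begin

section \<open>Smooth maps between Euclidean spaces\<close>

text \<open>Both notions are meant for open \<open>S\<close>; then \<open>Ck k S f\<close> is the usual
  \<open>f \<in> C^k(S)\<close>.\<close>

primrec Ck :: "nat \<Rightarrow> 'a::euclidean_space set \<Rightarrow> ('a \<Rightarrow> 'b::real_normed_vector) \<Rightarrow> bool" where
  "Ck 0 S f \<longleftrightarrow> continuous_on S f"
| "Ck (Suc k) S f \<longleftrightarrow> (\<forall>x\<in>S. f differentiable (at x)) \<and>
     (\<forall>b\<in>Basis. Ck k S (\<lambda>x. frechet_derivative f (at x) b))"

definition smooth_on :: "'a::euclidean_space set \<Rightarrow> ('a \<Rightarrow> 'b::real_normed_vector) \<Rightarrow> bool" where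
  "smooth_on S f \<longleftrightarrow> (\<forall>k. Ck k S f)"

text \<open>Iterated partial derivatives.\<close>

definition iter_pd :: "'n list \<Rightarrow> (real^'n::finite \<Rightarrow> real) \<Rightarrow> real^'n \<Rightarrow> real" where
  "iter_pd is f = foldr (\<lambda>i u. \<lambda>y. frechet_derivative u (at y) (axis i 1)) is f"


section \<open>Manifolds\<close>

text \<open>The underlying topological space of the manifold is the type \<open>'m\<close>, the smooth structure is
  given by an atlas. A chart is an open domain together with a coordinate map (only its values on
  the domain matter).

  A tangent vector at a point assigns to each chart around that point its
  component vector, the component vectors being related by the Jacobians of the chart transitions;
  it is normalised to \<open>0\<close> at the irrelevant charts, so that equality of tangent vectors is
  equality of functions.\<close>

type_synonym ('m, 'n) chart = "'m set \<times> ('m \<Rightarrow> real^'n)"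

type_synonym ('m, 'n) tvec = "('m, 'n) chart \<Rightarrow> real^'n"

record ('m, 'n::finite) spacetime =
  atlas :: "('m, 'n) chart set"
  lmetric :: "'m \<Rightarrow> ('m, 'n) tvec \<Rightarrow> ('m, 'n) tvec \<Rightarrow> real"
  torient :: "'m \<Rightarrow> ('m, 'n) tvec"

definition cinv :: "('m, 'n::finite) chart \<Rightarrow> real^'n \<Rightarrow> 'm" where
  "cinv c = inv_into (fst c) (snd c)"

definition smooth_manifold :: "('m::topological_space, 'n::finite, 'z) spacetime_scheme \<Rightarrow> bool" where
  "smooth_manifold S \<longleftrightarrow>
     (\<Union>c\<in>atlas S. fst c) = UNIV \<and>
     (\<forall>c\<in>atlas S. open (fst c) \<and> open (snd c ` fst c) \<and>
        homeomorphism (fst c) (snd c ` fst c) (snd c) (cinv c)) \<and>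
     (\<forall>c\<in>atlas S. \<forall>d\<in>atlas S. smooth_on (snd c ` (fst c \<inter> fst d)) (\<lambda>y. snd d (cinv c y)))"

definition charts_at :: "('m, 'n::finite, 'z) spacetime_scheme \<Rightarrow> 'm \<Rightarrow> ('m, 'n) chart set" where
  "charts_at S p = {c \<in> atlas S. p \<in> fst c}"

definition smooth_fun :: "('m, 'n::finite, 'z) spacetime_scheme \<Rightarrow> 'm set \<Rightarrow> ('m \<Rightarrow> real) \<Rightarrow> bool" where
  "smooth_fun S W f \<longleftrightarrow>
     (\<forall>c\<in>atlas S. smooth_on (snd c ` (W \<inter> fst c)) (\<lambda>y. f (cinv c y)))"

text \<open>The Jacobian at \<open>p\<close> of the change of coordinates from \<open>c\<close> to \<open>d\<close>.\<close>

definition jac :: "('m, 'n::finite) chart \<Rightarrow> ('m, 'n) chart \<Rightarrow> 'm \<Rightarrow> real^'n \<Rightarrow> real^'n" where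
  "jac c d p = frechet_derivative (\<lambda>y. snd d (cinv c y)) (at (snd c p))"

definition tangent_space :: "('m, 'n::finite, 'z) spacetime_scheme \<Rightarrow> 'm \<Rightarrow> ('m, 'n) tvec set" where
  "tangent_space S p = {X.
     (\<forall>c\<in>charts_at S p. \<forall>d\<in>charts_at S p. X d = jac c d p (X c)) \<and>
     (\<forall>c. c \<notin> charts_at S p \<longrightarrow> X c = 0)}"

text \<open>\<open>cvec S c i p\<close> is the coordinate vector field \<open>\<partial>/\<partial>x^i\<close> of the chart \<open>c\<close> at \<open>p\<close>.\<close>

definition cvec :: "('m, 'n::finite, 'z) spacetime_scheme \<Rightarrow> ('m, 'n) chart \<Rightarrow> 'n \<Rightarrow> 'm \<Rightarrow> ('m, 'n) tvec" where
  "cvec S c i p = (\<lambda>d. if d \<in> charts_at S p then jac c d p (axis i 1) else 0)"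

text \<open>The derivative of \<open>f\<close> in the direction of a tangent vector at \<open>p\<close>, computed in the chart
  \<open>c\<close> around \<open>p\<close>.\<close>

definition dirder :: "('m, 'n::finite) chart \<Rightarrow> ('m \<Rightarrow> real) \<Rightarrow> 'm \<Rightarrow> ('m, 'n) tvec \<Rightarrow> real" where
  "dirder c f p X = frechet_derivative (\<lambda>y. f (cinv c y)) (at (snd c p)) (X c)"

definition pd :: "('m, 'n::finite) chart \<Rightarrow> 'n \<Rightarrow> ('m \<Rightarrow> real) \<Rightarrow> 'm \<Rightarrow> real" where
  "pd c i f p = frechet_derivative (\<lambda>y. f (cinv c y)) (at (snd c p)) (axis i 1)"


section \<open>Time-oriented Lorentz manifolds and causality\<close>

definition gmat :: "('m, 'n::finite, 'z) spacetime_scheme \<Rightarrow> ('m, 'n) chart \<Rightarrow> 'm \<Rightarrow> real^'n^'n" where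
  "gmat S c p = (\<chi> i j. lmetric S p (cvec S c i p) (cvec S c j p))"

text \<open>A Lorentz metric of signature \<open>(+,-,\<dots>,-)\<close>: \<open>b\<close> below is an orthonormal basis.\<close>

definition lorentz_metric :: "('m, 'n::finite, 'z) spacetime_scheme \<Rightarrow> bool" where
  "lorentz_metric S \<longleftrightarrow>
     (\<forall>p. \<forall>X\<in>tangent_space S p. \<forall>Y\<in>tangent_space S p. \<forall>Z\<in>tangent_space S p. \<forall>a.
        lmetric S p (\<lambda>c. a *\<^sub>R X c + Y c) Z = a * lmetric S p X Z + lmetric S p Y Z) \<and>
     (\<forall>p. \<forall>X\<in>tangent_space S p. \<forall>Y\<in>tangent_space S p. lmetric S p X Y = lmetric S p Y X) \<and>
     (\<forall>p. \<exists>(b :: 'n \<Rightarrow> ('m, 'n) tvec) i0. (\<forall>i. b i \<in> tangent_space S p) \<and>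
        (\<forall>i j. lmetric S p (b i) (b j) = (if i \<noteq> j then 0 else if i = i0 then 1 else -1))) \<and>
     (\<forall>c\<in>atlas S. \<forall>i j. smooth_fun S (fst c) (\<lambda>p. gmat S c p $ i $ j))"

text \<open>The time orientation is given by a smooth timelike vector field.\<close>

definition time_oriented :: "('m, 'n::finite, 'z) spacetime_scheme \<Rightarrow> bool" where
  "time_oriented S \<longleftrightarrow>
     (\<forall>p. torient S p \<in> tangent_space S p \<and> lmetric S p (torient S p) (torient S p) > 0) \<and>
     (\<forall>c\<in>atlas S. \<forall>i. smooth_fun S (fst c) (\<lambda>p. torient S p c $ i))"

definition future_causal :: "('m, 'n::finite, 'z) spacetime_scheme \<Rightarrow> 'm \<Rightarrow> ('m, 'n) tvec \<Rightarrow> bool" where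
  "future_causal S p X \<longleftrightarrow> X \<in> tangent_space S p \<and> X \<noteq> (\<lambda>_. 0) \<and>
     lmetric S p X X \<ge> 0 \<and> lmetric S p (torient S p) X > 0"

definition smooth_curve :: "('m::topological_space, 'n::finite, 'z) spacetime_scheme \<Rightarrow> real set \<Rightarrow> (real \<Rightarrow> 'm) \<Rightarrow> bool" where
  "smooth_curve S I \<gamma> \<longleftrightarrow> continuous_on I \<gamma> \<and>
     (\<forall>c\<in>atlas S. smooth_on {t \<in> I. \<gamma> t \<in> fst c} (\<lambda>t. snd c (\<gamma> t)))"

definition velocity :: "('m, 'n::finite, 'z) spacetime_scheme \<Rightarrow> (real \<Rightarrow> 'm) \<Rightarrow> real \<Rightarrow> ('m, 'n) tvec" where
  "velocity S \<gamma> t =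
     (\<lambda>c. if c \<in> charts_at S (\<gamma> t) then vector_derivative (\<lambda>u. snd c (\<gamma> u)) (at t) else 0)"

text \<open>Pairs of points joined by a smooth future directed causal curve. Concatenation yields the
  piecewise smooth curves, hence the closures in the following definitions.\<close>

definition causal_rel :: "('m::topological_space, 'n::finite, 'z) spacetime_scheme \<Rightarrow> 'm rel" where
  "causal_rel S = {(p, q). \<exists>\<gamma> I. open I \<and> {0..1} \<subseteq> I \<and> smooth_curve S I \<gamma> \<and>
     \<gamma> 0 = p \<and> \<gamma> 1 = q \<and> (\<forall>t\<in>{0..1}. future_causal S (\<gamma> t) (velocity S \<gamma> t))}"

definition Jplus :: "('m::topological_space, 'n::finite, 'z) spacetime_scheme \<Rightarrow> 'm set \<Rightarrow> 'm set" where
  "Jplus S A = (causal_rel S)\<^sup>* `` A"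

definition Jminus :: "('m::topological_space, 'n::finite, 'z) spacetime_scheme \<Rightarrow> 'm set \<Rightarrow> 'm set" where
  "Jminus S A = ((causal_rel S)\<inverse>)\<^sup>* `` A"

definition spacelike :: "('m::topological_space, 'n::finite, 'z) spacetime_scheme \<Rightarrow> 'm set \<Rightarrow> 'm set \<Rightarrow> bool" where
  "spacelike S U U' \<longleftrightarrow> (Jplus S U \<union> Jminus S U) \<inter> U' = {}"

definition globally_hyperbolic :: "('m::topological_space, 'n::finite, 'z) spacetime_scheme \<Rightarrow> bool" where
  "globally_hyperbolic S \<longleftrightarrow>
     (\<forall>p. (p, p) \<notin> (causal_rel S)\<^sup>+) \<and>
     (\<forall>p q. compact (Jplus S {p} \<inter> Jminus S {q}))"

definition globally_hyperbolic_spacetime ::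
    "('m::topological_space, 'n::finite, 'z) spacetime_scheme \<Rightarrow> bool" where
  "globally_hyperbolic_spacetime S \<longleftrightarrow> smooth_manifold S \<and> connected (UNIV :: 'm set) \<and>
     lorentz_metric S \<and> time_oriented S \<and> globally_hyperbolic S"

text \<open>The metric density: \<open>sqrt(\<bar>det g\<bar>) dx\<close> in each chart.\<close>

definition metric_density :: "('m::topological_space, 'n::finite, 'z) spacetime_scheme \<Rightarrow> 'm measure \<Rightarrow> bool" where
  "metric_density S \<mu> \<longleftrightarrow> sets \<mu> = sets borel \<and>
     (\<forall>c\<in>atlas S. \<forall>A\<in>sets borel. A \<subseteq> fst c \<longrightarrow>
        emeasure \<mu> A =
          (\<integral>\<^sup>+y. indicator (snd c ` A) y * ennreal (sqrt \<bar>det (gmat S c (cinv c y))\<bar>) \<partial>lborel))"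


section \<open>Vector bundles\<close>

text \<open>The fibre of \<open>E\<close> over each point is the bare vector space \<open>'f\<close>, so the total space is the
  set \<open>'m \<times> 'f\<close>. This choice of linear isomorphisms between \<open>'f\<close> and the
  fibres is not required to be continuous in any sense: topology and smooth structure
  of the bundle are carried by a family of local frames \<open>(W, e)\<close>, where \<open>e i p\<close> for \<open>i < brank\<close> is
  a basis of the fibre over \<open>p \<in> W\<close>. Thus non-trivial bundles are included.

  The connection acts on local sections: \<open>conn s p X = \<nabla>\<^sub>X s\<close> for \<open>s\<close> smooth near \<open>p\<close>.\<close>

type_synonym ('m, 'f) frame = "'m set \<times> (nat \<Rightarrow> 'm \<Rightarrow> 'f)"

record ('m, 'n::finite, 'f) vbundle = "('m, 'n) spacetime" +
  brank :: nat
  frames :: "('m, 'f) frame set"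
  fmetric :: "'m \<Rightarrow> 'f \<Rightarrow> 'f \<Rightarrow> real"
  conn :: "('m \<Rightarrow> 'f) \<Rightarrow> 'm \<Rightarrow> ('m, 'n) tvec \<Rightarrow> 'f"

definition smooth_section ::
    "('m, 'n::finite, 'f::real_vector, 'z) vbundle_scheme \<Rightarrow> 'm set \<Rightarrow> ('m \<Rightarrow> 'f) \<Rightarrow> bool" where
  "smooth_section S W s \<longleftrightarrow> (\<forall>(W', e)\<in>frames S. \<exists>a.
     (\<forall>i<brank S. smooth_fun S (W \<inter> W') (a i)) \<and>
     (\<forall>p\<in>W \<inter> W'. s p = (\<Sum>i<brank S. a i p *\<^sub>R e i p)))"

definition vector_bundle :: "('m::topological_space, 'n::finite, 'f::real_vector, 'z) vbundle_scheme \<Rightarrow> bool" where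
  "vector_bundle S \<longleftrightarrow>
     (\<Union>fr\<in>frames S. fst fr) = UNIV \<and>
     (\<forall>(W, e)\<in>frames S. open W \<and>
        (\<forall>p\<in>W. inj_on (\<lambda>i. e i p) {..<brank S} \<and>
           independent ((\<lambda>i. e i p) ` {..<brank S}) \<and>
           span ((\<lambda>i. e i p) ` {..<brank S}) = UNIV) \<and>
        (\<forall>i<brank S. smooth_section S W (e i)))"

definition fiber_metric :: "('m, 'n::finite, 'f::real_vector, 'z) vbundle_scheme \<Rightarrow> bool" where
  "fiber_metric S \<longleftrightarrow>
     (\<forall>p. (\<forall>v. linear (fmetric S p v)) \<and> (\<forall>v w. fmetric S p v w = fmetric S p w v) \<and>
          (\<forall>v. (\<forall>w. fmetric S p v w = 0) \<longrightarrow> v = 0)) \<and>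
     (\<forall>(W, e)\<in>frames S. \<forall>i<brank S. \<forall>j<brank S.
        smooth_fun S W (\<lambda>p. fmetric S p (e i p) (e j p)))"

definition connection :: "('m::topological_space, 'n::finite, 'f::real_vector, 'z) vbundle_scheme \<Rightarrow> bool" where
  "connection S \<longleftrightarrow> (\<forall>W s. open W \<and> smooth_section S W s \<longrightarrow>
     (\<forall>p\<in>W. \<forall>X\<in>tangent_space S p. \<forall>Y\<in>tangent_space S p. \<forall>a.
        conn S s p (\<lambda>c. a *\<^sub>R X c + Y c) = a *\<^sub>R conn S s p X + conn S s p Y) \<and>
     (\<forall>t. smooth_section S W t \<longrightarrow> (\<forall>p\<in>W. \<forall>X\<in>tangent_space S p.
        conn S (\<lambda>q. s q + t q) p X = conn S s p X + conn S t p X)) \<and>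
     (\<forall>f. smooth_fun S W f \<longrightarrow> (\<forall>p\<in>W. \<forall>X\<in>tangent_space S p. \<forall>c\<in>charts_at S p.
        conn S (\<lambda>q. f q *\<^sub>R s q) p X = dirder c f p X *\<^sub>R s p + f p *\<^sub>R conn S s p X)) \<and>
     (\<forall>t. (\<forall>q\<in>W. s q = t q) \<longrightarrow> (\<forall>p\<in>W. \<forall>X\<in>tangent_space S p. conn S s p X = conn S t p X)) \<and>
     (\<forall>c\<in>atlas S. \<forall>i. smooth_section S (W \<inter> fst c) (\<lambda>p. conn S s p (cvec S c i p))))"

definition metric_connection :: "('m::topological_space, 'n::finite, 'f::real_vector, 'z) vbundle_scheme \<Rightarrow> bool" where
  "metric_connection S \<longleftrightarrow> connection S \<and>
     (\<forall>W s t. open W \<and> smooth_section S W s \<and> smooth_section S W t \<longrightarrow>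
        (\<forall>p\<in>W. \<forall>X\<in>tangent_space S p. \<forall>c\<in>charts_at S p.
           dirder c (\<lambda>q. fmetric S q (s q) (t q)) p X =
             fmetric S p (conn S s p X) (t p) + fmetric S p (s p) (conn S t p X)))"

definition metric_vector_bundle :: "('m::topological_space, 'n::finite, 'f::real_vector, 'z) vbundle_scheme \<Rightarrow> bool" where
  "metric_vector_bundle S \<longleftrightarrow> vector_bundle S \<and> fiber_metric S \<and> metric_connection S"

text \<open>A symmetric endomorphism field \<open>B = B\<^sup>*\<close>.\<close>

definition selfadjoint_endo ::
    "('m, 'n::finite, 'f::real_vector, 'z) vbundle_scheme \<Rightarrow> ('m \<Rightarrow> 'f \<Rightarrow> 'f) \<Rightarrow> bool" where
  "selfadjoint_endo S B \<longleftrightarrow>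
     (\<forall>p. linear (B p) \<and> (\<forall>v w. fmetric S p (B p v) w = fmetric S p v (B p w))) \<and>
     (\<forall>(W, e)\<in>frames S. \<forall>i<brank S. smooth_section S W (\<lambda>p. B p (e i p)))"

text \<open>Christoffel symbols \<open>\<Gamma>\<^sup>k\<^sub>i\<^sub>j\<close> of the Levi-Civita connection of \<open>g\<close>.\<close>

definition christoffel ::
    "('m, 'n::finite, 'z) spacetime_scheme \<Rightarrow> ('m, 'n) chart \<Rightarrow> 'n \<Rightarrow> 'n \<Rightarrow> 'n \<Rightarrow> 'm \<Rightarrow> real" where
  "christoffel S c k i j p = (\<Sum>l\<in>UNIV. matrix_inv (gmat S c p) $ k $ l *
     (pd c i (\<lambda>q. gmat S c q $ j $ l) p + pd c j (\<lambda>q. gmat S c q $ i $ l) p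
       - pd c l (\<lambda>q. gmat S c q $ i $ j) p)) / 2"

text \<open>The d'Alembert operator is the metric trace of the second covariant derivative:
  \<open>\<box>s = g\<^sup>i\<^sup>j (\<nabla>\<^sub>i \<nabla>\<^sub>j s - \<Gamma>\<^sup>k\<^sub>i\<^sub>j \<nabla>\<^sub>k s)\<close>, evaluated here in the chart \<open>c\<close>.\<close>

definition dalembert ::
    "('m, 'n::finite, 'f::real_vector, 'z) vbundle_scheme \<Rightarrow> ('m, 'n) chart \<Rightarrow> ('m \<Rightarrow> 'f) \<Rightarrow> 'm \<Rightarrow> 'f" where
  "dalembert S c s p = (\<Sum>i\<in>UNIV. \<Sum>j\<in>UNIV. matrix_inv (gmat S c p) $ i $ j *\<^sub>R
     (conn S (\<lambda>q. conn S s q (cvec S c j q)) p (cvec S c i p)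
       - (\<Sum>k\<in>UNIV. christoffel S c k i j p *\<^sub>R conn S s p (cvec S c k p))))"

text \<open>\<open>D = \<box> + B\<close> on smooth sections of \<open>E\<close>; the right-hand side does not depend on the chart.\<close>

definition dalembert_plus :: "('m::topological_space, 'n::finite, 'f::real_vector, 'z) vbundle_scheme
    \<Rightarrow> ('m \<Rightarrow> 'f \<Rightarrow> 'f) \<Rightarrow> (('m \<Rightarrow> 'f) \<Rightarrow> 'm \<Rightarrow> 'f) \<Rightarrow> bool" where
  "dalembert_plus S B D \<longleftrightarrow> (\<forall>s. smooth_section S UNIV s \<longrightarrow>
     (\<forall>p. \<forall>c\<in>charts_at S p. D s p = dalembert S c s p + B p (s p)))"


section \<open>Sections of the dual bundle and Green operators\<close>

text \<open>A section of \<open>E\<^sup>*\<close> is represented by the corresponding fibrewise linear function on the total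
  space \<open>'m \<times> 'f\<close> of \<open>E\<close>.\<close>

definition dual_sections :: "('m, 'n::finite, 'f::real_vector, 'z) vbundle_scheme \<Rightarrow> ('m \<times> 'f \<Rightarrow> real) set" where
  "dual_sections S = {\<phi>. (\<forall>p. linear (\<lambda>v. \<phi> (p, v))) \<and>
     (\<forall>(W, e)\<in>frames S. \<forall>i<brank S. smooth_fun S W (\<lambda>p. \<phi> (p, e i p)))}"

definition supp :: "('m::topological_space \<times> 'f \<Rightarrow> real) \<Rightarrow> 'm set" where
  "supp \<phi> = closure {p. \<exists>v. \<phi> (p, v) \<noteq> 0}"

definition Vcov :: "('m::topological_space, 'n::finite, 'f::real_vector, 'z) vbundle_scheme \<Rightarrow> ('m \<times> 'f \<Rightarrow> real) set" where
  "Vcov S = {\<phi> \<in> dual_sections S. compact (supp \<phi>)}"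

text \<open>The induced metric \<open>h^{-1}(\<alpha>, \<beta>) = \<alpha>(\<beta>\<^sup>\<sharp>)\<close> on the dual fibres.\<close>

definition sharp :: "('m, 'n::finite, 'f, 'z) vbundle_scheme \<Rightarrow> 'm \<Rightarrow> ('f \<Rightarrow> real) \<Rightarrow> 'f" where
  "sharp S p \<beta> = (THE w. \<forall>v. fmetric S p w v = \<beta> v)"

definition dual_metric :: "('m, 'n::finite, 'f, 'z) vbundle_scheme \<Rightarrow> 'm \<Rightarrow> ('f \<Rightarrow> real) \<Rightarrow> ('f \<Rightarrow> real) \<Rightarrow> real" where
  "dual_metric S p \<alpha> \<beta> = \<alpha> (sharp S p \<beta>)"

definition transpose_operator :: "('m::topological_space, 'n::finite, 'f::real_vector, 'z) vbundle_scheme \<Rightarrow> 'm measure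
    \<Rightarrow> (('m \<Rightarrow> 'f) \<Rightarrow> 'm \<Rightarrow> 'f) \<Rightarrow> (('m \<times> 'f \<Rightarrow> real) \<Rightarrow> 'm \<times> 'f \<Rightarrow> real) \<Rightarrow> bool" where
  "transpose_operator S \<mu> D DT \<longleftrightarrow> (\<forall>\<phi>\<in>dual_sections S. DT \<phi> \<in> dual_sections S \<and>
     (\<forall>u. smooth_section S UNIV u \<and> compact (closure {p. u p \<noteq> 0}) \<longrightarrow>
        (\<integral>p. DT \<phi> (p, u p) \<partial>\<mu>) = (\<integral>p. \<phi> (p, D u p) \<partial>\<mu>)))"

definition seminorm_on :: "('x \<Rightarrow> 'k::real_normed_field) set \<Rightarrow> (('x \<Rightarrow> 'k) \<Rightarrow> real) \<Rightarrow> bool" where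
  "seminorm_on V p \<longleftrightarrow>
     (\<forall>v\<in>V. p v \<ge> 0) \<and> (\<forall>v\<in>V. \<forall>w\<in>V. p (\<lambda>x. v x + w x) \<le> p v + p w) \<and>
     (\<forall>v\<in>V. \<forall>a. p (\<lambda>x. a * v x) = norm a * p v)"

text \<open>The seminorms defining the Frechet topology of \<open>\<Gamma>\<^sup>\<infinity>(E\<^sup>*)\<close>: suprema over a compact set, lying
  in the domains of a chart and a frame, of the partial derivatives up to order \<open>k\<close> of the components.\<close>

type_synonym ('m, 'n, 'f) seminorm_data = "('m, 'n) chart \<times> ('m, 'f) frame \<times> 'm set \<times> nat"

definition seminorm_data :: "('m::topological_space, 'n::finite, 'f, 'z) vbundle_scheme \<Rightarrow> ('m, 'n, 'f) seminorm_data set" where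
  "seminorm_data S = {(c, fr, K, k). c \<in> atlas S \<and> fr \<in> frames S \<and> compact K \<and> K \<subseteq> fst c \<inter> fst fr}"

fun csem :: "('m, 'n::finite, 'f, 'z) vbundle_scheme \<Rightarrow> ('m, 'n, 'f) seminorm_data \<Rightarrow> ('m \<times> 'f \<Rightarrow> real) \<Rightarrow> real" where
  "csem S (c, fr, K, k) \<phi> = Sup (insert 0
     {\<bar>iter_pd is (\<lambda>y. \<phi> (cinv c y, snd fr a (cinv c y))) (snd c p)\<bar> | is a p.
        length is \<le> k \<and> a < brank S \<and> p \<in> K})"

definition dominated_on :: "('m::topological_space, 'n::finite, 'f, 'z) vbundle_scheme
    \<Rightarrow> ('m \<times> 'f \<Rightarrow> real) set \<Rightarrow> (('m \<times> 'f \<Rightarrow> real) \<Rightarrow> real) \<Rightarrow> bool" where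
  "dominated_on S X p \<longleftrightarrow> (\<exists>Q C. finite Q \<and> Q \<subseteq> seminorm_data S \<and>
     (\<forall>\<phi>\<in>X. p \<phi> \<le> C * (\<Sum>d\<in>Q. csem S d \<phi>)))"

definition cont_seminorm_smooth :: "('m::topological_space, 'n::finite, 'f::real_vector, 'z) vbundle_scheme
    \<Rightarrow> (('m \<times> 'f \<Rightarrow> real) \<Rightarrow> real) \<Rightarrow> bool" where
  "cont_seminorm_smooth S p \<longleftrightarrow> seminorm_on (dual_sections S) p \<and> dominated_on S (dual_sections S) p"

text \<open>LF topology: a seminorm is continuous iff its restrictions to the Frechet spaces of
  sections supported in a fixed compact set are continuous.\<close>

definition cont_seminorm_LF :: "('m::topological_space, 'n::finite, 'f::real_vector, 'z) vbundle_scheme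
    \<Rightarrow> (('m \<times> 'f \<Rightarrow> real) \<Rightarrow> real) \<Rightarrow> bool" where
  "cont_seminorm_LF S p \<longleftrightarrow> seminorm_on (Vcov S) p \<and>
     (\<forall>K. compact K \<longrightarrow> dominated_on S {\<phi> \<in> Vcov S. supp \<phi> \<subseteq> K} p)"

definition green_operator :: "('m::topological_space, 'n::finite, 'f::real_vector, 'z) vbundle_scheme
    \<Rightarrow> ('m set \<Rightarrow> 'm set) \<Rightarrow> (('m \<times> 'f \<Rightarrow> real) \<Rightarrow> 'm \<times> 'f \<Rightarrow> real)
    \<Rightarrow> (('m \<times> 'f \<Rightarrow> real) \<Rightarrow> 'm \<times> 'f \<Rightarrow> real) \<Rightarrow> bool" where
  "green_operator S J DT G \<longleftrightarrow>
     (\<forall>\<phi>\<in>Vcov S. \<forall>\<psi>\<in>Vcov S. \<forall>a. G (\<lambda>x. a * \<phi> x + \<psi> x) = (\<lambda>x. a * G \<phi> x + G \<psi> x)) \<and>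
     (\<forall>\<phi>\<in>Vcov S. G \<phi> \<in> dual_sections S) \<and>
     (\<forall>q. cont_seminorm_smooth S q \<longrightarrow> cont_seminorm_LF S (\<lambda>\<phi>. q (G \<phi>))) \<and>
     (\<forall>\<phi>\<in>Vcov S. DT (G \<phi>) = \<phi> \<and> G (DT \<phi>) = \<phi> \<and> supp (G \<phi>) \<subseteq> J (supp \<phi>))"

text \<open>The propagator \<open>F = F\<^sup>+ - F\<^sup>-\<close> and the covariant pairing.\<close>

definition propagator :: "(('m \<times> 'f \<Rightarrow> real) \<Rightarrow> 'm \<times> 'f \<Rightarrow> real) \<Rightarrow> (('m \<times> 'f \<Rightarrow> real) \<Rightarrow> 'm \<times> 'f \<Rightarrow> real)
    \<Rightarrow> ('m \<times> 'f \<Rightarrow> real) \<Rightarrow> 'm \<times> 'f \<Rightarrow> real" where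
  "propagator Fp Fm \<phi> = (\<lambda>x. Fp \<phi> x - Fm \<phi> x)"

definition Lambda_cov :: "('m, 'n::finite, 'f, 'z) vbundle_scheme \<Rightarrow> 'm measure
    \<Rightarrow> (('m \<times> 'f \<Rightarrow> real) \<Rightarrow> 'm \<times> 'f \<Rightarrow> real)
    \<Rightarrow> ('m \<times> 'f \<Rightarrow> real) \<Rightarrow> ('m \<times> 'f \<Rightarrow> real) \<Rightarrow> real" where
  "Lambda_cov S \<mu> F \<phi> \<psi> = (\<integral>p. dual_metric S p (\<lambda>v. F \<phi> (p, v)) (\<lambda>v. \<psi> (p, v)) \<partial>\<mu>)"


section \<open>Symmetric tensors over a space of functions\<close>

text \<open>Let \<open>V\<close> be a linear space of \<open>'k\<close>-valued functions on a set \<open>'x\<close>. The algebraic tensor power of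
  order \<open>n\<close> of \<open>V\<close> is canonically the span, among the functions of \<open>n\<close> arguments, of the products
  \<open>v1(x1) \<cdots> vn(xn)\<close>. An element of the (full) tensor algebra is therefore a function on lists, whose
  homogeneous component of degree \<open>n\<close> is its restriction to the lists of length \<open>n\<close>. Likewise, tensor
  products of two such spaces consist of functions on pairs of lists.\<close>

abbreviation fscale :: "'k::field \<Rightarrow> ('x \<Rightarrow> 'k) \<Rightarrow> 'x \<Rightarrow> 'k" where
  "fscale a f \<equiv> (\<lambda>x. a * f x)"

abbreviation fspan :: "('x \<Rightarrow> 'k::field) set \<Rightarrow> ('x \<Rightarrow> 'k) set" where
  "fspan \<equiv> module.span fscale"

definition tens :: "('x \<Rightarrow> 'k::field) list \<Rightarrow> 'x list \<Rightarrow> 'k" where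
  "tens vs xs = (if length xs = length vs then \<Prod>i<length vs. (vs ! i) (xs ! i) else 0)"

definition tensor_power :: "('x \<Rightarrow> 'k::field) set \<Rightarrow> nat \<Rightarrow> ('x list \<Rightarrow> 'k) set" where
  "tensor_power V n = fspan {tens vs | vs. length vs = n \<and> set vs \<subseteq> V}"

definition sym_power :: "('x \<Rightarrow> 'k::field) set \<Rightarrow> nat \<Rightarrow> ('x list \<Rightarrow> 'k) set" where
  "sym_power V n = {t \<in> tensor_power V n.
     \<forall>\<sigma> xs. \<sigma> permutes {..<n} \<and> length xs = n \<longrightarrow> t (permute_list \<sigma> xs) = t xs}"

definition hcomp :: "nat \<Rightarrow> ('x list \<Rightarrow> 'k::zero) \<Rightarrow> 'x list \<Rightarrow> 'k" where
  "hcomp n a xs = (if length xs = n then a xs else 0)"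

definition sym_alg :: "('x \<Rightarrow> 'k::field) set \<Rightarrow> ('x list \<Rightarrow> 'k) set" where
  "sym_alg V = {a. (\<forall>n. hcomp n a \<in> sym_power V n) \<and> finite {n. hcomp n a \<noteq> 0}}"

definition otimes :: "('x list \<Rightarrow> 'k::field) \<Rightarrow> ('x list \<Rightarrow> 'k) \<Rightarrow> 'x list \<times> 'x list \<Rightarrow> 'k" where
  "otimes a b = (\<lambda>(xs, ys). a xs * b ys)"

text \<open>The symmetrized tensor product, as a linear map on the tensor product of two copies.\<close>

definition symmetrize :: "('x list \<Rightarrow> 'k::field_char_0) \<Rightarrow> 'x list \<Rightarrow> 'k" where
  "symmetrize t xs = (\<Sum>\<sigma> | \<sigma> permutes {..<length xs}. t (permute_list \<sigma> xs)) / fact (length xs)"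

definition sym_mult :: "('x list \<times> 'x list \<Rightarrow> 'k::field_char_0) \<Rightarrow> 'x list \<Rightarrow> 'k" where
  "sym_mult t = symmetrize (\<lambda>xs. \<Sum>k\<le>length xs. t (take k xs, drop k xs))"

text \<open>The commutative monomial \<open>v1 \<cdots> vn\<close>.\<close>

definition sprod :: "('x \<Rightarrow> 'k::field_char_0) list \<Rightarrow> 'x list \<Rightarrow> 'k" where
  "sprod vs = foldr (\<lambda>v a. sym_mult (otimes (tens [v]) a)) vs (tens [])"

definition omit :: "nat \<Rightarrow> 'a list \<Rightarrow> 'a list" where
  "omit k vs = take k vs @ drop (Suc k) vs"

text \<open>The map \<open>P\<^sub>\<Lambda>\<close>. It is determined on the span of the tensors \<open>otimes a b\<close> with
  \<open>a, b \<in> sym_alg V\<close>, and is only ever applied there.\<close>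

definition contraction :: "('x \<Rightarrow> 'k::field_char_0) set \<Rightarrow> (('x \<Rightarrow> 'k) \<Rightarrow> ('x \<Rightarrow> 'k) \<Rightarrow> 'k)
    \<Rightarrow> ('x list \<times> 'x list \<Rightarrow> 'k) \<Rightarrow> 'x list \<times> 'x list \<Rightarrow> 'k" where
  "contraction V \<Lambda> = (SOME P. Vector_Spaces.linear fscale fscale P \<and>
     (\<forall>vs ws. set vs \<subseteq> V \<and> set ws \<subseteq> V \<longrightarrow>
        P (otimes (sprod vs) (sprod ws)) =
          (\<Sum>k<length vs. \<Sum>l<length ws.
             fscale (\<Lambda> (vs ! k) (ws ! l)) (otimes (sprod (omit k vs)) (sprod (omit l ws))))))"

definition complexify :: "('x \<Rightarrow> real) set \<Rightarrow> ('x \<Rightarrow> complex) set" where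
  "complexify V = {f. (\<lambda>x. Re (f x)) \<in> V \<and> (\<lambda>x. Im (f x)) \<in> V}"

definition complexify_form :: "(('x \<Rightarrow> real) \<Rightarrow> ('x \<Rightarrow> real) \<Rightarrow> real) \<Rightarrow> ('x \<Rightarrow> complex) \<Rightarrow> ('x \<Rightarrow> complex) \<Rightarrow> complex" where
  "complexify_form \<Lambda> v w =
     Complex (\<Lambda> (\<lambda>x. Re (v x)) (\<lambda>x. Re (w x)) - \<Lambda> (\<lambda>x. Im (v x)) (\<lambda>x. Im (w x)))
             (\<Lambda> (\<lambda>x. Re (v x)) (\<lambda>x. Im (w x)) + \<Lambda> (\<lambda>x. Im (v x)) (\<lambda>x. Re (w x)))"


section \<open>The Poisson algebra and the Weyl algebra\<close>

record ('k, 'a) poisson_algebra = "('k, 'a) module" +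
  bracket :: "'a \<Rightarrow> 'a \<Rightarrow> 'a"

record ('k, 'a) top_star_algebra = "('k, 'a) module" +
  invol :: "'a \<Rightarrow> 'a"
  tplg :: "'a topology"

definition sym_poisson :: "('x \<Rightarrow> real) set \<Rightarrow> (('x \<Rightarrow> real) \<Rightarrow> ('x \<Rightarrow> real) \<Rightarrow> real)
    \<Rightarrow> (real, 'x list \<Rightarrow> real) poisson_algebra" where
  "sym_poisson V \<Lambda> =
     \<lparr>carrier = sym_alg V,
      mult = (\<lambda>a b. sym_mult (otimes a b)),
      one = tens [],
      zero = (\<lambda>_. 0),
      add = (\<lambda>a b xs. a xs + b xs),
      smult = fscale,
      bracket = (\<lambda>a b xs. 2 * sym_mult (contraction V \<Lambda> (otimes a b)) xs)\<rparr>"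

text \<open>The projective tensor power of a seminorm \<open>p\<close> on \<open>V\<close>.\<close>

definition proj_power :: "('x \<Rightarrow> 'k::real_normed_field) set \<Rightarrow> (('x \<Rightarrow> 'k) \<Rightarrow> real) \<Rightarrow> nat
    \<Rightarrow> ('x list \<Rightarrow> 'k) \<Rightarrow> real" where
  "proj_power V p n t = Inf {\<Sum>(c, vs)\<leftarrow>rep. norm c * (\<Prod>v\<leftarrow>vs. p v) | rep.
     (\<forall>(c, vs)\<in>set rep. length vs = n \<and> set vs \<subseteq> V) \<and>
     t = (\<lambda>xs. \<Sum>(c, vs)\<leftarrow>rep. c * tens vs xs)}"

definition weyl_seminorm :: "('x \<Rightarrow> 'k::real_normed_field) set \<Rightarrow> (('x \<Rightarrow> 'k) \<Rightarrow> real) \<Rightarrow> real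
    \<Rightarrow> ('x list \<Rightarrow> 'k) \<Rightarrow> real" where
  "weyl_seminorm V p R a = (\<Sum>n | hcomp n a \<noteq> 0. proj_power V p n (hcomp n a) * fact n powr R)"

text \<open>The locally convex topology of the seminorms \<open>p\<^sub>R\<close>, where \<open>p\<close> ranges over the set \<open>\<P>\<close> of
  all continuous seminorms on \<open>V\<close>. Single seminorms suffice in the neighbourhood bases, since \<open>\<P>\<close> is
  closed under maxima and positive multiples.\<close>

definition weyl_topology :: "('x \<Rightarrow> 'k::real_normed_field) set \<Rightarrow> (('x \<Rightarrow> 'k) \<Rightarrow> real) set \<Rightarrow> real
    \<Rightarrow> ('x list \<Rightarrow> 'k) topology" where
  "weyl_topology V \<P> R = topology (\<lambda>\<O>. \<O> \<subseteq> sym_alg V \<and>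
     (\<forall>a\<in>\<O>. \<exists>p\<in>\<P>. \<exists>\<epsilon>>0. {b \<in> sym_alg V. weyl_seminorm V p R (\<lambda>xs. b xs - a xs) < \<epsilon>} \<subseteq> \<O>))"

text \<open>For \<open>a, b \<in> sym_alg V\<close> only finitely many terms of the series for the star product are non-zero.\<close>

definition weyl_algebra :: "('x \<Rightarrow> complex) set \<Rightarrow> (('x \<Rightarrow> complex) \<Rightarrow> real) set
    \<Rightarrow> (('x \<Rightarrow> complex) \<Rightarrow> ('x \<Rightarrow> complex) \<Rightarrow> complex) \<Rightarrow> real \<Rightarrow> real
    \<Rightarrow> (complex, 'x list \<Rightarrow> complex) top_star_algebra" where
  "weyl_algebra V \<P> \<Lambda> R hbar =
     \<lparr>carrier = sym_alg V,
      mult = (\<lambda>a b xs. \<Sum>k. 1 / fact k * (\<i> * complex_of_real hbar / 2) ^ k *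
                sym_mult ((contraction V \<Lambda> ^^ k) (otimes a b)) xs),
      one = tens [],
      zero = (\<lambda>_. 0),
      add = (\<lambda>a b xs. a xs + b xs),
      smult = fscale,
      invol = (\<lambda>a xs. cnj (a xs)),
      tplg = weyl_topology V \<P> R\<rparr>"

text \<open>The unital Poisson subalgebra and the unital *-subalgebra generated by a set.\<close>

inductive_set poisson_generated :: "('k, 'a, 'z) poisson_algebra_scheme \<Rightarrow> 'a set \<Rightarrow> 'a set"
  for P G where
  gen: "a \<in> G \<Longrightarrow> a \<in> poisson_generated P G"
| one: "\<one>\<^bsub>P\<^esub> \<in> poisson_generated P G"
| add: "a \<in> poisson_generated P G \<Longrightarrow> b \<in> poisson_generated P G \<Longrightarrow> a \<oplus>\<^bsub>P\<^esub> b \<in> poisson_generated P G"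
| smult: "a \<in> poisson_generated P G \<Longrightarrow> z \<odot>\<^bsub>P\<^esub> a \<in> poisson_generated P G"
| mult: "a \<in> poisson_generated P G \<Longrightarrow> b \<in> poisson_generated P G \<Longrightarrow> a \<otimes>\<^bsub>P\<^esub> b \<in> poisson_generated P G"
| bracket: "a \<in> poisson_generated P G \<Longrightarrow> b \<in> poisson_generated P G \<Longrightarrow> bracket P a b \<in> poisson_generated P G"

inductive_set star_generated :: "('k, 'a, 'z) top_star_algebra_scheme \<Rightarrow> 'a set \<Rightarrow> 'a set"
  for W G where
  gen: "a \<in> G \<Longrightarrow> a \<in> star_generated W G"
| one: "\<one>\<^bsub>W\<^esub> \<in> star_generated W G"
| add: "a \<in> star_generated W G \<Longrightarrow> b \<in> star_generated W G \<Longrightarrow> a \<oplus>\<^bsub>W\<^esub> b \<in> star_generated W G"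
| smult: "a \<in> star_generated W G \<Longrightarrow> z \<odot>\<^bsub>W\<^esub> a \<in> star_generated W G"
| mult: "a \<in> star_generated W G \<Longrightarrow> b \<in> star_generated W G \<Longrightarrow> a \<otimes>\<^bsub>W\<^esub> b \<in> star_generated W G"
| invol: "a \<in> star_generated W G \<Longrightarrow> invol W a \<in> star_generated W G"

text \<open>The bracket induced on cosets of a Poisson ideal, in analogy to \<^const>\<open>rcoset_mult\<close>.\<close>

definition rcoset_bracket :: "('k, 'a, 'z) poisson_algebra_scheme \<Rightarrow> 'a set \<Rightarrow> 'a set \<Rightarrow> 'a set \<Rightarrow> 'a set" where
  "rcoset_bracket P I X Y = (\<Union>a\<in>X. \<Union>b\<in>Y. I +>\<^bsub>P\<^esub> bracket P a b)"


section \<open>The local algebras\<close>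

definition cov_poisson :: "('m::topological_space, 'n::finite, 'f::real_vector, 'z) vbundle_scheme \<Rightarrow> 'm measure
    \<Rightarrow> (('m \<times> 'f \<Rightarrow> real) \<Rightarrow> 'm \<times> 'f \<Rightarrow> real) \<Rightarrow> (real, ('m \<times> 'f) list \<Rightarrow> real) poisson_algebra" where
  "cov_poisson S \<mu> F = sym_poisson (Vcov S) (Lambda_cov S \<mu> F)"

text \<open>A seminorm on \<open>V \<otimes> \<complex> = V \<oplus> \<i>V\<close> is continuous iff its restriction to \<open>V\<close> is.\<close>

definition cov_weyl :: "('m::topological_space, 'n::finite, 'f::real_vector, 'z) vbundle_scheme \<Rightarrow> 'm measure
    \<Rightarrow> (('m \<times> 'f \<Rightarrow> real) \<Rightarrow> 'm \<times> 'f \<Rightarrow> real) \<Rightarrow> real \<Rightarrow> real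
    \<Rightarrow> (complex, ('m \<times> 'f) list \<Rightarrow> complex) top_star_algebra" where
  "cov_weyl S \<mu> F R hbar = weyl_algebra (complexify (Vcov S))
     {p. seminorm_on (complexify (Vcov S)) p \<and>
         cont_seminorm_LF S (\<lambda>\<phi>. p (\<lambda>x. complex_of_real (\<phi> x)))}
     (complexify_form (Lambda_cov S \<mu> F)) R hbar"

definition kernel_ideal :: "('m::topological_space, 'n::finite, 'f::real_vector, 'z) vbundle_scheme \<Rightarrow> 'm measure
    \<Rightarrow> (('m \<times> 'f \<Rightarrow> real) \<Rightarrow> 'm \<times> 'f \<Rightarrow> real) \<Rightarrow> (('m \<times> 'f) list \<Rightarrow> real) set" where
  "kernel_ideal S \<mu> F =
     genideal (cov_poisson S \<mu> F) {tens [\<phi>] | \<phi>. \<phi> \<in> Vcov S \<and> F \<phi> = (\<lambda>_. 0)}"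

text \<open>For \<open>U = {}\<close> only \<open>\<phi> = 0\<close> is available as a generator, so that the following sets consist of
  the scalar multiples of the unit.\<close>

definition pre_local_cl :: "('m::topological_space, 'n::finite, 'f::real_vector, 'z) vbundle_scheme \<Rightarrow> 'm measure
    \<Rightarrow> (('m \<times> 'f \<Rightarrow> real) \<Rightarrow> 'm \<times> 'f \<Rightarrow> real) \<Rightarrow> 'm set \<Rightarrow> (('m \<times> 'f) list \<Rightarrow> real) set" where
  "pre_local_cl S \<mu> F U = poisson_generated (cov_poisson S \<mu> F)
     {tens [\<phi>] | \<phi>. \<phi> \<in> Vcov S \<and> supp \<phi> \<subseteq> U}"

definition pre_local :: "('m::topological_space, 'n::finite, 'f::real_vector, 'z) vbundle_scheme \<Rightarrow> 'm measure
    \<Rightarrow> (('m \<times> 'f \<Rightarrow> real) \<Rightarrow> 'm \<times> 'f \<Rightarrow> real) \<Rightarrow> real \<Rightarrow> real \<Rightarrow> 'm set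
    \<Rightarrow> (('m \<times> 'f) list \<Rightarrow> complex) set" where
  "pre_local S \<mu> F R hbar U = star_generated (cov_weyl S \<mu> F R hbar)
     {tens [\<lambda>x. complex_of_real (\<phi> x)] | \<phi>. \<phi> \<in> Vcov S \<and> supp \<phi> \<subseteq> U}"

text \<open>\<open>kernel_ideal \<otimes> \<complex>\<close> is \<open>complexify kernel_ideal\<close>.\<close>

definition local_cl :: "('m::topological_space, 'n::finite, 'f::real_vector, 'z) vbundle_scheme \<Rightarrow> 'm measure
    \<Rightarrow> (('m \<times> 'f \<Rightarrow> real) \<Rightarrow> 'm \<times> 'f \<Rightarrow> real) \<Rightarrow> 'm set \<Rightarrow> (('m \<times> 'f) list \<Rightarrow> real) set set" where
  "local_cl S \<mu> F U =
     (\<lambda>a. kernel_ideal S \<mu> F +>\<^bsub>cov_poisson S \<mu> F\<^esub> a) ` pre_local_cl S \<mu> F U"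

definition local_alg :: "('m::topological_space, 'n::finite, 'f::real_vector, 'z) vbundle_scheme \<Rightarrow> 'm measure
    \<Rightarrow> (('m \<times> 'f \<Rightarrow> real) \<Rightarrow> 'm \<times> 'f \<Rightarrow> real) \<Rightarrow> real \<Rightarrow> real \<Rightarrow> 'm set
    \<Rightarrow> (('m \<times> 'f) list \<Rightarrow> complex) set set" where
  "local_alg S \<mu> F R hbar U =
     (\<lambda>a. complexify (kernel_ideal S \<mu> F) +>\<^bsub>cov_weyl S \<mu> F R hbar\<^esub> a) ` pre_local S \<mu> F R hbar U"

definition cov_bracket :: "('m::topological_space, 'n::finite, 'f::real_vector, 'z) vbundle_scheme \<Rightarrow> 'm measure
    \<Rightarrow> (('m \<times> 'f \<Rightarrow> real) \<Rightarrow> 'm \<times> 'f \<Rightarrow> real)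
    \<Rightarrow> (('m \<times> 'f) list \<Rightarrow> real) set \<Rightarrow> (('m \<times> 'f) list \<Rightarrow> real) set \<Rightarrow> (('m \<times> 'f) list \<Rightarrow> real) set" where
  "cov_bracket S \<mu> F = rcoset_bracket (cov_poisson S \<mu> F) (kernel_ideal S \<mu> F)"

definition cov_quot_cl :: "('m::topological_space, 'n::finite, 'f::real_vector, 'z) vbundle_scheme \<Rightarrow> 'm measure
    \<Rightarrow> (('m \<times> 'f \<Rightarrow> real) \<Rightarrow> 'm \<times> 'f \<Rightarrow> real) \<Rightarrow> (('m \<times> 'f) list \<Rightarrow> real) set ring" where
  "cov_quot_cl S \<mu> F = cov_poisson S \<mu> F Quot kernel_ideal S \<mu> F"

definition cov_quot :: "('m::topological_space, 'n::finite, 'f::real_vector, 'z) vbundle_scheme \<Rightarrow> 'm measure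
    \<Rightarrow> (('m \<times> 'f \<Rightarrow> real) \<Rightarrow> 'm \<times> 'f \<Rightarrow> real) \<Rightarrow> real \<Rightarrow> real
    \<Rightarrow> (('m \<times> 'f) list \<Rightarrow> complex) set ring" where
  "cov_quot S \<mu> F R hbar = cov_weyl S \<mu> F R hbar Quot complexify (kernel_ideal S \<mu> F)"

end

theory Submission
  imports Defs
begin

text \<open>The locality property rests on two facts about the covariant pairing \<open>\<Lambda> \<phi> \<psi>\<close>, the integral of
  \<open>h\<^sup>-\<^sup>1(F \<phi>, \<psi>)\<close>; isotony and the statement on unions only express that generated subalgebras
  grow with their generators.

  The first fact is causality. If \<open>supp \<phi> \<subseteq> U\<close> and \<open>supp \<psi> \<subseteq> U'\<close> with \<open>U\<close>, \<open>U'\<close> spacelike, then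
  \<open>F \<phi>\<close> is supported in \<open>J(U)\<close> and vanishes on the support of \<open>\<psi>\<close>, so \<open>\<Lambda> \<phi> \<psi> = 0\<close>; as being
  spacelike is a symmetric relation, also \<open>\<Lambda> \<psi> \<phi> = 0\<close> (\<open>\<Lambda>_spacelike\<close>). The symmetric tensors over
  the sections supported in \<open>U\<close> are closed under products and contractions, hence contain the
  subalgebra generated by these sections. A contraction between such tensors for \<open>U\<close> and for \<open>U'\<close>
  is a linear combination of terms with a factor \<open>\<Lambda> v w = 0\<close> (\<open>contraction_orthogonal\<close>). So the
  Poisson bracket vanishes, and the star products in both orders reduce to the commutative
  product, already before passing to quotients.

  The second fact concerns the kernel of the propagator. Bracket and product of cosets are unions
  over representatives, so one has to know in addition that the ideal generated by \<open>ker F\<close> absorbs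
  contractions. It consists of the combinations of monomials with a factor in \<open>ker F\<close>
  (\<open>genideal_sym_poisson\<close>), and a contraction can remove this factor only at the price of a
  coefficient \<open>\<Lambda> \<phi> \<psi>\<close> or \<open>\<Lambda> \<psi> \<phi>\<close> with \<open>F \<phi> = 0\<close>. The first vanishes by definition, the second by
  the following argument (\<open>\<Lambda>_kernel_right\<close>). The section \<open>\<omega> = F\<^sup>+ \<phi> = F\<^sup>- \<phi>\<close> has its support in
  \<open>J\<^sup>+(K) \<inter> J\<^sup>-(K)\<close> for the compact set \<open>K = supp \<phi>\<close>. By global hyperbolicity this support is
  compact, and \<open>\<phi> = D\<^sup>T \<omega>\<close>. Therefore \<open>\<Lambda> \<psi> \<phi> = \<integral> D\<^sup>T \<omega> \<cdot> (F \<psi>)\<^sup>\<sharp>\<close>, and moving the operator from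
  \<open>\<omega>\<close> to \<open>F \<psi>\<close> leaves \<open>\<integral> D\<^sup>T F \<psi> \<cdot> \<omega>\<^sup>\<sharp> = \<integral> (\<psi> - \<psi>) \<cdot> \<omega>\<^sup>\<sharp> = 0\<close>.

  The last step rests on the formal self-adjointness of \<open>D\<close> with respect to \<open>h\<close>
  (\<open>D_formally_selfadjoint\<close>). Pointwise, \<open>h (D u) v - h u (D v)\<close> times the volume density is a
  divergence of an explicit current in every chart, because the density is parallel for the
  Levi-Civita connection; cutoff functions reduce the integral to single charts, where integrals
  of derivatives of compactly supported functions vanish.

  On the algebraic side, the contraction map is specified by its values on monomials, and its
  existence has to be proved. It is obtained by feeding the first argument of both tensors into a
  linear functional that extends \<open>\<Lambda>\<close> to functions of two variables (\<open>contraction_exists\<close>).\<close>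

section \<open>Calculus of continuously differentiable functions\<close>

lemma Ck_SucD:
  assumes "Ck (Suc k) S f"
  shows "x \<in> S \<Longrightarrow> (f has_derivative frechet_derivative f (at x)) (at x)"
    and "b \<in> Basis \<Longrightarrow> Ck k S (\<lambda>x. frechet_derivative f (at x) b)"
  using assms by (simp_all add: frechet_derivative_works[symmetric])

lemma Ck_cong_open:
  assumes "open S" "\<And>x. x \<in> S \<Longrightarrow> f x = g x" "Ck k S f"
  shows "Ck k S g"
  using assms(2,3)
proof (induction k arbitrary: f g)
  case 0 then show ?case using continuous_on_eq by auto
next
  case (Suc k)
  have d: "(g has_derivative frechet_derivative f (at x)) (at x)" if x: "x \<in> S" for x
    by (rule has_derivative_transform_within_open[OF Ck_SucD(1)[OF Suc.prems(2) x] assms(1) x]) (rule Suc.prems(1))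
  have fd: "frechet_derivative f (at x) = frechet_derivative g (at x)" if x: "x \<in> S" for x
    by (rule frechet_derivative_at[OF d[OF x]])
  have "Ck k S (\<lambda>x. frechet_derivative g (at x) b)" if b: "b \<in> Basis" for b
    by (rule Suc.IH[OF _ Ck_SucD(2)[OF Suc.prems(2) b]]) (simp add: fd)
  then show ?case using d by (auto simp: differentiable_def)
qed

lemma Ck_SucI:
  assumes "open S" "\<And>x. x \<in> S \<Longrightarrow> (f has_derivative f' x) (at x)" "\<And>b. b \<in> Basis \<Longrightarrow> Ck k S (\<lambda>x. f' x b)"
  shows "Ck (Suc k) S f"
proof -
  have fd: "f' x = frechet_derivative f (at x)" if x: "x \<in> S" for x
    by (rule frechet_derivative_at[OF assms(2)[OF x]])
  have "Ck k S (\<lambda>x. frechet_derivative f (at x) b)" if b: "b \<in> Basis" for b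
    by (rule Ck_cong_open[OF assms(1) _ assms(3)[OF b]]) (simp add: fd)
  then show ?thesis using assms(2) by (auto simp: differentiable_def)
qed

lemma Ck_continuous: "Ck k S f \<Longrightarrow> continuous_on S f"
  by (cases k) (auto intro!: differentiable_imp_continuous_on simp: differentiable_on_def differentiable_at_withinI)

lemma Ck_Suc_imp: "Ck (Suc k) S f \<Longrightarrow> Ck k S f"
proof (induction k arbitrary: f)
  case 0 then show ?case using Ck_continuous[OF 0] by simp
next
  case (Suc k)
  have "Ck k S (\<lambda>x. frechet_derivative f (at x) b)" if b: "b \<in> Basis" for b
    by (rule Suc.IH[OF Ck_SucD(2)[OF Suc.prems b]])
  then show ?case using Suc.prems by simp
qed

lemma Ck_subset: "Ck k S f \<Longrightarrow> T \<subseteq> S \<Longrightarrow> Ck k T f"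
proof (induction k arbitrary: f)
  case 0 then show ?case by (auto intro: continuous_on_subset)
next
  case (Suc k) then show ?case by auto
qed

lemma Ck_local:
  assumes "\<And>x. x \<in> S \<Longrightarrow> \<exists>T. open T \<and> x \<in> T \<and> Ck k T f"
  shows "Ck k S f"
  using assms
proof (induction k arbitrary: f)
  case 0
  have "isCont f x" if x: "x \<in> S" for x
  proof -
    obtain T where "open T" "x \<in> T" "continuous_on T f" using 0[OF x] by auto
    then show ?thesis by (simp add: continuous_on_eq_continuous_at)
  qed
  then show ?case by (simp add: continuous_at_imp_continuous_on)
next
  case (Suc k)
  have "f differentiable (at x)" if "x \<in> S" for x
    using Suc.prems[OF that] by auto
  moreover have "Ck k S (\<lambda>x. frechet_derivative f (at x) b)" if b: "b \<in> Basis" for b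
  proof (rule Suc.IH)
    fix x assume "x \<in> S"
    then obtain T where T: "open T" "x \<in> T" "Ck (Suc k) T f" using Suc.prems by blast
    then show "\<exists>T. open T \<and> x \<in> T \<and> Ck k T (\<lambda>x. frechet_derivative f (at x) b)"
      using Ck_SucD(2)[OF T(3) b] by blast
  qed
  ultimately show ?case by simp
qed

lemma Ck_const: "open S \<Longrightarrow> Ck k S (\<lambda>x. c)"
proof (induction k arbitrary: c)
  case (Suc k)
  show ?case by (rule Ck_SucI[OF Suc.prems has_derivative_const Suc.IH[OF Suc.prems]])
qed simp

lemma Ck_add: "open S \<Longrightarrow> Ck k S f \<Longrightarrow> Ck k S g \<Longrightarrow> Ck k S (\<lambda>x. f x + g x)"
proof (induction k arbitrary: f g)
  case 0 then show ?case by (simp add: continuous_on_add)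
next
  case (Suc k)
  show ?case
    by (rule Ck_SucI[OF Suc.prems(1) has_derivative_add[OF Ck_SucD(1)[OF Suc.prems(2)] Ck_SucD(1)[OF Suc.prems(3)]]],
        assumption, assumption)
      (rule Suc.IH[OF Suc.prems(1) Ck_SucD(2)[OF Suc.prems(2)] Ck_SucD(2)[OF Suc.prems(3)]])
qed

lemma Ck_linear:
  assumes "bounded_linear h" "open S"
  shows "Ck k S h"
proof (cases k)
  case 0 then show ?thesis using assms(1) by (simp add: linear_continuous_on)
next
  case (Suc n)
  show ?thesis unfolding Suc
    by (rule Ck_SucI[OF assms(2) bounded_linear_imp_has_derivative[OF assms(1)] Ck_const[OF assms(2)]])
qed

lemma Ck_bounded_linear:
  assumes h: "bounded_linear h" and S: "open S"
  shows "Ck k S f \<Longrightarrow> Ck k S (\<lambda>x. h (f x))"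
proof (induction k arbitrary: f)
  case 0
  then show ?case using continuous_on_compose[of S f h] linear_continuous_on[OF h] by (simp add: comp_def)
next
  case (Suc k)
  show ?case
    by (rule Ck_SucI[OF S bounded_linear.has_derivative[OF h Ck_SucD(1)[OF Suc.prems]]], assumption)
       (rule Suc.IH[OF Ck_SucD(2)[OF Suc.prems]])
qed

lemma Ck_bilinear:
  assumes "bounded_bilinear p" "open S"
  shows "Ck k S f \<Longrightarrow> Ck k S g \<Longrightarrow> Ck k S (\<lambda>x. p (f x) (g x))"
proof (induction k arbitrary: f g)
  case 0 then show ?case using bounded_bilinear.continuous_on[OF assms(1)] by simp
next
  case (Suc k)
  have "Ck k S (\<lambda>x. p (f x) (frechet_derivative g (at x) b) + p (frechet_derivative f (at x) b) (g x))"
    if b: "b \<in> Basis" for b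
    by (intro Ck_add[OF assms(2)] Suc.IH Ck_SucD(2)[OF _ b] Suc.prems Ck_Suc_imp)
  then show ?case
    by (intro Ck_SucI[OF assms(2) bounded_bilinear.FDERIV[OF assms(1) Ck_SucD(1)[OF Suc.prems(1)] Ck_SucD(1)[OF Suc.prems(2)]]])
qed

lemma Ck_mult: "open S \<Longrightarrow> Ck k S f \<Longrightarrow> Ck k S g \<Longrightarrow> Ck k S (\<lambda>x. f x * g x :: real)"
  by (rule Ck_bilinear[OF bounded_bilinear_mult])

lemma Ck_scaleR: "open S \<Longrightarrow> Ck k S f \<Longrightarrow> Ck k S g \<Longrightarrow> Ck k S (\<lambda>x. f x *\<^sub>R g x)"
  by (rule Ck_bilinear[OF bounded_bilinear_scaleR])

lemma Ck_minus: "open S \<Longrightarrow> Ck k S f \<Longrightarrow> Ck k S (\<lambda>x. - f x)"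
  by (rule Ck_bounded_linear[OF bounded_linear_minus[OF bounded_linear_ident]])

lemma Ck_diff: "open S \<Longrightarrow> Ck k S f \<Longrightarrow> Ck k S g \<Longrightarrow> Ck k S (\<lambda>x. f x - g x)"
  using Ck_add[of S k f "\<lambda>x. - g x"] Ck_minus[of S k g] by simp

lemma Ck_sum: "open S \<Longrightarrow> (\<And>i. i \<in> I \<Longrightarrow> Ck k S (f i)) \<Longrightarrow> Ck k S (\<lambda>x. \<Sum>i\<in>I. f i x)"
proof (induction I rule: infinite_finite_induct)
  case (insert i I) then show ?case by (simp add: Ck_add)
qed (simp_all add: Ck_const)

text \<open>The chain rule presents the derivative of the composite as a sum over a basis of products of
  functions to which the induction hypothesis applies.\<close>

lemma Ck_compose:
  assumes S: "open S" and T: "open T" and sub: "g ` S \<subseteq> T"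
  shows "Ck k T f \<Longrightarrow> Ck k S g \<Longrightarrow> Ck k S (\<lambda>x. f (g x))"
proof (induction k arbitrary: f)
  case 0
  then show ?case using continuous_on_compose2[of T f S g] sub by simp
next
  case (Suc k)
  note f = Ck_SucD[OF Suc.prems(1)] and g = Ck_SucD[OF Suc.prems(2)]
  \<comment> \<open>the derivative of the composite, expanded in the basis of the intermediate space\<close>
  let ?d = "\<lambda>x h. \<Sum>b\<in>Basis. (frechet_derivative g (at x) h \<bullet> b) *\<^sub>R frechet_derivative f (at (g x)) b"
  show ?case
  proof (rule Ck_SucI[OF S])
    fix x assume x: "x \<in> S"
    have gx: "g x \<in> T" using x sub by blast
    have lin: "linear (frechet_derivative f (at (g x)))" using has_derivative_linear[OF f(1)[OF gx]] .
    have "frechet_derivative f (at (g x)) v = (\<Sum>b\<in>Basis. (v \<bullet> b) *\<^sub>R frechet_derivative f (at (g x)) b)" for v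
    proof -
      have "frechet_derivative f (at (g x)) v = frechet_derivative f (at (g x)) (\<Sum>b\<in>Basis. (v \<bullet> b) *\<^sub>R b)"
        by (simp add: euclidean_representation)
      then show ?thesis by (simp only: linear_sum[OF lin] linear_cmul[OF lin])
    qed
    then have "?d x = (\<lambda>h. frechet_derivative f (at (g x)) (frechet_derivative g (at x) h))"
      by (intro ext) (rule sym)
    moreover have "((\<lambda>x. f (g x)) has_derivative (\<lambda>h. frechet_derivative f (at (g x)) (frechet_derivative g (at x) h))) (at x)"
      by (rule has_derivative_compose[OF g(1)[OF x] f(1)[OF gx]])
    ultimately show "((\<lambda>x. f (g x)) has_derivative ?d x) (at x)" by (simp only:)
  next
    fix b :: 'a assume b: "b \<in> Basis"
    show "Ck k S (\<lambda>x. ?d x b)"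
    proof (intro Ck_sum[OF S] Ck_scaleR[OF S])
      fix b' :: 'b assume b': "b' \<in> Basis"
      show "Ck k S (\<lambda>x. frechet_derivative f (at (g x)) b')"
        by (rule Suc.IH[OF f(2)[OF b'] Ck_Suc_imp[OF Suc.prems(2)]])
      show "Ck k S (\<lambda>x. frechet_derivative g (at x) b \<bullet> b')"
        by (rule Ck_bounded_linear[OF bounded_linear_inner_left S g(2)[OF b]])
    qed
  qed
qed

section \<open>Smooth dependence of solutions of linear systems\<close>

text \<open>Where one factor vanishes, the product rule requires the other factor to be merely continuous.
  This is what lets differentiability of the solution of a linear system follow from its
  continuity.\<close>

lemma has_derivative_mult_vanishing:
  fixes f w :: "'a::real_normed_vector \<Rightarrow> real"
  assumes f: "(f has_derivative f') (at x)" and "f x = 0" and w: "isCont w x"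
  shows "((\<lambda>y. f y * w y) has_derivative (\<lambda>h. f' h * w x)) (at x)"
proof -
  have bl: "bounded_linear f'" using f by (rule has_derivative_bounded_linear)
  obtain K where K: "\<And>h. norm (f' h) \<le> norm h * K" "K > 0" using bounded_linear.pos_bounded[OF bl] by blast
  obtain d where d: "d > 0" "\<And>y. norm (y - x) < d \<Longrightarrow> norm (f y - f x - f' (y - x)) \<le> 1 * norm (y - x)"
    using f unfolding has_derivative_at_alt by (meson zero_less_one)
  have bd: "\<bar>f y\<bar> \<le> (1 + K) * norm (y - x)" if "norm (y - x) < d" for y
    using d(2)[OF that] K(1)[of "y - x"] assms(2) by (simp add: algebra_simps)
  have "((\<lambda>y. f y * (w y - w x)) has_derivative (\<lambda>h. 0)) (at x)"
    unfolding has_derivative_at_alt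
  proof (intro conjI allI impI)
    fix e :: real assume "e > 0"
    then obtain d' where d': "d' > 0" "\<And>y. dist y x < d' \<Longrightarrow> dist (w y) (w x) < e / (1 + K)"
      using w K(2) unfolding continuous_at_eps_delta
      by (metis add_pos_pos divide_pos_pos zero_less_one)
    show "\<exists>d>0. \<forall>y. norm (y - x) < d \<longrightarrow> norm (f y * (w y - w x) - f x * (w x - w x) - 0) \<le> e * norm (y - x)"
    proof (intro exI[of _ "min d d'"] conjI allI impI)
      fix y assume y: "norm (y - x) < min d d'"
      have "\<bar>f y\<bar> * \<bar>w y - w x\<bar> \<le> ((1 + K) * norm (y - x)) * (e / (1 + K))"
        using bd[of y] d'(2)[of y] y K(2) by (intro mult_mono) (auto simp: dist_norm)
      also have "\<dots> = e * norm (y - x)" using K(2) by (simp add: field_simps)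
      finally show "norm (f y * (w y - w x) - f x * (w x - w x) - 0) \<le> e * norm (y - x)"
        by (simp add: abs_mult)
    qed (use d d' in auto)
  qed simp
  moreover have "((\<lambda>y. f y * w x) has_derivative (\<lambda>h. f' h * w x)) (at x)"
    by (rule has_derivative_mult_left[OF f])
  ultimately have "((\<lambda>y. f y * w x + f y * (w y - w x)) has_derivative (\<lambda>h. f' h * w x + 0)) (at x)"
    by (intro has_derivative_add)
  then show ?thesis by (simp add: algebra_simps)
qed

text \<open>Matrices whose size is a number rather than a type occur for frames of a bundle, matrices
  indexed by a type for the metric. Stating smooth dependence for systems over a finite index set
  covers both.\<close>

locale linear_system =
  fixes J :: "'i set" and S :: "'a::euclidean_space set"
    and H :: "'a \<Rightarrow> 'i \<Rightarrow> 'i \<Rightarrow> real" and b w :: "'a \<Rightarrow> 'i \<Rightarrow> real"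
  assumes J: "finite J" and S: "open S"
    and eq: "\<And>x i. x \<in> S \<Longrightarrow> i \<in> J \<Longrightarrow> (\<Sum>j\<in>J. H x i j * w x j) = b x i"
    and inv: "\<And>x. x \<in> S \<Longrightarrow> \<exists>G. \<forall>j\<in>J. \<forall>l\<in>J. (\<Sum>i\<in>J. G j i * H x i l) = (if j = l then 1 else (0::real))"
begin

text \<open>Freezing the matrix at \<open>x0\<close> and applying its left inverse turns the system into a fixed point
  equation in which the solution only occurs with coefficients that vanish at \<open>x0\<close>.\<close>

lemma resolved:
  assumes "x0 \<in> S" "\<forall>j\<in>J. \<forall>l\<in>J. (\<Sum>i\<in>J. G j i * H x0 i l) = (if j = l then 1 else 0)"
    and "x \<in> S" "j \<in> J"
  shows "w x j = (\<Sum>i\<in>J. G j i * (b x i - (\<Sum>l\<in>J. (H x i l - H x0 i l) * w x l)))"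
proof -
  have "w x j = (\<Sum>l\<in>J. (if j = l then 1 else 0) * w x l)"
  proof -
    have "(\<Sum>l\<in>J. (if j = l then 1 else 0) * w x l) = (\<Sum>l\<in>J. if j = l then w x l else 0)"
      by (rule sum.cong) auto
    then show ?thesis using J assms(4) by simp
  qed
  also have "\<dots> = (\<Sum>l\<in>J. (\<Sum>i\<in>J. G j i * H x0 i l) * w x l)"
    using assms by (intro sum.cong) auto
  also have "\<dots> = (\<Sum>i\<in>J. G j i * (\<Sum>l\<in>J. H x0 i l * w x l))"
    unfolding sum_distrib_left sum_distrib_right mult.assoc by (rule sum.swap)
  also have "\<dots> = (\<Sum>i\<in>J. G j i * (b x i - (\<Sum>l\<in>J. (H x i l - H x0 i l) * w x l)))"
  proof (rule sum.cong[OF refl])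
    fix i assume i: "i \<in> J"
    have "(\<Sum>l\<in>J. (H x i l - H x0 i l) * w x l) = b x i - (\<Sum>l\<in>J. H x0 i l * w x l)"
      unfolding left_diff_distrib sum_subtractf eq[OF assms(3) i] ..
    then show "G j i * (\<Sum>l\<in>J. H x0 i l * w x l) = G j i * (b x i - (\<Sum>l\<in>J. (H x i l - H x0 i l) * w x l))"
      by simp
  qed
  finally show ?thesis .
qed

text \<open>The fixed point equation bounds the norm \<open>N\<close> of the solution by \<open>B + E * N\<close>, where \<open>B\<close> is
  bounded and \<open>E\<close> tends to 0. So the solution is bounded near \<open>x0\<close>, and the perturbation terms
  tend to 0.\<close>

lemma solution_isCont:
  assumes x0: "x0 \<in> S" and H: "\<And>i l. i \<in> J \<Longrightarrow> l \<in> J \<Longrightarrow> isCont (\<lambda>x. H x i l) x0"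
    and b: "\<And>i. i \<in> J \<Longrightarrow> isCont (\<lambda>x. b x i) x0" and j: "j \<in> J"
  shows "isCont (\<lambda>x. w x j) x0"
proof -
  obtain G where G: "\<forall>j\<in>J. \<forall>l\<in>J. (\<Sum>i\<in>J. G j i * H x0 i l) = (if j = l then 1 else (0::real))"
    using inv[OF x0] by blast
  note res = resolved[OF x0 G]
  let ?N = "\<lambda>x. \<Sum>j\<in>J. \<bar>w x j\<bar>"
  let ?B = "\<lambda>x. \<Sum>j\<in>J. \<Sum>i\<in>J. \<bar>G j i\<bar> * \<bar>b x i\<bar>"
  let ?E = "\<lambda>x. \<Sum>j\<in>J. \<Sum>i\<in>J. \<bar>G j i\<bar> * (\<Sum>l\<in>J. \<bar>H x i l - H x0 i l\<bar>)"
  have D0: "((\<lambda>x. H x i l - H x0 i l) \<longlongrightarrow> 0) (at x0)" if "i \<in> J" "l \<in> J" for i l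
    using H[OF that] by (simp add: isCont_def LIM_zero)
  have NE: "?N x \<le> ?B x + ?E x * ?N x" if x: "x \<in> S" for x
  proof -
    have "?N x \<le> (\<Sum>j\<in>J. \<Sum>i\<in>J. \<bar>G j i\<bar> * (\<bar>b x i\<bar> + (\<Sum>l\<in>J. \<bar>H x i l - H x0 i l\<bar>) * ?N x))"
    proof (rule sum_mono)
      fix j assume j: "j \<in> J"
      have "\<bar>w x j\<bar> \<le> (\<Sum>i\<in>J. \<bar>G j i * (b x i - (\<Sum>l\<in>J. (H x i l - H x0 i l) * w x l))\<bar>)"
        unfolding res[OF x j] by (rule sum_abs)
      also have "\<dots> \<le> (\<Sum>i\<in>J. \<bar>G j i\<bar> * (\<bar>b x i\<bar> + (\<Sum>l\<in>J. \<bar>H x i l - H x0 i l\<bar>) * ?N x))"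
        unfolding abs_mult
      proof (intro sum_mono mult_left_mono)
        fix i assume "i \<in> J"
        have "\<bar>\<Sum>l\<in>J. (H x i l - H x0 i l) * w x l\<bar> \<le> (\<Sum>l\<in>J. \<bar>H x i l - H x0 i l\<bar> * ?N x)"
        proof (rule order_trans[OF sum_abs], rule sum_mono)
          fix l assume "l \<in> J"
          then have "\<bar>w x l\<bar> \<le> ?N x" using J by (intro member_le_sum) auto
          then show "\<bar>(H x i l - H x0 i l) * w x l\<bar> \<le> \<bar>H x i l - H x0 i l\<bar> * ?N x"
            unfolding abs_mult by (intro mult_left_mono) auto
        qed
        then show "\<bar>b x i - (\<Sum>l\<in>J. (H x i l - H x0 i l) * w x l)\<bar> \<le> \<bar>b x i\<bar> + (\<Sum>l\<in>J. \<bar>H x i l - H x0 i l\<bar>) * ?N x"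
          unfolding sum_distrib_right by linarith
      qed auto
      finally show "\<bar>w x j\<bar> \<le> (\<Sum>i\<in>J. \<bar>G j i\<bar> * (\<bar>b x i\<bar> + (\<Sum>l\<in>J. \<bar>H x i l - H x0 i l\<bar>) * ?N x))" .
    qed
    also have "\<dots> = ?B x + ?E x * ?N x"
      unfolding distrib_left sum.distrib sum_distrib_right[symmetric] mult.assoc[symmetric] ..
    finally show ?thesis .
  qed
  have "(?E \<longlongrightarrow> 0) (at x0)"
    by (intro tendsto_null_sum tendsto_mult_right_zero tendsto_rabs_zero D0)
  then have ev1: "\<forall>\<^sub>F x in at x0. ?E x < 1 / 2" by (rule order_tendstoD) simp
  have "(?B \<longlongrightarrow> ?B x0) (at x0)"
    using b by (intro tendsto_intros) (auto simp: isCont_def)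
  then have ev2: "\<forall>\<^sub>F x in at x0. ?B x < ?B x0 + 1" by (rule order_tendstoD) simp
  have ev3: "\<forall>\<^sub>F x in at x0. x \<in> S" using S x0 by (rule eventually_at_in_open')
  \<comment> \<open>\<open>N \<le> B + N / 2\<close> and \<open>B \<le> B x0 + 1\<close> near \<open>x0\<close>\<close>
  define C where "C = 2 * (?B x0 + 1)"
  have half: "n \<le> 2 * (b0 + 1)" if "n \<le> b + m" "b < b0 + 1" "m \<le> (1 / 2) * n" for n b m b0 :: real
    using that by (simp add: field_simps)
  have bounded: "\<forall>\<^sub>F x in at x0. \<forall>l\<in>J. \<bar>w x l\<bar> \<le> C"
    using ev1 ev2 ev3
  proof eventually_elim
    case (elim x)
    have "0 \<le> ?N x" by (simp add: sum_nonneg)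
    then have "?E x * ?N x \<le> (1 / 2) * ?N x" using elim(1) by (intro mult_right_mono) auto
    from half[OF NE[OF elim(3)] elim(2) this] have "?N x \<le> C" unfolding C_def .
    moreover have "\<bar>w x l\<bar> \<le> ?N x" if "l \<in> J" for l using that J by (intro member_le_sum) auto
    ultimately show ?case by fastforce
  qed
  have small: "((\<lambda>x. (H x i l - H x0 i l) * w x l) \<longlongrightarrow> 0) (at x0)" if il: "i \<in> J" "l \<in> J" for i l
  proof (rule Lim_null_comparison)
    show "\<forall>\<^sub>F x in at x0. norm ((H x i l - H x0 i l) * w x l) \<le> \<bar>H x i l - H x0 i l\<bar> * C"
      using bounded by eventually_elim (use il in \<open>auto simp: abs_mult intro!: mult_left_mono\<close>)
    show "((\<lambda>x. \<bar>H x i l - H x0 i l\<bar> * C) \<longlongrightarrow> 0) (at x0)"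
      by (intro tendsto_mult_left_zero tendsto_rabs_zero D0 il)
  qed
  have "((\<lambda>x. \<Sum>i\<in>J. G j i * (b x i - (\<Sum>l\<in>J. (H x i l - H x0 i l) * w x l))) \<longlongrightarrow> (\<Sum>i\<in>J. G j i * (b x0 i - 0))) (at x0)"
    using b by (intro tendsto_sum tendsto_mult tendsto_const tendsto_diff tendsto_null_sum small) (auto simp: isCont_def)
  moreover have "w x0 j = (\<Sum>i\<in>J. G j i * (b x0 i - 0))" using res[OF x0 j] by simp
  ultimately have "((\<lambda>x. \<Sum>i\<in>J. G j i * (b x i - (\<Sum>l\<in>J. (H x i l - H x0 i l) * w x l))) \<longlongrightarrow> w x0 j) (at x0)"
    by (simp only:)
  moreover have "\<forall>\<^sub>F x in at x0. (\<Sum>i\<in>J. G j i * (b x i - (\<Sum>l\<in>J. (H x i l - H x0 i l) * w x l))) = w x j"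
    using ev3 by eventually_elim (rule res[OF _ j, symmetric])
  ultimately show ?thesis unfolding isCont_def by (rule Lim_transform_eventually)
qed

lemma solution_differentiable:
  assumes x0: "x0 \<in> S" and H: "\<And>i l. i \<in> J \<Longrightarrow> l \<in> J \<Longrightarrow> (\<lambda>x. H x i l) differentiable (at x0)"
    and b: "\<And>i. i \<in> J \<Longrightarrow> (\<lambda>x. b x i) differentiable (at x0)" and j: "j \<in> J"
  shows "(\<lambda>x. w x j) differentiable (at x0)"
proof -
  obtain G where G: "\<forall>j\<in>J. \<forall>l\<in>J. (\<Sum>i\<in>J. G j i * H x0 i l) = (if j = l then 1 else (0::real))"
    using inv[OF x0] by blast
  have cont: "isCont (\<lambda>x. w x l) x0" if "l \<in> J" for l
    using H b that by (intro solution_isCont[OF x0]) (auto intro: differentiable_imp_continuous_within)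
  have "(\<lambda>x. (H x i l - H x0 i l) * w x l) differentiable (at x0)" if "i \<in> J" "l \<in> J" for i l
  proof -
    have "(\<lambda>x. H x i l - H x0 i l) differentiable (at x0)"
      using H[OF that] by (intro differentiable_diff) auto
    then obtain D where "((\<lambda>x. H x i l - H x0 i l) has_derivative D) (at x0)" by (auto simp: differentiable_def)
    from has_derivative_mult_vanishing[OF this _ cont[OF that(2)]] show ?thesis by (auto simp: differentiable_def)
  qed
  then have "(\<lambda>x. \<Sum>i\<in>J. G j i * (b x i - (\<Sum>l\<in>J. (H x i l - H x0 i l) * w x l))) differentiable (at x0)"
    using J b by (intro differentiable_sum ballI differentiable_mult[OF differentiable_const] differentiable_diff) auto
  then obtain D where D: "((\<lambda>x. \<Sum>i\<in>J. G j i * (b x i - (\<Sum>l\<in>J. (H x i l - H x0 i l) * w x l))) has_derivative D) (at x0)"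
    by (auto simp: differentiable_def)
  have "((\<lambda>x. w x j) has_derivative D) (at x0)"
    by (rule has_derivative_transform_within_open[OF D S x0]) (rule resolved[OF x0 G _ j, symmetric])
  then show ?thesis by (auto simp: differentiable_def)
qed

end

text \<open>The derivative of a solution solves a system with the same matrix and another right-hand side,
  which makes induction on the order possible.\<close>

lemma Ck_linear_system:
  assumes "linear_system J S H b w"
    and "\<And>i l. i \<in> J \<Longrightarrow> l \<in> J \<Longrightarrow> Ck k S (\<lambda>x. H x i l)" "\<And>i. i \<in> J \<Longrightarrow> Ck k S (\<lambda>x. b x i)" "j \<in> J"
  shows "Ck k S (\<lambda>x. w x j)"
  using assms
proof (induction k arbitrary: b w j)
  case 0
  interpret linear_system J S H b w by (rule 0(1))
  show ?case
    using 0 S by (auto simp: continuous_on_eq_continuous_at intro!: solution_isCont)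
next
  case (Suc k)
  interpret linear_system J S H b w by (rule Suc.prems(1))
  have diff: "(\<lambda>x. w x l) differentiable (at x)" if "x \<in> S" "l \<in> J" for x l
    using that Suc.prems(2,3) by (intro solution_differentiable) auto
  let ?d = "\<lambda>f x. frechet_derivative f (at x)"
  have dw: "((\<lambda>x. w x l) has_derivative ?d (\<lambda>x. w x l) x) (at x)" if "x \<in> S" "l \<in> J" for x l
    using diff[OF that] by (simp add: frechet_derivative_works)
  have Ckw: "Ck k S (\<lambda>x. w x l)" if "l \<in> J" for l
    by (rule Suc.IH[OF Suc.prems(1) Ck_Suc_imp[OF Suc.prems(2)] Ck_Suc_imp[OF Suc.prems(3)] that])
  have "Ck k S (\<lambda>x. ?d (\<lambda>x. w x j) x e)" if e: "e \<in> Basis" for e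
  proof (rule Suc.IH)
    show "linear_system J S H (\<lambda>x i. ?d (\<lambda>x. b x i) x e - (\<Sum>l\<in>J. ?d (\<lambda>x. H x i l) x e * w x l)) (\<lambda>x j. ?d (\<lambda>x. w x j) x e)"
    proof (unfold_locales)
      fix x i assume x: "x \<in> S" and i: "i \<in> J"
      have "((\<lambda>x. \<Sum>l\<in>J. H x i l * w x l) has_derivative
          (\<lambda>h. \<Sum>l\<in>J. H x i l * ?d (\<lambda>x. w x l) x h + ?d (\<lambda>x. H x i l) x h * w x l)) (at x)"
        by (intro has_derivative_sum has_derivative_mult dw[OF x] Ck_SucD(1)[OF Suc.prems(2)] x i)
      then have "((\<lambda>x. b x i) has_derivative
          (\<lambda>h. \<Sum>l\<in>J. H x i l * ?d (\<lambda>x. w x l) x h + ?d (\<lambda>x. H x i l) x h * w x l)) (at x)"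
        by (rule has_derivative_transform_within_open[OF _ S x]) (rule eq[OF _ i])
      then have "?d (\<lambda>x. b x i) x = (\<lambda>h. \<Sum>l\<in>J. H x i l * ?d (\<lambda>x. w x l) x h + ?d (\<lambda>x. H x i l) x h * w x l)"
        by (rule frechet_derivative_at[symmetric])
      then show "(\<Sum>l\<in>J. H x i l * ?d (\<lambda>x. w x l) x e) =
          ?d (\<lambda>x. b x i) x e - (\<Sum>l\<in>J. ?d (\<lambda>x. H x i l) x e * w x l)"
        by (simp add: sum.distrib)
    qed (use J S inv in auto)
    show "Ck k S (\<lambda>x. H x i l)" if "i \<in> J" "l \<in> J" for i l
      by (rule Ck_Suc_imp[OF Suc.prems(2)[OF that]])
    show "Ck k S (\<lambda>x. ?d (\<lambda>x. b x i) x e - (\<Sum>l\<in>J. ?d (\<lambda>x. H x i l) x e * w x l))" if "i \<in> J" for i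
      by (intro Ck_diff[OF S] Ck_sum[OF S] Ck_mult[OF S] Ck_SucD(2)[OF _ e] Suc.prems(2,3) Ckw that)
  qed (rule Suc.prems(4))
  with diff Suc.prems(4) show ?case by simp
qed

lemma Ck_divide:
  fixes f g :: "'a::euclidean_space \<Rightarrow> real"
  assumes "open S" "Ck k S f" "Ck k S g" "\<And>x. x \<in> S \<Longrightarrow> g x \<noteq> 0"
  shows "Ck k S (\<lambda>x. f x / g x)"
proof -
  have "linear_system {()} S (\<lambda>x _ _. g x) (\<lambda>x _. f x) (\<lambda>x _. f x / g x)"
  proof unfold_locales
    fix x assume "x \<in> S"
    then show "\<exists>G. \<forall>j\<in>{()}. \<forall>l\<in>{()}. (\<Sum>i\<in>{()}. G j i * g x) = (if j = l then 1 else 0)"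
      using assms(4) by (intro exI[of _ "\<lambda>_ _. 1 / g x"]) auto
  qed (use assms in auto)
  from Ck_linear_system[OF this, of k "()"] assms show ?thesis by simp
qed

section \<open>Smooth cutoff functions\<close>

text \<open>The classical flat function \<open>exp (- 1 / t)\<close> together with its multiples by powers of \<open>1 / t\<close>:
  this family is closed under differentiation up to linear combinations.\<close>

definition flat :: "nat \<Rightarrow> real \<Rightarrow> real" where
  "flat m t = (if t > 0 then exp (- inverse t) * inverse t ^ m else 0)"

text \<open>Vanishing at the origin to first order, from \<open>exp u \<ge> (u / n)^n\<close> with \<open>u = 1 / t\<close> and
  \<open>n = m + 1\<close>.\<close>

lemma flat_bound: "\<bar>flat m t\<bar> \<le> real (Suc m) ^ Suc m * \<bar>t\<bar>"
proof (cases "t > 0")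
  case True
  let ?n = "Suc m" and ?u = "inverse t"
  have u: "?u > 0" using True by simp
  have "(?u / real ?n) ^ ?n \<le> (1 + ?u / real ?n) ^ ?n"
    using u by (intro power_mono) auto
  also have "\<dots> \<le> exp ?u"
    by (rule exp_ge_one_plus_x_over_n_power_n) (use u in linarith, simp)
  finally have 1: "(?u / real ?n) ^ ?n \<le> exp ?u" .
  have "exp (- ?u) = 1 / exp ?u" by (simp add: exp_minus field_simps)
  also have "\<dots> \<le> 1 / (?u / real ?n) ^ ?n"
    using 1 u by (intro divide_left_mono) auto
  also have "\<dots> = (real ?n * t) ^ ?n" using True by (simp add: power_divide field_simps)
  finally have "exp (- ?u) * ?u ^ m \<le> (real ?n * t) ^ ?n * ?u ^ m" using u by (intro mult_right_mono) auto
  also have "\<dots> = real ?n ^ ?n * (t ^ Suc m * ?u ^ m)" by (simp only: power_mult_distrib mult.assoc)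
  also have "t ^ Suc m * ?u ^ m = t" using True by (simp add: power_inverse)
  finally show ?thesis using True by (simp add: flat_def)
next
  case False
  have "0 \<le> real (Suc m) ^ Suc m * \<bar>t\<bar>" by (intro mult_nonneg_nonneg) auto
  then show ?thesis using False by (simp only: flat_def if_False abs_zero)
qed

lemma flat_deriv: "(flat m has_real_derivative (flat (m + 2) t - real m * flat (Suc m) t)) (at t)"
proof -
  consider "t > 0" | "t < 0" | "t = 0" by linarith
  then show ?thesis
  proof cases
    case 1
    have "((\<lambda>t. exp (- inverse t) * inverse t ^ m) has_real_derivative (flat (m + 2) t - real m * flat (Suc m) t)) (at t)"
    proof -
      have "((\<lambda>t. exp (- inverse t) * inverse t ^ m) has_real_derivative
        exp (- inverse t) * (inverse t * inverse t) * inverse t ^ m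
          + exp (- inverse t) * (real m * inverse t ^ (m - 1) * (- (inverse t * inverse t)))) (at t)"
        using 1 by (auto intro!: derivative_eq_intros)
      moreover have "exp (- inverse t) * (inverse t * inverse t) * inverse t ^ m
          + exp (- inverse t) * (real m * inverse t ^ (m - 1) * (- (inverse t * inverse t)))
          = flat (m + 2) t - real m * flat (Suc m) t"
        using 1 by (cases m) (auto simp: flat_def algebra_simps)
      ultimately show ?thesis by (simp only:)
    qed
    then show ?thesis
      by (rule has_field_derivative_transform_within_open[where S="{0<..}"]) (use 1 in \<open>auto simp: flat_def\<close>)
  next
    case 2
    have "((\<lambda>t. 0) has_real_derivative (flat (m + 2) t - real m * flat (Suc m) t)) (at t)"
      using 2 by (simp add: flat_def)
    then show ?thesis
      by (rule has_field_derivative_transform_within_open[where S="{..<0}"]) (use 2 in \<open>auto simp: flat_def\<close>)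
  next
    case 3
    have "((\<lambda>h. flat m h / h) \<longlongrightarrow> 0) (at 0)"
    proof (rule Lim_null_comparison)
      show "\<forall>\<^sub>F h in at 0. norm (flat m h / h) \<le> real (Suc (Suc m)) ^ Suc (Suc m) * \<bar>h\<bar>"
      proof (rule always_eventually, rule allI)
        fix h :: real
        have "flat m h / h = flat (Suc m) h" by (simp add: flat_def divide_inverse)
        then show "norm (flat m h / h) \<le> real (Suc (Suc m)) ^ Suc (Suc m) * \<bar>h\<bar>" using flat_bound[of "Suc m" h] by (simp only: real_norm_def)
      qed
      show "((\<lambda>h. real (Suc (Suc m)) ^ Suc (Suc m) * \<bar>h\<bar>) \<longlongrightarrow> 0) (at 0)"
        by (intro tendsto_mult_right_zero tendsto_rabs_zero tendsto_ident_at)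
    qed
    then show ?thesis unfolding 3 DERIV_def by (simp add: flat_def)
  qed
qed

lemma Ck_flat: "Ck k UNIV (flat m)"
proof (induction k arbitrary: m)
  case 0
  show ?case using DERIV_isCont[OF flat_deriv] by (simp add: continuous_at_imp_continuous_on)
next
  case (Suc k)
  show ?case
  proof (rule Ck_SucI[OF open_UNIV])
    fix t show "(flat m has_derivative (\<lambda>h. (flat (m + 2) t - real m * flat (Suc m) t) * h)) (at t)"
      using flat_deriv[of m t] by (simp add: has_field_derivative_def)
    fix e :: real assume "e \<in> Basis"
    show "Ck k UNIV (\<lambda>t. (flat (m + 2) t - real m * flat (Suc m) t) * e)"
      by (intro Ck_mult Ck_diff Ck_const Suc.IH open_UNIV)
  qed
qed

text \<open>With \<open>s = 2 * |y - y0|^2 / r^2\<close>, the function \<open>flat 0 (2 - s)\<close> vanishes for \<open>s \<ge> 2\<close> and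
  \<open>flat 0 (s - 1)\<close> vanishes for \<open>s \<le> 1\<close>, while their sum is positive.\<close>

lemma smooth_cutoff_euclidean:
  fixes y0 :: "'a::euclidean_space"
  assumes "r > 0"
  obtains q where "\<And>k. Ck k UNIV q" "\<And>y. norm (y - y0) < r / 2 \<Longrightarrow> q y = (1::real)" "\<And>y. norm (y - y0) \<ge> r \<Longrightarrow> q y = 0"
proof
  define s where "s y = 2 * ((y - y0) \<bullet> (y - y0)) / r\<^sup>2" for y
  let ?q = "\<lambda>y. flat 0 (2 - s y) / (flat 0 (2 - s y) + flat 0 (s y - 1))"
  fix k
  have "Ck k UNIV (\<lambda>y. y - y0)" by (intro Ck_diff Ck_const Ck_linear bounded_linear_ident open_UNIV)
  then have "Ck k UNIV (\<lambda>y. (y - y0) \<bullet> (y - y0))" by (intro Ck_bilinear[OF bounded_bilinear_inner] open_UNIV)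
  then have "Ck k UNIV (\<lambda>y. (2 / r\<^sup>2) * ((y - y0) \<bullet> (y - y0)))" by (intro Ck_mult Ck_const open_UNIV)
  then have "Ck k UNIV s" by (simp add: s_def[abs_def])
  then have f: "Ck k UNIV (\<lambda>y. flat 0 (2 - s y))" "Ck k UNIV (\<lambda>y. flat 0 (s y - 1))"
    by (intro Ck_compose[OF open_UNIV open_UNIV _ Ck_flat] Ck_diff Ck_const open_UNIV; simp)+
  show "Ck k UNIV ?q"
  proof (intro Ck_divide Ck_add f open_UNIV)
    fix y
    have "flat 0 (2 - s y) \<ge> 0" "flat 0 (s y - 1) \<ge> 0" "flat 0 (2 - s y) > 0 \<or> flat 0 (s y - 1) > 0"
      by (auto simp: flat_def)
    then show "flat 0 (2 - s y) + flat 0 (s y - 1) \<noteq> 0" by linarith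
  qed
next
  fix y assume y: "norm (y - y0) < r / 2"
  have "(y - y0) \<bullet> (y - y0) \<le> (r / 2)\<^sup>2"
    unfolding power2_norm_eq_inner[symmetric] using y by (intro power_mono) auto
  then have "4 * ((y - y0) \<bullet> (y - y0)) \<le> r\<^sup>2" by (simp add: power_divide)
  moreover have "0 \<le> (y - y0) \<bullet> (y - y0)" by simp
  ultimately have "2 * ((y - y0) \<bullet> (y - y0)) \<le> r\<^sup>2" by linarith
  then have "2 * ((y - y0) \<bullet> (y - y0)) / r\<^sup>2 \<le> 1" using assms by simp
  then show "flat 0 (2 - 2 * ((y - y0) \<bullet> (y - y0)) / r\<^sup>2) / (flat 0 (2 - 2 * ((y - y0) \<bullet> (y - y0)) / r\<^sup>2)
      + flat 0 (2 * ((y - y0) \<bullet> (y - y0)) / r\<^sup>2 - 1)) = 1"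
    by (simp add: flat_def)
next
  fix y assume y: "norm (y - y0) \<ge> r"
  have "r\<^sup>2 \<le> (y - y0) \<bullet> (y - y0)"
    unfolding power2_norm_eq_inner[symmetric] using y assms by (intro power_mono) auto
  then have "2 * ((y - y0) \<bullet> (y - y0)) / r\<^sup>2 \<ge> 2" using assms by (simp add: field_simps)
  then show "flat 0 (2 - 2 * ((y - y0) \<bullet> (y - y0)) / r\<^sup>2) / (flat 0 (2 - 2 * ((y - y0) \<bullet> (y - y0)) / r\<^sup>2)
      + flat 0 (2 * ((y - y0) \<bullet> (y - y0)) / r\<^sup>2 - 1)) = 0"
    by (simp add: flat_def)
qed

section \<open>Smooth functions on the manifold\<close>

locale smooth_mfd =
  fixes S :: "('m::t2_space, 'n::finite, 'z) spacetime_scheme"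
  assumes mfd: "smooth_manifold S"
begin

lemma chart_exists: "\<exists>c\<in>atlas S. p \<in> fst c"
  using mfd unfolding smooth_manifold_def by blast

context
  fixes c assumes c: "c \<in> atlas S"
begin

lemma chart_open: "open (fst c)"
  and chart_open_image: "open (snd c ` fst c)"
  and chart_homeo: "homeomorphism (fst c) (snd c ` fst c) (snd c) (cinv c)"
  using mfd c unfolding smooth_manifold_def by blast+

lemma cinv_coord: "p \<in> fst c \<Longrightarrow> cinv c (snd c p) = p"
  and coord_cinv: "y \<in> snd c ` fst c \<Longrightarrow> snd c (cinv c y) = y"
  and cinv_mem: "y \<in> snd c ` fst c \<Longrightarrow> cinv c y \<in> fst c"
  and coord_continuous: "continuous_on (fst c) (snd c)"
  and cinv_continuous: "continuous_on (snd c ` fst c) (cinv c)"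
  using chart_homeo unfolding homeomorphism_def by auto

lemma coord_image_iff: "y \<in> snd c ` (W \<inter> fst c) \<longleftrightarrow> y \<in> snd c ` fst c \<and> cinv c y \<in> W"
  using cinv_coord coord_cinv cinv_mem by force

lemma coord_image_open:
  assumes "open W"
  shows "open (snd c ` (W \<inter> fst c))"
proof -
  have "snd c ` (W \<inter> fst c) = snd c ` fst c \<inter> cinv c -` W"
    using coord_image_iff by blast
  then show ?thesis
    using continuous_open_preimage[OF cinv_continuous chart_open_image assms] by simp
qed

lemma coord_preimage_open: "open T \<Longrightarrow> open (fst c \<inter> snd c -` T)"
  by (rule continuous_open_preimage[OF coord_continuous chart_open])

end

lemma transition_smooth: "c \<in> atlas S \<Longrightarrow> d \<in> atlas S \<Longrightarrow> Ck k (snd c ` (fst c \<inter> fst d)) (\<lambda>y. snd d (cinv c y))"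
  using mfd unfolding smooth_manifold_def smooth_on_def by blast

lemma transition_open: "c \<in> atlas S \<Longrightarrow> d \<in> atlas S \<Longrightarrow> open (snd c ` (fst c \<inter> fst d))"
  using coord_image_open[of c "fst d"] chart_open[of d] by (simp add: Int_commute)

lemma smooth_funI: "(\<And>c k. c \<in> atlas S \<Longrightarrow> Ck k (snd c ` (W \<inter> fst c)) (\<lambda>y. f (cinv c y))) \<Longrightarrow> smooth_fun S W f"
  unfolding smooth_fun_def smooth_on_def by blast

lemma smooth_funD: "smooth_fun S W f \<Longrightarrow> c \<in> atlas S \<Longrightarrow> Ck k (snd c ` (W \<inter> fst c)) (\<lambda>y. f (cinv c y))"
  unfolding smooth_fun_def smooth_on_def by blast

lemma smooth_fun_subset: "smooth_fun S W f \<Longrightarrow> V \<subseteq> W \<Longrightarrow> smooth_fun S V f"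
  by (rule smooth_funI, rule Ck_subset[OF smooth_funD]) auto

lemma smooth_fun_cong:
  assumes "open W" "\<And>p. p \<in> W \<Longrightarrow> f p = g p" "smooth_fun S W f"
  shows "smooth_fun S W g"
proof (rule smooth_funI)
  fix c k assume c: "c \<in> atlas S"
  show "Ck k (snd c ` (W \<inter> fst c)) (\<lambda>y. g (cinv c y))"
    by (rule Ck_cong_open[OF coord_image_open[OF c assms(1)] _ smooth_funD[OF assms(3) c]])
       (use assms(2) coord_image_iff[OF c] in blast)
qed

lemma smooth_fun_local:
  assumes "\<And>p. p \<in> W \<Longrightarrow> \<exists>V. open V \<and> p \<in> V \<and> smooth_fun S V f"
  shows "smooth_fun S W f"
proof (rule smooth_funI, rule Ck_local)
  fix c k y assume c: "c \<in> atlas S" and y: "y \<in> snd c ` (W \<inter> fst c)"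
  then have "cinv c y \<in> W" using coord_image_iff by blast
  then obtain V where V: "open V" "cinv c y \<in> V" "smooth_fun S V f" using assms by blast
  have "y \<in> snd c ` (V \<inter> fst c)" using y V(2) coord_image_iff[OF c] by blast
  then show "\<exists>T. open T \<and> y \<in> T \<and> Ck k T (\<lambda>y. f (cinv c y))"
    using coord_image_open[OF c V(1)] smooth_funD[OF V(3) c] by blast
qed

lemma smooth_fun_const: "open W \<Longrightarrow> smooth_fun S W (\<lambda>p. a)"
  by (rule smooth_funI, rule Ck_const, rule coord_image_open)

lemma smooth_fun_add: "open W \<Longrightarrow> smooth_fun S W f \<Longrightarrow> smooth_fun S W g \<Longrightarrow> smooth_fun S W (\<lambda>p. f p + g p)"
  by (rule smooth_funI, rule Ck_add) (auto intro: coord_image_open smooth_funD)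

lemma smooth_fun_diff: "open W \<Longrightarrow> smooth_fun S W f \<Longrightarrow> smooth_fun S W g \<Longrightarrow> smooth_fun S W (\<lambda>p. f p - g p)"
  by (rule smooth_funI, rule Ck_diff) (auto intro: coord_image_open smooth_funD)

lemma smooth_fun_mult: "open W \<Longrightarrow> smooth_fun S W f \<Longrightarrow> smooth_fun S W g \<Longrightarrow> smooth_fun S W (\<lambda>p. f p * g p)"
  by (rule smooth_funI, rule Ck_mult) (auto intro: coord_image_open smooth_funD)

lemma smooth_fun_sum: "open W \<Longrightarrow> (\<And>i. i \<in> I \<Longrightarrow> smooth_fun S W (f i)) \<Longrightarrow> smooth_fun S W (\<lambda>p. \<Sum>i\<in>I. f i p)"
  by (rule smooth_funI, rule Ck_sum) (auto intro: coord_image_open smooth_funD)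

lemma smooth_fun_linear_system:
  assumes W: "open W" and J: "finite J"
    and H: "\<And>i l. i \<in> J \<Longrightarrow> l \<in> J \<Longrightarrow> smooth_fun S W (\<lambda>p. H p i l)" and b: "\<And>i. i \<in> J \<Longrightarrow> smooth_fun S W (\<lambda>p. b p i)"
    and eq: "\<And>p i. p \<in> W \<Longrightarrow> i \<in> J \<Longrightarrow> (\<Sum>j\<in>J. H p i j * w p j) = b p i"
    and inv: "\<And>p. p \<in> W \<Longrightarrow> \<exists>G. \<forall>j\<in>J. \<forall>l\<in>J. (\<Sum>i\<in>J. G j i * H p i l) = (if j = l then 1 else (0::real))"
    and j: "j \<in> J"
  shows "smooth_fun S W (\<lambda>p. w p j)"
proof (rule smooth_funI)
  fix c k assume c: "c \<in> atlas S"
  have "linear_system J (snd c ` (W \<inter> fst c)) (\<lambda>y. H (cinv c y)) (\<lambda>y. b (cinv c y)) (\<lambda>y. w (cinv c y))"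
  proof (unfold_locales, rule J, rule coord_image_open[OF c W])
    fix y assume "y \<in> snd c ` (W \<inter> fst c)"
    then have y: "cinv c y \<in> W" using coord_image_iff[OF c] by blast
    show "(\<Sum>j\<in>J. H (cinv c y) i j * w (cinv c y) j) = b (cinv c y) i" if "i \<in> J" for i by (rule eq[OF y that])
    show "\<exists>G. \<forall>j\<in>J. \<forall>l\<in>J. (\<Sum>i\<in>J. G j i * H (cinv c y) i l) = (if j = l then 1 else 0)" by (rule inv[OF y])
  qed
  then show "Ck k (snd c ` (W \<inter> fst c)) (\<lambda>y. w (cinv c y) j)"
    by (rule Ck_linear_system[OF _ smooth_funD[OF H c] smooth_funD[OF b c] j])
qed

text \<open>Smoothness in one chart suffices, as the transition maps are smooth.\<close>

lemma smooth_fun_in_chart: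
  assumes c: "c \<in> atlas S" and W: "open W" "W \<subseteq> fst c" and f: "\<And>k. Ck k (snd c ` W) (\<lambda>y. f (cinv c y))"
  shows "smooth_fun S W f"
proof (rule smooth_funI)
  fix d k assume d: "d \<in> atlas S"
  let ?D = "snd d ` (W \<inter> fst d)"
  have D: "open ?D" by (rule coord_image_open[OF d W(1)])
  have Dd: "?D \<subseteq> snd d ` (fst d \<inter> fst c)" using W(2) by auto
  have cW: "open (snd c ` W)" using coord_image_open[OF c W(1)] W(2) by (simp add: Int_absorb2)
  have "Ck k ?D (\<lambda>y. f (cinv c (snd c (cinv d y))))"
  proof (rule Ck_compose[OF D cW _ f])
    show "(\<lambda>y. snd c (cinv d y)) ` ?D \<subseteq> snd c ` W" using coord_image_iff[OF d] by blast
    show "Ck k ?D (\<lambda>y. snd c (cinv d y))" by (rule Ck_subset[OF transition_smooth[OF d c] Dd])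
  qed
  then show "Ck k ?D (\<lambda>y. f (cinv d y))"
  proof (rule Ck_cong_open[OF D, rotated])
    fix y assume "y \<in> ?D"
    then have "cinv d y \<in> fst c" using coord_image_iff[OF d] W(2) by blast
    then show "f (cinv c (snd c (cinv d y))) = f (cinv d y)" by (simp add: cinv_coord[OF c])
  qed
qed

lemma smooth_fun_continuous:
  assumes "open W" "smooth_fun S W f"
  shows "continuous_on W f"
proof -
  have "isCont f p" if p: "p \<in> W" for p
  proof -
    obtain c where c: "c \<in> atlas S" "p \<in> fst c" using chart_exists by blast
    have "continuous_on (W \<inter> fst c) (\<lambda>q. f (cinv c (snd c q)))"
      by (rule continuous_on_compose2[OF Ck_continuous[OF smooth_funD[OF assms(2) c(1), of 0]]
            continuous_on_subset[OF coord_continuous[OF c(1)]]]) auto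
    then have "continuous_on (W \<inter> fst c) f"
      by (rule continuous_on_eq) (simp add: cinv_coord[OF c(1)])
    then show ?thesis using p c assms(1) chart_open[OF c(1)] by (simp add: continuous_on_eq_continuous_at open_Int)
  qed
  then show ?thesis by (simp add: continuous_at_imp_continuous_on)
qed

text \<open>The Euclidean cutoff is transported by a chart and extended by zero. The extension is smooth
  because the support is compact in a Hausdorff space, hence closed.\<close>

lemma smooth_cutoff_point:
  assumes W: "open W" "p \<in> W"
  obtains \<rho> V K where "smooth_fun S UNIV \<rho>" "open V" "p \<in> V" "\<And>q. q \<in> V \<Longrightarrow> \<rho> q = 1"
    "compact K" "K \<subseteq> W" "V \<subseteq> K" "\<And>q. q \<notin> K \<Longrightarrow> \<rho> q = 0"
proof -
  obtain c where c: "c \<in> atlas S" "p \<in> fst c" using chart_exists by blast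
  let ?O = "snd c ` (W \<inter> fst c)"
  have "open ?O" "snd c p \<in> ?O" using coord_image_open[OF c(1) W(1)] W(2) c(2) by auto
  then obtain r where r: "r > 0" "cball (snd c p) r \<subseteq> ?O" using open_contains_cball by blast
  obtain q where q: "\<And>k. Ck k UNIV q" "\<And>y. norm (y - snd c p) < r / 2 \<Longrightarrow> q y = (1::real)"
    "\<And>y. norm (y - snd c p) \<ge> r \<Longrightarrow> q y = 0"
    using smooth_cutoff_euclidean[OF r(1)] by blast
  define \<rho> where "\<rho> x = (if x \<in> fst c then q (snd c x) else 0)" for x
  define K where "K = cinv c ` cball (snd c p) r"
  define V where "V = fst c \<inter> snd c -` ball (snd c p) (r / 2)"
  have sub: "cball (snd c p) r \<subseteq> snd c ` fst c" using r(2) by auto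
  have Kc: "compact K"
    unfolding K_def by (rule compact_continuous_image[OF continuous_on_subset[OF cinv_continuous[OF c(1)] sub]]) simp
  have KW: "K \<subseteq> W" unfolding K_def using r(2) coord_image_iff[OF c(1)] by blast
  have VK: "V \<subseteq> K"
  proof
    fix x assume x: "x \<in> V"
    then have "snd c x \<in> cball (snd c p) r" using r(1) by (auto simp: V_def)
    then have "cinv c (snd c x) \<in> K" unfolding K_def by blast
    then show "x \<in> K" using x cinv_coord[OF c(1)] by (simp add: V_def)
  qed
  have out: "\<rho> x = 0" if x: "x \<notin> K" for x
  proof (cases "x \<in> fst c")
    case True
    then have "snd c x \<notin> cball (snd c p) r" using x cinv_coord[OF c(1) True] unfolding K_def by force
    then show ?thesis using q(3)[of "snd c x"] by (simp add: \<rho>_def dist_norm norm_minus_commute)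
  qed (simp add: \<rho>_def)
  have "smooth_fun S UNIV \<rho>"
  proof (rule smooth_fun_local)
    fix x
    show "\<exists>V. open V \<and> x \<in> V \<and> smooth_fun S V \<rho>"
    proof (cases "x \<in> fst c")
      case True
      have "smooth_fun S (fst c) \<rho>"
      proof (rule smooth_fun_in_chart[OF c(1) chart_open[OF c(1)] order_refl])
        fix k
        show "Ck k (snd c ` fst c) (\<lambda>y. \<rho> (cinv c y))"
          by (rule Ck_cong_open[OF chart_open_image[OF c(1)] _ Ck_subset[OF q(1) subset_UNIV]])
             (simp add: \<rho>_def cinv_mem[OF c(1)] coord_cinv[OF c(1)])
      qed
      with True chart_open[OF c(1)] show ?thesis by blast
    next
      case False
      have O: "open (- K)" using compact_imp_closed[OF Kc] by blast
      have "smooth_fun S (- K) \<rho>"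
        by (rule smooth_fun_cong[OF O _ smooth_fun_const[OF O, of 0]]) (simp add: out)
      moreover have "x \<notin> K" using False cinv_mem[OF c(1)] sub unfolding K_def by blast
      ultimately show ?thesis using O by blast
    qed
  qed
  moreover have "open V" unfolding V_def by (rule coord_preimage_open[OF c(1)]) simp
  moreover have "p \<in> V" using c(2) r(1) by (simp add: V_def)
  moreover have "\<rho> x = 1" if "x \<in> V" for x
    using that q(2)[of "snd c x"] by (simp add: V_def \<rho>_def dist_norm norm_minus_commute)
  ultimately show ?thesis using that Kc KW VK out by blast
qed

text \<open>Cutoff functions \<open>\<rho> p\<close> near finitely many points are combined to \<open>1 - (\<Prod>p. 1 - \<rho> p)\<close>.\<close>

lemma smooth_cutoff_compact:
  assumes "compact K"
  obtains \<rho> L where "smooth_fun S UNIV \<rho>" "\<And>q. q \<in> K \<Longrightarrow> \<rho> q = 1" "compact L" "\<And>q. q \<notin> L \<Longrightarrow> \<rho> q = 0"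
proof -
  have "\<forall>p. \<exists>\<rho> V L. smooth_fun S UNIV \<rho> \<and> open V \<and> p \<in> V \<and> (\<forall>q\<in>V. \<rho> q = 1) \<and> compact L \<and> (\<forall>q. q \<notin> L \<longrightarrow> \<rho> q = 0)"
  proof
    fix p
    obtain \<rho> V L where "smooth_fun S UNIV \<rho>" "open V" "p \<in> V" "\<And>q. q \<in> V \<Longrightarrow> \<rho> q = 1"
      "compact L" "L \<subseteq> UNIV" "V \<subseteq> L" "\<And>q. q \<notin> L \<Longrightarrow> \<rho> q = 0"
      by (rule smooth_cutoff_point[OF open_UNIV UNIV_I[of p]]) blast
    then show "\<exists>\<rho> V L. smooth_fun S UNIV \<rho> \<and> open V \<and> p \<in> V \<and> (\<forall>q\<in>V. \<rho> q = 1) \<and> compact L \<and> (\<forall>q. q \<notin> L \<longrightarrow> \<rho> q = 0)"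
      by blast
  qed
  from choice[OF this] obtain \<rho> where "\<forall>p. \<exists>V L. smooth_fun S UNIV (\<rho> p) \<and> open V \<and> p \<in> V \<and> (\<forall>q\<in>V. \<rho> p q = 1) \<and> compact L \<and> (\<forall>q. q \<notin> L \<longrightarrow> \<rho> p q = 0)" ..
  from choice[OF this] obtain V where "\<forall>p. \<exists>L. smooth_fun S UNIV (\<rho> p) \<and> open (V p) \<and> p \<in> V p \<and> (\<forall>q\<in>V p. \<rho> p q = 1) \<and> compact L \<and> (\<forall>q. q \<notin> L \<longrightarrow> \<rho> p q = 0)" ..
  from choice[OF this] obtain L where L: "\<forall>p. smooth_fun S UNIV (\<rho> p) \<and> open (V p) \<and> p \<in> V p \<and> (\<forall>q\<in>V p. \<rho> p q = 1) \<and> compact (L p) \<and> (\<forall>q. q \<notin> L p \<longrightarrow> \<rho> p q = 0)" ..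
  have *: "\<And>p. smooth_fun S UNIV (\<rho> p)" "\<And>p. open (V p)" "\<And>p. p \<in> V p"
    "\<And>p q. q \<in> V p \<Longrightarrow> \<rho> p q = (1::real)" "\<And>p. compact (L p)" "\<And>p q. q \<notin> L p \<Longrightarrow> \<rho> p q = 0"
    using L by blast+
  have "K \<subseteq> (\<Union>p\<in>UNIV. V p)" using *(3) by auto
  from compactE_image[OF assms *(2) this] obtain T where T: "finite T" "K \<subseteq> (\<Union>p\<in>T. V p)" by auto
  let ?r = "\<lambda>q. 1 - (\<Prod>p\<in>T. 1 - \<rho> p q)"
  have "smooth_fun S UNIV (\<lambda>q. \<Prod>p\<in>T. 1 - \<rho> p q)"
    using T(1) by induction (simp_all add: smooth_fun_const smooth_fun_mult smooth_fun_diff *(1))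
  then have 1: "smooth_fun S UNIV ?r" by (intro smooth_fun_diff smooth_fun_const open_UNIV)
  have 2: "?r q = 1" if "q \<in> K" for q
  proof -
    obtain p where "p \<in> T" "q \<in> V p" using T(2) \<open>q \<in> K\<close> by blast
    then have "(\<Prod>p\<in>T. 1 - \<rho> p q) = 0" using T(1) *(4) by (intro prod_zero) auto
    then show ?thesis by simp
  qed
  have 3: "compact (\<Union>p\<in>T. L p)" using T(1) *(5) by (intro compact_UN) auto
  have 4: "?r q = 0" if "q \<notin> (\<Union>p\<in>T. L p)" for q
    using that *(6) by simp
  show ?thesis using that[of ?r, OF 1 2 3 4] by blast
qed

section \<open>Tangent vectors\<close>

lemma charts_atD: "c \<in> charts_at S p \<Longrightarrow> c \<in> atlas S" "c \<in> charts_at S p \<Longrightarrow> p \<in> fst c"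
  by (auto simp: charts_at_def)

lemma jac_derivative:
  assumes "c \<in> charts_at S p" "d \<in> charts_at S p"
  shows "((\<lambda>y. snd d (cinv c y)) has_derivative jac c d p) (at (snd c p))"
  unfolding jac_def
  by (rule Ck_SucD(1)[OF transition_smooth[of c d 1, unfolded One_nat_def]])
     (use assms charts_atD in auto)

lemma jac_linear: "c \<in> charts_at S p \<Longrightarrow> d \<in> charts_at S p \<Longrightarrow> linear (jac c d p)"
  by (rule has_derivative_linear[OF jac_derivative])

lemma coord_image_nbhd: "c \<in> charts_at S p \<Longrightarrow> d \<in> charts_at S p \<Longrightarrow> snd c p \<in> snd c ` (fst c \<inter> fst d)"
  by (auto simp: charts_at_def)

lemma jac_chain:
  assumes c: "c \<in> charts_at S p" and d: "d \<in> charts_at S p" and e: "e \<in> charts_at S p"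
  shows "jac d e p (jac c d p v) = jac c e p v"
proof -
  note cA = charts_atD[OF c] and dA = charts_atD[OF d]
  have p: "snd d (cinv c (snd c p)) = snd d p" by (simp add: cinv_coord[OF cA])
  have "((\<lambda>y. snd e (cinv d (snd d (cinv c y)))) has_derivative (\<lambda>v. jac d e p (jac c d p v))) (at (snd c p))"
    by (rule has_derivative_compose[OF jac_derivative[OF c d]]) (simp only: p jac_derivative[OF d e])
  then have "((\<lambda>y. snd e (cinv c y)) has_derivative (\<lambda>v. jac d e p (jac c d p v))) (at (snd c p))"
  proof (rule has_derivative_transform_within_open[OF _ transition_open[OF cA(1) dA(1)] coord_image_nbhd[OF c d]])
    fix y assume "y \<in> snd c ` (fst c \<inter> fst d)"
    then have "cinv c y \<in> fst d" using coord_image_iff[OF cA(1), of y "fst d"] by (simp add: Int_commute)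
    then show "snd e (cinv d (snd d (cinv c y))) = snd e (cinv c y)" by (simp add: cinv_coord[OF dA(1)])
  qed
  then have "(\<lambda>v. jac d e p (jac c d p v)) = jac c e p"
    using jac_derivative[OF c e] by (rule has_derivative_unique)
  then show ?thesis by metis
qed

lemma jac_self:
  assumes c: "c \<in> charts_at S p"
  shows "jac c c p v = v"
proof -
  note cA = charts_atD[OF c]
  have "((\<lambda>y. y) has_derivative jac c c p) (at (snd c p))"
    by (rule has_derivative_transform_within_open[OF jac_derivative[OF c c] transition_open[OF cA(1) cA(1)] coord_image_nbhd[OF c c]])
       (simp add: coord_cinv[OF cA(1)])
  then have "jac c c p = (\<lambda>v. v)" using has_derivative_ident by (rule has_derivative_unique)
  then show ?thesis by simp
qed

text \<open>The tangent vector at \<open>p\<close> with components \<open>v\<close> in the chart \<open>c\<close>.\<close>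

definition tv :: "('m, 'n) chart \<Rightarrow> 'm \<Rightarrow> real^'n \<Rightarrow> ('m, 'n) tvec" where
  "tv c p v = (\<lambda>d. if d \<in> charts_at S p then jac c d p v else 0)"

lemma cvec_tv: "cvec S c i p = tv c p (axis i 1)"
  by (simp add: cvec_def tv_def)

lemma tv_tangent: "c \<in> charts_at S p \<Longrightarrow> tv c p v \<in> tangent_space S p"
  by (simp add: tangent_space_def tv_def jac_chain)

lemma cvec_tangent: "c \<in> charts_at S p \<Longrightarrow> cvec S c i p \<in> tangent_space S p"
  by (simp add: cvec_tv tv_tangent)

lemma tv_self: "c \<in> charts_at S p \<Longrightarrow> tv c p v c = v"
  by (simp add: tv_def jac_self)

lemma tangent_tv:
  assumes X: "X \<in> tangent_space S p" and c: "c \<in> charts_at S p"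
  shows "X = tv c p (X c)"
proof
  fix d
  have 1: "d \<in> charts_at S p \<Longrightarrow> X d = jac c d p (X c)" and 0: "d \<notin> charts_at S p \<Longrightarrow> X d = 0"
    using X c unfolding tangent_space_def by blast+
  show "X d = tv c p (X c) d"
  proof (cases "d \<in> charts_at S p")
    case True show ?thesis unfolding tv_def if_P[OF True] by (rule 1[OF True])
  next
    case False show ?thesis unfolding tv_def if_not_P[OF False] by (rule 0[OF False])
  qed
qed

lemma tv_lin:
  assumes "c \<in> charts_at S p"
  shows "tv c p (a *\<^sub>R v + w) = (\<lambda>d. a *\<^sub>R tv c p v d + tv c p w d)"
proof
  fix d
  show "tv c p (a *\<^sub>R v + w) d = a *\<^sub>R tv c p v d + tv c p w d"
  proof (cases "d \<in> charts_at S p")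
    case True
    show ?thesis unfolding tv_def if_P[OF True]
      by (simp only: linear_add[OF jac_linear[OF assms True]] linear_cmul[OF jac_linear[OF assms True]])
  qed (simp add: tv_def)
qed

lemma dirder_cvec:
  assumes "c \<in> charts_at S p"
  shows "dirder c f p (cvec S c i p) = pd c i f p"
  by (simp add: dirder_def pd_def cvec_tv tv_self[OF assms])

end

lemma mult_swap3: "(a::real) * g * b = a * b * g"
  by simp

locale lorentz_mfd = smooth_mfd S
  for S :: "('m::t2_space, 'n::finite, 'z) spacetime_scheme" +
  assumes lor: "lorentz_metric S"
begin

lemma lmetric_lin: "X \<in> tangent_space S p \<Longrightarrow> Y \<in> tangent_space S p \<Longrightarrow> Z \<in> tangent_space S p \<Longrightarrow>
    lmetric S p (\<lambda>c. a *\<^sub>R X c + Y c) Z = a * lmetric S p X Z + lmetric S p Y Z"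
  and lmetric_sym: "X \<in> tangent_space S p \<Longrightarrow> Y \<in> tangent_space S p \<Longrightarrow> lmetric S p X Y = lmetric S p Y X"
  and gmat_smooth: "c \<in> atlas S \<Longrightarrow> smooth_fun S (fst c) (\<lambda>p. gmat S c p $ i $ j)"
  using lor unfolding lorentz_metric_def by blast+

lemma lmetric_linear:
  assumes c: "c \<in> charts_at S p" and Z: "Z \<in> tangent_space S p"
  shows "linear (\<lambda>v. lmetric S p (tv c p v) Z)"
proof -
  have L: "lmetric S p (tv c p (a *\<^sub>R v + w)) Z = a * lmetric S p (tv c p v) Z + lmetric S p (tv c p w) Z" for a v w
    unfolding tv_lin[OF c] by (rule lmetric_lin[OF tv_tangent[OF c] tv_tangent[OF c] Z])
  have z: "lmetric S p (tv c p 0) Z = 0" using L[of 1 0 0] by simp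
  show ?thesis
  proof (rule linearI)
    fix x y r
    show "lmetric S p (tv c p (x + y)) Z = lmetric S p (tv c p x) Z + lmetric S p (tv c p y) Z"
      using L[of 1 x y] by (simp only: scaleR_one mult_1)
    show "lmetric S p (tv c p (r *\<^sub>R x)) Z = r *\<^sub>R lmetric S p (tv c p x) Z"
      using L[of r x 0] by (simp only: z add_0_right real_scaleR_def)
  qed
qed

lemma lmetric_expand1:
  assumes c: "c \<in> charts_at S p" and Z: "Z \<in> tangent_space S p"
  shows "lmetric S p (tv c p v) Z = (\<Sum>i\<in>UNIV. v $ i * lmetric S p (cvec S c i p) Z)"
proof -
  have "v = (\<Sum>i\<in>UNIV. v $ i *\<^sub>R axis i 1)"
    using basis_expansion[of v] by (simp add: scalar_mult_eq_scaleR)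
  then have "lmetric S p (tv c p v) Z = lmetric S p (tv c p (\<Sum>i\<in>UNIV. v $ i *\<^sub>R axis i 1)) Z" by simp
  also have "\<dots> = (\<Sum>i\<in>UNIV. v $ i * lmetric S p (cvec S c i p) Z)"
    by (simp add: linear_sum[OF lmetric_linear[OF c Z]] linear_cmul[OF lmetric_linear[OF c Z]] cvec_tv)
  finally show ?thesis .
qed

text \<open>All computations with the metric take place in a chart, through the components of tangent
  vectors and the Gram matrix.\<close>

lemma lmetric_tv:
  assumes c: "c \<in> charts_at S p"
  shows "lmetric S p (tv c p v) (tv c p w) = (\<Sum>i\<in>UNIV. \<Sum>j\<in>UNIV. v $ i * w $ j * gmat S c p $ i $ j)"
proof -
  note t = tv_tangent[OF c] and ct = cvec_tangent[OF c]
  have 1: "lmetric S p (cvec S c i p) (tv c p w) = (\<Sum>j\<in>UNIV. w $ j * gmat S c p $ i $ j)" for i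
  proof -
    have "lmetric S p (cvec S c i p) (tv c p w) = (\<Sum>j\<in>UNIV. w $ j * lmetric S p (cvec S c j p) (cvec S c i p))"
      unfolding lmetric_sym[OF ct t] by (rule lmetric_expand1[OF c ct])
    also have "\<dots> = (\<Sum>j\<in>UNIV. w $ j * gmat S c p $ i $ j)"
      unfolding gmat_def vec_lambda_beta by (intro sum.cong refl arg_cong2[where f="(*)"] lmetric_sym[OF ct ct])
    finally show ?thesis .
  qed
  show ?thesis
    unfolding lmetric_expand1[OF c t] 1 sum_distrib_left mult.assoc ..
qed

lemma gmat_sym: "c \<in> charts_at S p \<Longrightarrow> gmat S c p $ i $ j = gmat S c p $ j $ i"
  unfolding gmat_def vec_lambda_beta by (rule lmetric_sym[OF cvec_tangent cvec_tangent])

text \<open>If the rows of \<open>B\<close> are the components of an orthonormal basis, then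
  \<open>B ** gmat S c p ** transpose B\<close> is diagonal with entries \<open>\<plusminus>1\<close>.\<close>

lemma gmat_det:
  assumes c: "c \<in> charts_at S p"
  shows "det (gmat S c p) \<noteq> 0"
proof -
  have "\<exists>(b :: 'n \<Rightarrow> ('m, 'n) tvec) i0. (\<forall>i. b i \<in> tangent_space S p) \<and>
        (\<forall>i j. lmetric S p (b i) (b j) = (if i \<noteq> j then 0 else if i = i0 then 1 else -1))"
    using lor unfolding lorentz_metric_def by blast
  then obtain b :: "'n \<Rightarrow> ('m, 'n) tvec" and i0 where b: "\<And>i. b i \<in> tangent_space S p"
    "\<And>i j. lmetric S p (b i) (b j) = (if i \<noteq> j then 0 else if i = i0 then 1 else -1)"
    by blast
  define B :: "real^'n^'n" where "B = (\<chi> i. b i c)"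
  define G where "G = gmat S c p"
  have B: "B $ i = b i c" for i by (simp add: B_def)
  have e: "(B ** G ** transpose B) $ i $ j = (if i \<noteq> j then 0 else if i = i0 then 1 else -1)" for i j
  proof -
    have "(B ** G ** transpose B) $ i $ j = (\<Sum>k\<in>UNIV. (\<Sum>l\<in>UNIV. B $ i $ l * G $ l $ k) * B $ j $ k)"
      by (simp only: matrix_matrix_mult_def transpose_def vec_lambda_beta)
    also have "\<dots> = (\<Sum>l\<in>UNIV. \<Sum>k\<in>UNIV. B $ i $ l * G $ l $ k * B $ j $ k)"
      unfolding sum_distrib_right by (rule sum.swap)
    also have "\<dots> = (\<Sum>l\<in>UNIV. \<Sum>k\<in>UNIV. B $ i $ l * B $ j $ k * G $ l $ k)"
      by (intro sum.cong refl) (rule mult_swap3)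
    also have "\<dots> = lmetric S p (tv c p (b i c)) (tv c p (b j c))"
      unfolding lmetric_tv[OF c] B G_def ..
    also have "\<dots> = lmetric S p (b i) (b j)"
      by (rule arg_cong2[where f="lmetric S p", OF tangent_tv[OF b(1) c, symmetric] tangent_tv[OF b(1) c, symmetric]])
    also have "\<dots> = (if i \<noteq> j then 0 else if i = i0 then 1 else -1)" by (rule b(2))
    finally show ?thesis .
  qed
  have "det (B ** G ** transpose B) = (\<Prod>i\<in>UNIV. (B ** G ** transpose B) $ i $ i)"
    by (rule det_diagonal) (simp only: e if_True simp_thms)
  also have "\<dots> \<noteq> 0" unfolding e by (simp add: prod_zero_iff)
  finally show ?thesis unfolding G_def[symmetric] by (auto simp: det_mul)
qed

end

section \<open>Spaces of functions and linear maps between them\<close>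

text \<open>Tensors are functions, with the pointwise vector space structure. The simplification rules of
  the vector space locale are switched off, since \<open>fscale\<close> abbreviates an abstraction and these
  rules would therefore match arbitrary products.\<close>

interpretation fs: vector_space "fscale :: 'k::field \<Rightarrow> ('x \<Rightarrow> 'k) \<Rightarrow> 'x \<Rightarrow> 'k"
  by unfold_locales (auto simp: fun_eq_iff algebra_simps)

declare fs.scale_scale [simp del] fs.scale_zero_left [simp del] fs.scale_zero_right [simp del]
  fs.scale_one [simp del] fs.scale_cancel_left [simp del] fs.scale_cancel_right [simp del]
  fs.scale_minus_left [simp del] fs.scale_minus_right [simp del] fs.scale_eq_0_iff [simp del]

lemma flinearI:
  assumes "\<And>f g. P (f + g) = P f + P g" "\<And>a f. P (fscale a f) = fscale a (P f)"
  shows "Vector_Spaces.linear fscale fscale (P :: ('x \<Rightarrow> 'k::field) \<Rightarrow> 'y \<Rightarrow> 'k)"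
  using assms by unfold_locales (simp_all add: algebra_simps fun_eq_iff)

lemma flinear_add: "Vector_Spaces.linear fscale fscale (P :: ('x \<Rightarrow> 'k::field) \<Rightarrow> 'y \<Rightarrow> 'k) \<Longrightarrow> P (f + g) = P f + P g"
  unfolding Vector_Spaces.linear_def module_hom_def module_hom_axioms_def by blast

lemma flinear_scale: "Vector_Spaces.linear fscale fscale (P :: ('x \<Rightarrow> 'k::field) \<Rightarrow> 'y \<Rightarrow> 'k) \<Longrightarrow> P (fscale a f) = fscale a (P f)"
  unfolding Vector_Spaces.linear_def module_hom_def module_hom_axioms_def by blast

lemma flinear_zero: "Vector_Spaces.linear fscale fscale (P :: ('x \<Rightarrow> 'k::field) \<Rightarrow> 'y \<Rightarrow> 'k) \<Longrightarrow> P 0 = 0"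
  using flinear_add[of P 0 0] by simp

lemma flinear_comp:
  assumes "Vector_Spaces.linear fscale fscale (P :: ('x \<Rightarrow> 'k::field) \<Rightarrow> 'y \<Rightarrow> 'k)"
    and "Vector_Spaces.linear fscale fscale (Q :: ('y \<Rightarrow> 'k::field) \<Rightarrow> 'z \<Rightarrow> 'k)"
  shows "Vector_Spaces.linear fscale fscale (\<lambda>t. Q (P t))"
  by (intro flinearI) (simp_all only: flinear_add[OF assms(1)] flinear_add[OF assms(2)]
    flinear_scale[OF assms(1)] flinear_scale[OF assms(2)])

lemma flinear_funpow:
  assumes "Vector_Spaces.linear fscale fscale (P :: ('x \<Rightarrow> 'k::field) \<Rightarrow> 'x \<Rightarrow> 'k)"
  shows "Vector_Spaces.linear fscale fscale (P ^^ n)"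
proof (induction n)
  case 0 show ?case by (intro flinearI) auto
next
  case (Suc n) from flinear_comp[OF Suc assms] show ?case by (simp add: comp_def)
qed

lemma otimes_add_left: "otimes (a + b) c = otimes a c + otimes b c"
  and otimes_add_right: "otimes a (b + c) = otimes a b + otimes a c"
  and otimes_scale_left: "otimes (fscale r a) b = fscale r (otimes a b)"
  and otimes_scale_right: "otimes a (fscale r b) = fscale r (otimes a b)"
  by (simp_all add: otimes_def fun_eq_iff distrib_left distrib_right mult.assoc mult.left_commute)

lemma fspan_mem_subspace: "x \<in> fspan A \<Longrightarrow> fs.subspace T \<Longrightarrow> A \<subseteq> T \<Longrightarrow> x \<in> T"
  using fs.span_minimal by blast

lemma flinear_span_mem:
  assumes "Vector_Spaces.linear fscale fscale (Q :: ('x \<Rightarrow> 'k::field) \<Rightarrow> 'y \<Rightarrow> 'k)"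
    and "x \<in> fspan A" "fs.subspace T" "\<And>a. a \<in> A \<Longrightarrow> Q a \<in> T"
  shows "Q x \<in> T"
proof -
  have "fs.subspace {x. Q x \<in> T}"
    using assms(3) unfolding fs.subspace_def
    by (auto simp only: mem_Collect_eq flinear_add[OF assms(1)] flinear_scale[OF assms(1)] flinear_zero[OF assms(1)])
  from fspan_mem_subspace[OF assms(2) this] assms(4) show ?thesis by auto
qed

lemma flinear_otimes_mem:
  assumes Q: "Vector_Spaces.linear fscale fscale (Q :: (_ \<Rightarrow> 'k::field) \<Rightarrow> 'y \<Rightarrow> 'k)"
    and "x \<in> fspan A" "y \<in> fspan B" "fs.subspace T"
    and "\<And>a b. a \<in> A \<Longrightarrow> b \<in> B \<Longrightarrow> Q (otimes a b) \<in> T"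
  shows "Q (otimes x y) \<in> T"
proof -
  have 1: "Q (otimes a y) \<in> T" if "a \<in> A" for a
  proof (rule flinear_span_mem[where Q="\<lambda>y. Q (otimes a y)", OF _ assms(3,4)])
    show "Vector_Spaces.linear fscale fscale (\<lambda>y. Q (otimes a y))"
      by (intro flinearI) (simp_all only: otimes_add_right otimes_scale_right flinear_add[OF Q] flinear_scale[OF Q])
  qed (use assms(5) that in auto)
  show ?thesis
  proof (rule flinear_span_mem[where Q="\<lambda>x. Q (otimes x y)", OF _ assms(2,4)])
    show "Vector_Spaces.linear fscale fscale (\<lambda>x. Q (otimes x y))"
      by (intro flinearI) (simp_all only: otimes_add_left otimes_scale_left flinear_add[OF Q] flinear_scale[OF Q])
  qed (use 1 in auto)
qed

section \<open>The symmetrised product\<close>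

text \<open>The product of the tensor algebra when tensors are functions of lists: every list is split at
  all positions, the degrees of the factors selecting the relevant ones.\<close>

definition cat :: "('x list \<Rightarrow> 'k::field) \<Rightarrow> ('x list \<Rightarrow> 'k) \<Rightarrow> 'x list \<Rightarrow> 'k" where
  "cat a b xs = (\<Sum>k\<le>length xs. a (take k xs) * b (drop k xs))"

lemma sym_mult_otimes: "sym_mult (otimes a b) = symmetrize (cat a b)"
  by (simp add: sym_mult_def otimes_def cat_def[abs_def])

lemma symmetrize_linear: "Vector_Spaces.linear fscale fscale (symmetrize :: ('x list \<Rightarrow> 'k::field_char_0) \<Rightarrow> _)"
  by (intro flinearI) (auto simp: symmetrize_def fun_eq_iff sum.distrib sum_distrib_left add_divide_distrib)

lemma sym_mult_linear: "Vector_Spaces.linear fscale fscale (sym_mult :: ('x list \<times> 'x list \<Rightarrow> 'k::field_char_0) \<Rightarrow> _)"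
  by (intro flinearI)
     (auto simp: sym_mult_def symmetrize_def fun_eq_iff sum.distrib sum_distrib_left add_divide_distrib)

lemma tens_Nil: "tens [] xs = (if xs = [] then 1 else 0)"
  by (simp add: tens_def)

lemma tens_Cons: "tens (v # vs) xs = (case xs of [] \<Rightarrow> 0 | x # xs \<Rightarrow> v x * tens vs xs)"
  by (cases xs) (auto simp: tens_def prod.lessThan_Suc_shift simp del: prod.lessThan_Suc)

lemma cat_tens_Nil_left: "cat (tens []) a = a"
proof
  fix xs
  have "cat (tens []) a xs = (\<Sum>k\<le>length xs. if k = 0 then a xs else 0)"
    unfolding cat_def by (intro sum.cong) (auto simp: tens_Nil)
  then show "cat (tens []) a xs = a xs" by simp
qed

lemma cat_tens_single: "cat (tens [v]) a xs = (case xs of [] \<Rightarrow> 0 | x # xs \<Rightarrow> v x * a xs)"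
proof (cases xs)
  case (Cons y ys)
  have "cat (tens [v]) a xs = (\<Sum>k\<le>length xs. if k = 1 then v y * a ys else 0)"
    unfolding cat_def by (intro sum.cong) (auto simp: tens_Nil tens_Cons Cons split: list.split nat.splits simp: take_Cons drop_Cons)
  then show ?thesis by (simp add: Cons del: sum.atMost_Suc)
qed (simp add: cat_def tens_Cons)

lemma cat_single_tens: "cat (tens [v]) (tens vs) = tens (v # vs)"
  by (auto simp: cat_tens_single tens_Cons fun_eq_iff split: list.split)

lemma cat_assoc: "cat a (cat b c) = cat (cat a b) c"
proof
  fix xs :: "'a list"
  let ?n = "length xs"
  have "cat a (cat b c) xs = (\<Sum>k\<le>?n. \<Sum>j\<le>?n-k. a (take k xs) * (b (take j (drop k xs)) * c (drop j (drop k xs))))"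
    by (simp add: cat_def sum_distrib_left)
  also have "\<dots> = (\<Sum>(k,j)\<in>(SIGMA k:{..?n}. {..?n-k}). a (take k xs) * (b (take j (drop k xs)) * c (drop j (drop k xs))))"
    by (subst sum.Sigma) auto
  also have "\<dots> = (\<Sum>(m,k)\<in>(SIGMA m:{..?n}. {..m}). a (take k (take m xs)) * b (drop k (take m xs)) * c (drop m xs))"
    by (rule sum.reindex_bij_witness[where i="\<lambda>(m,k). (k, m-k)" and j="\<lambda>(k,j). (k+j,k)"])
       (auto simp: drop_take min_def add.commute mult.assoc)
  also have "\<dots> = (\<Sum>m\<le>?n. \<Sum>k\<le>m. a (take k (take m xs)) * b (drop k (take m xs)) * c (drop m xs))"
    by (subst sum.Sigma) auto
  also have "\<dots> = cat (cat a b) c xs"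
    by (auto simp: cat_def sum_distrib_right min_def intro!: sum.cong split: if_splits)
  finally show "cat a (cat b c) xs = cat (cat a b) c xs" .
qed

lemma sum_permutes_compose_right:
  assumes "\<tau> permutes S"
  shows "(\<Sum>\<sigma> | \<sigma> permutes S. f (\<sigma> \<circ> \<tau>)) = (\<Sum>\<sigma> | \<sigma> permutes S. f \<sigma>)"
  by (rule sum.reindex_bij_witness[where i="\<lambda>\<sigma>. \<sigma> \<circ> inv_into UNIV \<tau>" and j="\<lambda>\<sigma>. \<sigma> \<circ> \<tau>"])
     (use assms in \<open>auto simp: permutes_compose permutes_inv o_assoc[symmetric] permutes_inv_o\<close>)

lemma sum_permutes_compose_left:
  assumes "\<tau> permutes S"
  shows "(\<Sum>\<sigma> | \<sigma> permutes S. f (\<tau> \<circ> \<sigma>)) = (\<Sum>\<sigma> | \<sigma> permutes S. f \<sigma>)"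
  by (rule sum.reindex_bij_witness[where i="\<lambda>\<sigma>. inv_into UNIV \<tau> \<circ> \<sigma>" and j="\<lambda>\<sigma>. \<tau> \<circ> \<sigma>"])
     (use assms in \<open>auto simp: permutes_compose permutes_inv o_assoc permutes_inv_o\<close>)

lemma sum_permute_list:
  assumes "\<tau> permutes {..<length xs}"
  shows "(\<Sum>\<sigma> | \<sigma> permutes {..<length xs}. f (permute_list \<tau> (permute_list \<sigma> xs)))
       = (\<Sum>\<sigma> | \<sigma> permutes {..<length xs}. f (permute_list \<sigma> xs))"
proof -
  have "permute_list \<tau> (permute_list \<sigma> xs) = permute_list (\<sigma> \<circ> \<tau>) xs" if "\<sigma> permutes {..<length xs}" for \<sigma>
    using permute_list_compose[of \<tau> xs \<sigma>] assms by simp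
  then have "(\<Sum>\<sigma> | \<sigma> permutes {..<length xs}. f (permute_list \<tau> (permute_list \<sigma> xs)))
      = (\<Sum>\<sigma> | \<sigma> permutes {..<length xs}. f (permute_list (\<sigma> \<circ> \<tau>) xs))"
    by (intro sum.cong) auto
  also have "\<dots> = (\<Sum>\<sigma> | \<sigma> permutes {..<length xs}. f (permute_list \<sigma> xs))"
    by (rule sum_permutes_compose_right[OF assms])
  finally show ?thesis .
qed

definition sym_fun :: "('x list \<Rightarrow> 'k) \<Rightarrow> bool" where
  "sym_fun a \<longleftrightarrow> (\<forall>xs ys. mset xs = mset ys \<longrightarrow> a xs = a ys)"

lemma sym_funD: "sym_fun a \<Longrightarrow> mset xs = mset ys \<Longrightarrow> a xs = a ys"
  unfolding sym_fun_def by blast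

text \<open>Invariance under permutations of the arguments is dependence on the multiset of arguments only;
  the latter form needs no reference to the degree.\<close>

lemma sym_fun_permute: "sym_fun a \<longleftrightarrow> (\<forall>\<sigma> xs. \<sigma> permutes {..<length xs} \<longrightarrow> a (permute_list \<sigma> xs) = a xs)"
proof (intro iffI allI impI)
  fix \<sigma> and xs :: "'a list" assume "sym_fun a" "\<sigma> permutes {..<length xs}"
  then show "a (permute_list \<sigma> xs) = a xs" by (intro sym_funD[of a]) simp_all
next
  assume *: "\<forall>\<sigma> xs. \<sigma> permutes {..<length xs} \<longrightarrow> a (permute_list \<sigma> xs) = a xs"
  show "sym_fun a" unfolding sym_fun_def
  proof (intro allI impI)
    fix xs ys :: "'a list" assume "mset xs = mset ys"
    then obtain p where "p permutes {..<length ys}" "permute_list p ys = xs"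
      using mset_eq_permutation by blast
    with * show "a xs = a ys" by metis
  qed
qed

lemma sym_fun_symmetrize: "sym_fun (symmetrize a)"
proof -
  have "symmetrize a (permute_list \<tau> xs) = symmetrize a xs" if \<tau>: "\<tau> permutes {..<length xs}" for \<tau> xs
  proof -
    have "(\<Sum>\<sigma> | \<sigma> permutes {..<length xs}. a (permute_list \<sigma> (permute_list \<tau> xs)))
        = (\<Sum>\<sigma> | \<sigma> permutes {..<length xs}. a (permute_list (\<tau> \<circ> \<sigma>) xs))"
      by (intro sum.cong) (auto simp: permute_list_compose)
    also have "\<dots> = (\<Sum>\<sigma> | \<sigma> permutes {..<length xs}. a (permute_list \<sigma> xs))"
      by (rule sum_permutes_compose_left[OF \<tau>, of "\<lambda>\<sigma>. a (permute_list \<sigma> xs)"])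
    finally show ?thesis by (simp add: symmetrize_def)
  qed
  then show ?thesis by (simp add: sym_fun_permute)
qed

lemma symmetrize_id: "sym_fun a \<Longrightarrow> symmetrize a = (a :: 'x list \<Rightarrow> 'k::field_char_0)"
  by (auto simp: symmetrize_def fun_eq_iff sym_fun_permute card_permutations[OF refl])

lemma rotate_permutation:
  "\<exists>\<rho>. \<rho> permutes {..<n} \<and> (\<forall>xs::'a list. length xs = n \<longrightarrow> permute_list \<rho> xs = rotate k xs)"
proof -
  have "mset (rotate k [0..<n]) = mset [0..<n]"
    by (metis append_take_drop_id mset_append rotate_drop_take union_commute)
  then obtain \<rho> where \<rho>: "\<rho> permutes {..<n}" "permute_list \<rho> [0..<n] = rotate k [0..<n]"
    using mset_eq_permutation by (metis diff_zero length_upt)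
  have "permute_list \<rho> xs = rotate k xs" if "length xs = n" for xs :: "'a list"
  proof -
    have xs: "xs = map ((!) xs) [0..<n]" using that map_nth by metis
    have "permute_list \<rho> xs = map ((!) xs) (permute_list \<rho> [0..<n])"
      by (subst xs, subst permute_list_map) (use \<rho> in auto)
    also have "\<dots> = rotate k xs"
      unfolding \<rho> by (subst (2) xs) (simp add: rotate_map)
    finally show ?thesis .
  qed
  with \<rho> show ?thesis by blast
qed

text \<open>Rotating a list by \<open>k\<close> exchanges its first \<open>k\<close> entries with the remaining ones, and
  symmetrization is insensitive to rotations.\<close>

lemma symmetrize_cat_commute: "symmetrize (cat a b) = symmetrize (cat b (a :: 'x list \<Rightarrow> 'k::field_char_0))"
proof
  fix xs :: "'x list"
  let ?n = "length xs" and ?P = "{\<sigma>. \<sigma> permutes {..<length xs}}"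
  have "(\<Sum>\<sigma>\<in>?P. cat a b (permute_list \<sigma> xs))
      = (\<Sum>k\<le>?n. \<Sum>\<sigma>\<in>?P. a (take k (permute_list \<sigma> xs)) * b (drop k (permute_list \<sigma> xs)))"
    unfolding cat_def by (subst sum.swap) simp
  also have "\<dots> = (\<Sum>k\<le>?n. \<Sum>\<sigma>\<in>?P. b (take (?n - k) (permute_list \<sigma> xs)) * a (drop (?n - k) (permute_list \<sigma> xs)))"
  proof (rule sum.cong[OF refl])
    fix k assume k: "k \<in> {..?n}"
    obtain \<rho> where \<rho>: "\<rho> permutes {..<?n}" "\<And>xs::'x list. length xs = ?n \<Longrightarrow> permute_list \<rho> xs = rotate k xs"
      using rotate_permutation by metis
    have "(\<Sum>\<sigma>\<in>?P. b (take (?n - k) (permute_list \<sigma> xs)) * a (drop (?n - k) (permute_list \<sigma> xs)))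
      = (\<Sum>\<sigma>\<in>?P. b (take (?n - k) (permute_list \<rho> (permute_list \<sigma> xs))) * a (drop (?n - k) (permute_list \<rho> (permute_list \<sigma> xs))))"
      by (rule sum_permute_list[OF \<rho>(1), symmetric])
    also have "\<dots> = (\<Sum>\<sigma>\<in>?P. a (take k (permute_list \<sigma> xs)) * b (drop k (permute_list \<sigma> xs)))"
    proof (rule sum.cong[OF refl])
      fix \<sigma>
      let ?ys = "permute_list \<sigma> xs"
      have "rotate k ?ys = drop k ?ys @ take k ?ys" using k
        by (cases "k = ?n") (auto simp: rotate_drop_take)
      then show "b (take (?n - k) (permute_list \<rho> ?ys)) * a (drop (?n - k) (permute_list \<rho> ?ys)) =
         a (take k ?ys) * b (drop k ?ys)"
        by (simp add: \<rho>(2))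
    qed
    finally show "(\<Sum>\<sigma>\<in>?P. a (take k (permute_list \<sigma> xs)) * b (drop k (permute_list \<sigma> xs))) =
      (\<Sum>\<sigma>\<in>?P. b (take (?n - k) (permute_list \<sigma> xs)) * a (drop (?n - k) (permute_list \<sigma> xs)))" ..
  qed
  also have "\<dots> = (\<Sum>k\<le>?n. \<Sum>\<sigma>\<in>?P. b (take k (permute_list \<sigma> xs)) * a (drop k (permute_list \<sigma> xs)))"
    by (rule sum.reindex_bij_witness[where i="\<lambda>k. ?n - k" and j="\<lambda>k. ?n - k"]) auto
  also have "\<dots> = (\<Sum>\<sigma>\<in>?P. cat b a (permute_list \<sigma> xs))"
    unfolding cat_def by (subst sum.swap) simp
  finally show "symmetrize (cat a b) xs = symmetrize (cat b a) xs"
    by (simp add: symmetrize_def)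
qed

lemma permutes_shift:
  fixes k m :: nat
  assumes "\<tau> permutes {..<m}"
  shows "(\<lambda>i. if i < k then i else k + \<tau> (i - k)) permutes {..<k + m}"
proof (rule bij_imp_permutes)
  show "bij_betw (\<lambda>i. if i < k then i else k + \<tau> (i - k)) {..<k + m} {..<k + m}"
  proof (rule bij_betw_byWitness[where f'="\<lambda>i. if i < k then i else k + inv_into UNIV \<tau> (i - k)"])
    have "\<tau> (i - k) < m" "inv_into UNIV \<tau> (i - k) < m" if "i < k + m" "\<not> i < k" for i
    proof -
      have "i - k < m" using that by linarith
      then show "\<tau> (i - k) < m" "inv_into UNIV \<tau> (i - k) < m"
        using permutes_in_image[OF assms, of "i - k"] permutes_in_image[OF permutes_inv[OF assms], of "i - k"] by auto
    qed
    then show "(\<lambda>i. if i < k then i else k + \<tau> (i - k)) ` {..<k + m} \<subseteq> {..<k + m}"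
      "(\<lambda>i. if i < k then i else k + inv_into UNIV \<tau> (i - k)) ` {..<k + m} \<subseteq> {..<k + m}"
      by (auto split: if_splits)
  qed (auto simp: permutes_inverses[OF assms])
  fix i assume "i \<notin> {..<k + m}"
  then show "(if i < k then i else k + \<tau> (i - k)) = i"
    using permutes_not_in[OF assms, of "i - k"] by auto
qed

text \<open>A permutation of the last entries of a list is a permutation of the whole list, hence absorbed
  by the outer symmetrization. This is the source of associativity of the symmetrized product.\<close>

lemma symmetrize_cat_symmetrize_right:
  "symmetrize (cat a (symmetrize b)) = symmetrize (cat a (b :: 'x list \<Rightarrow> 'k::field_char_0))"
proof
  fix xs :: "'x list"
  let ?n = "length xs" and ?P = "\<lambda>n. {\<sigma>. \<sigma> permutes {..<n::nat}}"
  have "(\<Sum>\<sigma>\<in>?P ?n. cat a (symmetrize b) (permute_list \<sigma> xs))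
      = (\<Sum>k\<le>?n. \<Sum>\<sigma>\<in>?P ?n. a (take k (permute_list \<sigma> xs)) * symmetrize b (drop k (permute_list \<sigma> xs)))"
    unfolding cat_def by (subst sum.swap) simp
  also have "\<dots> = (\<Sum>k\<le>?n. \<Sum>\<sigma>\<in>?P ?n. a (take k (permute_list \<sigma> xs)) * b (drop k (permute_list \<sigma> xs)))"
  proof (rule sum.cong[OF refl])
    fix k assume k: "k \<in> {..?n}"
    let ?m = "?n - k"
    have *: "(\<Sum>\<sigma>\<in>?P ?n. a (take k (permute_list \<sigma> xs)) * b (permute_list \<tau> (drop k (permute_list \<sigma> xs))))
       = (\<Sum>\<sigma>\<in>?P ?n. a (take k (permute_list \<sigma> xs)) * b (drop k (permute_list \<sigma> xs)))"
      if \<tau>: "\<tau> permutes {..<?m}" for \<tau>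
    proof -
      define \<tau>' where "\<tau>' = (\<lambda>i. if i < k then i else k + \<tau> (i - k))"
      have \<tau>': "\<tau>' permutes {..<?n}" using permutes_shift[OF \<tau>, of k] k by (simp add: \<tau>'_def)
      have t: "take k (permute_list \<tau>' ys) = take k ys" "drop k (permute_list \<tau>' ys) = permute_list \<tau> (drop k ys)"
        if "length ys = ?n" for ys :: "'x list"
      proof -
        show "take k (permute_list \<tau>' ys) = take k ys"
          by (rule nth_equalityI) (use that k in \<open>simp_all add: permute_list_def \<tau>'_def\<close>)
        show "drop k (permute_list \<tau>' ys) = permute_list \<tau> (drop k ys)"
        proof (rule nth_equalityI)
          fix i assume "i < length (drop k (permute_list \<tau>' ys))"
          then have i: "i < ?m" "k + i < ?n" using that by auto
          have "drop k (permute_list \<tau>' ys) ! i = ys ! (k + \<tau> i)"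
            using i that k by (simp add: permute_list_def \<tau>'_def)
          also have "\<dots> = permute_list \<tau> (drop k ys) ! i"
            using i that k by (simp add: permute_list_def)
          finally show "drop k (permute_list \<tau>' ys) ! i = permute_list \<tau> (drop k ys) ! i" .
        qed (use that in simp)
      qed
      have "(\<Sum>\<sigma>\<in>?P ?n. a (take k (permute_list \<sigma> xs)) * b (permute_list \<tau> (drop k (permute_list \<sigma> xs))))
        = (\<Sum>\<sigma>\<in>?P ?n. a (take k (permute_list \<tau>' (permute_list \<sigma> xs))) * b (drop k (permute_list \<tau>' (permute_list \<sigma> xs))))"
        by (simp add: t)
      also have "\<dots> = (\<Sum>\<sigma>\<in>?P ?n. a (take k (permute_list \<sigma> xs)) * b (drop k (permute_list \<sigma> xs)))"
        by (rule sum_permute_list[OF \<tau>'])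
      finally show ?thesis .
    qed
    have "(\<Sum>\<sigma>\<in>?P ?n. a (take k (permute_list \<sigma> xs)) * symmetrize b (drop k (permute_list \<sigma> xs)))
      = (\<Sum>\<sigma>\<in>?P ?n. \<Sum>\<tau>\<in>?P ?m. a (take k (permute_list \<sigma> xs)) * b (permute_list \<tau> (drop k (permute_list \<sigma> xs)))) / fact ?m"
      by (simp add: symmetrize_def sum_distrib_left sum_divide_distrib)
    also have "\<dots> = (\<Sum>\<tau>\<in>?P ?m. \<Sum>\<sigma>\<in>?P ?n. a (take k (permute_list \<sigma> xs)) * b (drop k (permute_list \<sigma> xs))) / fact ?m"
      using * by (subst sum.swap) simp
    also have "\<dots> = (\<Sum>\<sigma>\<in>?P ?n. a (take k (permute_list \<sigma> xs)) * b (drop k (permute_list \<sigma> xs)))"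
      by (simp add: card_permutations[OF refl])
    finally show "(\<Sum>\<sigma>\<in>?P ?n. a (take k (permute_list \<sigma> xs)) * symmetrize b (drop k (permute_list \<sigma> xs))) =
      (\<Sum>\<sigma>\<in>?P ?n. a (take k (permute_list \<sigma> xs)) * b (drop k (permute_list \<sigma> xs)))" .
  qed
  also have "\<dots> = (\<Sum>\<sigma>\<in>?P ?n. cat a b (permute_list \<sigma> xs))"
    unfolding cat_def by (subst sum.swap) simp
  finally show "symmetrize (cat a (symmetrize b)) xs = symmetrize (cat a b) xs"
    by (simp add: symmetrize_def)
qed

lemma sym_mult_commute: "sym_mult (otimes a b) = sym_mult (otimes b a)"
  by (simp add: sym_mult_otimes symmetrize_cat_commute)

lemma sym_mult_assoc:
  "sym_mult (otimes (sym_mult (otimes a b)) c) = sym_mult (otimes a (sym_mult (otimes b c)))"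
proof -
  have "symmetrize (cat (symmetrize (cat a b)) c) = symmetrize (cat (cat a b) c)"
    unfolding symmetrize_cat_commute[of "symmetrize (cat a b)" c] symmetrize_cat_symmetrize_right
    by (rule symmetrize_cat_commute)
  then show ?thesis
    by (simp add: sym_mult_otimes symmetrize_cat_symmetrize_right cat_assoc)
qed

section \<open>Monomials\<close>

lemma sprod_Cons: "sprod (v # vs) = sym_mult (otimes (tens [v]) (sprod vs))"
  and sprod_Nil: "sprod [] = tens []"
  by (simp_all add: sprod_def)

lemma sprod_symmetrize: "sprod vs = symmetrize (tens vs)"
proof (induction vs)
  case Nil
  have "sym_fun (tens [] :: 'a list \<Rightarrow> 'b)" by (auto simp: sym_fun_def tens_Nil)
  then show ?case by (simp add: sprod_Nil symmetrize_id)
next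
  case (Cons v vs)
  then show ?case
    by (simp add: sprod_Cons sym_mult_otimes symmetrize_cat_symmetrize_right cat_single_tens)
qed

lemma sym_fun_sprod: "sym_fun (sprod vs)"
  by (simp add: sprod_symmetrize sym_fun_symmetrize)

lemma sym_mult_one: "sym_fun a \<Longrightarrow> sym_mult (otimes (tens []) a) = a"
  by (simp add: sym_mult_otimes cat_tens_Nil_left symmetrize_id)

lemma sprod_append: "sprod (vs @ ws) = sym_mult (otimes (sprod vs) (sprod ws))"
  by (induction vs) (simp_all add: sprod_Nil sym_mult_one sym_fun_sprod sprod_Cons sym_mult_assoc)

lemma sprod_single: "sprod [v] = tens [v]"
proof -
  have "sym_fun (tens [v])"
    unfolding sym_fun_def
  proof (intro allI impI)
    fix xs ys :: "'a list" assume *: "mset xs = mset ys"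
    show "tens [v] xs = tens [v] ys"
    proof (cases "length xs = 1")
      case True
      then obtain x where "xs = [x]" by (auto simp: length_Suc_conv)
      with * have "ys = [x]" by (metis mset_single_iff_right mset.simps)
      with \<open>xs = [x]\<close> show ?thesis by simp
    next
      case False
      with * have "length ys \<noteq> 1" by (metis size_mset)
      with False show ?thesis by (simp add: tens_def)
    qed
  qed
  then show ?thesis by (simp add: sprod_symmetrize symmetrize_id)
qed

lemma sprod_eq_0: "length xs \<noteq> length vs \<Longrightarrow> sprod vs xs = 0"
  by (simp add: sprod_symmetrize symmetrize_def tens_def)

text \<open>As \<open>\<sigma>\<close> ranges over the permutations, \<open>\<sigma> 0\<close> takes every value equally often.\<close>

lemma sum_permutes_at:
  fixes f :: "nat \<Rightarrow> 'k::field_char_0"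
  assumes "0 < n"
  shows "(\<Sum>\<sigma> | \<sigma> permutes {..<n}. f (\<sigma> 0)) = fact n * (\<Sum>i<n. f i) / of_nat n"
proof -
  let ?P = "{\<sigma>. \<sigma> permutes {..<n}}"
  have same: "(\<Sum>\<sigma>\<in>?P. f (\<sigma> i)) = (\<Sum>\<sigma>\<in>?P. f (\<sigma> 0))" if "i < n" for i
  proof -
    have "(\<Sum>\<sigma>\<in>?P. f ((\<sigma> \<circ> Transposition.transpose 0 i) 0)) = (\<Sum>\<sigma>\<in>?P. f (\<sigma> 0))"
      by (rule sum_permutes_compose_right[OF permutes_swap_id]) (use that assms in auto)
    then show ?thesis by (simp add: comp_def)
  qed
  have "of_nat n * (\<Sum>\<sigma>\<in>?P. f (\<sigma> 0)) = (\<Sum>i<n. \<Sum>\<sigma>\<in>?P. f (\<sigma> 0))"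
    by simp
  also have "\<dots> = (\<Sum>i<n. \<Sum>\<sigma>\<in>?P. f (\<sigma> i))"
    by (rule sum.cong[OF refl]) (rule same[symmetric], simp)
  also have "\<dots> = (\<Sum>\<sigma>\<in>?P. \<Sum>i<n. f (\<sigma> i))" by (rule sum.swap)
  also have "\<dots> = (\<Sum>\<sigma>\<in>?P. \<Sum>i<n. f i)"
  proof (rule sum.cong[OF refl])
    fix \<sigma> assume "\<sigma> \<in> ?P"
    then show "(\<Sum>i<n. f (\<sigma> i)) = (\<Sum>i<n. f i)"
      using sum.permute[of \<sigma> "{..<n}" f] by (simp add: comp_def)
  qed
  also have "\<dots> = fact n * (\<Sum>i<n. f i)"
    by (simp add: card_permutations[OF refl])
  finally show ?thesis using assms by (simp add: field_simps)
qed

lemma omit_0: "omit 0 (v # vs) = vs"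
  and omit_Suc: "omit (Suc k) (v # vs) = v # omit k vs"
  and length_omit: "k < length vs \<Longrightarrow> length (omit k vs) = length vs - 1"
  by (auto simp: omit_def)

lemma mset_omit: "k < length vs \<Longrightarrow> add_mset (vs ! k) (mset (omit k vs)) = mset vs"
proof -
  assume "k < length vs"
  then have "vs = take k vs @ vs ! k # drop (Suc k) vs" by (rule id_take_nth_drop)
  then have "mset vs = mset (take k vs @ vs ! k # drop (Suc k) vs)" by (rule arg_cong)
  then show ?thesis by (simp add: omit_def)
qed

lemma symmetrize_cat_single:
  assumes b: "sym_fun (b :: 'x list \<Rightarrow> 'k::field_char_0)" and n: "length xs = n" "n > 0"
  shows "symmetrize (cat (tens [v]) b) xs = (\<Sum>i<n. v (xs ! i) * b (omit i xs)) / of_nat n"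
proof -
  let ?P = "{\<sigma>. \<sigma> permutes {..<n}}"
  have "(\<Sum>\<sigma>\<in>?P. cat (tens [v]) b (permute_list \<sigma> xs)) = (\<Sum>\<sigma>\<in>?P. v (xs ! \<sigma> 0) * b (omit (\<sigma> 0) xs))"
  proof (rule sum.cong[OF refl])
    fix \<sigma> assume "\<sigma> \<in> ?P"
    then have \<sigma>: "\<sigma> permutes {..<length xs}" "\<sigma> 0 < length xs"
      using n permutes_in_image[of \<sigma> "{..<n}" 0] by auto
    obtain y ys where y: "permute_list \<sigma> xs = y # ys"
      using n by (metis length_0_conv length_permute_list less_irrefl list.exhaust)
    have "y = permute_list \<sigma> xs ! 0" by (simp add: y)
    then have y': "y = xs ! \<sigma> 0" using \<sigma> n by (simp add: permute_list_nth)
    have "add_mset y (mset ys) = mset xs" using \<sigma> by (metis y mset.simps(2) mset_permute_list)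
    also have "\<dots> = add_mset y (mset (omit (\<sigma> 0) xs))" using mset_omit[OF \<sigma>(2)] y' by simp
    finally have "b ys = b (omit (\<sigma> 0) xs)" by (intro sym_funD[OF b]) simp
    then show "cat (tens [v]) b (permute_list \<sigma> xs) = v (xs ! \<sigma> 0) * b (omit (\<sigma> 0) xs)"
      by (simp add: cat_tens_single y y')
  qed
  also have "\<dots> = fact n * (\<Sum>i<n. v (xs ! i) * b (omit i xs)) / of_nat n"
    using sum_permutes_at[OF n(2), of "\<lambda>i. v (xs ! i) * b (omit i xs)"] .
  finally show ?thesis using n by (simp add: symmetrize_def)
qed

text \<open>Inserting a point into the first argument acts on monomials as a derivation, up to the degree.
  This turns contraction of monomials into an operation on functions that makes sense for all
  tensors.\<close>

lemma sprod_first_slot: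
  "of_nat (Suc (length xs)) * sprod vs (x # xs) = (\<Sum>k<length vs. (vs ! k) x * sprod (omit k vs) xs)"
proof (cases "length vs = Suc (length xs)")
  case False
  then show ?thesis by (auto simp: sprod_eq_0 length_omit)
next
  case True
  then show ?thesis
  proof (induction vs arbitrary: xs)
    case (Cons v vs)
    define n where "n = length vs"
    have len: "length xs = n" using Cons.prems by (simp add: n_def)
    have "of_nat (Suc n) * sprod (v # vs) (x # xs) = (\<Sum>i<Suc n. v ((x # xs) ! i) * sprod vs (omit i (x # xs)))"
      using symmetrize_cat_single[OF sym_fun_sprod, of "x # xs" "Suc n" v vs] len
      by (simp add: sprod_Cons sym_mult_otimes del: of_nat_Suc sum.lessThan_Suc)
    also have "\<dots> = v x * sprod vs xs + (\<Sum>i<n. v (xs ! i) * sprod vs (x # omit i xs))"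
      by (simp add: sum.lessThan_Suc_shift omit_0 omit_Suc del: sum.lessThan_Suc)
    also have "(\<Sum>i<n. v (xs ! i) * sprod vs (x # omit i xs)) = (\<Sum>k<n. (vs ! k) x * sprod (v # omit k vs) xs)"
    proof (cases "n = 0")
      case False
      have "(\<Sum>i<n. v (xs ! i) * sprod vs (x # omit i xs))
          = (\<Sum>i<n. v (xs ! i) * ((\<Sum>k<n. (vs ! k) x * sprod (omit k vs) (omit i xs)) / of_nat n))"
      proof (rule sum.cong[OF refl])
        fix i assume "i \<in> {..<n}"
        then have l: "Suc (length (omit i xs)) = n" using len by (simp add: length_omit)
        then have "of_nat n * sprod vs (x # omit i xs) = (\<Sum>k<n. (vs ! k) x * sprod (omit k vs) (omit i xs))"
          using Cons.IH[of "omit i xs"] by (simp add: n_def)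
        then show "v (xs ! i) * sprod vs (x # omit i xs) =
          v (xs ! i) * ((\<Sum>k<n. (vs ! k) x * sprod (omit k vs) (omit i xs)) / of_nat n)"
          using False by (simp add: field_simps)
      qed
      also have "\<dots> = (\<Sum>i<n. \<Sum>k<n. (vs ! k) x * (v (xs ! i) * sprod (omit k vs) (omit i xs))) / of_nat n"
        by (simp add: sum_distrib_left sum_divide_distrib mult_ac)
      also have "\<dots> = (\<Sum>k<n. (vs ! k) x * ((\<Sum>i<n. v (xs ! i) * sprod (omit k vs) (omit i xs)) / of_nat n))"
        by (subst sum.swap) (simp add: sum_distrib_left sum_divide_distrib)
      also have "\<dots> = (\<Sum>k<n. (vs ! k) x * sprod (v # omit k vs) xs)"
        using symmetrize_cat_single[OF sym_fun_sprod, of xs n v] len False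
        by (simp add: sprod_Cons sym_mult_otimes)
      finally show ?thesis .
    qed simp
    also have "v x * sprod vs xs + (\<Sum>k<n. (vs ! k) x * sprod (v # omit k vs) xs)
        = (\<Sum>k<Suc n. ((v # vs) ! k) x * sprod (omit k (v # vs)) xs)"
      by (simp add: sum.lessThan_Suc_shift omit_0 omit_Suc del: sum.lessThan_Suc)
    finally show ?case by (simp add: len n_def[symmetric] del: of_nat_Suc sum.lessThan_Suc)
  qed simp
qed

section \<open>The symmetric algebra is spanned by monomials\<close>

definition sym_span :: "('x \<Rightarrow> 'k::field_char_0) set \<Rightarrow> ('x list \<Rightarrow> 'k) set" where
  "sym_span A = fspan {sprod vs | vs. set vs \<subseteq> A}"

lemma subspace_sym_fun: "fs.subspace {a :: 'x list \<Rightarrow> 'k::field_char_0. sym_fun a}"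
  by (auto simp: fs.subspace_def sym_fun_permute)

lemma sym_span_sym_fun: "a \<in> sym_span A \<Longrightarrow> sym_fun a"
  unfolding sym_span_def using fspan_mem_subspace[OF _ subspace_sym_fun] sym_fun_sprod by fastforce

lemma hcomp_linear: "Vector_Spaces.linear fscale fscale (hcomp n :: ('x list \<Rightarrow> 'k::field) \<Rightarrow> _)"
  by (intro flinearI) (auto simp: hcomp_def fun_eq_iff)

lemma hcomp_sprod: "hcomp n (sprod vs) = (if n = length vs then sprod vs else 0)"
  by (auto simp: hcomp_def fun_eq_iff sprod_eq_0)

lemma tens_permute:
  assumes \<sigma>: "\<sigma> permutes {..<length xs}"
  shows "tens vs (permute_list \<sigma> xs) = tens (permute_list (inv_into UNIV \<sigma>) vs) xs"
proof (cases "length vs = length xs")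
  case True
  have "(\<Prod>i<length xs. (vs ! i) (xs ! \<sigma> i)) = (\<Prod>i<length xs. (vs ! inv_into UNIV \<sigma> i) (xs ! i))"
    using prod.permute[OF \<sigma>, of "\<lambda>i. (vs ! inv_into UNIV \<sigma> i) (xs ! i)"]
    by (simp add: comp_def permutes_inverses[OF \<sigma>])
  then show ?thesis using True \<sigma> permutes_inv[OF \<sigma>]
    by (simp add: tens_def permute_list_nth)
qed (simp add: tens_def)

lemma sum_fun_eq: "(\<lambda>x. \<Sum>i\<in>I. f i x) = sum f I"
proof
  fix x show "(\<Sum>i\<in>I. f i x) = sum f I x"
  proof (induction I rule: infinite_finite_induct)
    case (insert i I) then show ?case by simp
  qed simp_all
qed

lemma sum_fun_apply: "sum f I x = (\<Sum>i\<in>I. f i x)"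
  by (rule fun_cong[OF sum_fun_eq[symmetric]])

lemma fs_sum_mem: "fs.subspace T \<Longrightarrow> (\<And>i. i \<in> I \<Longrightarrow> f i \<in> T) \<Longrightarrow> (\<lambda>x. \<Sum>i\<in>I. f i x) \<in> T"
  unfolding sum_fun_eq by (rule fs.subspace_sum)

lemma sprod_mem_sym_alg:
  assumes "set vs \<subseteq> V"
  shows "sprod vs \<in> sym_alg V"
proof -
  let ?n = "length vs"
  have tp: "sprod vs \<in> tensor_power V ?n"
  proof -
    let ?T = "\<lambda>\<sigma>. if \<sigma> permutes {..<?n} then fscale (1 / fact ?n) (tens (permute_list (inv_into UNIV \<sigma>) vs)) else 0"
    have "sprod vs = (\<lambda>xs. \<Sum>\<sigma> | \<sigma> permutes {..<?n}. ?T \<sigma> xs)"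
    proof
      fix xs
      show "sprod vs xs = (\<Sum>\<sigma> | \<sigma> permutes {..<?n}. ?T \<sigma> xs)"
      proof (cases "length xs = ?n")
        case True
        then show ?thesis
          by (simp add: sprod_symmetrize symmetrize_def sum_divide_distrib tens_permute)
      next
        case False
        then show ?thesis by (simp add: sprod_eq_0 tens_def)
      qed
    qed
    also have "\<dots> \<in> tensor_power V ?n"
      unfolding tensor_power_def
    proof (rule fs_sum_mem[OF fs.subspace_span])
      fix \<sigma> assume "\<sigma> \<in> {\<sigma>. \<sigma> permutes {..<?n}}"
      then have \<sigma>: "\<sigma> permutes {..<?n}" by simp
      have "set (permute_list (inv_into UNIV \<sigma>) vs) \<subseteq> V"
        using permutes_inv[OF \<sigma>] assms by simp
      then have "tens (permute_list (inv_into UNIV \<sigma>) vs) \<in> fspan {tens vs |vs. length vs = ?n \<and> set vs \<subseteq> V}"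
        by (intro fs.span_base) (auto intro!: exI[of _ "permute_list (inv_into UNIV \<sigma>) vs"])
      from fs.span_scale[OF this, of "1 / fact ?n"] \<sigma>
      show "?T \<sigma> \<in> fspan {tens vs |vs. length vs = ?n \<and> set vs \<subseteq> V}" by simp
    qed
    finally show ?thesis .
  qed
  have "hcomp n (sprod vs) \<in> sym_power V n" for n
  proof (cases "n = ?n")
    case True
    then show ?thesis
      using tp sym_fun_sprod[of vs] by (auto simp: hcomp_sprod sym_power_def sym_fun_permute)
  next
    case False
    have "0 \<in> tensor_power V n" unfolding tensor_power_def by (rule fs.span_zero)
    with False show ?thesis by (simp add: hcomp_sprod sym_power_def)
  qed
  moreover have "{n. hcomp n (sprod vs) \<noteq> 0} \<subseteq> {?n}" by (auto simp: hcomp_sprod)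
  ultimately show ?thesis by (auto simp: sym_alg_def intro: finite_subset)
qed

lemma subspace_sym_power: "fs.subspace (sym_power V n)"
  unfolding fs.subspace_def sym_power_def tensor_power_def
  by (auto intro: fs.span_zero fs.span_add fs.span_scale)

lemma subspace_sym_alg: "fs.subspace (sym_alg (V :: ('a \<Rightarrow> 'b::field) set))"
  unfolding fs.subspace_def
proof (intro conjI ballI allI)
  have h0: "hcomp n 0 = (0 :: 'a list \<Rightarrow> 'b)" for n by (rule flinear_zero[OF hcomp_linear])
  have "0 \<in> sym_power V n" for n by (rule fs.subspace_0[OF subspace_sym_power])
  then show "0 \<in> sym_alg V"
    unfolding sym_alg_def mem_Collect_eq h0 by simp
  fix a :: "'a list \<Rightarrow> 'b" assume a: "a \<in> sym_alg V"
  { fix b assume b: "b \<in> sym_alg V"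
    have "{n. hcomp n (a + b) \<noteq> 0} \<subseteq> {n. hcomp n a \<noteq> 0} \<union> {n. hcomp n b \<noteq> 0}"
      unfolding flinear_add[OF hcomp_linear] by auto
    with a b show "a + b \<in> sym_alg V"
      unfolding sym_alg_def mem_Collect_eq flinear_add[OF hcomp_linear]
      by (auto intro: fs.subspace_add[OF subspace_sym_power] finite_subset) }
  fix c
  have "{n. hcomp n (fscale c a) \<noteq> 0} \<subseteq> {n. hcomp n a \<noteq> 0}"
    unfolding flinear_scale[OF hcomp_linear] by (auto simp: fun_eq_iff)
  with a show "fscale c a \<in> sym_alg V"
    unfolding sym_alg_def mem_Collect_eq flinear_scale[OF hcomp_linear]
    by (auto intro: fs.subspace_scale[OF subspace_sym_power] finite_subset)
qed

text \<open>A symmetric tensor equals its symmetrization, and symmetrizing the product tensors that span the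
  tensor power yields monomials.\<close>

lemma sym_alg_eq_span: "sym_alg V = sym_span (V :: ('x \<Rightarrow> 'k::field_char_0) set)"
proof
  show "sym_span V \<subseteq> sym_alg V"
    unfolding sym_span_def by (rule fs.span_minimal[OF _ subspace_sym_alg]) (auto intro: sprod_mem_sym_alg)
  show "sym_alg V \<subseteq> sym_span V"
  proof
    fix a assume a: "a \<in> sym_alg V"
    have h: "hcomp n a \<in> sym_span V" for n
    proof -
      have hn: "hcomp n a \<in> sym_power V n" using a by (simp add: sym_alg_def)
      have "sym_fun (hcomp n a)"
        unfolding sym_fun_permute
      proof (intro allI impI)
        fix \<sigma> and xs :: "'x list" assume "\<sigma> permutes {..<length xs}"
        with hn show "hcomp n a (permute_list \<sigma> xs) = hcomp n a xs"
          by (cases "length xs = n") (auto simp: sym_power_def, simp add: hcomp_def)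
      qed
      then have e: "hcomp n a = symmetrize (hcomp n a)" by (simp add: symmetrize_id)
      have "hcomp n a \<in> fspan {tens vs |vs. length vs = n \<and> set vs \<subseteq> V}"
        using hn by (simp add: sym_power_def tensor_power_def)
      then have "symmetrize (hcomp n a) \<in> sym_span V"
        unfolding sym_span_def
        by (rule flinear_span_mem[OF symmetrize_linear _ fs.subspace_span])
           (auto simp: sprod_symmetrize[symmetric] intro!: fs.span_base)
      with e show ?thesis by simp
    qed
    let ?N = "{n. hcomp n a \<noteq> 0}"
    have "a = (\<lambda>xs. \<Sum>n\<in>?N. hcomp n a xs)"
    proof
      fix xs
      have "(\<Sum>n\<in>?N. hcomp n a xs) = (\<Sum>n\<in>?N. if n = length xs then a xs else 0)"
        by (rule sum.cong) (auto simp: hcomp_def)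
      also have "\<dots> = (if length xs \<in> ?N then a xs else 0)"
        using a by (subst sum.delta) (auto simp: sym_alg_def)
      also have "\<dots> = a xs"
        by (auto simp: hcomp_def fun_eq_iff)
      finally show "a xs = (\<Sum>n\<in>?N. hcomp n a xs)" ..
    qed
    also have "\<dots> \<in> sym_span V"
      using h unfolding sym_span_def by (intro fs_sum_mem[OF fs.subspace_span])
    finally show "a \<in> sym_span V" .
  qed
qed

lemma subspace_sym_span: "fs.subspace (sym_span A)"
  unfolding sym_span_def by (rule fs.subspace_span)

lemma sprod_mem_sym_span: "set vs \<subseteq> A \<Longrightarrow> sprod vs \<in> sym_span A"
  unfolding sym_span_def by (rule fs.span_base) auto

section \<open>Existence of the contraction\<close>

text \<open>Products \<open>b(x) * c(y)\<close> of elements of a basis of \<open>V\<close> are linearly independent functions of two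
  variables, so that a linear functional may be prescribed on them. In this way a bilinear form
  can be applied to two arguments of a tensor without decomposing the tensor.\<close>

lemma bilinear_form_functional:
  fixes V :: "('x \<Rightarrow> 'k::field) set"
  assumes V: "fs.subspace V"
    and add_left: "\<And>u v w. u \<in> V \<Longrightarrow> v \<in> V \<Longrightarrow> w \<in> V \<Longrightarrow> \<Lambda> (u + v) w = \<Lambda> u w + \<Lambda> v w"
    and scale_left: "\<And>a v w. v \<in> V \<Longrightarrow> w \<in> V \<Longrightarrow> \<Lambda> (fscale a v) w = a * \<Lambda> v w"
    and add_right: "\<And>u v w. u \<in> V \<Longrightarrow> v \<in> V \<Longrightarrow> w \<in> V \<Longrightarrow> \<Lambda> w (u + v) = \<Lambda> w u + \<Lambda> w v"
    and scale_right: "\<And>a v w. v \<in> V \<Longrightarrow> w \<in> V \<Longrightarrow> \<Lambda> w (fscale a v) = a * \<Lambda> w v"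
  obtains L where "\<And>f g. L (f + g) = L f + L g" "\<And>a f. L (fscale a f) = a * L (f :: 'x \<times> 'x \<Rightarrow> 'k)"
    "\<And>v w. v \<in> V \<Longrightarrow> w \<in> V \<Longrightarrow> L (\<lambda>(x, y). v x * w y) = \<Lambda> v w"
proof -
  obtain B where B: "B \<subseteq> V" "fs.independent B" "V \<subseteq> fspan B"
    using fs.maximal_independent_subset by blast
  define T where "T p = (\<lambda>(x, y). fst p x * snd p y :: 'k)" for p :: "('x \<Rightarrow> 'k) \<times> ('x \<Rightarrow> 'k)"
  \<comment> \<open>independence of the products: freeze \<open>y\<close>, then use independence of the basis twice\<close>
  have key: "(\<forall>p\<in>P. u p = 0)" if P: "finite P" "P \<subseteq> B \<times> B" and z: "\<And>x y. (\<Sum>p\<in>P. u p * T p (x, y)) = 0" for P u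
  proof -
    let ?P1 = "fst ` P" and ?P2 = "snd ` P"
    define u' where "u' b c = (if (b, c) \<in> P then u (b, c) else 0)" for b c
    have "(\<Sum>b\<in>?P1. (\<Sum>c\<in>?P2. u' b c * c y) * b x) = 0" for x y
    proof -
      have "(\<Sum>b\<in>?P1. (\<Sum>c\<in>?P2. u' b c * c y) * b x) = (\<Sum>b\<in>?P1. \<Sum>c\<in>?P2. u' b c * T (b, c) (x, y))"
        by (simp add: sum_distrib_right sum_distrib_left T_def mult_ac)
      also have "\<dots> = (\<Sum>p\<in>?P1 \<times> ?P2. u' (fst p) (snd p) * T p (x, y))"
        unfolding sum.cartesian_product by (simp add: case_prod_beta)
      also have "\<dots> = (\<Sum>p\<in>P. u' (fst p) (snd p) * T p (x, y))"
        by (rule sum.mono_neutral_right) (use P in \<open>force simp: u'_def\<close>)+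
      also have "\<dots> = (\<Sum>p\<in>P. u p * T p (x, y))" by (rule sum.cong) (auto simp: u'_def)
      finally show ?thesis using z by simp
    qed
    then have "(\<Sum>b\<in>?P1. fscale (\<Sum>c\<in>?P2. u' b c * c y) b) = 0" for y
      unfolding sum_fun_eq[symmetric] by (auto simp: fun_eq_iff)
    then have "(\<Sum>c\<in>?P2. u' b c * c y) = 0" if "b \<in> ?P1" for y b
      using that P by (intro fs.independentD[OF B(2), of ?P1]) auto
    then have "(\<Sum>c\<in>?P2. fscale (u' b c) c) = 0" if "b \<in> ?P1" for b
      using that unfolding sum_fun_eq[symmetric] by (auto simp: fun_eq_iff)
    then have "u' b c = 0" if "b \<in> ?P1" "c \<in> ?P2" for b c
      using that P by (intro fs.independentD[OF B(2), of ?P2 "u' b"]) auto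
    then show ?thesis unfolding u'_def by force
  qed
  have inj: "inj_on T (B \<times> B)"
  proof (rule inj_onI, rule ccontr)
    fix p q assume *: "p \<in> B \<times> B" "q \<in> B \<times> B" "T p = T q" "p \<noteq> q"
    have "\<forall>r\<in>{p, q}. (if r = p then 1 else -1 :: 'k) = 0"
      by (rule key) (use * in auto)
    then show False by simp
  qed
  have ind: "fs.independent (T ` (B \<times> B))"
    unfolding fs.independent_explicit_module
  proof (intro allI impI)
    fix t u f assume t: "finite t" "t \<subseteq> T ` (B \<times> B)" "(\<Sum>f\<in>t. fscale (u f) f) = (0 :: 'x \<times> 'x \<Rightarrow> 'k)" "f \<in> t"
    define P where "P = {p \<in> B \<times> B. T p \<in> t}"
    have injP: "inj_on T P" using inj by (rule inj_on_subset) (auto simp: P_def)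
    have im: "T ` P = t" using t(2) by (auto simp: P_def)
    have fin: "finite P" using t(1) im injP finite_imageD by blast
    have "\<forall>p\<in>P. u (T p) = 0"
    proof (rule key[OF fin])
      fix x y
      have "(\<Sum>p\<in>P. u (T p) * T p (x, y)) = (\<Sum>f\<in>t. u f * f (x, y))"
        unfolding im[symmetric] by (simp add: sum.reindex[OF injP])
      also have "\<dots> = (\<Sum>f\<in>t. fscale (u f) f) (x, y)" by (simp add: sum_fun_eq[symmetric])
      finally show "(\<Sum>p\<in>P. u (T p) * T p (x, y)) = 0" by (simp only: t(3) zero_fun_apply)
    qed (auto simp: P_def)
    with t(4) im show "u f = 0" by auto
  qed
  interpret vp: vector_space_pair "fscale :: 'k \<Rightarrow> ('x \<times> 'x \<Rightarrow> 'k) \<Rightarrow> _" "(*) :: 'k \<Rightarrow> _"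
    by unfold_locales (auto simp: algebra_simps)
  obtain L where L: "Vector_Spaces.linear fscale (*) L"
    "\<And>f. f \<in> T ` (B \<times> B) \<Longrightarrow> L f = (case inv_into (B \<times> B) T f of (b, c) \<Rightarrow> \<Lambda> b c)"
    using vp.linear_independent_extend[OF ind, of "\<lambda>f. case inv_into (B \<times> B) T f of (b, c) \<Rightarrow> \<Lambda> b c"] by blast
  have LT: "L (\<lambda>(x, y). b x * c y) = \<Lambda> b c" if "b \<in> B" "c \<in> B" for b c
  proof -
    have "L (T (b, c)) = \<Lambda> b c"
      using L(2)[of "T (b, c)"] inv_into_f_f[OF inj, of "(b, c)"] that by simp
    then show ?thesis by (simp add: T_def)
  qed
  have Ladd: "L (f + g) = L f + L g" and Lscale: "L (fscale a f) = a * L f" for f g a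
    using L(1) unfolding Vector_Spaces.linear_def module_hom_def module_hom_axioms_def by blast+
  have "fscale 0 0 = (0 :: 'x \<times> 'x \<Rightarrow> 'k)" by (simp add: fun_eq_iff)
  then have L0: "L 0 = 0" using Lscale[of 0 0] by simp
  have z: "\<Lambda> 0 w = 0" "\<Lambda> w 0 = 0" if "w \<in> V" for w
    using scale_left[OF that that, of 0] scale_right[OF that that, of 0] by (auto simp: zero_fun_def)
  have t0: "(\<lambda>(x, y). (0 :: 'x \<Rightarrow> 'k) x * w y) = 0" "(\<lambda>(x, y). w x * (0 :: 'x \<Rightarrow> 'k) y) = 0" for w :: "'x \<Rightarrow> 'k"
    by (auto simp: fun_eq_iff)
  have ta: "(\<lambda>(x, y). (u + v) x * w y) = (\<lambda>(x, y). u x * w y) + (\<lambda>(x, y). v x * w y)"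
    "(\<lambda>(x, y). w x * (u + v) y) = (\<lambda>(x, y). w x * u y) + (\<lambda>(x, y). w x * v y)"
    "(\<lambda>(x, y). fscale a u x * w y) = fscale a (\<lambda>(x, y). u x * w y)"
    "(\<lambda>(x, y). w x * fscale a u y) = fscale a (\<lambda>(x, y). w x * u y)" for u v w :: "'x \<Rightarrow> 'k" and a
    by (auto simp: fun_eq_iff algebra_simps)
  have 1: "L (\<lambda>(x, y). v x * c y) = \<Lambda> v c" if v: "v \<in> V" and c: "c \<in> B" for v c
  proof -
    let ?S = "{v \<in> V. L (\<lambda>(x, y). v x * c y) = \<Lambda> v c}"
    have "fs.subspace ?S"
      unfolding fs.subspace_def mem_Collect_eq
      using c B(1) V
      by (auto simp only: ta t0 Ladd Lscale L0 z add_left scale_left subset_iff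
          intro: fs.subspace_0 fs.subspace_add fs.subspace_scale)
    then have "v \<in> ?S" by (rule fspan_mem_subspace[where A=B, rotated]) (use v B c LT in auto)
    then show ?thesis by simp
  qed
  have 2: "L (\<lambda>(x, y). v x * w y) = \<Lambda> v w" if v: "v \<in> V" and w: "w \<in> V" for v w
  proof -
    let ?S = "{w \<in> V. L (\<lambda>(x, y). v x * w y) = \<Lambda> v w}"
    have "fs.subspace ?S"
      unfolding fs.subspace_def mem_Collect_eq
      using v V
      by (auto simp only: ta t0 Ladd Lscale L0 z add_right scale_right
          intro: fs.subspace_0 fs.subspace_add fs.subspace_scale)
    then have "w \<in> ?S" by (rule fspan_mem_subspace[where A=B, rotated]) (use w B v 1 in auto)
    then show ?thesis by simp
  qed
  show ?thesis using that[OF Ladd Lscale 2] .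
qed

locale bilinear_form =
  fixes V :: "('x \<Rightarrow> 'k::field_char_0) set" and \<Lambda> :: "('x \<Rightarrow> 'k) \<Rightarrow> ('x \<Rightarrow> 'k) \<Rightarrow> 'k"
  assumes subspace_V: "fs.subspace V"
    and add_left: "\<And>u v w. u \<in> V \<Longrightarrow> v \<in> V \<Longrightarrow> w \<in> V \<Longrightarrow> \<Lambda> (u + v) w = \<Lambda> u w + \<Lambda> v w"
    and scale_left: "\<And>a v w. v \<in> V \<Longrightarrow> w \<in> V \<Longrightarrow> \<Lambda> (fscale a v) w = a * \<Lambda> v w"
    and add_right: "\<And>u v w. u \<in> V \<Longrightarrow> v \<in> V \<Longrightarrow> w \<in> V \<Longrightarrow> \<Lambda> w (u + v) = \<Lambda> w u + \<Lambda> w v"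
    and scale_right: "\<And>a v w. v \<in> V \<Longrightarrow> w \<in> V \<Longrightarrow> \<Lambda> w (fscale a v) = a * \<Lambda> w v"
begin

text \<open>The witness inserts the first arguments of both tensors into a functional extending \<open>\<Lambda>\<close>. The
  degree factors compensate for the averaging over positions in the symmetrized product.\<close>

lemma contraction_exists:
  "\<exists>P. Vector_Spaces.linear fscale fscale P \<and>
     (\<forall>vs ws. set vs \<subseteq> V \<and> set ws \<subseteq> V \<longrightarrow>
        P (otimes (sprod vs) (sprod ws)) =
          (\<Sum>k<length vs. \<Sum>l<length ws.
             fscale (\<Lambda> (vs ! k) (ws ! l)) (otimes (sprod (omit k vs)) (sprod (omit l ws)))))"
proof -
  obtain L where L: "\<And>f g. L (f + g) = L f + L g" "\<And>a f. L (fscale a f) = a * L (f :: 'x \<times> 'x \<Rightarrow> 'k)"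
    "\<And>v w. v \<in> V \<Longrightarrow> w \<in> V \<Longrightarrow> L (\<lambda>(x, y). v x * w y) = \<Lambda> v w"
    using bilinear_form_functional[OF subspace_V add_left scale_left add_right scale_right] by blast
  have L0: "L 0 = 0" using L(1)[of 0 0] by simp
  have Lsum: "L (\<lambda>p. \<Sum>i\<in>I. f i p) = (\<Sum>i\<in>I. L (f i))" for f :: "nat \<Rightarrow> 'x \<times> 'x \<Rightarrow> 'k" and I
    unfolding sum_fun_eq
  proof (induction I rule: infinite_finite_induct)
    case (insert i I) show ?case by (simp only: sum.insert[OF insert(1,2)] L(1) insert.IH)
  next
    case (infinite I) then show ?case by (simp only: sum.infinite L0 not_False_eq_True)
  next
    case empty then show ?case by (simp only: sum.empty L0)
  qed
  define P :: "('x list \<times> 'x list \<Rightarrow> 'k) \<Rightarrow> 'x list \<times> 'x list \<Rightarrow> 'k" where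
    "P t = (\<lambda>(xs, ys). of_nat (Suc (length xs)) * of_nat (Suc (length ys)) * L (\<lambda>(x, y). t (x # xs, y # ys)))" for t
  have "Vector_Spaces.linear fscale fscale P"
  proof (rule flinearI)
    fix f g :: "'x list \<times> 'x list \<Rightarrow> 'k" and a
    have 1: "(\<lambda>(x, y). (f + g) (x # xs, y # ys)) = (\<lambda>(x, y). f (x # xs, y # ys)) + (\<lambda>(x, y). g (x # xs, y # ys))"
      and 2: "(\<lambda>(x, y). fscale a f (x # xs, y # ys)) = fscale a (\<lambda>(x, y). f (x # xs, y # ys))" for xs ys
      by (auto simp: fun_eq_iff)
    show "P (f + g) = P f + P g"
      unfolding P_def 1 L(1) by (rule ext) (simp only: plus_fun_apply case_prod_beta distrib_left)
    show "P (fscale a f) = fscale a (P f)"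
      unfolding P_def 2 L(2) by (rule ext, clarify) (simp only: prod.case mult.left_commute[of _ a])
  qed
  moreover have "P (otimes (sprod vs) (sprod ws)) =
          (\<Sum>k<length vs. \<Sum>l<length ws.
             fscale (\<Lambda> (vs ! k) (ws ! l)) (otimes (sprod (omit k vs)) (sprod (omit l ws))))"
    if vw: "set vs \<subseteq> V" "set ws \<subseteq> V" for vs ws
  proof (rule ext, clarify)
    fix xs ys :: "'x list"
    let ?m = "of_nat (Suc (length xs)) :: 'k" and ?n = "of_nat (Suc (length ys)) :: 'k"
    have "P (otimes (sprod vs) (sprod ws)) (xs, ys)
       = L (fscale (?m * ?n) (\<lambda>(x, y). sprod vs (x # xs) * sprod ws (y # ys)))"
      unfolding P_def otimes_def L(2) by (simp only: prod.case)
    also have "fscale (?m * ?n) (\<lambda>(x, y). sprod vs (x # xs) * sprod ws (y # ys))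
       = (\<lambda>(x, y). (?m * sprod vs (x # xs)) * (?n * sprod ws (y # ys)))"
      by (auto simp: fun_eq_iff)
    also have "\<dots> = (\<lambda>p. \<Sum>k<length vs. (\<Sum>l<length ws. fscale (sprod (omit k vs) xs * sprod (omit l ws) ys)
                        (\<lambda>(x, y). (vs ! k) x * (ws ! l) y) p))"
      unfolding sprod_first_slot
      by (auto simp: fun_eq_iff sum_product mult_ac)
    also have "L \<dots> = (\<Sum>k<length vs. \<Sum>l<length ws. sprod (omit k vs) xs * sprod (omit l ws) ys * \<Lambda> (vs ! k) (ws ! l))"
    proof -
      have "L (\<lambda>(x, y). (vs ! k) x * (ws ! l) y) = \<Lambda> (vs ! k) (ws ! l)" if "k < length vs" "l < length ws" for k l
        using that vw by (intro L(3)) auto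
      then show ?thesis unfolding Lsum L(2) by (intro sum.cong refl) simp
    qed
    also have "\<dots> = (\<Sum>k<length vs. \<Sum>l<length ws.
             fscale (\<Lambda> (vs ! k) (ws ! l)) (otimes (sprod (omit k vs)) (sprod (omit l ws)))) (xs, ys)"
      by (simp only: sum_fun_apply otimes_def prod.case mult.commute[of "\<Lambda> _ _"] mult.assoc)
    finally show "P (otimes (sprod vs) (sprod ws)) (xs, ys) = (\<Sum>k<length vs. \<Sum>l<length ws.
             fscale (\<Lambda> (vs ! k) (ws ! l)) (otimes (sprod (omit k vs)) (sprod (omit l ws)))) (xs, ys)" .
  qed
  ultimately show ?thesis by blast
qed

lemma contraction_spec:
  "Vector_Spaces.linear fscale fscale (contraction V \<Lambda>) \<and>
     (\<forall>vs ws. set vs \<subseteq> V \<and> set ws \<subseteq> V \<longrightarrow>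
        contraction V \<Lambda> (otimes (sprod vs) (sprod ws)) =
          (\<Sum>k<length vs. \<Sum>l<length ws.
             fscale (\<Lambda> (vs ! k) (ws ! l)) (otimes (sprod (omit k vs)) (sprod (omit l ws)))))"
  unfolding contraction_def by (rule someI_ex[OF contraction_exists])

lemmas contraction_linear = contraction_spec[THEN conjunct1]
lemmas contraction_sprod = contraction_spec[THEN conjunct2, rule_format, OF conjI]

end

section \<open>Contractions and monomials\<close>

lemma set_omit: "set (omit k vs) \<subseteq> set vs"
  by (auto simp: omit_def dest: in_set_takeD in_set_dropD)

lemma set_omit_insert: "k < length vs \<Longrightarrow> set vs = insert (vs ! k) (set (omit k vs))"
  using mset_omit[of k vs] by (metis set_mset_add_mset_insert set_mset_mset)

text \<open>Subspaces of the symmetric algebra, and of its tensor square, are described by the monomials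
  that span them. Closure properties then reduce to statements on lists of factors.\<close>

definition lin_monos :: "('x \<Rightarrow> 'k::field_char_0) list set \<Rightarrow> ('x list \<Rightarrow> 'k) set" where
  "lin_monos X = fspan (sprod ` X)"

definition lin_monos2 :: "('x \<Rightarrow> 'k::field_char_0) list set \<Rightarrow> ('x \<Rightarrow> 'k) list set \<Rightarrow> ('x list \<times> 'x list \<Rightarrow> 'k) set" where
  "lin_monos2 X Y = fspan {otimes (sprod vs) (sprod ws) | vs ws. vs \<in> X \<and> ws \<in> Y}"

lemma sym_span_monos: "sym_span A = lin_monos {vs. set vs \<subseteq> A}"
  by (simp add: sym_span_def lin_monos_def setcompr_eq_image)

lemma subspace_lin_monos: "fs.subspace (lin_monos X)"
  by (simp add: lin_monos_def)

lemma sprod_lin_monos: "vs \<in> X \<Longrightarrow> sprod vs \<in> lin_monos X"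
  by (auto simp: lin_monos_def intro: fs.span_base)

lemma otimes_lin_monos2: "a \<in> lin_monos X \<Longrightarrow> b \<in> lin_monos Y \<Longrightarrow> otimes a b \<in> lin_monos2 X Y"
  unfolding lin_monos_def lin_monos2_def
  by (rule flinear_otimes_mem[where Q="\<lambda>t. t"]) (auto intro!: flinearI fs.span_base)

lemma sym_mult_lin_monos2:
  assumes "t \<in> lin_monos2 X Y" "\<And>vs ws. vs \<in> X \<Longrightarrow> ws \<in> Y \<Longrightarrow> vs @ ws \<in> Z"
  shows "sym_mult t \<in> lin_monos Z"
  using assms(1) unfolding lin_monos2_def
  by (rule flinear_span_mem[OF sym_mult_linear]) (auto simp: subspace_lin_monos sprod_append[symmetric] intro!: sprod_lin_monos assms(2))

lemma sym_mult_lin_monos: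
  assumes "a \<in> lin_monos X" "b \<in> lin_monos Y" "\<And>vs ws. vs \<in> X \<Longrightarrow> ws \<in> Y \<Longrightarrow> vs @ ws \<in> Z"
  shows "sym_mult (otimes a b) \<in> lin_monos Z"
  using sym_mult_lin_monos2[OF otimes_lin_monos2] assms by blast

lemma lin_monos_mono: "X \<subseteq> Y \<Longrightarrow> lin_monos X \<subseteq> lin_monos Y"
  by (simp add: lin_monos_def fs.span_mono image_mono)

definition sym_ideal :: "('x \<Rightarrow> 'k::field_char_0) set \<Rightarrow> ('x \<Rightarrow> 'k) set \<Rightarrow> ('x list \<Rightarrow> 'k) set" where
  "sym_ideal V N = lin_monos {vs. set vs \<subseteq> V \<and> set vs \<inter> N \<noteq> {}}"

lemma sym_ideal_subset: "sym_ideal V N \<subseteq> sym_span V"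
  unfolding sym_ideal_def sym_span_monos by (rule lin_monos_mono) auto

lemma subspace_sym_ideal: "fs.subspace (sym_ideal V N)"
  unfolding sym_ideal_def by (rule subspace_lin_monos)

lemma sym_span_mult: "a \<in> sym_span A \<Longrightarrow> b \<in> sym_span A \<Longrightarrow> sym_mult (otimes a b) \<in> sym_span A"
  unfolding sym_span_monos by (rule sym_mult_lin_monos) auto

lemma sym_ideal_mult_left: "a \<in> sym_span V \<Longrightarrow> b \<in> sym_ideal V N \<Longrightarrow> sym_mult (otimes a b) \<in> sym_ideal V N"
  unfolding sym_span_monos sym_ideal_def by (rule sym_mult_lin_monos) auto

lemma sym_ideal_mult_right: "a \<in> sym_ideal V N \<Longrightarrow> b \<in> sym_span V \<Longrightarrow> sym_mult (otimes a b) \<in> sym_ideal V N"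
  by (subst sym_mult_commute) (rule sym_ideal_mult_left)

context bilinear_form
begin

text \<open>A contraction removes one factor on each side and multiplies with their pairing. So it preserves
  any class of monomials that is stable under the removal of factors with non-zero pairing.
  Nilpotency and the absorption property of the ideal are instances.\<close>

lemma contraction_lin_monos2:
  assumes "\<And>vs. vs \<in> X \<Longrightarrow> set vs \<subseteq> V" "\<And>ws. ws \<in> Y \<Longrightarrow> set ws \<subseteq> V"
    and closed: "\<And>vs ws k l. vs \<in> X \<Longrightarrow> ws \<in> Y \<Longrightarrow> k < length vs \<Longrightarrow> l < length ws \<Longrightarrow>
        \<Lambda> (vs ! k) (ws ! l) \<noteq> 0 \<Longrightarrow> omit k vs \<in> X' \<and> omit l ws \<in> Y'"
    and t: "t \<in> lin_monos2 X Y"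
  shows "contraction V \<Lambda> t \<in> lin_monos2 X' Y'"
  using t unfolding lin_monos2_def
proof (rule flinear_span_mem[OF contraction_linear])
  fix a assume "a \<in> {otimes (sprod vs) (sprod ws) |vs ws. vs \<in> X \<and> ws \<in> Y}"
  then obtain vs ws where a: "a = otimes (sprod vs) (sprod ws)" "vs \<in> X" "ws \<in> Y" by auto
  let ?S = "fspan {otimes (sprod vs) (sprod ws) |vs ws. vs \<in> X' \<and> ws \<in> Y'}"
  have "fscale (\<Lambda> (vs ! k) (ws ! l)) (otimes (sprod (omit k vs)) (sprod (omit l ws))) \<in> ?S"
    if "k < length vs" "l < length ws" for k l
  proof (cases "\<Lambda> (vs ! k) (ws ! l) = 0")
    case True
    then show ?thesis using fs.span_zero[of "{otimes (sprod vs) (sprod ws) |vs ws. vs \<in> X' \<and> ws \<in> Y'}"]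
      by (simp add: zero_fun_def)
  next
    case False
    then show ?thesis using closed[OF a(2,3) that]
      by (intro fs.span_scale fs.span_base) auto
  qed
  then show "contraction V \<Lambda> a \<in> ?S"
    unfolding a(1) contraction_sprod[OF assms(1)[OF a(2)] assms(2)[OF a(3)]]
    by (intro fs.span_sum) auto
qed simp

lemma contraction_funpow_lin_monos2:
  assumes "\<And>vs. vs \<in> X \<Longrightarrow> set vs \<subseteq> V" "\<And>ws. ws \<in> Y \<Longrightarrow> set ws \<subseteq> V"
    and "\<And>vs ws k l. vs \<in> X \<Longrightarrow> ws \<in> Y \<Longrightarrow> k < length vs \<Longrightarrow> l < length ws \<Longrightarrow>
        \<Lambda> (vs ! k) (ws ! l) \<noteq> 0 \<Longrightarrow> omit k vs \<in> X \<and> omit l ws \<in> Y"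
    and "t \<in> lin_monos2 X Y"
  shows "(contraction V \<Lambda> ^^ n) t \<in> lin_monos2 X Y"
proof (induction n)
  case (Suc n) then show ?case using contraction_lin_monos2[OF assms(1-3) Suc] by simp
qed (use assms(4) in simp)

lemma contraction_degree_nilpotent:
  "t \<in> lin_monos2 {vs. set vs \<subseteq> V \<and> length vs < n} {ws. set ws \<subseteq> V} \<Longrightarrow> (contraction V \<Lambda> ^^ n) t = 0"
proof (induction n arbitrary: t)
  case 0
  then show ?case by (simp add: lin_monos2_def)
next
  case (Suc n)
  have "contraction V \<Lambda> t \<in> lin_monos2 {vs. set vs \<subseteq> V \<and> length vs < n} {ws. set ws \<subseteq> V}"
  proof (rule contraction_lin_monos2[OF _ _ _ Suc.prems])
    fix vs ws :: "('x \<Rightarrow> 'k) list" and k l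
    assume "vs \<in> {vs. set vs \<subseteq> V \<and> length vs < Suc n}" "ws \<in> {ws. set ws \<subseteq> V}" "k < length vs"
    then show "omit k vs \<in> {vs. set vs \<subseteq> V \<and> length vs < n} \<and> omit l ws \<in> {ws. set ws \<subseteq> V}"
      using set_omit[of k vs] set_omit[of l ws] by (auto simp: length_omit)
  qed auto
  from Suc.IH[OF this] show ?case by (simp only: funpow_Suc_right comp_apply)
qed

lemma contraction_sprod_nilpotent:
  assumes "set vs \<subseteq> V" "set ws \<subseteq> V" "length vs < n"
  shows "(contraction V \<Lambda> ^^ n) (otimes (sprod vs) (sprod ws)) = 0"
proof (rule contraction_degree_nilpotent)
  show "otimes (sprod vs) (sprod ws) \<in> lin_monos2 {vs. set vs \<subseteq> V \<and> length vs < n} {ws. set ws \<subseteq> V}"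
    by (rule otimes_lin_monos2; rule sprod_lin_monos) (use assms in auto)
qed

text \<open>Every contraction lowers the degree, so that the series of the star product is a finite sum.\<close>

lemma contraction_nilpotent:
  assumes "a \<in> sym_span V" "b \<in> sym_span V"
  shows "\<exists>K. \<forall>n\<ge>K. (contraction V \<Lambda> ^^ n) (otimes a b) = 0"
proof -
  let ?T = "{t. \<exists>K. \<forall>n\<ge>K. (contraction V \<Lambda> ^^ n) t = 0}"
  note lin = flinear_funpow[OF contraction_linear]
  have T: "fs.subspace ?T"
    unfolding fs.subspace_def mem_Collect_eq
  proof (intro conjI ballI allI; (elim CollectE exE)?)
    show "\<exists>K. \<forall>n\<ge>K. (contraction V \<Lambda> ^^ n) 0 = 0"
      by (intro exI allI impI) (rule flinear_zero[OF lin])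
    fix x y K L
    assume *: "\<forall>n\<ge>K. (contraction V \<Lambda> ^^ n) x = 0" "\<forall>n\<ge>L. (contraction V \<Lambda> ^^ n) y = 0"
    show "\<exists>K. \<forall>n\<ge>K. (contraction V \<Lambda> ^^ n) (x + y) = 0"
    proof (intro exI[of _ "max K L"] allI impI)
      fix n assume "n \<ge> max K L"
      with * have "(contraction V \<Lambda> ^^ n) x = 0" "(contraction V \<Lambda> ^^ n) y = 0" by auto
      then show "(contraction V \<Lambda> ^^ n) (x + y) = 0"
        by (simp only: flinear_add[OF lin] add_0)
    qed
  next
    fix c x K
    assume *: "\<forall>n\<ge>K. (contraction V \<Lambda> ^^ n) x = 0"
    have "fscale c (0 :: 'x list \<times> 'x list \<Rightarrow> 'k) = 0" by (rule ext) simp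
    with * show "\<exists>K. \<forall>n\<ge>K. (contraction V \<Lambda> ^^ n) (fscale c x) = 0"
      unfolding flinear_scale[OF lin] by metis
  qed
  have "(\<lambda>t. t) (otimes a b) \<in> ?T"
    using assms unfolding sym_span_def
  proof (rule flinear_otimes_mem[rotated, OF _ _ T])
    fix a b assume "a \<in> {sprod vs |vs. set vs \<subseteq> V}" "b \<in> {sprod vs |vs. set vs \<subseteq> V}"
    then obtain vs ws where ab: "a = sprod vs" "b = sprod ws" "set vs \<subseteq> V" "set ws \<subseteq> V" by blast
    have "\<forall>n\<ge>Suc (length vs). (contraction V \<Lambda> ^^ n) (otimes a b) = 0"
      unfolding ab(1,2) using contraction_sprod_nilpotent[OF ab(3,4)] by (meson Suc_le_lessD)
    then show "otimes a b \<in> ?T" by blast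
  qed (intro flinearI; rule refl)
  then show ?thesis by blast
qed

text \<open>The algebraic form of locality: between tensors over sets of vectors that are orthogonal for \<open>\<Lambda>\<close>
  there is nothing to contract.\<close>

lemma contraction_orthogonal:
  assumes "a \<in> sym_span A" "b \<in> sym_span B" "A \<subseteq> V" "B \<subseteq> V"
    and "\<And>v w. v \<in> A \<Longrightarrow> w \<in> B \<Longrightarrow> \<Lambda> v w = 0"
  shows "contraction V \<Lambda> (otimes a b) = 0"
proof -
  have "contraction V \<Lambda> (otimes a b) \<in> {0}"
    using assms(1,2) unfolding sym_span_def
  proof (rule flinear_otimes_mem[OF contraction_linear])
    fix a b assume "a \<in> {sprod vs |vs. set vs \<subseteq> A}" "b \<in> {sprod vs |vs. set vs \<subseteq> B}"
    then obtain vs ws where e: "a = sprod vs" "b = sprod ws" "set vs \<subseteq> A" "set ws \<subseteq> B" by auto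
    then have "\<Lambda> (vs ! k) (ws ! l) = 0" if "k < length vs" "l < length ws" for k l
      using that by (intro assms(5)) auto
    then have "contraction V \<Lambda> (otimes a b) = 0"
      unfolding e(1,2) using e(3,4) assms(3,4)
      by (subst contraction_sprod) (auto intro!: sum.neutral simp: zero_fun_def)
    then show "contraction V \<Lambda> (otimes a b) \<in> {0}" by simp
  qed simp
  then show ?thesis by simp
qed

lemma contraction_funpow_sym_span:
  assumes "A \<subseteq> V" "a \<in> sym_span A" "b \<in> sym_span A"
  shows "sym_mult ((contraction V \<Lambda> ^^ n) (otimes a b)) \<in> sym_span A"
proof -
  let ?X = "{vs. set vs \<subseteq> A}"
  have "otimes a b \<in> lin_monos2 ?X ?X"
    using assms(2,3) unfolding sym_span_monos by (rule otimes_lin_monos2)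
  then have "(contraction V \<Lambda> ^^ n) (otimes a b) \<in> lin_monos2 ?X ?X"
  proof (rule contraction_funpow_lin_monos2[rotated -1])
    fix vs ws :: "('x \<Rightarrow> 'k) list" and k l assume "vs \<in> ?X" "ws \<in> ?X"
    then show "omit k vs \<in> ?X \<and> omit l ws \<in> ?X"
      using set_omit[of k vs] set_omit[of l ws] by (simp add: subset_iff)
  qed (use assms(1) in auto)
  then show ?thesis unfolding sym_span_monos by (rule sym_mult_lin_monos2) auto
qed

end

locale null_space = bilinear_form V \<Lambda>
  for V :: "('x \<Rightarrow> 'k::field_char_0) set" and \<Lambda> +
  fixes N :: "('x \<Rightarrow> 'k) set"
  assumes N_V: "N \<subseteq> V"
    and null_left: "\<And>v w. v \<in> N \<Longrightarrow> w \<in> V \<Longrightarrow> \<Lambda> v w = 0"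
    and null_right: "\<And>v w. v \<in> N \<Longrightarrow> w \<in> V \<Longrightarrow> \<Lambda> w v = 0"
begin

text \<open>A factor in the null space pairs to zero with everything, so no contraction can remove it.\<close>

lemma contraction_funpow_sym_ideal:
  shows "a \<in> sym_ideal V N \<Longrightarrow> b \<in> sym_span V \<Longrightarrow> sym_mult ((contraction V \<Lambda> ^^ n) (otimes a b)) \<in> sym_ideal V N"
    and "b \<in> sym_ideal V N \<Longrightarrow> a \<in> sym_span V \<Longrightarrow> sym_mult ((contraction V \<Lambda> ^^ n) (otimes a b)) \<in> sym_ideal V N"
proof -
  let ?X = "{vs. set vs \<subseteq> V \<and> set vs \<inter> N \<noteq> {}}" and ?Y = "{vs. set vs \<subseteq> V}"
  have oX: "omit k vs \<in> ?X" if "vs \<in> ?X" "k < length vs" "vs ! k \<notin> N" for k vs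
    using that set_omit_insert[OF that(2)] by auto
  have oY: "omit k vs \<in> ?Y" if "vs \<in> ?Y" for k vs
    using that set_omit[of k vs] by auto
  have X1: "omit k vs \<in> ?X \<and> omit l ws \<in> ?Y"
    if "vs \<in> ?X" "ws \<in> ?Y" "k < length vs" "l < length ws" "\<Lambda> (vs ! k) (ws ! l) \<noteq> 0" for vs ws k l
  proof -
    have "ws ! l \<in> V" using that nth_mem by blast
    then have "vs ! k \<notin> N" using null_left that by blast
    with oX oY that show ?thesis by blast
  qed
  have X2: "omit k vs \<in> ?Y \<and> omit l ws \<in> ?X"
    if "vs \<in> ?Y" "ws \<in> ?X" "k < length vs" "l < length ws" "\<Lambda> (vs ! k) (ws ! l) \<noteq> 0" for vs ws k l
  proof -
    have "vs ! k \<in> V" using that nth_mem by blast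
    then have "ws ! l \<notin> N" using null_right that by blast
    with oX oY that show ?thesis by blast
  qed
  { assume "a \<in> sym_ideal V N" "b \<in> sym_span V"
    then have "otimes a b \<in> lin_monos2 ?X ?Y" unfolding sym_span_monos sym_ideal_def by (rule otimes_lin_monos2)
    then have "(contraction V \<Lambda> ^^ n) (otimes a b) \<in> lin_monos2 ?X ?Y"
      by (intro contraction_funpow_lin_monos2[OF _ _ X1]) auto
    then show "sym_mult ((contraction V \<Lambda> ^^ n) (otimes a b)) \<in> sym_ideal V N"
      unfolding sym_ideal_def by (rule sym_mult_lin_monos2) auto }
  { assume "b \<in> sym_ideal V N" "a \<in> sym_span V"
    then have "otimes a b \<in> lin_monos2 ?Y ?X" unfolding sym_span_monos sym_ideal_def by (intro otimes_lin_monos2)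
    then have "(contraction V \<Lambda> ^^ n) (otimes a b) \<in> lin_monos2 ?Y ?X"
      by (intro contraction_funpow_lin_monos2[OF _ _ X2]) auto
    then show "sym_mult ((contraction V \<Lambda> ^^ n) (otimes a b)) \<in> sym_ideal V N"
      unfolding sym_ideal_def by (rule sym_mult_lin_monos2) auto }
qed

end

section \<open>The Poisson algebra of symmetric tensors\<close>

lemma sym_poisson_simps:
  "carrier (sym_poisson V \<Lambda>) = sym_span V" "\<one>\<^bsub>sym_poisson V \<Lambda>\<^esub> = tens []" "\<zero>\<^bsub>sym_poisson V \<Lambda>\<^esub> = 0"
  "a \<oplus>\<^bsub>sym_poisson V \<Lambda>\<^esub> b = a + b" "a \<otimes>\<^bsub>sym_poisson V \<Lambda>\<^esub> b = sym_mult (otimes a b)"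
  "c \<odot>\<^bsub>sym_poisson V \<Lambda>\<^esub> a = fscale c a"
  "bracket (sym_poisson V \<Lambda>) a b = fscale 2 (sym_mult (contraction V \<Lambda> (otimes a b)))"
  by (simp_all add: sym_poisson_def sym_alg_eq_span fun_eq_iff)

lemma sym_span_mono: "A \<subseteq> B \<Longrightarrow> sym_span A \<subseteq> sym_span B"
  unfolding sym_span_monos by (rule lin_monos_mono) auto

lemma tens_Nil_sym_span: "tens [] \<in> sym_span A"
  using sprod_mem_sym_span[of "[]" A] by (simp add: sprod_Nil)

lemma tens_single_sym_span: "v \<in> A \<Longrightarrow> tens [v] \<in> sym_span A"
  using sprod_mem_sym_span[of "[v]" A] by (simp add: sprod_single)

lemma sym_mult_one_left: "a \<in> sym_span A \<Longrightarrow> sym_mult (otimes (tens []) a) = a"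
  by (rule sym_mult_one[OF sym_span_sym_fun])

lemma sym_mult_add_left: "sym_mult (otimes (a + b) c) = sym_mult (otimes a c) + sym_mult (otimes b c)"
  by (simp only: otimes_add_left flinear_add[OF sym_mult_linear])

lemma sym_mult_scale_left: "sym_mult (otimes (fscale r a) c) = fscale r (sym_mult (otimes a c))"
  by (simp only: otimes_scale_left flinear_scale[OF sym_mult_linear])

lemma abelian_group_function_space:
  assumes "fs.subspace (carrier R)" "\<zero>\<^bsub>R\<^esub> = (0 :: 'x \<Rightarrow> 'k::field)" "\<And>a b. a \<oplus>\<^bsub>R\<^esub> b = a + b"
  shows "abelian_group R"
proof (rule abelian_groupI)
  fix x assume "x \<in> carrier R"
  then have "- x \<in> carrier R" by (rule fs.subspace_neg[OF assms(1)])
  then show "\<exists>y\<in>carrier R. y \<oplus>\<^bsub>R\<^esub> x = \<zero>\<^bsub>R\<^esub>" unfolding assms(2,3) by (intro bexI[of _ "- x"]) simp_all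
qed (use fs.subspace_0[OF assms(1)] fs.subspace_add[OF assms(1)] in \<open>simp_all only: assms(2,3) add.assoc add.commute add_0_left add_0_right add.left_commute\<close>)

text \<open>The ring structure makes the general theory of generated ideals applicable.\<close>

lemma cring_sym_poisson: "cring (sym_poisson V \<Lambda>)"
proof (rule cringI)
  show "abelian_group (sym_poisson V \<Lambda>)"
    by (rule abelian_group_function_space) (simp_all add: sym_poisson_simps subspace_sym_span)
  show "comm_monoid (sym_poisson V \<Lambda>)"
  proof (rule comm_monoidI)
    fix x y assume "x \<in> carrier (sym_poisson V \<Lambda>)" "y \<in> carrier (sym_poisson V \<Lambda>)"
    then show "x \<otimes>\<^bsub>sym_poisson V \<Lambda>\<^esub> y \<in> carrier (sym_poisson V \<Lambda>)"
      unfolding sym_poisson_simps by (rule sym_span_mult)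
  next
    fix x assume "x \<in> carrier (sym_poisson V \<Lambda>)"
    then show "\<one>\<^bsub>sym_poisson V \<Lambda>\<^esub> \<otimes>\<^bsub>sym_poisson V \<Lambda>\<^esub> x = x"
      unfolding sym_poisson_simps by (rule sym_mult_one_left)
  next
    show "\<one>\<^bsub>sym_poisson V \<Lambda>\<^esub> \<in> carrier (sym_poisson V \<Lambda>)"
      unfolding sym_poisson_simps by (rule tens_Nil_sym_span)
  next
    fix x y z
    show "(x \<otimes>\<^bsub>sym_poisson V \<Lambda>\<^esub> y) \<otimes>\<^bsub>sym_poisson V \<Lambda>\<^esub> z = x \<otimes>\<^bsub>sym_poisson V \<Lambda>\<^esub> (y \<otimes>\<^bsub>sym_poisson V \<Lambda>\<^esub> z)"
      unfolding sym_poisson_simps by (rule sym_mult_assoc)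
    show "x \<otimes>\<^bsub>sym_poisson V \<Lambda>\<^esub> y = y \<otimes>\<^bsub>sym_poisson V \<Lambda>\<^esub> x"
      unfolding sym_poisson_simps by (rule sym_mult_commute)
  qed
qed (simp only: sym_poisson_simps sym_mult_add_left)

lemma subgroup_function_space:
  assumes "fs.subspace (carrier R)" "\<zero>\<^bsub>R\<^esub> = (0 :: 'x \<Rightarrow> 'k::field)" "\<And>a b. a \<oplus>\<^bsub>R\<^esub> b = a + b"
    and "fs.subspace I" "I \<subseteq> carrier R"
  shows "subgroup I (add_monoid R)"
proof -
  interpret abelian_group R by (rule abelian_group_function_space) fact+
  show ?thesis
  proof (rule group.subgroupI[OF a_group])
    show "I \<subseteq> carrier (add_monoid R)" using assms(5) by simp
    show "I \<noteq> {}" using fs.subspace_0[OF assms(4)] by blast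
    fix a assume a: "a \<in> I"
    have "- a \<in> I" by (rule fs.subspace_neg[OF assms(4) a])
    moreover have "\<ominus>\<^bsub>R\<^esub> a = - a"
      by (rule minus_equality) (use a calculation assms in auto)
    ultimately show "inv\<^bsub>add_monoid R\<^esub> a \<in> I" by (simp add: a_inv_def)
    fix b assume "b \<in> I"
    then show "a \<otimes>\<^bsub>add_monoid R\<^esub> b \<in> I"
      using fs.subspace_add[OF assms(4) a] by (simp add: assms(3))
  qed
qed

text \<open>The span of the monomials with a factor in \<open>N\<close> is an ideal. Conversely every ideal is closed
  under scalars, as multiples of the unit belong to the algebra, and thus contains these monomials
  once it contains their factors in \<open>N\<close>.\<close>

lemma genideal_sym_poisson:
  assumes "N \<subseteq> V"
  shows "genideal (sym_poisson V \<Lambda>) {tens [v] | v. v \<in> N} = sym_ideal V N"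
proof
  interpret cring "sym_poisson V \<Lambda>" by (rule cring_sym_poisson)
  let ?G = "{tens [v] | v. v \<in> N}"
  have G: "?G \<subseteq> carrier (sym_poisson V \<Lambda>)"
    unfolding sym_poisson_simps using assms tens_single_sym_span by blast
  have "ideal (sym_ideal V N) (sym_poisson V \<Lambda>)"
  proof (rule idealI[OF ring_axioms])
    show "subgroup (sym_ideal V N) (add_monoid (sym_poisson V \<Lambda>))"
      by (rule subgroup_function_space)
         (simp_all only: sym_poisson_simps subspace_sym_span subspace_sym_ideal sym_ideal_subset)
  qed (simp_all only: sym_poisson_simps sym_ideal_mult_left sym_ideal_mult_right)
  moreover have "?G \<subseteq> sym_ideal V N"
  proof clarify
    fix v assume "v \<in> N"
    then have "sprod [v] \<in> sym_ideal V N" using assms unfolding sym_ideal_def by (intro sprod_lin_monos) auto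
    then show "tens [v] \<in> sym_ideal V N" by (simp only: sprod_single)
  qed
  ultimately show "genideal (sym_poisson V \<Lambda>) ?G \<subseteq> sym_ideal V N" by (rule genideal_minimal)
  interpret I: ideal "genideal (sym_poisson V \<Lambda>) ?G" "sym_poisson V \<Lambda>" by (rule genideal_ideal[OF G])
  let ?I = "genideal (sym_poisson V \<Lambda>) ?G"
  have "fs.subspace ?I"
    unfolding fs.subspace_def
  proof (intro conjI ballI allI)
    show "0 \<in> ?I" using I.zero_closed by (simp only: sym_poisson_simps)
    fix x assume x: "x \<in> ?I"
    show "x + y \<in> ?I" if "y \<in> ?I" for y using I.a_closed[OF x that] by (simp only: sym_poisson_simps)
    fix c
    have xs: "x \<in> sym_span V" using I.a_subset x unfolding sym_poisson_simps by blast
    have "fscale c (tens []) \<in> carrier (sym_poisson V \<Lambda>)"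
      unfolding sym_poisson_simps by (rule fs.subspace_scale[OF subspace_sym_span tens_Nil_sym_span])
    from I.I_l_closed[OF x this] show "fscale c x \<in> ?I"
      by (simp only: sym_poisson_simps sym_mult_scale_left sym_mult_one_left[OF xs])
  qed
  moreover have "sprod vs \<in> ?I" if vs: "set vs \<subseteq> V" "set vs \<inter> N \<noteq> {}" for vs
  proof -
    obtain v where v: "v \<in> set vs" "v \<in> N" using vs(2) by blast
    obtain us ws where e: "vs = us @ [v] @ ws" using split_list[OF v(1)] by auto
    have "tens [v] \<in> ?I" using genideal_self[OF G] v(2) by blast
    moreover have "sprod us \<in> carrier (sym_poisson V \<Lambda>)" "sprod ws \<in> carrier (sym_poisson V \<Lambda>)"
      unfolding sym_poisson_simps using vs(1) e by (auto intro!: sprod_mem_sym_span)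
    ultimately have "sprod us \<otimes>\<^bsub>sym_poisson V \<Lambda>\<^esub> (tens [v] \<otimes>\<^bsub>sym_poisson V \<Lambda>\<^esub> sprod ws) \<in> ?I"
      by (intro I.I_l_closed I.I_r_closed)
    then show ?thesis unfolding e by (simp only: sym_poisson_simps sprod_append sprod_single)
  qed
  ultimately show "sym_ideal V N \<subseteq> ?I"
    unfolding sym_ideal_def lin_monos_def by (intro fs.span_minimal) auto
qed

text \<open>Contracting tensors over \<open>A\<close> yields tensors over \<open>A\<close> again, so the bracket does not enlarge the
  algebra generated by \<open>A\<close>.\<close>

lemma (in bilinear_form) poisson_generated_subset:
  fixes R :: "('k, 'x list \<Rightarrow> 'k) poisson_algebra"
  assumes "A \<subseteq> V" "G \<subseteq> sym_span A"
    and R: "\<one>\<^bsub>R\<^esub> = tens []" "\<And>a b. a \<oplus>\<^bsub>R\<^esub> b = a + b" "\<And>a b. a \<otimes>\<^bsub>R\<^esub> b = sym_mult (otimes a b)"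
      "\<And>c a. c \<odot>\<^bsub>R\<^esub> a = fscale c a" "\<And>a b. bracket R a b = fscale 2 (sym_mult (contraction V \<Lambda> (otimes a b)))"
  shows "poisson_generated R G \<subseteq> sym_span A"
proof
  fix a assume "a \<in> poisson_generated R G"
  then show "a \<in> sym_span A"
  proof induction
    case (bracket a b)
    then have "sym_mult ((contraction V \<Lambda> ^^ 1) (otimes a b)) \<in> sym_span A"
      by (intro contraction_funpow_sym_span assms)
    then show ?case unfolding R by (intro fs.subspace_scale[OF subspace_sym_span]) simp
  next
    case (gen a) then show ?case using assms(2) by blast
  next
    case one show ?case unfolding R by (rule tens_Nil_sym_span)
  next
    case (add a b) then show ?case unfolding R by (intro fs.subspace_add[OF subspace_sym_span])
  next
    case (smult a z) then show ?case unfolding R by (intro fs.subspace_scale[OF subspace_sym_span])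
  next
    case (mult a b) then show ?case unfolding R by (intro sym_span_mult)
  qed
qed

lemma a_r_coset_function_space:
  assumes "\<And>a b. a \<oplus>\<^bsub>R\<^esub> b = a + (b :: 'x \<Rightarrow> 'k::field)"
  shows "I +>\<^bsub>R\<^esub> a = {i + a | i. i \<in> I}"
  unfolding a_r_coset_def' using assms by auto

lemma translate_subspace:
  assumes "fs.subspace I" "c \<in> I"
  shows "{i + c | i. i \<in> I} = (I :: ('x \<Rightarrow> 'k::field) set)"
proof
  show "{i + c | i. i \<in> I} \<subseteq> I" using assms fs.subspace_add by blast
  have "x = (x - c) + c \<and> x - c \<in> I" if "x \<in> I" for x
    using fs.subspace_diff[OF assms(1) that assms(2)] by simp
  then show "I \<subseteq> {i + c | i. i \<in> I}" by blast
qed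

text \<open>The bracket of two representatives differs from the vanishing bracket of \<open>a\<close> and \<open>b\<close> by brackets
  with elements of the ideal, which the ideal absorbs.\<close>

theorem (in null_space) rcoset_bracket_zero:
  fixes P :: "('k, 'x list \<Rightarrow> 'k) poisson_algebra"
  assumes A: "A \<subseteq> V" "a \<in> sym_span A" and B: "B \<subseteq> V" "b \<in> sym_span B"
    and orth: "\<And>v w. v \<in> A \<Longrightarrow> w \<in> B \<Longrightarrow> \<Lambda> v w = 0"
    and P: "\<And>a b. a \<oplus>\<^bsub>P\<^esub> b = a + b" "\<And>a b. bracket P a b = fscale 2 (sym_mult (contraction V \<Lambda> (otimes a b)))"
  defines "I \<equiv> sym_ideal V N"
  shows "rcoset_bracket P I (I +>\<^bsub>P\<^esub> a) (I +>\<^bsub>P\<^esub> b) = I"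
proof -
  have aV: "a \<in> sym_span V" and bV: "b \<in> sym_span V"
    using A B sym_span_mono by blast+
  have mem: "bracket P (i + a) (j + b) \<in> I" if ij: "i \<in> I" "j \<in> I" for i j
  proof -
    have jb: "j + b \<in> sym_span V"
      using ij bV sym_ideal_subset unfolding I_def by (intro fs.subspace_add[OF subspace_sym_span]) blast+
    have "sym_mult (contraction V \<Lambda> (otimes i (j + b))) \<in> I"
      using contraction_funpow_sym_ideal(1)[of i "j + b" 1] ij jb unfolding I_def by simp
    moreover have "sym_mult (contraction V \<Lambda> (otimes a j)) \<in> I"
      using contraction_funpow_sym_ideal(2)[of j a 1] ij aV unfolding I_def by simp
    moreover have "sym_mult (contraction V \<Lambda> (otimes a b)) = 0"
      by (simp only: contraction_orthogonal[OF A(2) B(2) A(1) B(1) orth] flinear_zero[OF sym_mult_linear])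
    moreover have "otimes (i + a) (j + b) = otimes i (j + b) + (otimes a j + otimes a b)"
      by (simp only: otimes_add_left[of i a "j + b"] otimes_add_right[of a j b])
    ultimately have "sym_mult (contraction V \<Lambda> (otimes (i + a) (j + b))) \<in> I"
      unfolding I_def
      by (simp only: flinear_add[OF contraction_linear] flinear_add[OF sym_mult_linear] add_0_right
          fs.subspace_add[OF subspace_sym_ideal])
    then show ?thesis unfolding P I_def by (rule fs.subspace_scale[OF subspace_sym_ideal])
  qed
  have "I +>\<^bsub>P\<^esub> bracket P x y = I" if xy: "x \<in> I +>\<^bsub>P\<^esub> a" "y \<in> I +>\<^bsub>P\<^esub> b" for x y
  proof -
    obtain i j where "x = i + a" "y = j + b" "i \<in> I" "j \<in> I"
      using xy unfolding a_r_coset_function_space[OF P(1)] by blast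
    then have "bracket P x y \<in> I" using mem by simp
    then show ?thesis unfolding a_r_coset_function_space[OF P(1)] I_def
      by (rule translate_subspace[OF subspace_sym_ideal])
  qed
  moreover have "I +>\<^bsub>P\<^esub> a \<noteq> {}" "I +>\<^bsub>P\<^esub> b \<noteq> {}"
    unfolding a_r_coset_function_space[OF P(1)] I_def using fs.subspace_0[OF subspace_sym_ideal] by blast+
  ultimately show ?thesis unfolding rcoset_bracket_def by blast
qed

section \<open>Complexification\<close>

abbreviation cplx :: "('x \<Rightarrow> real) \<Rightarrow> 'x \<Rightarrow> complex" where
  "cplx f \<equiv> (\<lambda>x. complex_of_real (f x))"

lemma subspace_complexify:
  assumes "fs.subspace V"
  shows "fs.subspace (complexify V)"
proof -
  have Re: "(\<lambda>x. Re ((f + g) x)) = (\<lambda>x. Re (f x)) + (\<lambda>x. Re (g x))" "(\<lambda>x. Im ((f + g) x)) = (\<lambda>x. Im (f x)) + (\<lambda>x. Im (g x))"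
    "(\<lambda>x. Re (c * f x)) = fscale (Re c) (\<lambda>x. Re (f x)) - fscale (Im c) (\<lambda>x. Im (f x))"
    "(\<lambda>x. Im (c * f x)) = fscale (Re c) (\<lambda>x. Im (f x)) + fscale (Im c) (\<lambda>x. Re (f x))"
    "(\<lambda>x. Re ((0 :: 'a \<Rightarrow> complex) x)) = 0" "(\<lambda>x. Im ((0 :: 'a \<Rightarrow> complex) x)) = 0"
    for f g :: "'a \<Rightarrow> complex" and c
    by (rule ext, simp)+
  show ?thesis
    unfolding fs.subspace_def complexify_def mem_Collect_eq Re
    by (intro conjI ballI allI; (elim CollectE conjE)?; intro conjI fs.subspace_0[OF assms] fs.subspace_add[OF assms]
        fs.subspace_diff[OF assms] fs.subspace_scale[OF assms]; assumption)
qed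

lemma cplx_decomp: "f = cplx (\<lambda>x. Re (f x)) + fscale \<i> (cplx (\<lambda>x. Im (f x)))"
  by (rule ext) (simp add: complex_eq_iff)

lemma cplx_tens: "cplx (tens vs) = tens (map cplx vs)"
  by (rule ext) (simp add: tens_def)

lemma cplx_sprod: "cplx (sprod vs) = sprod (map cplx vs)"
proof (rule ext)
  fix xs
  have "complex_of_real (tens vs ys) = tens (map cplx vs) ys" for ys
    by (rule fun_cong[OF cplx_tens])
  then show "complex_of_real (sprod vs xs) = sprod (map cplx vs) xs"
    by (simp add: sprod_symmetrize symmetrize_def)
qed

lemma cplx_lin_monos:
  assumes "f \<in> lin_monos X" "\<And>vs. vs \<in> X \<Longrightarrow> map cplx vs \<in> Y"
  shows "cplx f \<in> lin_monos Y"
proof -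
  have "fs.subspace {f :: 'a list \<Rightarrow> real. cplx f \<in> lin_monos Y}"
  proof -
    have "cplx (0 :: 'a list \<Rightarrow> real) = 0" "cplx (f + g) = cplx f + cplx g" "cplx (fscale c f) = fscale (of_real c) (cplx f)"
      for f g :: "'a list \<Rightarrow> real" and c
      by (rule ext, simp)+
    then show ?thesis
      unfolding fs.subspace_def mem_Collect_eq
      by (intro conjI ballI allI; simp only: mem_Collect_eq fs.subspace_0[OF subspace_lin_monos]
          fs.subspace_add[OF subspace_lin_monos] fs.subspace_scale[OF subspace_lin_monos])
  qed
  moreover have "sprod ` X \<subseteq> {f. cplx f \<in> lin_monos Y}"
    using assms(2) by (auto simp: cplx_sprod intro!: sprod_lin_monos)
  ultimately have "f \<in> {f. cplx f \<in> lin_monos Y}"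
    by (rule fspan_mem_subspace[OF assms(1)[unfolded lin_monos_def]])
  then show ?thesis by simp
qed

lemma Re_sym_mult: "(\<lambda>x. Re (sym_mult (otimes a b) x)) =
    sym_mult (otimes (\<lambda>x. Re (a x)) (\<lambda>x. Re (b x))) - sym_mult (otimes (\<lambda>x. Im (a x)) (\<lambda>x. Im (b x)))"
  and Im_sym_mult: "(\<lambda>x. Im (sym_mult (otimes a b) x)) =
    sym_mult (otimes (\<lambda>x. Re (a x)) (\<lambda>x. Im (b x))) + sym_mult (otimes (\<lambda>x. Im (a x)) (\<lambda>x. Re (b x)))"
proof -
  have Re_fact: "Re (z / fact n) = Re z / fact n" and Im_fact: "Im (z / fact n) = Im z / fact n" for z n
    unfolding of_real_fact[symmetric, where ?'a=complex]
    by (rule Re_divide_of_real, rule Im_divide_of_real)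
  have Re: "(\<lambda>x. Re (sym_mult t x)) = sym_mult (\<lambda>p. Re (t p))" and Im: "(\<lambda>x. Im (sym_mult t x)) = sym_mult (\<lambda>p. Im (t p))"
    for t :: "'a list \<times> 'a list \<Rightarrow> complex"
    by (rule ext, simp only: sym_mult_def symmetrize_def Re_fact Im_fact Re_sum Im_sum)+
  have m: "f + fscale (-1) g = f - g" for f g :: "'a list \<Rightarrow> real" by (rule ext) simp
  have "(\<lambda>p. Re (otimes a b p)) = otimes (\<lambda>x. Re (a x)) (\<lambda>x. Re (b x)) + fscale (-1) (otimes (\<lambda>x. Im (a x)) (\<lambda>x. Im (b x)))"
    by (rule ext) (simp add: otimes_def case_prod_beta)
  then show "(\<lambda>x. Re (sym_mult (otimes a b) x)) =
    sym_mult (otimes (\<lambda>x. Re (a x)) (\<lambda>x. Re (b x))) - sym_mult (otimes (\<lambda>x. Im (a x)) (\<lambda>x. Im (b x)))"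
    by (simp only: Re flinear_add[OF sym_mult_linear] flinear_scale[OF sym_mult_linear] m)
  have "(\<lambda>p. Im (otimes a b p)) = otimes (\<lambda>x. Re (a x)) (\<lambda>x. Im (b x)) + otimes (\<lambda>x. Im (a x)) (\<lambda>x. Re (b x))"
    by (rule ext) (simp add: otimes_def case_prod_beta)
  then show "(\<lambda>x. Im (sym_mult (otimes a b) x)) =
    sym_mult (otimes (\<lambda>x. Re (a x)) (\<lambda>x. Im (b x))) + sym_mult (otimes (\<lambda>x. Im (a x)) (\<lambda>x. Re (b x)))"
    by (simp only: Im flinear_add[OF sym_mult_linear])
qed

lemma tens_single_Re: "(\<lambda>xs. Re (tens [v] xs)) = tens [\<lambda>x. Re (v x)]"
  and tens_single_Im: "(\<lambda>xs. Im (tens [v] xs)) = tens [\<lambda>x. Im (v x)]"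
  by (rule ext, simp add: tens_def)+

text \<open>A product of complex factors is expanded into real and imaginary parts, one factor at a time.\<close>

lemma sprod_complexify:
  assumes "fs.subspace V"
  shows "set vs \<subseteq> complexify V \<Longrightarrow> sprod vs \<in> complexify (sym_span V)"
    and "set vs \<subseteq> complexify V \<Longrightarrow> N \<subseteq> V \<Longrightarrow> set vs \<inter> complexify N \<noteq> {} \<Longrightarrow> sprod vs \<in> complexify (sym_ideal V N)"
proof (induction vs)
  case Nil
  have e: "(\<lambda>xs. Re (tens [] xs)) = tens ([] :: ('a \<Rightarrow> real) list)" "(\<lambda>xs. Im (tens ([] :: ('a \<Rightarrow> complex) list) xs)) = 0"
    by (rule ext, simp add: tens_def)+
  show "sprod [] \<in> complexify (sym_span V)"
    unfolding complexify_def sprod_Nil mem_Collect_eq e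
    by (intro conjI tens_Nil_sym_span fs.subspace_0[OF subspace_sym_span])
  show "set [] \<inter> complexify N \<noteq> {} \<Longrightarrow> sprod [] \<in> complexify (sym_ideal V N)" by simp
next
  case (Cons v vs)
  note add = fs.subspace_add[OF subspace_sym_span[of V]] fs.subspace_diff[OF subspace_sym_span[of V]]
    fs.subspace_add[OF subspace_sym_ideal[of V N]] fs.subspace_diff[OF subspace_sym_ideal[of V N]]
  have v: "(\<lambda>x. Re (v x)) \<in> V \<and> (\<lambda>x. Im (v x)) \<in> V" if "set (v # vs) \<subseteq> complexify V"
    using that by (auto simp: complexify_def)
  show "sprod (v # vs) \<in> complexify (sym_span V)" if "set (v # vs) \<subseteq> complexify V"
  proof -
    have "sprod vs \<in> complexify (sym_span V)" using Cons.IH(1) that by simp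
    then show ?thesis
      unfolding complexify_def mem_Collect_eq sprod_Cons Re_sym_mult Im_sym_mult tens_single_Re tens_single_Im
      using tens_single_sym_span[of "\<lambda>x. Re (v x)" V] tens_single_sym_span[of "\<lambda>x. Im (v x)" V] v[OF that]
      by (intro conjI add sym_span_mult) auto
  qed
  assume *: "set (v # vs) \<subseteq> complexify V" "N \<subseteq> V" "set (v # vs) \<inter> complexify N \<noteq> {}"
  show "sprod (v # vs) \<in> complexify (sym_ideal V N)"
  proof (cases "v \<in> complexify N")
    case True
    then have n: "(\<lambda>x. Re (v x)) \<in> N" "(\<lambda>x. Im (v x)) \<in> N" by (auto simp: complexify_def)
    have "tens [w] \<in> sym_ideal V N" if "w \<in> N" for w
      unfolding sprod_single[symmetric] sym_ideal_def using that *(2) by (intro sprod_lin_monos) auto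
    with n have t: "tens [\<lambda>x. Re (v x)] \<in> sym_ideal V N" "tens [\<lambda>x. Im (v x)] \<in> sym_ideal V N" by blast+
    have "sprod vs \<in> complexify (sym_span V)" using Cons.IH(1) *(1) by simp
    then show ?thesis
      unfolding complexify_def mem_Collect_eq sprod_Cons Re_sym_mult Im_sym_mult tens_single_Re tens_single_Im
      using t by (intro conjI add sym_ideal_mult_right) auto
  next
    case False
    then have "sprod vs \<in> complexify (sym_ideal V N)" using Cons.IH(2) * by auto
    then show ?thesis
      unfolding complexify_def mem_Collect_eq sprod_Cons Re_sym_mult Im_sym_mult tens_single_Re tens_single_Im
      using tens_single_sym_span[of "\<lambda>x. Re (v x)" V] tens_single_sym_span[of "\<lambda>x. Im (v x)" V] v[OF *(1)]
      by (intro conjI add sym_ideal_mult_left) auto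
  qed
qed

text \<open>The complexified ideal is again generated by a null space, so the real results transfer to the
  Weyl algebra.\<close>

lemma complexify_sym_ideal:
  assumes V: "fs.subspace V" and N: "fs.subspace N" "N \<subseteq> V"
  shows "complexify (sym_ideal V N) = sym_ideal (complexify V) (complexify N)"
proof
  have c: "cplx v \<in> complexify W \<longleftrightarrow> v \<in> W" if "fs.subspace W" for v and W :: "('a \<Rightarrow> real) set"
    using fs.subspace_0[OF that] by (simp add: complexify_def zero_fun_def)
  have "cplx g \<in> sym_ideal (complexify V) (complexify N)" if "g \<in> sym_ideal V N" for g
    using that unfolding sym_ideal_def by (rule cplx_lin_monos) (use c[OF V] c[OF N(1)] in auto)
  then show "complexify (sym_ideal V N) \<subseteq> sym_ideal (complexify V) (complexify N)"
  proof (intro subsetI)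
    fix f assume *: "f \<in> complexify (sym_ideal V N)" "\<And>g. g \<in> sym_ideal V N \<Longrightarrow> cplx g \<in> sym_ideal (complexify V) (complexify N)"
    have "cplx (\<lambda>x. Re (f x)) + fscale \<i> (cplx (\<lambda>x. Im (f x))) \<in> sym_ideal (complexify V) (complexify N)"
      using * by (intro fs.subspace_add[OF subspace_sym_ideal] fs.subspace_scale[OF subspace_sym_ideal]) (auto simp: complexify_def)
    then show "f \<in> sym_ideal (complexify V) (complexify N)" using cplx_decomp[of f] by simp
  qed
  show "sym_ideal (complexify V) (complexify N) \<subseteq> complexify (sym_ideal V N)"
    unfolding sym_ideal_def[of "complexify V"] lin_monos_def
    by (rule fs.span_minimal[OF _ subspace_complexify[OF subspace_sym_ideal]])
       (use sprod_complexify(2)[OF V _ N(2)] in auto)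
qed

lemma (in bilinear_form) zero_left: "w \<in> V \<Longrightarrow> \<Lambda> 0 w = 0" and zero_right: "w \<in> V \<Longrightarrow> \<Lambda> w 0 = 0"
  using scale_left[of w w 0] scale_right[of w w 0] by (auto simp: zero_fun_def)

lemma null_space_complexify:
  fixes V :: "('x \<Rightarrow> real) set"
  assumes "null_space V \<Lambda> N"
  shows "null_space (complexify V) (complexify_form \<Lambda>) (complexify N)"
proof -
  interpret null_space V \<Lambda> N by fact
  have Re: "(\<lambda>x. Re ((f + g) x)) = (\<lambda>x. Re (f x)) + (\<lambda>x. Re (g x))" "(\<lambda>x. Im ((f + g) x)) = (\<lambda>x. Im (f x)) + (\<lambda>x. Im (g x))"
    "(\<lambda>x. Re (c * f x)) = fscale (Re c) (\<lambda>x. Re (f x)) + fscale (- Im c) (\<lambda>x. Im (f x))"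
    "(\<lambda>x. Im (c * f x)) = fscale (Re c) (\<lambda>x. Im (f x)) + fscale (Im c) (\<lambda>x. Re (f x))"
    for f g :: "'x \<Rightarrow> complex" and c
    by (rule ext, simp)+
  note sc = fs.subspace_scale[OF subspace_V]
  show ?thesis
  proof unfold_locales
    show "fs.subspace (complexify V)" by (rule subspace_complexify[OF subspace_V])
    show "complexify N \<subseteq> complexify V" using N_V by (auto simp: complexify_def)
  next
    fix v w assume "v \<in> complexify N" "w \<in> complexify V"
    then show "complexify_form \<Lambda> v w = 0" "complexify_form \<Lambda> w v = 0"
      unfolding complexify_def complexify_form_def mem_Collect_eq
      by (auto simp: null_left null_right complex_eq_iff)
  next
    fix u v w assume "u \<in> complexify V" "v \<in> complexify V" "w \<in> complexify V"
    then have m: "(\<lambda>x. Re (u x)) \<in> V" "(\<lambda>x. Im (u x)) \<in> V" "(\<lambda>x. Re (v x)) \<in> V" "(\<lambda>x. Im (v x)) \<in> V"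
      "(\<lambda>x. Re (w x)) \<in> V" "(\<lambda>x. Im (w x)) \<in> V" by (auto simp: complexify_def)
    show "complexify_form \<Lambda> (u + v) w = complexify_form \<Lambda> u w + complexify_form \<Lambda> v w"
      unfolding complexify_form_def Re
      by (simp only: add_left[OF m(1,3,5)] add_left[OF m(1,3,6)] add_left[OF m(2,4,5)] add_left[OF m(2,4,6)])
         (simp add: complex_eq_iff)
    show "complexify_form \<Lambda> w (u + v) = complexify_form \<Lambda> w u + complexify_form \<Lambda> w v"
      unfolding complexify_form_def Re
      by (simp only: add_right[OF m(1,3,5)] add_right[OF m(1,3,6)] add_right[OF m(2,4,5)] add_right[OF m(2,4,6)])
         (simp add: complex_eq_iff)
  next
    fix a v w assume "v \<in> complexify V" "w \<in> complexify V"
    then have m: "(\<lambda>x. Re (v x)) \<in> V" "(\<lambda>x. Im (v x)) \<in> V" "(\<lambda>x. Re (w x)) \<in> V" "(\<lambda>x. Im (w x)) \<in> V"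
      by (auto simp: complexify_def)
    have L: "\<Lambda> (fscale s p + fscale t q) r = s * \<Lambda> p r + t * \<Lambda> q r"
      "\<Lambda> r (fscale s p + fscale t q) = s * \<Lambda> r p + t * \<Lambda> r q"
      if pq: "p \<in> V" "q \<in> V" "r \<in> V" for s t p q r
      by (simp_all only: add_left[OF sc[OF pq(1)] sc[OF pq(2)] pq(3)] add_right[OF sc[OF pq(1)] sc[OF pq(2)] pq(3)]
          scale_left[OF pq(1,3)] scale_left[OF pq(2,3)] scale_right[OF pq(1,3)] scale_right[OF pq(2,3)])
    show "complexify_form \<Lambda> (fscale a v) w = a * complexify_form \<Lambda> v w"
      unfolding complexify_form_def Re L(1)[OF m(1,2,3)] L(1)[OF m(1,2,4)]
        L(1)[OF m(2,1,3)] L(1)[OF m(2,1,4)]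
      by (rule complex_eqI; simp add: algebra_simps)
    show "complexify_form \<Lambda> w (fscale a v) = a * complexify_form \<Lambda> w v"
      unfolding complexify_form_def Re L(2)[OF m(1,2,3)] L(2)[OF m(1,2,4)]
        L(2)[OF m(2,1,3)] L(2)[OF m(2,1,4)]
      by (rule complex_eqI; simp add: algebra_simps)
  qed
qed

section \<open>The Weyl algebra\<close>

definition star_series :: "(nat \<Rightarrow> complex) \<Rightarrow> (('x list \<times> 'x list \<Rightarrow> complex) \<Rightarrow> 'x list \<times> 'x list \<Rightarrow> complex)
    \<Rightarrow> ('x list \<Rightarrow> complex) \<Rightarrow> ('x list \<Rightarrow> complex) \<Rightarrow> 'x list \<Rightarrow> complex" where
  "star_series c P a b = (\<lambda>xs. \<Sum>k. c k * sym_mult ((P ^^ k) (otimes a b)) xs)"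

lemma star_series_finite:
  assumes "\<forall>n\<ge>K. (P ^^ n) (otimes a b) = 0" "K \<le> L"
  shows "star_series c P a b = (\<Sum>k<L. fscale (c k) (sym_mult ((P ^^ k) (otimes a b))))"
proof (rule ext)
  fix xs
  have "sym_mult ((P ^^ n) (otimes a b)) = 0" if "n \<ge> L" for n
    using assms that flinear_zero[OF sym_mult_linear] by (metis order_trans)
  then have "(\<Sum>k. c k * sym_mult ((P ^^ k) (otimes a b)) xs) = (\<Sum>k<L. c k * sym_mult ((P ^^ k) (otimes a b)) xs)"
    by (intro suminf_finite) auto
  then show "star_series c P a b xs = (\<Sum>k<L. fscale (c k) (sym_mult ((P ^^ k) (otimes a b)))) xs"
    by (simp only: star_series_def sum_fun_apply)
qed

locale weyl_form = bilinear_form V \<Lambda>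
  for V :: "('x \<Rightarrow> complex) set" and \<Lambda> +
  fixes c :: "nat \<Rightarrow> complex"
begin

abbreviation "star \<equiv> star_series c (contraction V \<Lambda>)"

lemma star_mem:
  assumes "a \<in> sym_span V" "b \<in> sym_span V" "fs.subspace T"
    and "\<And>n. sym_mult ((contraction V \<Lambda> ^^ n) (otimes a b)) \<in> T"
  shows "star a b \<in> T"
proof -
  obtain K where K: "\<forall>n\<ge>K. (contraction V \<Lambda> ^^ n) (otimes a b) = 0"
    using contraction_nilpotent[OF assms(1,2)] by blast
  show ?thesis
    unfolding star_series_finite[OF K order_refl]
    by (intro fs.subspace_sum[OF assms(3)] fs.subspace_scale[OF assms(3)] assms(4))
qed

lemma star_add:
  assumes "a \<in> sym_span V" "a' \<in> sym_span V" "b \<in> sym_span V"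
  shows "star (a + a') b = star a b + star a' b" "star b (a + a') = star b a + star b a'"
proof -
  note lin = flinear_funpow[OF contraction_linear]
  obtain K where K: "\<forall>n\<ge>K. (contraction V \<Lambda> ^^ n) (otimes a b) = 0"
    using contraction_nilpotent[OF assms(1,3)] by blast
  obtain K' where K': "\<forall>n\<ge>K'. (contraction V \<Lambda> ^^ n) (otimes a' b) = 0"
    using contraction_nilpotent[OF assms(2,3)] by blast
  obtain K2 where K2: "\<forall>n\<ge>K2. (contraction V \<Lambda> ^^ n) (otimes (a + a') b) = 0"
    using contraction_nilpotent[OF fs.subspace_add[OF subspace_sym_span assms(1,2)] assms(3)] by blast
  obtain L where L: "\<forall>n\<ge>L. (contraction V \<Lambda> ^^ n) (otimes b a) = 0"
    using contraction_nilpotent[OF assms(3,1)] by blast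
  obtain L' where L': "\<forall>n\<ge>L'. (contraction V \<Lambda> ^^ n) (otimes b a') = 0"
    using contraction_nilpotent[OF assms(3,2)] by blast
  obtain L2 where L2: "\<forall>n\<ge>L2. (contraction V \<Lambda> ^^ n) (otimes b (a + a')) = 0"
    using contraction_nilpotent[OF assms(3) fs.subspace_add[OF subspace_sym_span assms(1,2)]] by blast
  let ?M = "K + K' + K2 + L + L' + L2"
  have M: "K \<le> ?M" "K' \<le> ?M" "K2 \<le> ?M" "L \<le> ?M" "L' \<le> ?M" "L2 \<le> ?M" by auto
  have sc: "fscale r (f + g) = fscale r f + fscale r g" for r and f g :: "'x list \<Rightarrow> complex"
    by (rule ext) (simp add: distrib_left)
  show "star (a + a') b = star a b + star a' b"
    unfolding star_series_finite[OF K M(1)] star_series_finite[OF K' M(2)] star_series_finite[OF K2 M(3)]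
      otimes_add_left flinear_add[OF lin] flinear_add[OF sym_mult_linear] sc
    by (rule sum.distrib)
  show "star b (a + a') = star b a + star b a'"
    unfolding star_series_finite[OF L M(4)] star_series_finite[OF L' M(5)] star_series_finite[OF L2 M(6)]
      otimes_add_right flinear_add[OF lin] flinear_add[OF sym_mult_linear] sc
    by (rule sum.distrib)
qed

lemma star_orthogonal:
  assumes "contraction V \<Lambda> (otimes a b) = 0"
  shows "star a b = fscale (c 0) (sym_mult (otimes a b))"
proof -
  note lin = flinear_funpow[OF contraction_linear]
  have "(contraction V \<Lambda> ^^ n) (otimes a b) = 0" if n: "n \<ge> 1" for n
  proof -
    have "n = Suc (n - 1)" using n by simp
    then obtain m where "n = Suc m" by blast
    then show ?thesis by (simp only: funpow_Suc_right comp_apply assms flinear_zero[OF lin])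
  qed
  then have "star a b = (\<Sum>k<1. fscale (c k) (sym_mult ((contraction V \<Lambda> ^^ k) (otimes a b))))"
    by (intro star_series_finite[of 1]) auto
  also have "\<dots> = fscale (c 0) (sym_mult (otimes a b))"
    by (simp only: lessThan_Suc One_nat_def lessThan_0 sum.insert finite.emptyI empty_iff not_False_eq_True sum.empty add_0_right funpow_0)
  finally show ?thesis .
qed

text \<open>The star product is a sum of iterated contractions, which stay over \<open>A\<close>. The involution does so
  because the generators are real.\<close>

lemma star_generated_subset:
  fixes W :: "(complex, 'x list \<Rightarrow> complex) top_star_algebra"
  assumes "A \<subseteq> V" "G \<subseteq> sym_span A"
    and W: "\<one>\<^bsub>W\<^esub> = tens []" "\<And>a b. a \<oplus>\<^bsub>W\<^esub> b = a + b" "\<And>a b. a \<otimes>\<^bsub>W\<^esub> b = star a b"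
      "\<And>z a. z \<odot>\<^bsub>W\<^esub> a = fscale z a" "\<And>a. invol W a = (\<lambda>xs. cnj (a xs))"
    and real: "\<And>v. v \<in> A \<Longrightarrow> (\<lambda>x. cnj (v x)) = v"
  shows "star_generated W G \<subseteq> sym_span A"
proof
  note AV = sym_span_mono[OF assms(1), THEN subsetD]
  fix a assume "a \<in> star_generated W G"
  then show "a \<in> sym_span A"
  proof induction
    case (gen a) then show ?case using assms(2) by blast
  next
    case one show ?case unfolding W by (rule tens_Nil_sym_span)
  next
    case (add a b) then show ?case unfolding W by (intro fs.subspace_add[OF subspace_sym_span])
  next
    case (smult a z) then show ?case unfolding W by (intro fs.subspace_scale[OF subspace_sym_span])
  next
    case (mult a b) then show ?case unfolding W
      by (intro star_mem AV subspace_sym_span contraction_funpow_sym_span assms(1))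
  next
    case (invol a)
    have "fs.subspace {f :: 'x list \<Rightarrow> complex. (\<lambda>xs. cnj (f xs)) \<in> sym_span A}"
    proof -
      have e: "(\<lambda>xs. cnj ((f + g) xs)) = (\<lambda>xs. cnj (f xs)) + (\<lambda>xs. cnj (g xs))"
        "(\<lambda>xs. cnj (z * f xs)) = fscale (cnj z) (\<lambda>xs. cnj (f xs))" "(\<lambda>xs. cnj ((0 :: 'x list \<Rightarrow> complex) xs)) = 0"
        for f g :: "'x list \<Rightarrow> complex" and z
        by (rule ext, simp)+
      show ?thesis
        unfolding fs.subspace_def mem_Collect_eq e
        by (intro conjI ballI allI; simp only: mem_Collect_eq fs.subspace_0[OF subspace_sym_span]
            fs.subspace_add[OF subspace_sym_span] fs.subspace_scale[OF subspace_sym_span])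
    qed
    moreover have "(\<lambda>xs. cnj (sprod vs xs)) = sprod vs" if "set vs \<subseteq> A" for vs
    proof (rule ext)
      fix xs
      have "cnj (v x) = v x" if "v \<in> set vs" for v x
        using real[of v] \<open>set vs \<subseteq> A\<close> that fun_cong by (metis subsetD)
      then have "cnj (tens vs ys) = tens vs ys" for ys by (simp add: tens_def)
      then show "cnj (sprod vs xs) = sprod vs xs" by (simp add: sprod_symmetrize symmetrize_def)
    qed
    ultimately have "a \<in> {f. (\<lambda>xs. cnj (f xs)) \<in> sym_span A}"
      by (intro fspan_mem_subspace[OF invol.IH[unfolded sym_span_def]]) (auto intro!: fs.span_base simp: sym_span_def)
    then show ?case unfolding W by simp
  qed
qed

end

text \<open>Without contractions only the commutative term of the star product survives, so \<open>a\<close> and \<open>b\<close>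
  commute in the algebra itself. The ideal absorbs star products, hence the product of cosets is
  the coset of the product.\<close>

theorem star_commute_mod_null_ideal:
  fixes W :: "(complex, 'x list \<Rightarrow> complex) top_star_algebra"
  assumes "null_space V \<Lambda> N"
    and A: "A \<subseteq> V" "a \<in> sym_span A" and B: "B \<subseteq> V" "b \<in> sym_span B"
    and orth: "\<And>v w. v \<in> A \<Longrightarrow> w \<in> B \<Longrightarrow> \<Lambda> v w = 0" "\<And>v w. v \<in> A \<Longrightarrow> w \<in> B \<Longrightarrow> \<Lambda> w v = 0"
    and W: "carrier W = sym_span V" "\<zero>\<^bsub>W\<^esub> = 0" "\<And>a b. a \<oplus>\<^bsub>W\<^esub> b = a + b"
      "\<And>a b. a \<otimes>\<^bsub>W\<^esub> b = star_series c (contraction V \<Lambda>) a b"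
  defines "I \<equiv> sym_ideal V N"
  shows "(I +>\<^bsub>W\<^esub> a) \<otimes>\<^bsub>W Quot I\<^esub> (I +>\<^bsub>W\<^esub> b) \<ominus>\<^bsub>W Quot I\<^esub> (I +>\<^bsub>W\<^esub> b) \<otimes>\<^bsub>W Quot I\<^esub> (I +>\<^bsub>W\<^esub> a) = \<zero>\<^bsub>W Quot I\<^esub>"
proof -
  interpret null_space V \<Lambda> N by fact
  interpret weyl_form V \<Lambda> c by unfold_locales
  note cos = a_r_coset_function_space[OF W(3)]
  have I: "fs.subspace I" "I \<subseteq> sym_span V" unfolding I_def by (rule subspace_sym_ideal, rule sym_ideal_subset)
  have absorb: "star i x \<in> I" "star x i \<in> I" if "i \<in> I" "x \<in> sym_span V" for i x
    using that I contraction_funpow_sym_ideal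
    by (auto intro!: star_mem simp: I_def)
  have prod: "(I +>\<^bsub>W\<^esub> x) \<otimes>\<^bsub>W Quot I\<^esub> (I +>\<^bsub>W\<^esub> y) = I +>\<^bsub>W\<^esub> star x y"
    if x: "x \<in> sym_span V" and y: "y \<in> sym_span V" for x y
  proof -
    have "I +>\<^bsub>W\<^esub> (star x' y') = I +>\<^bsub>W\<^esub> star x y" if x'y': "x' \<in> I +>\<^bsub>W\<^esub> x" "y' \<in> I +>\<^bsub>W\<^esub> y" for x' y'
    proof -
      obtain i j where ij: "x' = i + x" "y' = j + y" "i \<in> I" "j \<in> I"
        using x'y' unfolding cos by blast
      have iV: "i \<in> sym_span V" "j \<in> sym_span V" using ij I by auto
      have jy: "j + y \<in> sym_span V" by (rule fs.subspace_add[OF subspace_sym_span iV(2) y])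
      have e: "star x' y' = (star i (j + y) + star x j) + star x y"
        unfolding ij by (simp only: star_add(1)[OF iV(1) x jy] star_add(2)[OF iV(2) y x] add.assoc)
      let ?d = "star i (j + y) + star x j"
      have d: "?d \<in> I" by (intro fs.subspace_add[OF I(1)] absorb ij x jy)
      have "{i + (?d + star x y) | i. i \<in> I} = {i + star x y | i. i \<in> {i + ?d | i. i \<in> I}}"
        by (auto simp: add.assoc)
      then show ?thesis unfolding cos e translate_subspace[OF I(1) d] .
    qed
    moreover have "I +>\<^bsub>W\<^esub> x \<noteq> {}" "I +>\<^bsub>W\<^esub> y \<noteq> {}"
      unfolding cos using fs.subspace_0[OF I(1)] by blast+
    ultimately have "(\<Union>x'\<in>I +>\<^bsub>W\<^esub> x. \<Union>y'\<in>I +>\<^bsub>W\<^esub> y. I +>\<^bsub>W\<^esub> (star x' y')) = I +>\<^bsub>W\<^esub> star x y" by blast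
    then show ?thesis by (simp only: FactRing_def rcoset_mult_def W monoid.simps)
  qed
  have aV: "a \<in> sym_span V" and bV: "b \<in> sym_span V" using A B sym_span_mono by blast+
  have comm: "star a b = star b a"
    using star_orthogonal[OF contraction_orthogonal[OF A(2) B(2) A(1) B(1) orth(1)]]
      star_orthogonal[OF contraction_orthogonal[OF B(2) A(2) B(1) A(1) orth(2)]]
    by (simp only: sym_mult_commute[of b a])
  have ag: "abelian_group W" by (rule abelian_group_function_space) (simp_all only: W subspace_sym_span)
  interpret W: abelian_group W by (rule ag)
  have "subgroup I (add_monoid W)"
    by (rule subgroup_function_space) (simp_all only: W subspace_sym_span I)
  then interpret S: abelian_subgroup I W
    by (intro abelian_subgroupI3 additive_subgroupI ag)
  have Q: "comm_group (add_monoid (W Quot I))"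
    using S.a_factorgroup_is_comm_group by (simp add: A_FactGroup_def FactGroup_def FactRing_def A_RCOSETS_def set_add_def)
  then interpret Q: comm_group "add_monoid (W Quot I)" .
  have "star a b \<in> sym_span V"
    by (intro star_mem aV bV subspace_sym_span contraction_funpow_sym_span order_refl)
  then have "I +>\<^bsub>W\<^esub> star a b \<in> carrier (add_monoid (W Quot I))"
    using W.a_rcosetsI[of I "star a b"] I by (simp add: FactRing_def W)
  from Q.r_inv[OF this] show ?thesis
    unfolding prod[OF aV bV] prod[OF bV aV] comm[symmetric] a_minus_def a_inv_def by simp
qed

section \<open>The fibre metric\<close>

locale metric_bundle = lorentz_mfd S
  for S :: "('m::t2_space, 'n::finite, 'f::real_vector, 'z) vbundle_scheme" +
  assumes bun: "metric_vector_bundle S"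
begin

abbreviation "r \<equiv> brank S"
abbreviation "h \<equiv> fmetric S"

lemma vb: "vector_bundle S" and fm: "fiber_metric S" and mc: "metric_connection S"
  using bun unfolding metric_vector_bundle_def by blast+

lemma frame_exists: "\<exists>W e. (W, e) \<in> frames S \<and> p \<in> W"
proof -
  have "(\<Union>fr\<in>frames S. fst fr) = UNIV" using vb unfolding vector_bundle_def by (rule conjunct1)
  then have "p \<in> (\<Union>fr\<in>frames S. fst fr)" by simp
  then obtain fr where "fr \<in> frames S" "p \<in> fst fr" by blast
  then show ?thesis by (intro exI[of _ "fst fr"] exI[of _ "snd fr"]) simp
qed

lemma frame_facts:
  assumes "(W, e) \<in> frames S"
  shows "open W" "p \<in> W \<Longrightarrow> inj_on (\<lambda>i. e i p) {..<r}" "p \<in> W \<Longrightarrow> independent ((\<lambda>i. e i p) ` {..<r})"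
    "p \<in> W \<Longrightarrow> span ((\<lambda>i. e i p) ` {..<r}) = UNIV" "i < r \<Longrightarrow> smooth_section S W (e i)"
    "i < r \<Longrightarrow> j < r \<Longrightarrow> smooth_fun S W (\<lambda>p. h p (e i p) (e j p))"
proof -
  have 1: "open W \<and> (\<forall>p\<in>W. inj_on (\<lambda>i. e i p) {..<r} \<and> independent ((\<lambda>i. e i p) ` {..<r}) \<and>
      span ((\<lambda>i. e i p) ` {..<r}) = UNIV) \<and> (\<forall>i<r. smooth_section S W (e i))"
    using bspec[OF conjunct2[OF vb[unfolded vector_bundle_def]] assms] unfolding prod.case by assumption
  have 2: "\<forall>i<r. \<forall>j<r. smooth_fun S W (\<lambda>p. h p (e i p) (e j p))"
    using bspec[OF conjunct2[OF fm[unfolded fiber_metric_def]] assms] unfolding prod.case by assumption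
  show "open W" "p \<in> W \<Longrightarrow> inj_on (\<lambda>i. e i p) {..<r}" "p \<in> W \<Longrightarrow> independent ((\<lambda>i. e i p) ` {..<r})"
    "p \<in> W \<Longrightarrow> span ((\<lambda>i. e i p) ` {..<r}) = UNIV" "i < r \<Longrightarrow> smooth_section S W (e i)"
    using 1 by blast+
  show "i < r \<Longrightarrow> j < r \<Longrightarrow> smooth_fun S W (\<lambda>p. h p (e i p) (e j p))"
    using 2 by blast
qed

lemma h_linear: "linear (h p v)" and h_sym: "h p v w = h p w v"
  and h_nondeg: "(\<And>w. h p v w = 0) \<Longrightarrow> v = 0"
  using spec[OF conjunct1[OF fm[unfolded fiber_metric_def]], of p] by blast+

lemma h_linear_left: "linear (\<lambda>v. h p v w)"
  using h_linear[of p w] by (simp add: h_sym[of p _ w])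

lemma frame_coeffs:
  assumes "(W, e) \<in> frames S" "p \<in> W"
  shows "\<exists>a. v = (\<Sum>i<r. a i *\<^sub>R e i p)"
proof -
  have "v \<in> span ((\<lambda>i. e i p) ` {..<r})" using frame_facts(4)[OF assms] by simp
  then obtain u where "v = (\<Sum>x\<in>(\<lambda>i. e i p) ` {..<r}. u x *\<^sub>R x)"
    by (subst (asm) span_finite) auto
  then have "v = (\<Sum>i<r. u (e i p) *\<^sub>R e i p)"
    by (simp add: sum.reindex[OF frame_facts(2)[OF assms]])
  then show ?thesis by (rule exI[of _ "\<lambda>i. u (e i p)"])
qed

lemma frame_indep:
  assumes fr: "(W, e) \<in> frames S" "p \<in> W" and eq: "(\<Sum>i<r. a i *\<^sub>R e i p) = (\<Sum>i<r. b i *\<^sub>R e i p)" and i: "i < r"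
  shows "a i = b i"
proof -
  note inj = frame_facts(2)[OF fr] and ind = frame_facts(3)[OF fr]
  define u where "u x = a (inv_into {..<r} (\<lambda>i. e i p) x) - b (inv_into {..<r} (\<lambda>i. e i p) x)" for x
  have u: "u (e j p) = a j - b j" if "j < r" for j
    using inv_into_f_f[OF inj, of j] that by (simp add: u_def)
  have "(\<Sum>x\<in>(\<lambda>i. e i p) ` {..<r}. u x *\<^sub>R x) = (\<Sum>j<r. (a j - b j) *\<^sub>R e j p)"
    by (simp add: sum.reindex[OF inj] u)
  also have "\<dots> = 0" using eq by (simp add: scaleR_diff_left sum_subtractf)
  finally have "u (e i p) = 0" using i by (intro independentD[OF ind]) auto
  then show ?thesis using u[OF i] by simp
qed

lemma h_frame_expand:
  "h p (\<Sum>i<r. a i *\<^sub>R e i p) (\<Sum>j<r. b j *\<^sub>R e j p) = (\<Sum>i<r. \<Sum>j<r. a i * b j * h p (e i p) (e j p))"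
proof -
  have "h p (\<Sum>i<r. a i *\<^sub>R e i p) (\<Sum>j<r. b j *\<^sub>R e j p) = (\<Sum>i<r. a i * h p (e i p) (\<Sum>j<r. b j *\<^sub>R e j p))"
    by (simp only: linear_sum[OF h_linear_left] linear_cmul[OF h_linear_left] real_scaleR_def)
  also have "\<dots> = (\<Sum>i<r. \<Sum>j<r. a i * b j * h p (e i p) (e j p))"
    by (simp only: linear_sum[OF h_linear] linear_cmul[OF h_linear] real_scaleR_def sum_distrib_left mult.assoc)
  finally show ?thesis .
qed

text \<open>By non-degeneracy, mapping a vector to its pairings with the frame is an injective endomorphism
  of the finite-dimensional fibre, hence surjective.\<close>

lemma dual_basis_vector:
  assumes fr: "(W, e) \<in> frames S" "p \<in> W"
  shows "\<exists>w. \<forall>i<r. h p w (e i p) = \<beta> i"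
proof -
  let ?B = "(\<lambda>i. e i p) ` {..<r}"
  interpret fd: finite_dimensional_vector_space "scaleR :: real \<Rightarrow> 'f \<Rightarrow> 'f" ?B
    by unfold_locales
       (use frame_facts(3)[OF fr] frame_facts(4)[OF fr] in \<open>simp_all add: dependent_raw_def span_raw_def algebra_simps\<close>)
  let ?T = "\<lambda>v. \<Sum>i<r. h p v (e i p) *\<^sub>R e i p"
  have lin: "linear ?T"
    by (rule linearI)
       (simp_all add: linear_add[OF h_linear_left] linear_cmul[OF h_linear_left] scaleR_add_left sum.distrib scaleR_sum_right)
  have "v = 0" if v: "?T v = 0" for v
  proof (rule h_nondeg)
    fix w
    obtain b where b: "w = (\<Sum>i<r. b i *\<^sub>R e i p)" using frame_coeffs[OF fr] by blast
    have "h p v (e i p) = 0" if i: "i < r" for i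
      using frame_indep[OF fr, of "\<lambda>i. h p v (e i p)" "\<lambda>_. 0", OF _ i] v by simp
    then show "h p v w = 0" unfolding b by (simp add: linear_sum[OF h_linear] linear_cmul[OF h_linear])
  qed
  then have "inj ?T" using lin by (simp add: linear_injective_0)
  then have "surj ?T"
    by (rule fd.linear_inj_imp_surj[OF lin[unfolded linear_def]])
  then obtain w where w: "(\<Sum>i<r. \<beta> i *\<^sub>R e i p) = ?T w" unfolding surj_def by blast
  have "h p w (e i p) = \<beta> i" if "i < r" for i
    using frame_indep[OF fr w that] by simp
  then show ?thesis by blast
qed

lemma sharp_unique:
  assumes "\<And>v. h p w v = \<beta> v"
  shows "sharp S p \<beta> = w"
  unfolding sharp_def
proof (rule the_equality)
  show "\<forall>v. h p w v = \<beta> v" using assms by blast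
  fix w' assume "\<forall>v. h p w' v = \<beta> v"
  then have "h p (w' - w) v = 0" for v using assms by (simp add: linear_diff[OF h_linear_left])
  then have "w' - w = 0" by (rule h_nondeg)
  then show "w' = w" by simp
qed

lemma h_sharp:
  assumes "linear \<beta>"
  shows "h p (sharp S p \<beta>) v = \<beta> v"
proof -
  obtain W e where fr: "(W, e) \<in> frames S" "p \<in> W" using frame_exists by blast
  obtain w where w: "\<forall>i<r. h p w (e i p) = \<beta> (e i p)" using dual_basis_vector[OF fr, of "\<lambda>i. \<beta> (e i p)"] by blast
  have "h p w v = \<beta> v" for v
  proof -
    obtain b where b: "v = (\<Sum>i<r. b i *\<^sub>R e i p)" using frame_coeffs[OF fr] by blast
    show ?thesis unfolding b using w
      by (simp add: linear_sum[OF h_linear] linear_cmul[OF h_linear] linear_sum[OF assms] linear_cmul[OF assms])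
  qed
  then show ?thesis using sharp_unique[of p w \<beta>] by simp
qed

lemma sharp_lin:
  assumes "linear \<alpha>" "linear \<beta>"
  shows "sharp S p (\<lambda>v. a * \<alpha> v + \<beta> v) = a *\<^sub>R sharp S p \<alpha> + sharp S p \<beta>"
  by (rule sharp_unique)
     (simp add: linear_add[OF h_linear_left] linear_cmul[OF h_linear_left] h_sharp assms)

lemma sharp_zero: "sharp S p (\<lambda>v. 0) = 0"
  by (rule sharp_unique) (simp add: linear_0[OF h_linear_left])

section \<open>Smooth sections\<close>

lemma smooth_sectionI:
  assumes "\<And>W' e. (W', e) \<in> frames S \<Longrightarrow> \<exists>a. (\<forall>i<r. smooth_fun S (W \<inter> W') (a i)) \<and> (\<forall>p\<in>W \<inter> W'. s p = (\<Sum>i<r. a i p *\<^sub>R e i p))"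
  shows "smooth_section S W s"
  unfolding smooth_section_def using assms by blast

lemma smooth_sectionE:
  assumes "smooth_section S W s" "(W', e) \<in> frames S"
  obtains a where "\<And>i. i < r \<Longrightarrow> smooth_fun S (W \<inter> W') (a i)" "\<And>p. p \<in> W \<inter> W' \<Longrightarrow> s p = (\<Sum>i<r. a i p *\<^sub>R e i p)"
  using assms unfolding smooth_section_def by blast

lemma smooth_section_subset: "smooth_section S W s \<Longrightarrow> V \<subseteq> W \<Longrightarrow> smooth_section S V s"
proof (rule smooth_sectionI)
  fix W' e assume s: "smooth_section S W s" and V: "V \<subseteq> W" and fr: "(W', e) \<in> frames S"
  obtain a where "\<And>i. i < r \<Longrightarrow> smooth_fun S (W \<inter> W') (a i)" "\<And>p. p \<in> W \<inter> W' \<Longrightarrow> s p = (\<Sum>i<r. a i p *\<^sub>R e i p)"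
    using smooth_sectionE[OF s fr] by blast
  then show "\<exists>a. (\<forall>i<r. smooth_fun S (V \<inter> W') (a i)) \<and> (\<forall>p\<in>V \<inter> W'. s p = (\<Sum>i<r. a i p *\<^sub>R e i p))"
    using V by (intro exI[of _ a]) (auto intro: smooth_fun_subset)
qed

lemma smooth_section_cong:
  assumes "smooth_section S W s" "\<And>p. p \<in> W \<Longrightarrow> s p = t p"
  shows "smooth_section S W t"
proof (rule smooth_sectionI)
  fix W' e assume fr: "(W', e) \<in> frames S"
  obtain a where "\<And>i. i < r \<Longrightarrow> smooth_fun S (W \<inter> W') (a i)" "\<And>p. p \<in> W \<inter> W' \<Longrightarrow> s p = (\<Sum>i<r. a i p *\<^sub>R e i p)"
    using smooth_sectionE[OF assms(1) fr] by blast
  then show "\<exists>a. (\<forall>i<r. smooth_fun S (W \<inter> W') (a i)) \<and> (\<forall>p\<in>W \<inter> W'. t p = (\<Sum>i<r. a i p *\<^sub>R e i p))"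
    using assms(2) by (intro exI[of _ a]) auto
qed

text \<open>Components with respect to a frame are unique, so local choices of smooth components fit
  together.\<close>

lemma smooth_section_local:
  assumes W: "open W" and loc: "\<And>p. p \<in> W \<Longrightarrow> \<exists>V. open V \<and> p \<in> V \<and> smooth_section S V s"
  shows "smooth_section S W s"
proof (rule smooth_sectionI)
  fix W' e assume fr: "(W', e) \<in> frames S"
  have "\<forall>p. \<exists>a. p \<in> W' \<longrightarrow> s p = (\<Sum>i<r. a i *\<^sub>R e i p)" using frame_coeffs[OF fr] by blast
  from choice[OF this] obtain a where a: "\<forall>p. p \<in> W' \<longrightarrow> s p = (\<Sum>i<r. a p i *\<^sub>R e i p)" ..
  have "smooth_fun S (W \<inter> W') (\<lambda>p. a p i)" if i: "i < r" for i
  proof (rule smooth_fun_local)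
    fix p assume p: "p \<in> W \<inter> W'"
    obtain V where V: "open V" "p \<in> V" "smooth_section S V s" using loc p by blast
    obtain b where b: "\<And>i. i < r \<Longrightarrow> smooth_fun S (V \<inter> W') (b i)" "\<And>p. p \<in> V \<inter> W' \<Longrightarrow> s p = (\<Sum>i<r. b i p *\<^sub>R e i p)"
      using smooth_sectionE[OF V(3) fr] by blast
    have O: "open (V \<inter> W')" using V(1) frame_facts(1)[OF fr] by blast
    have "smooth_fun S (V \<inter> W') (\<lambda>p. a p i)"
    proof (rule smooth_fun_cong[OF O _ b(1)[OF i]])
      fix q assume q: "q \<in> V \<inter> W'"
      show "b i q = a q i"
        by (rule frame_indep[OF fr _ _ i]) (use q a b(2)[OF q] in auto)
    qed
    then show "\<exists>V. open V \<and> p \<in> V \<and> smooth_fun S V (\<lambda>p. a p i)" using O V(2) p by blast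
  qed
  with a show "\<exists>a. (\<forall>i<r. smooth_fun S (W \<inter> W') (a i)) \<and> (\<forall>p\<in>W \<inter> W'. s p = (\<Sum>i<r. a i p *\<^sub>R e i p))"
    by (intro exI[of _ "\<lambda>i p. a p i"]) auto
qed

lemma smooth_section_zero: "open W \<Longrightarrow> smooth_section S W (\<lambda>p. 0)"
  by (rule smooth_sectionI, rule exI[of _ "\<lambda>_ _. 0"]) (auto intro!: smooth_fun_const open_Int dest: frame_facts(1))

lemma smooth_section_lin:
  assumes W: "open W" and s: "smooth_section S W s" and t: "smooth_section S W t" and f: "smooth_fun S W f"
  shows "smooth_section S W (\<lambda>p. f p *\<^sub>R s p + t p)"
proof (rule smooth_sectionI)
  fix W' e assume fr: "(W', e) \<in> frames S"
  obtain a where a: "\<And>i. i < r \<Longrightarrow> smooth_fun S (W \<inter> W') (a i)" "\<And>p. p \<in> W \<inter> W' \<Longrightarrow> s p = (\<Sum>i<r. a i p *\<^sub>R e i p)"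
    using smooth_sectionE[OF s fr] by blast
  obtain b where b: "\<And>i. i < r \<Longrightarrow> smooth_fun S (W \<inter> W') (b i)" "\<And>p. p \<in> W \<inter> W' \<Longrightarrow> t p = (\<Sum>i<r. b i p *\<^sub>R e i p)"
    using smooth_sectionE[OF t fr] by blast
  have O: "open (W \<inter> W')" using W frame_facts(1)[OF fr] by blast
  have "smooth_fun S (W \<inter> W') (\<lambda>p. f p * a i p + b i p)" if "i < r" for i
    by (intro smooth_fun_add[OF O] smooth_fun_mult[OF O] a(1) b(1) that smooth_fun_subset[OF f]) auto
  moreover have "f p *\<^sub>R s p + t p = (\<Sum>i<r. (f p * a i p + b i p) *\<^sub>R e i p)" if "p \<in> W \<inter> W'" for p
    by (simp add: a(2)[OF that] b(2)[OF that] scaleR_sum_right scaleR_add_left sum.distrib)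
  ultimately show "\<exists>a. (\<forall>i<r. smooth_fun S (W \<inter> W') (a i)) \<and> (\<forall>p\<in>W \<inter> W'. f p *\<^sub>R s p + t p = (\<Sum>i<r. a i p *\<^sub>R e i p))"
    by (intro exI[of _ "\<lambda>i p. f p * a i p + b i p"]) auto
qed

lemma smooth_section_add: "open W \<Longrightarrow> smooth_section S W s \<Longrightarrow> smooth_section S W t \<Longrightarrow> smooth_section S W (\<lambda>p. s p + t p)"
  using smooth_section_lin[of W s t "\<lambda>p. 1"] smooth_fun_const[of W 1] by simp

lemma smooth_section_scale: "open W \<Longrightarrow> smooth_fun S W f \<Longrightarrow> smooth_section S W s \<Longrightarrow> smooth_section S W (\<lambda>p. f p *\<^sub>R s p)"
  using smooth_section_lin[of W s "\<lambda>p. 0" f] smooth_section_zero[of W] by simp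

lemma smooth_section_diff:
  assumes "open W" "smooth_section S W s" "smooth_section S W t"
  shows "smooth_section S W (\<lambda>p. s p - t p)"
  using smooth_section_lin[OF assms(1,3,2) smooth_fun_const[OF assms(1), of "-1"]] by simp

lemma smooth_section_sum:
  "open W \<Longrightarrow> (\<And>i. i \<in> I \<Longrightarrow> smooth_section S W (s i)) \<Longrightarrow> smooth_section S W (\<lambda>p. \<Sum>i\<in>I. s i p)"
proof (induction I rule: infinite_finite_induct)
  case (insert i I) then show ?case by (simp add: smooth_section_add)
qed (simp_all add: smooth_section_zero)

lemma h_smooth:
  assumes W: "open W" and s: "smooth_section S W s" and t: "smooth_section S W t"
  shows "smooth_fun S W (\<lambda>p. h p (s p) (t p))"
proof (rule smooth_fun_local)
  fix p assume p: "p \<in> W"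
  obtain W' e where fr: "(W', e) \<in> frames S" "p \<in> W'" using frame_exists by blast
  obtain a where a: "\<And>i. i < r \<Longrightarrow> smooth_fun S (W \<inter> W') (a i)" "\<And>p. p \<in> W \<inter> W' \<Longrightarrow> s p = (\<Sum>i<r. a i p *\<^sub>R e i p)"
    using smooth_sectionE[OF s fr(1)] by blast
  obtain b where b: "\<And>i. i < r \<Longrightarrow> smooth_fun S (W \<inter> W') (b i)" "\<And>p. p \<in> W \<inter> W' \<Longrightarrow> t p = (\<Sum>i<r. b i p *\<^sub>R e i p)"
    using smooth_sectionE[OF t fr(1)] by blast
  have O: "open (W \<inter> W')" using W frame_facts(1)[OF fr(1)] by blast
  have "smooth_fun S (W \<inter> W') (\<lambda>p. \<Sum>i<r. \<Sum>j<r. a i p * b j p * h p (e i p) (e j p))"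
    by (intro smooth_fun_sum[OF O] smooth_fun_mult[OF O] a(1) b(1) smooth_fun_subset[OF frame_facts(6)[OF fr(1)]]) auto
  then have "smooth_fun S (W \<inter> W') (\<lambda>p. h p (s p) (t p))"
    by (rule smooth_fun_cong[OF O, rotated]) (simp only: a(2) b(2) h_frame_expand[where a="\<lambda>i. a i _" and b="\<lambda>i. b i _" and e=e])
  then show "\<exists>V. open V \<and> p \<in> V \<and> smooth_fun S V (\<lambda>p. h p (s p) (t p))" using O p fr(2) by blast
qed

section \<open>Sections of the dual bundle\<close>

lemma dual_linear: "\<phi> \<in> dual_sections S \<Longrightarrow> linear (\<lambda>v. \<phi> (p, v))"
  and dual_smooth: "\<phi> \<in> dual_sections S \<Longrightarrow> (W, e) \<in> frames S \<Longrightarrow> i < r \<Longrightarrow> smooth_fun S W (\<lambda>p. \<phi> (p, e i p))"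
  unfolding dual_sections_def by blast+

lemma dual_sections_lin:
  assumes "\<phi> \<in> dual_sections S" "\<psi> \<in> dual_sections S"
  shows "(\<lambda>x. a * \<phi> x + \<psi> x) \<in> dual_sections S"
  unfolding dual_sections_def
proof (intro CollectI conjI allI ballI, goal_cases)
  case (1 p)
  show ?case
    by (rule linearI) (simp_all add: linear_add[OF dual_linear[OF assms(1)]] linear_add[OF dual_linear[OF assms(2)]]
      linear_cmul[OF dual_linear[OF assms(1)]] linear_cmul[OF dual_linear[OF assms(2)]] algebra_simps)
next
  case (2 fr)
  obtain W e where fr: "fr = (W, e)" by (cases fr)
  then have f: "(W, e) \<in> frames S" using 2 by simp
  note O = frame_facts(1)[OF f]
  have "smooth_fun S W (\<lambda>p. a * \<phi> (p, e i p) + \<psi> (p, e i p))" if "i < r" for i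
    by (intro smooth_fun_add[OF O] smooth_fun_mult[OF O] smooth_fun_const[OF O] dual_smooth[OF _ f that] assms)
  then show ?case by (simp add: fr)
qed

text \<open>The section \<open>\<phi>\<^sup>\<sharp>\<close> of \<open>E\<close> that corresponds to a section of \<open>E\<^sup>*\<close> under the fibre metric.\<close>

definition shs :: "('m \<times> 'f \<Rightarrow> real) \<Rightarrow> 'm \<Rightarrow> 'f" where
  "shs \<phi> p = sharp S p (\<lambda>v. \<phi> (p, v))"

lemma h_shs: "\<phi> \<in> dual_sections S \<Longrightarrow> h p (shs \<phi> p) v = \<phi> (p, v)"
  unfolding shs_def by (rule h_sharp[OF dual_linear])

lemma shs_lin:
  assumes "\<phi> \<in> dual_sections S" "\<psi> \<in> dual_sections S"
  shows "shs (\<lambda>x. a * \<phi> x + \<psi> x) p = a *\<^sub>R shs \<phi> p + shs \<psi> p"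
  unfolding shs_def by (rule sharp_lin[OF dual_linear[OF assms(1)] dual_linear[OF assms(2)]])

lemma shs_zero: "(\<And>v. \<phi> (p, v) = 0) \<Longrightarrow> shs \<phi> p = 0"
  unfolding shs_def using sharp_zero by simp

text \<open>The components in a frame solve the linear system given by the Gram matrix of the frame.\<close>

lemma shs_smooth:
  assumes \<phi>: "\<phi> \<in> dual_sections S"
  shows "smooth_section S UNIV (shs \<phi>)"
proof (rule smooth_sectionI)
  fix W e assume fr: "(W, e) \<in> frames S"
  note O = frame_facts(1)[OF fr]
  have "\<forall>p. \<exists>a. p \<in> W \<longrightarrow> shs \<phi> p = (\<Sum>i<r. a i *\<^sub>R e i p)" using frame_coeffs[OF fr] by blast
  from choice[OF this] obtain a where a: "\<forall>p. p \<in> W \<longrightarrow> shs \<phi> p = (\<Sum>i<r. a p i *\<^sub>R e i p)" ..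
  have "smooth_fun S W (\<lambda>p. a p i)" if i: "i < r" for i
  proof (rule smooth_fun_linear_system[where H="\<lambda>p i j. h p (e i p) (e j p)" and J="{..<r}" and b="\<lambda>p i. \<phi> (p, e i p)"])
    show "smooth_fun S W (\<lambda>p. h p (e i p) (e l p))" if "i \<in> {..<r}" "l \<in> {..<r}" for i l
      using frame_facts(6)[OF fr] that by simp
    show "smooth_fun S W (\<lambda>p. \<phi> (p, e i p))" if "i \<in> {..<r}" for i
      using dual_smooth[OF \<phi> fr] that by simp
    fix p assume p: "p \<in> W"
    show "(\<Sum>j<r. h p (e i p) (e j p) * a p j) = \<phi> (p, e i p)" for i
    proof -
      have "\<phi> (p, e i p) = h p (e i p) (shs \<phi> p)" using h_shs[OF \<phi>, of p "e i p"] h_sym by metis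
      also have "\<dots> = (\<Sum>j<r. h p (e i p) (e j p) * a p j)"
        using a p by (simp add: linear_sum[OF h_linear] linear_cmul[OF h_linear] mult.commute)
      finally show ?thesis ..
    qed
    have "\<forall>j. \<exists>g. \<forall>l<r. (\<Sum>i<r. g i * h p (e i p) (e l p)) = (if j = l then 1 else 0)"
    proof
      fix j
      obtain w where w: "\<forall>l<r. h p w (e l p) = (if j = l then 1 else 0)"
        using dual_basis_vector[OF fr p, of "\<lambda>l. if j = l then 1 else 0"] by blast
      obtain g where g: "w = (\<Sum>i<r. g i *\<^sub>R e i p)" using frame_coeffs[OF fr p] by blast
      have "h p w (e l p) = (\<Sum>i<r. g i * h p (e i p) (e l p))" for l
        unfolding g by (simp add: linear_sum[OF h_linear_left] linear_cmul[OF h_linear_left])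
      with w have "\<forall>l<r. (\<Sum>i<r. g i * h p (e i p) (e l p)) = (if j = l then 1 else 0)" by simp
      then show "\<exists>g. \<forall>l<r. (\<Sum>i<r. g i * h p (e i p) (e l p)) = (if j = l then 1 else 0)"
        by (rule exI[where P="\<lambda>g. \<forall>l<r. (\<Sum>i<r. g i * h p (e i p) (e l p)) = (if j = l then 1 else 0)"])
    qed
    from choice[OF this] obtain G where "\<forall>j. \<forall>l<r. (\<Sum>i<r. G j i * h p (e i p) (e l p)) = (if j = l then 1 else 0)" ..
    then show "\<exists>G. \<forall>j\<in>{..<r}. \<forall>l\<in>{..<r}. (\<Sum>i<r. G j i * h p (e i p) (e l p)) = (if j = l then 1 else 0)"
      by (intro exI[of _ G]) auto
  qed (use O i in auto)
  with a show "\<exists>a. (\<forall>i<r. smooth_fun S (UNIV \<inter> W) (a i)) \<and> (\<forall>p\<in>UNIV \<inter> W. shs \<phi> p = (\<Sum>i<r. a i p *\<^sub>R e i p))"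
    by (intro exI[of _ "\<lambda>i p. a p i"]) auto
qed

section \<open>The connection\<close>

context
  fixes W s assumes W: "open W" and s: "smooth_section S W s"
begin

lemma conn_clauses:
  "(\<forall>t. smooth_section S W t \<longrightarrow> (\<forall>p\<in>W. \<forall>X\<in>tangent_space S p. conn S (\<lambda>q. s q + t q) p X = conn S s p X + conn S t p X)) \<and>
   (\<forall>t. (\<forall>q\<in>W. s q = t q) \<longrightarrow> (\<forall>p\<in>W. \<forall>X\<in>tangent_space S p. conn S s p X = conn S t p X)) \<and>
   (\<forall>c\<in>atlas S. \<forall>i. smooth_section S (W \<inter> fst c) (\<lambda>p. conn S s p (cvec S c i p)))"
  using mp[OF spec[OF spec[OF conjunct1[OF mc[unfolded metric_connection_def], unfolded connection_def], of W], of s] conjI[OF W s]]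
  by (elim conjE) (intro conjI; assumption)

lemma conn_add:
  assumes "smooth_section S W t" "p \<in> W" "X \<in> tangent_space S p"
  shows "conn S (\<lambda>q. s q + t q) p X = conn S s p X + conn S t p X"
  by (rule bspec[OF bspec[OF mp[OF spec[OF conjunct1[OF conn_clauses]] assms(1)] assms(2)] assms(3)])

lemma conn_cong:
  assumes "\<And>q. q \<in> W \<Longrightarrow> s q = t q" "p \<in> W" "X \<in> tangent_space S p"
  shows "conn S s p X = conn S t p X"
  by (rule bspec[OF bspec[OF mp[OF spec[OF conjunct1[OF conjunct2[OF conn_clauses]]] ballI[OF assms(1)]] assms(2)] assms(3)])

lemma conn_smooth: "c \<in> atlas S \<Longrightarrow> smooth_section S (W \<inter> fst c) (\<lambda>p. conn S s p (cvec S c i p))"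
  by (rule spec[OF bspec[OF conjunct2[OF conjunct2[OF conn_clauses]]]])

lemma conn_metric:
  assumes "smooth_section S W t" "p \<in> W" "c \<in> charts_at S p"
  shows "pd c i (\<lambda>q. h q (s q) (t q)) p = h p (conn S s p (cvec S c i p)) (t p) + h p (s p) (conn S t p (cvec S c i p))"
proof -
  have "dirder c (\<lambda>q. h q (s q) (t q)) p (cvec S c i p) = h p (conn S s p (cvec S c i p)) (t p) + h p (s p) (conn S t p (cvec S c i p))"
    by (rule bspec[OF bspec[OF bspec[OF mp[OF spec[OF spec[OF spec[OF conjunct2[OF mc[unfolded metric_connection_def]], of W], of s], of t]
      conjI[OF W conjI[OF s assms(1)]]] assms(2)] cvec_tangent[OF assms(3)]] assms(3)])
  then show ?thesis by (simp only: dirder_cvec[OF assms(3)])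
qed

end

text \<open>Covariant derivatives only depend on the section near the point.\<close>

lemma conn_zero:
  assumes "open W" "\<And>q. q \<in> W \<Longrightarrow> s q = 0" "p \<in> W" "X \<in> tangent_space S p"
  shows "conn S s p X = 0"
proof -
  have z: "smooth_section S W (\<lambda>p. 0)" by (rule smooth_section_zero[OF assms(1)])
  have "conn S (\<lambda>q. 0 + 0) p X = conn S (\<lambda>q. 0) p X + conn S (\<lambda>q. 0) p X"
    by (rule conn_add[OF assms(1) z z assms(3,4)])
  then have "conn S (\<lambda>q. 0) p X = 0" by simp
  moreover have "conn S (\<lambda>q. 0) p X = conn S s p X"
    by (rule conn_cong[OF assms(1) z _ assms(3,4)]) (simp add: assms(2))
  ultimately show ?thesis by simp
qed

end

section \<open>Derivatives of determinants and of inverse matrices\<close>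

lemma sum_kronecker: "(\<Sum>b\<in>UNIV. f b * (if b = k then 1 else (0::real))) = f (k :: 'n::finite)"
proof -
  have "(\<Sum>b\<in>UNIV. f b * (if b = k then 1 else 0)) = (\<Sum>b\<in>UNIV. if b = k then f b else 0)"
    by (rule sum.cong) auto
  then show ?thesis by simp
qed

lemma matrix_inv_spec:
  fixes A :: "real^'n^'n"
  assumes "det A \<noteq> 0"
  shows "A ** matrix_inv A = mat 1 \<and> matrix_inv A ** A = mat 1"
proof -
  have "\<exists>B. A ** B = mat 1 \<and> B ** A = mat 1"
    using assms unfolding invertible_det_nz[symmetric] invertible_def .
  from someI_ex[OF this] show ?thesis unfolding matrix_inv_def .
qed

text \<open>Multilinearity of the determinant in the rows, read off from the Leibniz formula.\<close>

lemma det_row_derivative: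
  fixes G :: "real \<Rightarrow> real^'n^'n" and G' :: "real^'n^'n"
  assumes d: "\<And>i j. ((\<lambda>t. G t $ i $ j) has_real_derivative G' $ i $ j) (at t0)"
  shows "((\<lambda>t. det (G t)) has_real_derivative (\<Sum>k\<in>UNIV. det (\<chi> i. if i = k then G' $ k else G t0 $ i))) (at t0)"
proof -
  let ?P = "{p. p permutes (UNIV :: 'n set)}"
  have prod: "((\<lambda>t. \<Prod>i\<in>UNIV. G t $ i $ p i) has_real_derivative
      (\<Sum>k\<in>UNIV. G' $ k $ p k * (\<Prod>j\<in>UNIV - {k}. G t0 $ j $ p j))) (at t0)" for p :: "'n \<Rightarrow> 'n"
  proof -
    have "((\<lambda>t. \<Prod>i\<in>UNIV. G t $ i $ p i) has_derivative
      (\<lambda>y. \<Sum>k\<in>UNIV. (G' $ k $ p k * y) * (\<Prod>j\<in>UNIV - {k}. G t0 $ j $ p j))) (at t0)"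
      using d by (intro has_derivative_prod) (simp add: has_field_derivative_def)
    moreover have "(\<lambda>y. \<Sum>k\<in>UNIV. (G' $ k $ p k * y) * (\<Prod>j\<in>UNIV - {k}. G t0 $ j $ p j))
      = (*) (\<Sum>k\<in>UNIV. G' $ k $ p k * (\<Prod>j\<in>UNIV - {k}. G t0 $ j $ p j))"
      by (rule ext) (simp only: sum_distrib_right, intro sum.cong refl, rule mult_swap3)
    ultimately show ?thesis by (simp only: has_field_derivative_def)
  qed
  have "((\<lambda>t. \<Sum>p\<in>?P. of_int (sign p) * (\<Prod>i\<in>UNIV. G t $ i $ p i)) has_real_derivative
      (\<Sum>p\<in>?P. of_int (sign p) * (\<Sum>k\<in>UNIV. G' $ k $ p k * (\<Prod>j\<in>UNIV - {k}. G t0 $ j $ p j)))) (at t0)"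
    by (intro DERIV_sum DERIV_cmult prod)
  also have "(\<Sum>p\<in>?P. of_int (sign p) * (\<Sum>k\<in>UNIV. G' $ k $ p k * (\<Prod>j\<in>UNIV - {k}. G t0 $ j $ p j)))
    = (\<Sum>k\<in>UNIV. det (\<chi> i. if i = k then G' $ k else G t0 $ i))"
  proof -
    have "(\<Prod>i\<in>UNIV. (\<chi> i. if i = k then G' $ k else G t0 $ i) $ i $ p i)
      = G' $ k $ p k * (\<Prod>j\<in>UNIV - {k}. G t0 $ j $ p j)" for k and p :: "'n \<Rightarrow> 'n"
      by (subst prod.remove[of UNIV k]) (auto intro!: prod.cong arg_cong2[where f="(*)"])
    then show ?thesis
      unfolding det_def sum_distrib_left by (subst sum.swap) simp
  qed
  finally show ?thesis unfolding det_def .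
qed

text \<open>Jacobi's formula: by Cramer's rule, replacing a row of \<open>G\<close> by a row of \<open>G'\<close> multiplies the
  determinant with an entry of \<open>G' ** matrix_inv G\<close>.\<close>

lemma det_derivative:
  fixes G :: "real \<Rightarrow> real^'n^'n" and G' :: "real^'n^'n"
  assumes d: "\<And>i j. ((\<lambda>t. G t $ i $ j) has_real_derivative G' $ i $ j) (at t0)" and inv: "det (G t0) \<noteq> 0"
  shows "((\<lambda>t. det (G t)) has_real_derivative
      det (G t0) * (\<Sum>k\<in>UNIV. \<Sum>b\<in>UNIV. G' $ k $ b * matrix_inv (G t0) $ b $ k)) (at t0)"
proof -
  let ?I = "matrix_inv (G t0)"
  have I: "?I ** G t0 = mat 1" using matrix_inv_spec[OF inv] by (rule conjunct2)
  have row: "det (\<chi> i. if i = k then G' $ k else G t0 $ i) = (\<Sum>b\<in>UNIV. G' $ k $ b * ?I $ b $ k) * det (G t0)" for k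
  proof -
    let ?x = "G' $ k v* ?I"
    have "?x v* G t0 = G' $ k" by (simp add: vector_matrix_mul_assoc I)
    moreover have "?x v* G t0 = (\<Sum>i\<in>UNIV. ?x $ i *s row i (G t0))"
      by (simp add: vec_eq_iff vector_matrix_mult_def row_def mult.commute)
    ultimately have "(\<Sum>i\<in>UNIV. ?x $ i *s row i (G t0)) = G' $ k" by simp
    then have "det (\<chi> i. if i = k then G' $ k else row i (G t0)) = ?x $ k * det (G t0)"
      using cramer_lemma_transpose[of k ?x "G t0"] by (simp only:)
    moreover have "row i (G t0) = G t0 $ i" for i by (simp add: row_def vec_eq_iff)
    moreover have "?x $ k = (\<Sum>b\<in>UNIV. G' $ k $ b * ?I $ b $ k)"
      by (simp only: vector_matrix_mult_def vec_lambda_beta mult.commute)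
    ultimately show ?thesis by (simp only:)
  qed
  show ?thesis
    using det_row_derivative[OF d] unfolding row sum_distrib_right[symmetric] by (simp only: mult.commute)
qed

lemma DERIV_sqrt_abs:
  assumes "x \<noteq> 0"
  shows "((\<lambda>x. sqrt \<bar>x\<bar>) has_real_derivative sqrt \<bar>x\<bar> / (2 * x)) (at x)"
proof (cases "x > 0")
  case True
  have "(sqrt has_real_derivative inverse (sqrt x) / 2) (at x)" by (rule DERIV_real_sqrt[OF True])
  moreover have "inverse (sqrt x) / 2 = sqrt \<bar>x\<bar> / (2 * x)"
    using True real_sqrt_mult_self[of x] by (simp add: field_simps)
  ultimately have "(sqrt has_real_derivative sqrt \<bar>x\<bar> / (2 * x)) (at x)" by (simp only:)
  then show ?thesis
    by (rule has_field_derivative_transform_within_open[where S="{0<..}"]) (use True in auto)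
next
  case False
  then have neg: "- x > 0" using assms by simp
  have "((\<lambda>x. sqrt (- x)) has_real_derivative (inverse (sqrt (- x)) / 2) * (- 1)) (at x)"
    by (rule DERIV_chain2[where f=sqrt and g=uminus, OF DERIV_real_sqrt[OF neg]]) (auto intro!: derivative_eq_intros)
  moreover have "(inverse (sqrt (- x)) / 2) * (- 1) = sqrt \<bar>x\<bar> / (2 * x)"
    using neg real_sqrt_mult_self[of "- x"] by (simp add: field_simps)
  ultimately have "((\<lambda>x. sqrt (- x)) has_real_derivative sqrt \<bar>x\<bar> / (2 * x)) (at x)" by (simp only:)
  then show ?thesis
    by (rule has_field_derivative_transform_within_open[where S="{..<0}"]) (use neg in auto)
qed

lemma open_nonzero: "open (- {0 :: real})"
  by (rule open_Compl[OF closed_singleton])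

lemma Ck_sqrt_abs: "Ck k (- {0}) (\<lambda>x::real. sqrt \<bar>x\<bar>)"
proof (induction k)
  case 0 show ?case by (auto intro!: continuous_intros)
next
  case (Suc k)
  show ?case
  proof (rule Ck_SucI[OF open_nonzero])
    fix x :: real assume "x \<in> - {0}"
    then show "((\<lambda>x. sqrt \<bar>x\<bar>) has_derivative (\<lambda>h. (sqrt \<bar>x\<bar> / (2 * x)) * h)) (at x)"
      by (intro DERIV_sqrt_abs[unfolded has_field_derivative_def]) simp
  next
    fix b :: real assume "b \<in> Basis"
    have "Ck k (- {0}) (\<lambda>x::real. x)" by (intro Ck_linear bounded_linear_ident open_nonzero)
    then show "Ck k (- {0}) (\<lambda>x::real. (sqrt \<bar>x\<bar> / (2 * x)) * b)"
      by (intro Ck_mult Ck_const Ck_divide Suc.IH open_nonzero) auto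
  qed
qed

section \<open>The volume density and the Christoffel symbols\<close>

context lorentz_mfd
begin

definition ginv :: "('m, 'n) chart \<Rightarrow> 'm \<Rightarrow> real^'n^'n" where
  "ginv c p = matrix_inv (gmat S c p)"

definition vol :: "('m, 'n) chart \<Rightarrow> 'm \<Rightarrow> real" where
  "vol c p = sqrt \<bar>det (gmat S c p)\<bar>"

context
  fixes c p assumes c: "c \<in> charts_at S p"
begin

lemma ginv_left: "ginv c p ** gmat S c p = mat 1" and ginv_right: "gmat S c p ** ginv c p = mat 1"
  using matrix_inv_spec[OF gmat_det[OF c]] by (simp_all only: ginv_def)

lemma ginv_sym: "ginv c p $ i $ j = ginv c p $ j $ i"
proof -
  have t: "transpose (gmat S c p) = gmat S c p"
    by (simp only: vec_eq_iff transpose_def vec_lambda_beta) (intro allI gmat_sym[OF c])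
  have "transpose (ginv c p) ** gmat S c p = mat 1" "gmat S c p ** transpose (ginv c p) = mat 1"
    using arg_cong[OF ginv_right, of transpose] arg_cong[OF ginv_left, of transpose]
    by (simp_all add: matrix_transpose_mul t)
  then have "ginv c p = transpose (ginv c p)"
    by (metis ginv_left matrix_mul_assoc matrix_mul_lid matrix_mul_rid)
  from arg_cong[OF this, of "\<lambda>A. A $ i $ j"] show ?thesis by (simp only: transpose_def vec_lambda_beta)
qed

lemma ginv_left_sum: "(\<Sum>a\<in>UNIV. ginv c p $ i $ a * gmat S c p $ a $ b) = (if i = b then 1 else 0)"
  and ginv_right_sum: "(\<Sum>a\<in>UNIV. gmat S c p $ i $ a * ginv c p $ a $ b) = (if i = b then 1 else 0)"
  using arg_cong[OF ginv_left, of "\<lambda>A. A $ i $ b"] arg_cong[OF ginv_right, of "\<lambda>A. A $ i $ b"]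
  by (simp_all only: matrix_matrix_mult_def mat_def vec_lambda_beta)

end

context
  fixes c assumes c: "c \<in> atlas S"
begin

lemma chart_at: "p \<in> fst c \<Longrightarrow> c \<in> charts_at S p"
  using c by (simp add: charts_at_def)

lemma ginv_smooth: "smooth_fun S (fst c) (\<lambda>p. ginv c p $ j $ k)"
proof (rule smooth_fun_linear_system[where H="\<lambda>p i j. gmat S c p $ i $ j" and J=UNIV and b="\<lambda>p i. if i = k then 1 else 0"
    and w="\<lambda>p j. ginv c p $ j $ k"])
  show "\<exists>G. \<forall>j\<in>UNIV. \<forall>l\<in>UNIV. (\<Sum>i\<in>UNIV. G j i * gmat S c p $ i $ l) = (if j = l then 1 else 0)" if "p \<in> fst c" for p
    using ginv_left_sum[OF chart_at[OF that]] by (intro exI[of _ "\<lambda>j i. ginv c p $ j $ i"]) simp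
qed (use ginv_right_sum[OF chart_at] chart_open[OF c] gmat_smooth[OF c] in \<open>auto intro: smooth_fun_const\<close>)

lemma det_smooth: "smooth_fun S (fst c) (\<lambda>p. det (gmat S c p))"
proof -
  have "smooth_fun S (fst c) (\<lambda>p. \<Prod>i\<in>I. gmat S c p $ i $ s i)" if "finite I" for I and s :: "'n \<Rightarrow> 'n"
    using that by induction (simp_all add: smooth_fun_const smooth_fun_mult gmat_smooth[OF c] chart_open[OF c])
  then show ?thesis
    unfolding det_def by (intro smooth_fun_sum smooth_fun_mult smooth_fun_const chart_open[OF c]) auto
qed

lemma vol_smooth: "smooth_fun S (fst c) (vol c)"
proof (rule smooth_funI)
  fix d k assume d: "d \<in> atlas S"
  have "Ck k (snd d ` (fst c \<inter> fst d)) (\<lambda>y. sqrt \<bar>det (gmat S c (cinv d y))\<bar>)"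
  proof (rule Ck_compose[OF coord_image_open[OF d chart_open[OF c]] open_nonzero _ Ck_sqrt_abs smooth_funD[OF det_smooth d]])
    show "(\<lambda>y. det (gmat S c (cinv d y))) ` (snd d ` (fst c \<inter> fst d)) \<subseteq> - {0}"
      by (auto simp: cinv_coord[OF d] gmat_det[OF chart_at])
  qed
  then show "Ck k (snd d ` (fst c \<inter> fst d)) (\<lambda>y. vol c (cinv d y))" by (simp add: vol_def)
qed

lemma pd_has_derivative:
  assumes f: "smooth_fun S (fst c) f" and p: "p \<in> fst c"
  shows "((\<lambda>t. f (cinv c (snd c p + t *\<^sub>R axis i 1))) has_real_derivative pd c i f p) (at 0)"
proof -
  let ?F = "\<lambda>y. f (cinv c y)" and ?e = "axis i 1 :: real^'n"
  have "Ck (Suc 0) (snd c ` (fst c \<inter> fst c)) ?F" by (rule smooth_funD[OF f c])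
  then have F: "(?F has_derivative frechet_derivative ?F (at (snd c p))) (at (snd c p))"
    by (rule Ck_SucD(1)) (use p in auto)
  have L: "((\<lambda>t. snd c p + t *\<^sub>R ?e) has_derivative (\<lambda>t. t *\<^sub>R ?e)) (at 0)"
    by (auto intro!: derivative_eq_intros)
  have "((\<lambda>t. ?F (snd c p + t *\<^sub>R ?e)) has_derivative (\<lambda>t. frechet_derivative ?F (at (snd c p)) (t *\<^sub>R ?e))) (at 0)"
    by (rule has_derivative_compose[OF L]) (use F in simp)
  moreover have "(\<lambda>t. frechet_derivative ?F (at (snd c p)) (t *\<^sub>R ?e)) = (*) (pd c i f p)"
    by (rule ext) (simp add: pd_def linear_cmul[OF has_derivative_linear[OF F]])
  ultimately show ?thesis by (simp only: has_field_derivative_def)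
qed

lemma pd_unique:
  assumes "smooth_fun S (fst c) f" "p \<in> fst c"
    "((\<lambda>t. f (cinv c (snd c p + t *\<^sub>R axis i 1))) has_real_derivative d) (at 0)"
  shows "pd c i f p = d"
  by (rule DERIV_unique[OF pd_has_derivative[OF assms(1,2)] assms(3)])

lemma pd_smooth:
  assumes f: "smooth_fun S (fst c) f"
  shows "smooth_fun S (fst c) (pd c i f)"
proof (rule smooth_fun_in_chart[OF c chart_open[OF c] order_refl])
  fix k
  let ?F = "\<lambda>y. f (cinv c y)"
  have "Ck (Suc k) (snd c ` (fst c \<inter> fst c)) ?F" by (rule smooth_funD[OF f c])
  then have "Ck k (snd c ` (fst c \<inter> fst c)) (\<lambda>y. frechet_derivative ?F (at y) (axis i 1))"
    by (rule Ck_SucD(2)) (simp add: axis_in_Basis_iff)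
  then have "Ck k (snd c ` fst c) (\<lambda>y. frechet_derivative ?F (at y) (axis i 1))" by simp
  then show "Ck k (snd c ` fst c) (\<lambda>y. pd c i f (cinv c y))"
    by (rule Ck_cong_open[OF chart_open_image[OF c], rotated]) (simp add: pd_def coord_cinv[OF c])
qed

lemma line_continuous: "continuous_on UNIV (\<lambda>t. y + t *\<^sub>R (v :: real^'n))"
  by (intro continuous_intros)

lemma pd_mult:
  assumes f: "smooth_fun S (fst c) f" and g: "smooth_fun S (fst c) g" and p: "p \<in> fst c"
  shows "pd c i (\<lambda>q. f q * g q) p = pd c i f p * g p + f p * pd c i g p"
  by (rule pd_unique[OF smooth_fun_mult[OF chart_open[OF c] f g] p])
     (use DERIV_mult[OF pd_has_derivative[OF f p, of i] pd_has_derivative[OF g p, of i]] in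
       \<open>simp add: cinv_coord[OF c p] algebra_simps\<close>)

lemma pd_sum:
  assumes f: "\<And>j. j \<in> J \<Longrightarrow> smooth_fun S (fst c) (f j)" and p: "p \<in> fst c"
  shows "pd c i (\<lambda>q. \<Sum>j\<in>J. f j q) p = (\<Sum>j\<in>J. pd c i (f j) p)"
  by (rule pd_unique[OF smooth_fun_sum[OF chart_open[OF c] f] p])
     (auto intro!: DERIV_sum pd_has_derivative f p)

lemma pd_diff:
  assumes f: "smooth_fun S (fst c) f" and g: "smooth_fun S (fst c) g" and p: "p \<in> fst c"
  shows "pd c i (\<lambda>q. f q - g q) p = pd c i f p - pd c i g p"
  by (rule pd_unique[OF smooth_fun_diff[OF chart_open[OF c] f g] p])
     (rule DERIV_diff[OF pd_has_derivative[OF f p] pd_has_derivative[OF g p]])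

lemma gmat_entry_smooth: "smooth_fun S (fst c) (\<lambda>q. gmat S c q $ a $ b)"
  by (rule gmat_smooth[OF c])

lemma pd_gmat_sym: "p \<in> fst c \<Longrightarrow> pd c i (\<lambda>q. gmat S c q $ a $ b) p = pd c i (\<lambda>q. gmat S c q $ b $ a) p"
proof -
  assume p: "p \<in> fst c"
  show ?thesis
  proof (rule pd_unique[OF gmat_entry_smooth p])
    let ?y = "\<lambda>t. snd c p + t *\<^sub>R axis i (1::real)"
    have "open {t. ?y t \<in> snd c ` fst c}"
      using open_vimage[OF chart_open_image[OF c] line_continuous] by (simp add: vimage_def)
    then show "((\<lambda>t. gmat S c (cinv c (?y t)) $ a $ b) has_real_derivative pd c i (\<lambda>q. gmat S c q $ b $ a) p) (at 0)"
      by (rule has_field_derivative_transform_within_open[OF pd_has_derivative[OF gmat_entry_smooth p]])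
         (use p in \<open>auto intro!: gmat_sym chart_at cinv_mem[OF c]\<close>)
  qed
qed

lemma pd_vol:
  assumes p: "p \<in> fst c"
  shows "pd c i (vol c) p = 1 / 2 * vol c p * (\<Sum>a\<in>UNIV. \<Sum>b\<in>UNIV. pd c i (\<lambda>q. gmat S c q $ a $ b) p * ginv c p $ b $ a)"
proof (rule pd_unique[OF vol_smooth p])
  let ?G = "\<lambda>t. gmat S c (cinv c (snd c p + t *\<^sub>R axis i 1))"
  let ?G' = "\<chi> a b. pd c i (\<lambda>q. gmat S c q $ a $ b) p"
  have G0: "?G 0 = gmat S c p" by (simp add: cinv_coord[OF c p])
  have nz: "det (gmat S c p) \<noteq> 0" by (rule gmat_det[OF chart_at[OF p]])
  have "((\<lambda>t. det (?G t)) has_real_derivative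
      det (?G 0) * (\<Sum>k\<in>UNIV. \<Sum>b\<in>UNIV. ?G' $ k $ b * matrix_inv (?G 0) $ b $ k)) (at 0)"
  proof (rule det_derivative)
    show "((\<lambda>t. ?G t $ k $ j) has_real_derivative ?G' $ k $ j) (at 0)" for k j
      unfolding vec_lambda_beta by (rule pd_has_derivative[OF gmat_entry_smooth p])
    show "det (?G 0) \<noteq> 0" unfolding G0 by (rule nz)
  qed
  then have d: "((\<lambda>t. det (?G t)) has_real_derivative
      det (gmat S c p) * (\<Sum>a\<in>UNIV. \<Sum>b\<in>UNIV. pd c i (\<lambda>q. gmat S c q $ a $ b) p * ginv c p $ b $ a)) (at 0)"
    unfolding G0 ginv_def vec_lambda_beta .
  have "((\<lambda>t. sqrt \<bar>det (?G t)\<bar>) has_real_derivative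
     (sqrt \<bar>det (?G 0)\<bar> / (2 * det (?G 0))) * (det (gmat S c p) * (\<Sum>a\<in>UNIV. \<Sum>b\<in>UNIV. pd c i (\<lambda>q. gmat S c q $ a $ b) p * ginv c p $ b $ a))) (at 0)"
    by (rule DERIV_chain2[OF DERIV_sqrt_abs d]) (unfold G0, rule nz)
  then show "((\<lambda>t. vol c (cinv c (snd c p + t *\<^sub>R axis i 1))) has_real_derivative
     1 / 2 * vol c p * (\<Sum>a\<in>UNIV. \<Sum>b\<in>UNIV. pd c i (\<lambda>q. gmat S c q $ a $ b) p * ginv c p $ b $ a)) (at 0)"
    unfolding G0 vol_def using nz by simp
qed

text \<open>Obtained by differentiating the relation between the metric and its inverse.\<close>

lemma pd_ginv:
  assumes p: "p \<in> fst c"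
  shows "pd c i (\<lambda>q. ginv c q $ a $ k) p
    = - (\<Sum>d\<in>UNIV. \<Sum>b\<in>UNIV. ginv c p $ a $ b * pd c i (\<lambda>q. gmat S c q $ b $ d) p * ginv c p $ d $ k)"
proof -
  note O = chart_open[OF c] and cp = chart_at[OF p]
  let ?gi = "\<lambda>a b. ginv c p $ a $ b" and ?g = "\<lambda>a b. gmat S c p $ a $ b"
  let ?dgi = "\<lambda>a b. pd c i (\<lambda>q. ginv c q $ a $ b) p" and ?dg = "\<lambda>a b. pd c i (\<lambda>q. gmat S c q $ a $ b) p"
  have z: "(\<Sum>b\<in>UNIV. ?dgi a b * ?g b d + ?gi a b * ?dg b d) = 0" for d
  proof -
    have sm: "smooth_fun S (fst c) (\<lambda>q. ginv c q $ a $ b * gmat S c q $ b $ d)" for b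
      by (intro smooth_fun_mult O ginv_smooth gmat_entry_smooth)
    have "pd c i (\<lambda>q. \<Sum>b\<in>UNIV. ginv c q $ a $ b * gmat S c q $ b $ d) p = 0"
    proof (rule pd_unique[OF smooth_fun_sum[OF O sm] p])
      let ?y = "\<lambda>t. snd c p + t *\<^sub>R axis i (1::real)"
      have o: "open {t. ?y t \<in> snd c ` fst c}"
        using open_vimage[OF chart_open_image[OF c] line_continuous] by (simp add: vimage_def)
      have "((\<lambda>t. if a = d then 1 else 0) has_real_derivative 0) (at 0)" by simp
      then show "((\<lambda>t. \<Sum>b\<in>UNIV. ginv c (cinv c (?y t)) $ a $ b * gmat S c (cinv c (?y t)) $ b $ d) has_real_derivative 0) (at 0)"
        by (rule has_field_derivative_transform_within_open[OF _ o])
           (use p in \<open>auto simp: ginv_left_sum[OF chart_at[OF cinv_mem[OF c]]]\<close>)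
    qed
    then show ?thesis
      by (simp only: pd_sum[OF sm p] pd_mult[OF ginv_smooth gmat_entry_smooth p])
  qed
  have "?dgi a k = (\<Sum>b\<in>UNIV. ?dgi a b * (if b = k then 1 else 0))" by (rule sum_kronecker[symmetric])
  also have "\<dots> = (\<Sum>b\<in>UNIV. \<Sum>d\<in>UNIV. ?dgi a b * ?g b d * ?gi d k)"
    by (simp only: ginv_right_sum[OF cp, symmetric] sum_distrib_left mult.assoc)
  also have "\<dots> = (\<Sum>d\<in>UNIV. (\<Sum>b\<in>UNIV. ?dgi a b * ?g b d) * ?gi d k)"
    unfolding sum_distrib_right by (rule sum.swap)
  also have "\<dots> = (\<Sum>d\<in>UNIV. (- (\<Sum>b\<in>UNIV. ?gi a b * ?dg b d)) * ?gi d k)"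
  proof -
    have "(\<Sum>b\<in>UNIV. ?dgi a b * ?g b d) = - (\<Sum>b\<in>UNIV. ?gi a b * ?dg b d)" for d
      using z[of d] by (simp add: sum.distrib)
    then show ?thesis by simp
  qed
  also have "\<dots> = - (\<Sum>d\<in>UNIV. \<Sum>b\<in>UNIV. ?gi a b * ?dg b d * ?gi d k)"
    by (simp only: mult_minus_left sum_negf sum_distrib_right)
  finally show ?thesis .
qed

lemma christoffel_smooth: "smooth_fun S (fst c) (christoffel S c k i j)"
proof -
  have "smooth_fun S (fst c) (\<lambda>p. (\<Sum>l\<in>UNIV. ginv c p $ k $ l *
     (pd c i (\<lambda>q. gmat S c q $ j $ l) p + pd c j (\<lambda>q. gmat S c q $ i $ l) p - pd c l (\<lambda>q. gmat S c q $ i $ j) p)) * (1 / 2))"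
    by (intro smooth_fun_mult smooth_fun_sum smooth_fun_add smooth_fun_diff smooth_fun_const chart_open[OF c]
        ginv_smooth pd_smooth gmat_entry_smooth)
  then show ?thesis by (simp add: christoffel_def[abs_def] ginv_def)
qed

text \<open>The densitised inverse metric is parallel for the Levi-Civita connection. In this contracted form,
  the identity turns the d'Alembert operator into a divergence.\<close>

lemma densitised_metric_divergence:
  assumes p: "p \<in> fst c"
  shows "(\<Sum>i\<in>UNIV. pd c i (vol c) p * ginv c p $ i $ k + vol c p * pd c i (\<lambda>q. ginv c q $ i $ k) p)
    = - vol c p * (\<Sum>i\<in>UNIV. \<Sum>j\<in>UNIV. ginv c p $ i $ j * christoffel S c k i j p)"
proof -
  note cp = chart_at[OF p]
  define gi where "gi a b = ginv c p $ a $ b" for a b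
  define dg where "dg i a b = pd c i (\<lambda>q. gmat S c q $ a $ b) p" for i a b
  have gs: "gi a b = gi b a" for a b unfolding gi_def by (rule ginv_sym[OF cp])
  have ds: "dg i a b = dg i b a" for i a b unfolding dg_def by (rule pd_gmat_sym[OF p])
  let ?v = "vol c p"
  let ?P = "\<Sum>i\<in>UNIV. \<Sum>j\<in>UNIV. \<Sum>l\<in>UNIV. gi i j * gi k l * dg i j l"
  let ?Q = "\<Sum>i\<in>UNIV. \<Sum>j\<in>UNIV. \<Sum>l\<in>UNIV. gi i j * gi k l * dg l i j"
  have chr: "christoffel S c k i j p = (\<Sum>l\<in>UNIV. gi k l * (dg i j l + dg j i l - dg l i j)) / 2" for i j
    by (simp only: christoffel_def gi_def dg_def ginv_def)
  have "(\<Sum>i\<in>UNIV. \<Sum>j\<in>UNIV. gi i j * christoffel S c k i j p)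
      = (\<Sum>i\<in>UNIV. \<Sum>j\<in>UNIV. \<Sum>l\<in>UNIV. (gi i j * gi k l * dg i j l + gi i j * gi k l * dg j i l - gi i j * gi k l * dg l i j) / 2)"
    by (simp add: chr sum_divide_distrib sum_distrib_left algebra_simps)
  also have "\<dots> = (?P + (\<Sum>i\<in>UNIV. \<Sum>j\<in>UNIV. \<Sum>l\<in>UNIV. gi i j * gi k l * dg j i l) - ?Q) / 2"
    by (simp only: sum_divide_distrib[symmetric] sum.distrib sum_subtractf)
  also have "(\<Sum>i\<in>UNIV. \<Sum>j\<in>UNIV. \<Sum>l\<in>UNIV. gi i j * gi k l * dg j i l) = ?P"
  proof -
    have "(\<Sum>i\<in>UNIV. \<Sum>j\<in>UNIV. \<Sum>l\<in>UNIV. gi i j * gi k l * dg j i l)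
        = (\<Sum>j\<in>UNIV. \<Sum>i\<in>UNIV. \<Sum>l\<in>UNIV. gi i j * gi k l * dg j i l)" by (rule sum.swap)
    also have "\<dots> = (\<Sum>j\<in>UNIV. \<Sum>i\<in>UNIV. \<Sum>l\<in>UNIV. gi j i * gi k l * dg j i l)"
      by (intro sum.cong refl) (subst gs, rule refl)
    finally show ?thesis .
  qed
  finally have R: "(\<Sum>i\<in>UNIV. \<Sum>j\<in>UNIV. gi i j * christoffel S c k i j p) = (2 * ?P - ?Q) / 2" by simp
  have L1: "(\<Sum>i\<in>UNIV. (\<Sum>a\<in>UNIV. \<Sum>b\<in>UNIV. dg i a b * gi b a) * gi i k) = ?Q"
  proof -
    have "(\<Sum>i\<in>UNIV. (\<Sum>a\<in>UNIV. \<Sum>b\<in>UNIV. dg i a b * gi b a) * gi i k)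
        = (\<Sum>l\<in>UNIV. \<Sum>i\<in>UNIV. \<Sum>j\<in>UNIV. gi i j * gi k l * dg l i j)"
    proof (simp only: sum_distrib_right, intro sum.cong refl)
      fix l a b :: 'n show "dg l a b * gi b a * gi l k = gi a b * gi k l * dg l a b"
        using gs[of b a] gs[of l k] by simp
    qed
    also have "\<dots> = (\<Sum>i\<in>UNIV. \<Sum>l\<in>UNIV. \<Sum>j\<in>UNIV. gi i j * gi k l * dg l i j)" by (rule sum.swap)
    also have "\<dots> = ?Q" by (rule sum.cong[OF refl]) (rule sum.swap)
    finally show ?thesis .
  qed
  have L2: "(\<Sum>i\<in>UNIV. \<Sum>d\<in>UNIV. \<Sum>b\<in>UNIV. gi i b * dg i b d * gi d k) = ?P"
  proof (rule sum.cong[OF refl])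
    fix i :: 'n
    have "(\<Sum>d\<in>UNIV. \<Sum>b\<in>UNIV. gi i b * dg i b d * gi d k) = (\<Sum>b\<in>UNIV. \<Sum>d\<in>UNIV. gi i b * dg i b d * gi d k)"
      by (rule sum.swap)
    also have "\<dots> = (\<Sum>j\<in>UNIV. \<Sum>l\<in>UNIV. gi i j * gi k l * dg i j l)"
    proof (intro sum.cong refl)
      fix j l :: 'n show "gi i j * dg i j l * gi l k = gi i j * gi k l * dg i j l" using gs[of l k] by simp
    qed
    finally show "(\<Sum>d\<in>UNIV. \<Sum>b\<in>UNIV. gi i b * dg i b d * gi d k) = (\<Sum>j\<in>UNIV. \<Sum>l\<in>UNIV. gi i j * gi k l * dg i j l)" .
  qed
  have "(\<Sum>i\<in>UNIV. pd c i (vol c) p * gi i k + ?v * pd c i (\<lambda>q. ginv c q $ i $ k) p)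
     = (\<Sum>i\<in>UNIV. (1 / 2 * ?v) * ((\<Sum>a\<in>UNIV. \<Sum>b\<in>UNIV. dg i a b * gi b a) * gi i k)
          - ?v * (\<Sum>d\<in>UNIV. \<Sum>b\<in>UNIV. gi i b * dg i b d * gi d k))"
    by (intro sum.cong refl) (simp only: pd_vol[OF p] pd_ginv[OF p] gi_def dg_def mult.assoc mult_minus_right diff_conv_add_uminus)
  also have "\<dots> = (1 / 2 * ?v) * ?Q - ?v * ?P"
    unfolding sum_subtractf sum_distrib_left[symmetric] L1 L2 ..
  also have "\<dots> = - ?v * ((2 * ?P - ?Q) / 2)" by (simp add: algebra_simps)
  finally have F: "(\<Sum>i\<in>UNIV. pd c i (vol c) p * gi i k + ?v * pd c i (\<lambda>q. ginv c q $ i $ k) p) = - ?v * ((2 * ?P - ?Q) / 2)" .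
  show ?thesis unfolding gi_def[symmetric] F R ..
qed

end

end

section \<open>The Green identity, pointwise\<close>

locale dalembert_bundle = metric_bundle S
  for S :: "('m::t2_space, 'n::finite, 'f::real_vector, 'z) vbundle_scheme" +
  fixes B :: "'m \<Rightarrow> 'f \<Rightarrow> 'f" and D :: "('m \<Rightarrow> 'f) \<Rightarrow> 'm \<Rightarrow> 'f"
  assumes sa: "selfadjoint_endo S B" and dal: "dalembert_plus S B D"
begin

lemma B_linear: "linear (B p)" and B_sym: "h p (B p v) w = h p v (B p w)"
  using spec[OF conjunct1[OF sa[unfolded selfadjoint_endo_def]], of p] by blast+

lemma B_frame_smooth: "(W, e) \<in> frames S \<Longrightarrow> i < r \<Longrightarrow> smooth_section S W (\<lambda>p. B p (e i p))"
  using bspec[OF conjunct2[OF sa[unfolded selfadjoint_endo_def]], of "(W, e)"] unfolding prod.case by blast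

lemma D_eq: "smooth_section S UNIV s \<Longrightarrow> c \<in> atlas S \<Longrightarrow> p \<in> fst c \<Longrightarrow> D s p = dalembert S c s p + B p (s p)"
  using dal chart_at[of c p] unfolding dalembert_plus_def by blast

lemma B_smooth:
  assumes W: "open W" and s: "smooth_section S W s"
  shows "smooth_section S W (\<lambda>p. B p (s p))"
proof (rule smooth_section_local[OF W])
  fix p assume p: "p \<in> W"
  obtain W' e where fr: "(W', e) \<in> frames S" "p \<in> W'" using frame_exists by blast
  obtain a where a: "\<And>i. i < r \<Longrightarrow> smooth_fun S (W \<inter> W') (a i)" "\<And>p. p \<in> W \<inter> W' \<Longrightarrow> s p = (\<Sum>i<r. a i p *\<^sub>R e i p)"
    using smooth_sectionE[OF s fr(1)] by blast
  have O: "open (W \<inter> W')" using W frame_facts(1)[OF fr(1)] by blast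
  have "smooth_section S (W \<inter> W') (\<lambda>p. \<Sum>i<r. a i p *\<^sub>R B p (e i p))"
    by (intro smooth_section_sum[OF O] smooth_section_scale[OF O] a(1) smooth_section_subset[OF B_frame_smooth[OF fr(1)]]) auto
  then have "smooth_section S (W \<inter> W') (\<lambda>p. B p (s p))"
    by (rule smooth_section_cong) (simp add: a(2) linear_sum[OF B_linear] linear_cmul[OF B_linear])
  then show "\<exists>V. open V \<and> p \<in> V \<and> smooth_section S V (\<lambda>p. B p (s p))" using O p fr(2) by blast
qed

lemma conn_chart_smooth:
  assumes s: "smooth_section S UNIV s" and c: "c \<in> atlas S"
  shows "smooth_section S (fst c) (\<lambda>p. conn S s p (cvec S c i p))"
    and "smooth_section S (fst c) (\<lambda>p. conn S (\<lambda>q. conn S s q (cvec S c j q)) p (cvec S c i p))"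
proof -
  show 1: "smooth_section S (fst c) (\<lambda>p. conn S s p (cvec S c i p))" for i
    using conn_smooth[OF open_UNIV s c] by simp
  show "smooth_section S (fst c) (\<lambda>p. conn S (\<lambda>q. conn S s q (cvec S c j q)) p (cvec S c i p))"
    using conn_smooth[OF chart_open[OF c] 1 c] by simp
qed

lemma dalembert_smooth:
  assumes s: "smooth_section S UNIV s" and c: "c \<in> atlas S"
  shows "smooth_section S (fst c) (dalembert S c s)"
proof -
  note O = chart_open[OF c]
  have "smooth_section S (fst c) (\<lambda>p. \<Sum>i\<in>UNIV. \<Sum>j\<in>UNIV. ginv c p $ i $ j *\<^sub>R
     (conn S (\<lambda>q. conn S s q (cvec S c j q)) p (cvec S c i p)
       - (\<Sum>k\<in>UNIV. christoffel S c k i j p *\<^sub>R conn S s p (cvec S c k p))))"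
    by (intro smooth_section_sum[OF O] smooth_section_scale[OF O] smooth_section_diff[OF O]
        conn_chart_smooth[OF s c] ginv_smooth[OF c] christoffel_smooth[OF c])
  then show ?thesis by (simp only: dalembert_def[abs_def] ginv_def)
qed

lemma D_smooth:
  assumes s: "smooth_section S UNIV s"
  shows "smooth_section S UNIV (D s)"
proof (rule smooth_section_local[OF open_UNIV])
  fix p
  obtain c where c: "c \<in> atlas S" "p \<in> fst c" using chart_exists by blast
  note O = chart_open[OF c(1)]
  have "smooth_section S (fst c) (\<lambda>q. dalembert S c s q + B q (s q))"
    by (intro smooth_section_add[OF O] dalembert_smooth[OF s c(1)] B_smooth[OF O] smooth_section_subset[OF s]) simp
  then have "smooth_section S (fst c) (D s)"
    by (rule smooth_section_cong) (simp add: D_eq[OF s c(1)])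
  with O c(2) show "\<exists>V. open V \<and> p \<in> V \<and> smooth_section S V (D s)" by blast
qed

text \<open>Differential operators are local: this bounds the support of \<open>D s\<close>.\<close>

lemma D_zero:
  assumes s: "smooth_section S UNIV s" and W: "open W" "\<And>q. q \<in> W \<Longrightarrow> s q = 0" "p \<in> W"
  shows "D s p = 0"
proof -
  obtain c where c: "c \<in> atlas S" "p \<in> fst c" using chart_exists by blast
  have O: "open (W \<inter> fst c)" using W(1) chart_open[OF c(1)] by blast
  have 1: "conn S s q (cvec S c k q) = 0" if "q \<in> W \<inter> fst c" for q k
    using that by (intro conn_zero[OF W(1,2)] cvec_tangent chart_at[OF c(1)]) auto
  have 2: "conn S (\<lambda>q. conn S s q (cvec S c j q)) p (cvec S c i p) = 0" for i j
    using W(3) c(2) by (intro conn_zero[OF O 1] cvec_tangent chart_at[OF c(1)]) auto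
  have 3: "conn S s p (cvec S c k p) = 0" for k using 1 W(3) c(2) by blast
  have "dalembert S c s p = 0" unfolding dalembert_def 2 3 by simp
  then show ?thesis using D_eq[OF s c] W by (simp add: linear_0[OF B_linear])
qed

lemma D_add:
  assumes s: "smooth_section S UNIV s" and t: "smooth_section S UNIV t"
  shows "D (\<lambda>q. s q + t q) p = D s p + D t p"
proof -
  obtain c where c: "c \<in> atlas S" "p \<in> fst c" using chart_exists by blast
  note O = chart_open[OF c(1)]
  have st: "smooth_section S UNIV (\<lambda>q. s q + t q)" by (rule smooth_section_add[OF open_UNIV s t])
  have 1: "conn S (\<lambda>q. s q + t q) q (cvec S c k q) = conn S s q (cvec S c k q) + conn S t q (cvec S c k q)"
    if "q \<in> fst c" for q k
    by (rule conn_add[OF open_UNIV s t UNIV_I cvec_tangent[OF chart_at[OF c(1) that]]])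
  have 2: "conn S (\<lambda>q. conn S (\<lambda>q. s q + t q) q (cvec S c j q)) p (cvec S c i p)
     = conn S (\<lambda>q. conn S s q (cvec S c j q)) p (cvec S c i p) + conn S (\<lambda>q. conn S t q (cvec S c j q)) p (cvec S c i p)" for i j
  proof -
    note T = cvec_tangent[OF chart_at[OF c]]
    have "conn S (\<lambda>q. conn S (\<lambda>q. s q + t q) q (cvec S c j q)) p (cvec S c i p)
      = conn S (\<lambda>q. conn S s q (cvec S c j q) + conn S t q (cvec S c j q)) p (cvec S c i p)"
      by (rule conn_cong[OF O conn_chart_smooth(1)[OF st c(1)] 1 c(2) T])
    also have "\<dots> = conn S (\<lambda>q. conn S s q (cvec S c j q)) p (cvec S c i p) + conn S (\<lambda>q. conn S t q (cvec S c j q)) p (cvec S c i p)"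
      by (rule conn_add[OF O conn_chart_smooth(1)[OF s c(1)] conn_chart_smooth(1)[OF t c(1)] c(2) T])
    finally show ?thesis .
  qed
  have "dalembert S c (\<lambda>q. s q + t q) p = dalembert S c s p + dalembert S c t p"
    unfolding dalembert_def 2 1[OF c(2)]
    by (simp only: scaleR_add_right sum.distrib add_diff_add)
  then show ?thesis using D_eq[OF st c] D_eq[OF s c] D_eq[OF t c] by (simp add: linear_add[OF B_linear])
qed

text \<open>The current whose divergence measures the failure of pointwise symmetry of \<open>D\<close>.\<close>

definition current :: "('m \<Rightarrow> 'f) \<Rightarrow> ('m \<Rightarrow> 'f) \<Rightarrow> ('m, 'n) chart \<Rightarrow> 'n \<Rightarrow> 'm \<Rightarrow> real" where
  "current u v c j q = h q (conn S u q (cvec S c j q)) (v q) - h q (u q) (conn S v q (cvec S c j q))"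

context
  fixes u v c
  assumes u: "smooth_section S UNIV u" and v: "smooth_section S UNIV v" and c: "c \<in> atlas S"
begin

lemma current_smooth: "smooth_fun S (fst c) (current u v c j)"
  unfolding current_def[abs_def]
  by (intro smooth_fun_diff h_smooth chart_open[OF c] conn_chart_smooth[OF u c] conn_chart_smooth[OF v c]
      smooth_section_subset[OF u] smooth_section_subset[OF v] subset_UNIV)

text \<open>The connection is metric, so derivatives of the fibre metric are expressed by covariant
  derivatives.\<close>

lemma pd_current:
  assumes p: "p \<in> fst c"
  shows "pd c i (current u v c j) p =
    h p (conn S (\<lambda>q. conn S u q (cvec S c j q)) p (cvec S c i p)) (v p)
    - h p (u p) (conn S (\<lambda>q. conn S v q (cvec S c j q)) p (cvec S c i p))
    + (h p (conn S u p (cvec S c j p)) (conn S v p (cvec S c i p)) - h p (conn S u p (cvec S c i p)) (conn S v p (cvec S c j p)))"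
proof -
  note O = chart_open[OF c] and cp = chart_at[OF c p]
  note u' = smooth_section_subset[OF u subset_UNIV] and v' = smooth_section_subset[OF v subset_UNIV]
  note cu = conn_chart_smooth(1)[OF u c] and cv = conn_chart_smooth(1)[OF v c]
  have "pd c i (current u v c j) p = pd c i (\<lambda>q. h q (conn S u q (cvec S c j q)) (v q)) p
      - pd c i (\<lambda>q. h q (u q) (conn S v q (cvec S c j q))) p"
    unfolding current_def[abs_def] by (rule pd_diff[OF c h_smooth[OF O cu v'] h_smooth[OF O u' cv] p])
  also have "\<dots> = (h p (conn S (\<lambda>q. conn S u q (cvec S c j q)) p (cvec S c i p)) (v p)
      + h p (conn S u p (cvec S c j p)) (conn S v p (cvec S c i p)))
    - (h p (conn S u p (cvec S c i p)) (conn S v p (cvec S c j p))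
      + h p (u p) (conn S (\<lambda>q. conn S v q (cvec S c j q)) p (cvec S c i p)))"
    by (simp only: conn_metric[OF O cu v' p cp] conn_metric[OF O u' cv p cp])
  finally show ?thesis by simp
qed

text \<open>The products of first derivatives in the derivative of the current are antisymmetric in \<open>i\<close>, \<open>j\<close>
  and cancel against the symmetric inverse metric; \<open>B\<close> drops out because it is symmetric.\<close>

lemma green_pointwise:
  assumes p: "p \<in> fst c"
  shows "h p (D u p) (v p) - h p (u p) (D v p) =
    (\<Sum>i\<in>UNIV. \<Sum>j\<in>UNIV. ginv c p $ i $ j *
      (pd c i (current u v c j) p - (\<Sum>k\<in>UNIV. christoffel S c k i j p * current u v c k p)))"
proof -
  define g where "g i j = ginv c p $ i $ j" for i j
  define x where "x i j = h p (conn S (\<lambda>q. conn S u q (cvec S c j q)) p (cvec S c i p)) (v p)" for i j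
  define y where "y i j = h p (u p) (conn S (\<lambda>q. conn S v q (cvec S c j q)) p (cvec S c i p))" for i j
  define z where "z i j = h p (conn S u p (cvec S c j p)) (conn S v p (cvec S c i p))" for i j
  define G where "G k i j = christoffel S c k i j p" for k i j
  define A where "A k = h p (conn S u p (cvec S c k p)) (v p)" for k
  define A' where "A' k = h p (u p) (conn S v p (cvec S c k p))" for k
  have 1: "h p (dalembert S c u p) (v p) = (\<Sum>i\<in>UNIV. \<Sum>j\<in>UNIV. g i j * (x i j - (\<Sum>k\<in>UNIV. G k i j * A k)))"
    by (simp only: dalembert_def linear_sum[OF h_linear_left] linear_cmul[OF h_linear_left] linear_diff[OF h_linear_left]
        real_scaleR_def g_def x_def G_def A_def ginv_def)
  have 2: "h p (u p) (dalembert S c v p) = (\<Sum>i\<in>UNIV. \<Sum>j\<in>UNIV. g i j * (y i j - (\<Sum>k\<in>UNIV. G k i j * A' k)))"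
    by (simp only: dalembert_def linear_sum[OF h_linear] linear_cmul[OF h_linear] linear_diff[OF h_linear]
        real_scaleR_def g_def y_def G_def A'_def ginv_def)
  \<comment> \<open>cancellation of the products of first derivatives\<close>
  have sym: "(\<Sum>i\<in>UNIV. \<Sum>j\<in>UNIV. g i j * z j i) = (\<Sum>i\<in>UNIV. \<Sum>j\<in>UNIV. g i j * z i j)"
  proof -
    have "(\<Sum>i\<in>UNIV. \<Sum>j\<in>UNIV. g i j * z j i) = (\<Sum>j\<in>UNIV. \<Sum>i\<in>UNIV. g i j * z j i)" by (rule sum.swap)
    also have "\<dots> = (\<Sum>j\<in>UNIV. \<Sum>i\<in>UNIV. g j i * z j i)"
      unfolding g_def by (intro sum.cong refl arg_cong2[where f="(*)"] ginv_sym[OF chart_at[OF c p]])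
    finally show ?thesis .
  qed
  have "(\<Sum>i\<in>UNIV. \<Sum>j\<in>UNIV. ginv c p $ i $ j *
      (pd c i (current u v c j) p - (\<Sum>k\<in>UNIV. christoffel S c k i j p * current u v c k p)))
    = (\<Sum>i\<in>UNIV. \<Sum>j\<in>UNIV. (g i j * (x i j - (\<Sum>k\<in>UNIV. G k i j * A k)) - g i j * (y i j - (\<Sum>k\<in>UNIV. G k i j * A' k)))
        + (g i j * z i j - g i j * z j i))"
    unfolding pd_current[OF p] current_def[of u v c _ p] g_def x_def y_def z_def G_def A_def A'_def
    by (intro sum.cong refl) (simp add: algebra_simps sum_subtractf)
  also have "\<dots> = h p (dalembert S c u p) (v p) - h p (u p) (dalembert S c v p)"
    unfolding sum.distrib sum_subtractf sym 1 2 by simp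
  also have "\<dots> = h p (D u p) (v p) - h p (u p) (D v p)"
    by (simp add: D_eq[OF u c p] D_eq[OF v c p] linear_add[OF h_linear_left] linear_add[OF h_linear] B_sym)
  finally show ?thesis ..
qed

text \<open>The current with raised index, as a density: its coordinate divergence is a covariant one.\<close>

definition flux :: "'n \<Rightarrow> 'm \<Rightarrow> real" where
  "flux i q = (\<Sum>k\<in>UNIV. vol c q * ginv c q $ i $ k * current u v c k q)"

lemma flux_smooth: "smooth_fun S (fst c) (flux i)"
  unfolding flux_def[abs_def]
  by (intro smooth_fun_sum smooth_fun_mult vol_smooth[OF c, unfolded eta_contract_eq] ginv_smooth[OF c] current_smooth chart_open[OF c])

text \<open>The derivatives falling on the densitised inverse metric produce exactly the Christoffel terms
  of the d'Alembert operator.\<close>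

lemma green_divergence:
  assumes p: "p \<in> fst c"
  shows "vol c p * (h p (D u p) (v p) - h p (u p) (D v p)) = (\<Sum>i\<in>UNIV. pd c i (flux i) p)"
proof -
  note O = chart_open[OF c]
  have vs: "smooth_fun S (fst c) (\<lambda>q. vol c q)" by (rule vol_smooth[OF c])
  have vg: "smooth_fun S (fst c) (\<lambda>q. vol c q * ginv c q $ i $ k)" for i k
    by (rule smooth_fun_mult[OF O vs ginv_smooth[OF c]])
  have "pd c i (flux i) p = (\<Sum>k\<in>UNIV. (pd c i (vol c) p * ginv c p $ i $ k + vol c p * pd c i (\<lambda>q. ginv c q $ i $ k) p) * current u v c k p
      + vol c p * ginv c p $ i $ k * pd c i (current u v c k) p)" for i
    unfolding flux_def[abs_def]
    by (simp only: pd_sum[OF c smooth_fun_mult[OF O vg current_smooth] p] pd_mult[OF c vg current_smooth p]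
        pd_mult[OF c vs ginv_smooth[OF c] p])
  then have "(\<Sum>i\<in>UNIV. pd c i (flux i) p) =
      (\<Sum>i\<in>UNIV. \<Sum>k\<in>UNIV. (pd c i (vol c) p * ginv c p $ i $ k + vol c p * pd c i (\<lambda>q. ginv c q $ i $ k) p) * current u v c k p)
      + (\<Sum>i\<in>UNIV. \<Sum>k\<in>UNIV. vol c p * ginv c p $ i $ k * pd c i (current u v c k) p)"
    by (simp only: sum.distrib)
  also have "(\<Sum>i\<in>UNIV. \<Sum>k\<in>UNIV. (pd c i (vol c) p * ginv c p $ i $ k + vol c p * pd c i (\<lambda>q. ginv c q $ i $ k) p) * current u v c k p)
      = (\<Sum>k\<in>UNIV. (\<Sum>i\<in>UNIV. pd c i (vol c) p * ginv c p $ i $ k + vol c p * pd c i (\<lambda>q. ginv c q $ i $ k) p) * current u v c k p)"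
    unfolding sum_distrib_right by (rule sum.swap)
  also have "\<dots> = (\<Sum>k\<in>UNIV. \<Sum>i\<in>UNIV. \<Sum>j\<in>UNIV. - (vol c p * (ginv c p $ i $ j * (christoffel S c k i j p * current u v c k p))))"
    unfolding densitised_metric_divergence[OF c p]
    by (simp add: sum_distrib_left sum_distrib_right sum_negf mult.assoc)
  also have "\<dots> = (\<Sum>i\<in>UNIV. \<Sum>k\<in>UNIV. \<Sum>j\<in>UNIV. - (vol c p * (ginv c p $ i $ j * (christoffel S c k i j p * current u v c k p))))"
    by (rule sum.swap)
  also have "\<dots> = (\<Sum>i\<in>UNIV. \<Sum>j\<in>UNIV. \<Sum>k\<in>UNIV. - (vol c p * (ginv c p $ i $ j * (christoffel S c k i j p * current u v c k p))))"
    by (rule sum.cong[OF refl]) (rule sum.swap)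
  also have "\<dots> + (\<Sum>i\<in>UNIV. \<Sum>k\<in>UNIV. vol c p * ginv c p $ i $ k * pd c i (current u v c k) p)
     = (\<Sum>i\<in>UNIV. \<Sum>j\<in>UNIV. vol c p * (ginv c p $ i $ j *
      (pd c i (current u v c j) p - (\<Sum>k\<in>UNIV. christoffel S c k i j p * current u v c k p))))"
    unfolding sum.distrib[symmetric]
    by (intro sum.cong refl) (simp add: sum_negf sum_distrib_left right_diff_distrib mult.assoc)
  also have "\<dots> = vol c p * (h p (D u p) (v p) - h p (u p) (D v p))"
    by (simp only: green_pointwise[OF p] sum_distrib_left)
  finally show ?thesis ..
qed

end

end

section \<open>Integrals of derivatives of compactly supported functions\<close>

lemma integrable_compact_support_lborel:
  fixes f :: "'a::euclidean_space \<Rightarrow> real"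
  assumes "continuous_on UNIV f" "compact C" "\<And>y. y \<notin> C \<Longrightarrow> f y = 0"
  shows "integrable lborel f"
proof -
  have "bounded (f ` C)"
    by (intro compact_imp_bounded compact_continuous_image continuous_on_subset[OF assms(1)] assms(2)) simp
  then obtain M where M: "\<And>y. y \<in> C \<Longrightarrow> norm (f y) \<le> M" unfolding bounded_iff by blast
  show ?thesis
    by (rule integrableI_bounded_set[of C _ _ M])
       (use assms M emeasure_bounded_finite[OF compact_imp_bounded[OF assms(2)]] in
         \<open>auto intro: borel_measurable_continuous_onI borel_compact\<close>)
qed

text \<open>The difference quotients integrate to zero, as Lebesgue measure is invariant under translations.
  They are dominated by a multiple of the indicator function of a ball, so the limit may be taken
  under the integral.\<close>

lemma integral_directional_derivative:
  fixes f g :: "'a::euclidean_space \<Rightarrow> real"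
  assumes f: "continuous_on UNIV f" and g: "continuous_on UNIV g" and C: "compact C"
    and f0: "\<And>y. y \<notin> C \<Longrightarrow> f y = 0" and g0: "\<And>y. y \<notin> C \<Longrightarrow> g y = 0"
    and d: "\<And>y. ((\<lambda>t. f (y + t *\<^sub>R e)) has_real_derivative g y) (at 0)"
  shows "integral\<^sup>L lborel g = 0"
proof -
  have fi: "integrable lborel f" by (rule integrable_compact_support_lborel[OF f C f0])
  have "bounded (g ` C)"
    by (intro compact_imp_bounded compact_continuous_image continuous_on_subset[OF g] C) simp
  then obtain M0 where M0: "\<And>y. y \<in> C \<Longrightarrow> norm (g y) \<le> M0" unfolding bounded_iff by blast
  define M where "M = \<bar>M0\<bar>"
  have M: "\<bar>g y\<bar> \<le> M" for y using M0[of y] g0[of y] by (cases "y \<in> C") (auto simp: M_def)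
  obtain R where R: "\<And>y. y \<in> C \<Longrightarrow> norm y \<le> R" using compact_imp_bounded[OF C] unfolding bounded_iff by blast
  \<comment> \<open>contains the supports of all difference quotients, whose step is at most 1\<close>
  let ?C' = "cball (0::'a) (R + norm e)"
  define F where "F n y = real (Suc n) * (f (y + (1 / real (Suc n)) *\<^sub>R e) - f y)" for n y
  have deriv: "((\<lambda>t. f (y + t *\<^sub>R e)) has_real_derivative g (y + t *\<^sub>R e)) (at t)" for y t
  proof -
    have "((\<lambda>s. f ((y + t *\<^sub>R e) + s *\<^sub>R e)) has_real_derivative g (y + t *\<^sub>R e)) (at 0)" by (rule d)
    then have "((\<lambda>s. f (y + (s + t) *\<^sub>R e)) has_real_derivative g (y + t *\<^sub>R e)) (at 0)"
      by (simp add: scaleR_add_left add_ac)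
    then show ?thesis using DERIV_shift[of "\<lambda>t. f (y + t *\<^sub>R e)" "g (y + t *\<^sub>R e)" 0 t] by simp
  qed
  have bound: "\<bar>F n y\<bar> \<le> M" for n y
  proof -
    have "\<exists>z>0. z < 1 / real (Suc n) \<and> f (y + (1 / real (Suc n)) *\<^sub>R e) - f (y + 0 *\<^sub>R e) = (1 / real (Suc n) - 0) * g (y + z *\<^sub>R e)"
      by (rule MVT2) (use deriv in auto)
    then obtain z where "f (y + (1 / real (Suc n)) *\<^sub>R e) - f y = (1 / real (Suc n)) * g (y + z *\<^sub>R e)" by auto
    then have "F n y = g (y + z *\<^sub>R e)" by (simp add: F_def)
    then show ?thesis using M by simp
  qed
  have supp: "F n y = 0" if "y \<notin> ?C'" for n y
  proof -
    have y: "norm y > R + norm e" using that by simp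
    have "norm ((1 / real (Suc n)) *\<^sub>R e) \<le> 1 * norm e"
      unfolding norm_scaleR by (intro mult_right_mono) auto
    then have "norm (y + (1 / real (Suc n)) *\<^sub>R e) > R"
      using y norm_triangle_ineq4[of "y + (1 / real (Suc n)) *\<^sub>R e" "(1 / real (Suc n)) *\<^sub>R e"] by simp
    then have "y + (1 / real (Suc n)) *\<^sub>R e \<notin> C" "y \<notin> C"
      using R y norm_ge_zero[of e] by fastforce+
    then show ?thesis by (simp add: F_def f0)
  qed
  have shift: "integrable lborel (\<lambda>y. f (y + v))" "(\<integral>y. f (y + v) \<partial>lborel) = integral\<^sup>L lborel f" for v
  proof -
    have D: "distr lborel borel ((+) v) = lborel" by (rule lborel_distr_plus)
    have m: "(+) v \<in> borel_measurable lborel" by simp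
    have fm: "f \<in> borel_measurable borel" by (rule borel_measurable_continuous_onI[OF f])
    show "integrable lborel (\<lambda>y. f (y + v))"
      using integrable_distr_eq[OF m fm] fi by (simp add: D add.commute)
    show "(\<integral>y. f (y + v) \<partial>lborel) = integral\<^sup>L lborel f"
      using integral_distr[OF m fm] by (simp add: D add.commute)
  qed
  have F0: "integral\<^sup>L lborel (F n) = 0" for n
    unfolding F_def using shift fi by simp
  have Fc: "continuous_on UNIV (F n)" for n
    unfolding F_def[abs_def] by (intro continuous_intros continuous_on_compose2[OF f]) auto
  have Fm: "F n \<in> borel_measurable lborel" for n
    using borel_measurable_continuous_onI[OF Fc] by simp
  have lim: "(\<lambda>n. F n y) \<longlonglongrightarrow> g y" for y
  proof -
    have "((\<lambda>t. (f (y + t *\<^sub>R e) - f y) / t) \<longlongrightarrow> g y) (at 0)"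
      using d[of y] by (simp add: DERIV_def)
    moreover have "filterlim (\<lambda>n. 1 / real (Suc n)) (at 0) sequentially"
      by (rule filterlim_atI[OF LIMSEQ_Suc[OF lim_1_over_n]]) simp
    ultimately have "(\<lambda>n. (f (y + (1 / real (Suc n)) *\<^sub>R e) - f y) / (1 / real (Suc n))) \<longlonglongrightarrow> g y"
      by (rule filterlim_compose)
    then show ?thesis by (simp add: F_def field_simps)
  qed
  have "(\<lambda>n. integral\<^sup>L lborel (F n)) \<longlonglongrightarrow> integral\<^sup>L lborel g"
  proof (rule integral_dominated_convergence[where w="\<lambda>y. M * indicator ?C' y"])
    show "g \<in> borel_measurable lborel" using borel_measurable_continuous_onI[OF g] by simp
    show "integrable lborel (\<lambda>y. M * indicator ?C' y)"
      using emeasure_bounded_finite[of ?C'] by (intro integrable_mult_right integrable_real_indicator) auto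
    show "AE y in lborel. norm (F n y) \<le> M * indicator ?C' y" for n
      by (rule AE_I2) (use bound supp in \<open>auto simp: indicator_def\<close>)
  qed (use Fm lim in auto)
  then have "(\<lambda>n. 0) \<longlonglongrightarrow> integral\<^sup>L lborel g" unfolding F0 .
  from LIMSEQ_unique[OF this tendsto_const] show ?thesis .
qed

section \<open>Integration with respect to the metric density\<close>

locale density_bundle = dalembert_bundle S B D
  for S :: "('m::t2_space, 'n::finite, 'f::real_vector, 'z) vbundle_scheme" and B D +
  fixes \<mu> :: "'m measure"
  assumes dens: "metric_density S \<mu>"
begin

lemma sets_mu: "sets \<mu> = sets borel" using dens unfolding metric_density_def by blast

lemma emeasure_chart: "c \<in> atlas S \<Longrightarrow> A \<in> sets borel \<Longrightarrow> A \<subseteq> fst c \<Longrightarrow>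
    emeasure \<mu> A = (\<integral>\<^sup>+y. indicator (snd c ` A) y * ennreal (vol c (cinv c y)) \<partial>lborel)"
  using conjunct2[OF dens[unfolded metric_density_def]] unfolding vol_def by (elim ballE impE) auto

lemma measurable_mu: "measurable \<mu> N = measurable borel N"
  by (rule measurable_cong_sets[OF sets_mu refl])

lemma vol_cinv_continuous:
  assumes c: "c \<in> atlas S"
  shows "continuous_on (snd c ` fst c) (\<lambda>y. vol c (cinv c y))"
  using Ck_continuous[OF smooth_funD[OF vol_smooth[OF c] c, of 0]] by simp

lemma vol_nonneg: "vol c p \<ge> 0" by (simp add: vol_def)

text \<open>The density of \<open>\<mu>\<close> in a chart is continuous, hence bounded on a closed ball of coordinates.\<close>

lemma locally_finite: "\<exists>V. open V \<and> p \<in> V \<and> emeasure \<mu> V < \<infinity>"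
proof -
  obtain c where c: "c \<in> atlas S" "p \<in> fst c" using chart_exists by blast
  obtain e where e: "e > 0" "cball (snd c p) e \<subseteq> snd c ` fst c"
    using open_contains_cball[THEN iffD1, OF chart_open_image[OF c(1)]] c(2) by blast
  let ?b = "ball (snd c p) e" and ?C = "cball (snd c p) e"
  define V where "V = fst c \<inter> snd c -` ?b"
  have V: "open V" "p \<in> V" "V \<subseteq> fst c"
    unfolding V_def using coord_preimage_open[OF c(1) open_ball] c(2) e(1) by auto
  have im: "snd c ` V \<subseteq> ?C" by (auto simp: V_def)
  have "bounded ((\<lambda>y. vol c (cinv c y)) ` ?C)"
    by (intro compact_imp_bounded compact_continuous_image continuous_on_subset[OF vol_cinv_continuous[OF c(1)] e(2)]) simp
  then obtain M where M: "\<And>y. y \<in> ?C \<Longrightarrow> norm (vol c (cinv c y)) \<le> M" unfolding bounded_iff by blast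
  have "emeasure \<mu> V = (\<integral>\<^sup>+y. indicator (snd c ` V) y * ennreal (vol c (cinv c y)) \<partial>lborel)"
    by (rule emeasure_chart[OF c(1) _ V(3)]) (use V in auto)
  also have "\<dots> \<le> (\<integral>\<^sup>+y. ennreal M * indicator ?C y \<partial>lborel)"
  proof (rule nn_integral_mono)
    fix y
    show "indicator (snd c ` V) y * ennreal (vol c (cinv c y)) \<le> ennreal M * indicator ?C y"
    proof (cases "y \<in> snd c ` V")
      case True
      then have y: "y \<in> ?C" using im by blast
      have "vol c (cinv c y) \<le> M" using M[OF y] by (simp add: abs_le_iff)
      then show ?thesis using True y by (simp add: ennreal_leI)
    qed simp
  qed
  also have "\<dots> = ennreal M * emeasure lborel ?C"
    by (rule nn_integral_cmult_indicator) simp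
  also have "\<dots> < \<infinity>"
    using emeasure_bounded_finite[OF bounded_cball, of "snd c p" e] by (simp add: ennreal_mult_less_top)
  finally show ?thesis using V by blast
qed

lemma emeasure_compact:
  assumes "compact K"
  shows "emeasure \<mu> K < \<infinity>"
proof -
  have "\<forall>p. \<exists>V. open V \<and> p \<in> V \<and> emeasure \<mu> V < \<infinity>" using locally_finite by blast
  from choice[OF this] obtain V where V: "\<forall>p. open (V p) \<and> p \<in> V p \<and> emeasure \<mu> (V p) < \<infinity>" ..
  have "K \<subseteq> (\<Union>p\<in>UNIV. V p)" using V by blast
  from compactE_image[OF assms _ this] V obtain T where T: "finite T" "K \<subseteq> (\<Union>p\<in>T. V p)" by metis
  have Vs: "V p \<in> sets \<mu>" for p using V sets_mu by auto
  have "emeasure \<mu> K \<le> emeasure \<mu> (\<Union>p\<in>T. V p)"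
    by (rule emeasure_mono[OF T(2)]) (use T(1) Vs in auto)
  also have "\<dots> \<le> (\<Sum>p\<in>T. emeasure \<mu> (V p))"
    by (rule emeasure_subadditive_finite[OF T(1)]) (use Vs in auto)
  also have "\<dots> < \<infinity>" using V T(1) by simp
  finally show ?thesis .
qed

lemma integrable_compact_support:
  fixes f :: "'m \<Rightarrow> real"
  assumes f: "smooth_fun S UNIV f" and K: "compact K" "\<And>q. q \<notin> K \<Longrightarrow> f q = 0"
  shows "integrable \<mu> f"
proof -
  have cf: "continuous_on UNIV f" by (rule smooth_fun_continuous[OF open_UNIV f])
  have "bounded (f ` K)"
    by (intro compact_imp_bounded compact_continuous_image continuous_on_subset[OF cf] K(1)) simp
  then obtain M where M: "\<And>y. y \<in> K \<Longrightarrow> norm (f y) \<le> M" unfolding bounded_iff by blast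
  show ?thesis
  proof (rule integrableI_bounded_set[of K _ _ M])
    show "K \<in> sets \<mu>" unfolding sets_mu by (rule borel_compact[OF K(1)])
    show "f \<in> borel_measurable \<mu>" unfolding measurable_mu by (rule borel_measurable_continuous_onI[OF cf])
    show "emeasure \<mu> K < \<infinity>" by (rule emeasure_compact[OF K(1)])
  qed (use M K(2) in auto)
qed

text \<open>On the domain of a chart, \<open>\<mu>\<close> is the image under the inverse chart of Lebesgue measure weighted
  with the volume density.\<close>

lemma integral_chart:
  fixes f :: "'m \<Rightarrow> real"
  assumes c: "c \<in> atlas S" and f: "f \<in> borel_measurable borel" and f0: "\<And>q. q \<notin> fst c \<Longrightarrow> f q = 0"
  shows "integral\<^sup>L \<mu> f = (\<integral>y. indicator (snd c ` fst c) y * (vol c (cinv c y) * f (cinv c y)) \<partial>lborel)"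
proof -
  let ?O = "snd c ` fst c"
  define T where "T y = (if y \<in> ?O then cinv c y else undefined)" for y
  define w where "w y = (if y \<in> ?O then vol c (cinv c y) else 0)" for y
  have Ob: "?O \<in> sets borel" using chart_open_image[OF c] by simp
  have Tm: "T \<in> measurable borel borel"
    unfolding T_def[abs_def]
    by (rule borel_measurable_continuous_on_if[OF Ob cinv_continuous[OF c] continuous_on_const])
  have wm: "w \<in> borel_measurable borel"
    unfolding w_def[abs_def]
    by (rule borel_measurable_continuous_on_if[OF Ob vol_cinv_continuous[OF c] continuous_on_const])
  have w0: "w y \<ge> 0" for y by (simp add: w_def vol_nonneg)
  have Fs: "fst c \<in> sets \<mu>" using chart_open[OF c] sets_mu by auto
  let ?M1 = "density \<mu> (\<lambda>q. ennreal (indicator (fst c) q))" and ?N = "density lborel (\<lambda>y. ennreal (w y))"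
  have "?M1 = distr ?N borel T"
  proof (rule measure_eqI)
    show "sets ?M1 = sets (distr ?N borel T)" by (simp add: sets_mu)
    fix A assume "A \<in> sets ?M1"
    then have A: "A \<in> sets borel" by (simp add: sets_mu)
    have AF: "A \<inter> fst c \<in> sets borel" using A chart_open[OF c] by auto
    have "emeasure ?M1 A = (\<integral>\<^sup>+q. indicator (A \<inter> fst c) q \<partial>\<mu>)"
    proof -
      have "emeasure ?M1 A = (\<integral>\<^sup>+q. ennreal (indicator (fst c) q) * indicator A q \<partial>\<mu>)"
        using A chart_open[OF c] by (intro emeasure_density) (auto simp: sets_mu measurable_mu)
      also have "\<dots> = (\<integral>\<^sup>+q. indicator (A \<inter> fst c) q \<partial>\<mu>)"
        by (rule nn_integral_cong) (simp split: split_indicator)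
      finally show ?thesis .
    qed
    also have "\<dots> = emeasure \<mu> (A \<inter> fst c)" using AF by (simp add: sets_mu)
    also have "\<dots> = (\<integral>\<^sup>+y. indicator (snd c ` (A \<inter> fst c)) y * ennreal (vol c (cinv c y)) \<partial>lborel)"
      by (rule emeasure_chart[OF c AF]) simp
    also have "\<dots> = (\<integral>\<^sup>+y. ennreal (w y) * indicator (T -` A) y \<partial>lborel)"
    proof (rule nn_integral_cong)
      fix y
      have "y \<in> snd c ` (A \<inter> fst c) \<longleftrightarrow> y \<in> ?O \<and> cinv c y \<in> A" by (rule coord_image_iff[OF c])
      then show "indicator (snd c ` (A \<inter> fst c)) y * ennreal (vol c (cinv c y)) = ennreal (w y) * indicator (T -` A) y"
        by (cases "y \<in> ?O"; cases "cinv c y \<in> A") (simp_all add: w_def T_def)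
    qed
    also have "\<dots> = emeasure ?N (T -` A)"
      using wm measurable_sets[OF Tm A] by (subst emeasure_density) auto
    also have "\<dots> = emeasure (distr ?N borel T) A"
      using Tm A by (subst emeasure_distr) auto
    finally show "emeasure ?M1 A = emeasure (distr ?N borel T) A" .
  qed
  then have "integral\<^sup>L ?M1 f = integral\<^sup>L (distr ?N borel T) f" by simp
  also have "\<dots> = (\<integral>y. f (T y) \<partial>?N)" using Tm f by (intro integral_distr) auto
  also have "\<dots> = (\<integral>y. w y *\<^sub>R f (T y) \<partial>lborel)"
    using wm w0 measurable_compose[OF Tm f] by (intro integral_density) auto
  also have "\<dots> = (\<integral>y. indicator ?O y * (vol c (cinv c y) * f (cinv c y)) \<partial>lborel)"
    by (rule Bochner_Integration.integral_cong) (auto simp: w_def T_def)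
  finally have 1: "integral\<^sup>L ?M1 f = (\<integral>y. indicator ?O y * (vol c (cinv c y) * f (cinv c y)) \<partial>lborel)" .
  have "integral\<^sup>L ?M1 f = (\<integral>q. indicator (fst c) q *\<^sub>R f q \<partial>\<mu>)"
    using f Fs by (intro integral_density) (auto simp: measurable_mu sets_mu)
  also have "\<dots> = integral\<^sup>L \<mu> f"
    by (rule Bochner_Integration.integral_cong) (use f0 in \<open>auto simp: indicator_def\<close>)
  finally show ?thesis using 1 by simp
qed

definition green_density :: "('m \<Rightarrow> 'f) \<Rightarrow> ('m \<Rightarrow> 'f) \<Rightarrow> 'm \<Rightarrow> real" where
  "green_density u v q = h q (D u q) (v q) - h q (u q) (D v q)"

context
  fixes u v K
  assumes u: "smooth_section S UNIV u" and v: "smooth_section S UNIV v"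
    and K: "compact K" "\<And>q. q \<notin> K \<Longrightarrow> u q = 0"
begin

lemma D_outside: "q \<notin> K \<Longrightarrow> D u q = 0"
  by (rule D_zero[OF u, of "- K"]) (use K compact_imp_closed in auto)

lemma green_density_outside: "q \<notin> K \<Longrightarrow> green_density u v q = 0"
  using D_outside K(2) by (simp add: green_density_def linear_0[OF h_linear_left])

lemma h_D_smooth: "smooth_fun S UNIV (\<lambda>q. h q (D u q) (v q))" "smooth_fun S UNIV (\<lambda>q. h q (u q) (D v q))"
  by (rule h_smooth[OF open_UNIV D_smooth[OF u] v], rule h_smooth[OF open_UNIV u D_smooth[OF v]])

lemma h_D_integrable: "integrable \<mu> (\<lambda>q. h q (D u q) (v q))" "integrable \<mu> (\<lambda>q. h q (u q) (D v q))"
  by (rule integrable_compact_support[OF h_D_smooth(1) K(1)], simp add: D_outside linear_0[OF h_linear_left],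
      rule integrable_compact_support[OF h_D_smooth(2) K(1)], simp add: K(2) linear_0[OF h_linear_left])

lemma green_density_integrable: "integrable \<mu> (green_density u v)"
  unfolding green_density_def[abs_def] by (rule Bochner_Integration.integrable_diff[OF h_D_integrable])

lemma flux_outside:
  assumes c: "c \<in> atlas S" and q: "q \<in> fst c" "q \<notin> K"
  shows "flux u v c i q = 0"
proof -
  have O: "open (- K)" using compact_imp_closed[OF K(1)] by blast
  have "conn S u q (cvec S c k q) = 0" for k
    by (rule conn_zero[OF O _ _ cvec_tangent[OF chart_at[OF c q(1)]]]) (use K(2) q in auto)
  then show ?thesis
    by (simp add: flux_def[OF u v c] current_def K(2)[OF q(2)] linear_0[OF h_linear_left])
qed

lemma pd_flux_outside:
  assumes c: "c \<in> atlas S" and q: "q \<in> fst c" "q \<notin> K"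
  shows "pd c i (flux u v c i) q = 0"
proof (rule pd_unique[OF c flux_smooth[OF u v c] q(1)])
  let ?y = "\<lambda>t. snd c q + t *\<^sub>R axis i (1::real)"
  have o: "open {t. ?y t \<in> snd c ` (- K \<inter> fst c)}"
    using open_vimage[OF coord_image_open[OF c open_Compl[OF compact_imp_closed[OF K(1)]]] line_continuous[OF c]] by (simp add: vimage_def)
  have "((\<lambda>t. 0) has_real_derivative 0) (at 0)" by simp
  then show "((\<lambda>t. flux u v c i (cinv c (?y t))) has_real_derivative 0) (at 0)"
  proof (rule has_field_derivative_transform_within_open[OF _ o])
    have "snd c q \<in> snd c ` (- K \<inter> fst c)" by (rule imageI) (use q in simp)
    then show "0 \<in> {t. ?y t \<in> snd c ` (- K \<inter> fst c)}" by simp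
    fix t assume "t \<in> {t. ?y t \<in> snd c ` (- K \<inter> fst c)}"
    then have "?y t \<in> snd c ` (- K \<inter> fst c)" by (rule CollectD)
    from this[unfolded coord_image_iff[OF c]] have "?y t \<in> snd c ` fst c" "cinv c (?y t) \<in> - K" by simp_all
    then show "0 = flux u v c i (cinv c (?y t))" using flux_outside[OF c cinv_mem[OF c]] by simp
  qed
qed

text \<open>Extended by zero, the components of the flux are differentiable on the whole coordinate space,
  and so the integral of their divergence vanishes.\<close>

lemma integral_green_density_chart:
  assumes c: "c \<in> atlas S" and Kc: "K \<subseteq> fst c"
  shows "integral\<^sup>L \<mu> (green_density u v) = 0"
proof -
  let ?O = "snd c ` fst c" and ?C = "snd c ` K"
  have C: "compact ?C" by (rule compact_continuous_image[OF continuous_on_subset[OF coord_continuous[OF c] Kc] K(1)])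
  have CO: "?C \<subseteq> ?O" using Kc by blast
  have outC: "cinv c y \<notin> K" if "y \<in> ?O" "y \<notin> ?C" for y
  proof
    assume "cinv c y \<in> K"
    then have "snd c (cinv c y) \<in> ?C" by (rule imageI)
    with that show False by (simp add: coord_cinv[OF c])
  qed
  define g where "g i y = (if y \<in> ?O then pd c i (flux u v c i) (cinv c y) else 0)" for i y
  define f where "f i y = (if y \<in> ?O then flux u v c i (cinv c y) else 0)" for i y
  have g0: "g i y = 0" if "y \<notin> ?C" for i y
    using that pd_flux_outside[OF c cinv_mem[OF c] outC] by (simp add: g_def)
  have f0: "f i y = 0" if "y \<notin> ?C" for i y
    using that flux_outside[OF c cinv_mem[OF c] outC] by (simp add: f_def)
  have cont: "continuous_on UNIV k" if k: "continuous_on ?O k" "\<And>y. y \<notin> ?C \<Longrightarrow> k y = 0" for k :: "real^'n \<Rightarrow> real"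
  proof -
    have oC: "open (- ?C)" using compact_imp_closed[OF C] by blast
    have "continuous_on (- ?C) k" by (rule continuous_on_eq[OF continuous_on_const[of _ 0]]) (use k(2) in auto)
    then have "continuous_on (?O \<union> - ?C) k" by (rule continuous_on_open_Un[OF chart_open_image[OF c] oC k(1)])
    moreover have "?O \<union> - ?C = UNIV" using CO by blast
    ultimately show ?thesis by simp
  qed
  have cont_g: "continuous_on UNIV (g i)" for i
  proof (rule cont[OF _ g0])
    have "continuous_on ?O (\<lambda>y. pd c i (flux u v c i) (cinv c y))"
      using Ck_continuous[OF smooth_funD[OF pd_smooth[OF c flux_smooth[OF u v c]] c, of 0]] by simp
    then show "continuous_on ?O (g i)" by (rule continuous_on_eq) (simp add: g_def)
  qed
  have cont_f: "continuous_on UNIV (f i)" for i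
  proof (rule cont[OF _ f0])
    have "continuous_on ?O (\<lambda>y. flux u v c i (cinv c y))"
      using Ck_continuous[OF smooth_funD[OF flux_smooth[OF u v c] c, of 0]] by simp
    then show "continuous_on ?O (f i)" by (rule continuous_on_eq) (simp add: f_def)
  qed
  have deriv: "((\<lambda>t. f i (y + t *\<^sub>R axis i 1)) has_real_derivative g i y) (at 0)" for i y
  proof (cases "y \<in> ?O")
    case True
    have o: "open {t. y + t *\<^sub>R axis i (1::real) \<in> ?O}"
      using open_vimage[OF chart_open_image[OF c] line_continuous[OF c]] by (simp add: vimage_def)
    have "((\<lambda>t. flux u v c i (cinv c (y + t *\<^sub>R axis i 1))) has_real_derivative g i y) (at 0)"
      using pd_has_derivative[OF c flux_smooth[OF u v c] cinv_mem[OF c True], of i i] True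
      by (simp add: g_def coord_cinv[OF c])
    then show ?thesis
      by (rule has_field_derivative_transform_within_open[OF _ o]) (use True in \<open>auto simp: f_def\<close>)
  next
    case False
    have o: "open {t. y + t *\<^sub>R axis i (1::real) \<in> - ?C}"
      using open_vimage[OF _ line_continuous[OF c], of "- ?C"] compact_imp_closed[OF C] by (simp add: vimage_def open_Compl)
    have "((\<lambda>t. 0) has_real_derivative g i y) (at 0)" using False by (simp add: g_def)
    then show ?thesis
      by (rule has_field_derivative_transform_within_open[OF _ o]) (use False CO f0 in auto)
  qed
  have g_int: "integral\<^sup>L lborel (g i) = 0" for i
    by (rule integral_directional_derivative[OF cont_f cont_g C f0 g0 deriv])
  have gi: "integrable lborel (g i)" for i by (rule integrable_compact_support_lborel[OF cont_g C g0])
  have gm: "green_density u v \<in> borel_measurable borel"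
    using borel_measurable_integrable[OF green_density_integrable] by (simp add: measurable_mu)
  have "integral\<^sup>L \<mu> (green_density u v)
      = (\<integral>y. indicator ?O y * (vol c (cinv c y) * green_density u v (cinv c y)) \<partial>lborel)"
    by (rule integral_chart[OF c gm]) (use green_density_outside Kc in blast)
  also have "\<dots> = (\<integral>y. (\<Sum>i\<in>UNIV. g i y) \<partial>lborel)"
  proof (rule Bochner_Integration.integral_cong[OF refl])
    fix y
    show "indicator ?O y * (vol c (cinv c y) * green_density u v (cinv c y)) = (\<Sum>i\<in>UNIV. g i y)"
    proof (cases "y \<in> ?O")
      case True
      then show ?thesis
        using green_divergence[OF u v c cinv_mem[OF c True]] by (simp add: g_def green_density_def)
    qed (simp add: g_def)
  qed
  also have "\<dots> = 0" using gi g_int by (subst Bochner_Integration.integral_sum) auto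
  finally show ?thesis .
qed

end

lemma green_density_add:
  assumes "smooth_section S UNIV u" "smooth_section S UNIV w"
  shows "green_density (\<lambda>q. u q + w q) v q = green_density u v q + green_density w v q"
  by (simp add: green_density_def D_add[OF assms] linear_add[OF h_linear_left])

text \<open>A compact support is covered by finitely many patches that carry a cutoff function with support
  in a chart. Splitting off one cutoff at a time, \<open>u = \<rho> u + (1 - \<rho>) u\<close>, removes one patch from
  the cover and leaves a section supported in a chart.\<close>

lemma integral_green_density:
  assumes v: "smooth_section S UNIV v" and u: "smooth_section S UNIV u" and K: "compact K" "\<And>q. q \<notin> K \<Longrightarrow> u q = 0"
  shows "integral\<^sup>L \<mu> (green_density u v) = 0"
proof -
  have "\<forall>p. \<exists>\<rho> V L. smooth_fun S UNIV \<rho> \<and> open V \<and> p \<in> V \<and> (\<forall>q\<in>V. \<rho> q = 1) \<and> compact L \<and> (\<exists>c\<in>atlas S. L \<subseteq> fst c) \<and> (\<forall>q. q \<notin> L \<longrightarrow> \<rho> q = 0)"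
    (is "\<forall>p. \<exists>\<rho> V L. ?P p \<rho> V L")
  proof
    fix p
    obtain c where c: "c \<in> atlas S" "p \<in> fst c" using chart_exists by blast
    obtain \<rho> V L where "smooth_fun S UNIV \<rho>" "open V" "p \<in> V" "\<And>q. q \<in> V \<Longrightarrow> \<rho> q = 1"
      "compact L" "L \<subseteq> fst c" "V \<subseteq> L" "\<And>q. q \<notin> L \<Longrightarrow> \<rho> q = 0"
      by (rule smooth_cutoff_point[OF chart_open[OF c(1)] c(2)]) blast
    then show "\<exists>\<rho> V L. ?P p \<rho> V L" using c(1) by blast
  qed
  from choice[OF this] obtain \<rho> where "\<forall>p. \<exists>V L. ?P p (\<rho> p) V L" ..
  from choice[OF this] obtain V where "\<forall>p. \<exists>L. ?P p (\<rho> p) (V p) L" ..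
  from choice[OF this] obtain L where L: "\<forall>p. ?P p (\<rho> p) (V p) (L p)" ..
  have ind: "\<forall>u K. smooth_section S UNIV u \<longrightarrow> compact K \<longrightarrow> (\<forall>q. q \<notin> K \<longrightarrow> u q = 0) \<longrightarrow> K \<subseteq> (\<Union>p\<in>T. V p)
      \<longrightarrow> integral\<^sup>L \<mu> (green_density u v) = 0" if "finite T" for T
    using that
  proof induction
    case empty
    show ?case
    proof (intro allI impI)
      fix u K assume u: "smooth_section S UNIV u" and K: "compact K" "\<forall>q. q \<notin> K \<longrightarrow> u q = 0" "K \<subseteq> (\<Union>p\<in>{}. V p)"
      have "green_density u v q = 0" for q
        by (rule green_density_outside[OF u v K(1)]) (use K in auto)
      then have "green_density u v = (\<lambda>q. 0)" by (rule ext)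
      then show "integral\<^sup>L \<mu> (green_density u v) = 0" by simp
    qed
  next
    case (insert p T)
    show ?case
    proof (intro allI impI)
      fix u K assume u: "smooth_section S UNIV u" and K: "compact K" "\<forall>q. q \<notin> K \<longrightarrow> u q = 0" "K \<subseteq> (\<Union>p\<in>insert p T. V p)"
      have \<rho>: "smooth_fun S UNIV (\<rho> p)" "open (V p)" "\<And>q. q \<in> V p \<Longrightarrow> \<rho> p q = 1" "compact (L p)" "\<And>q. q \<notin> L p \<Longrightarrow> \<rho> p q = 0"
        using L by blast+
      obtain c where c: "c \<in> atlas S" "L p \<subseteq> fst c" using L by blast
      let ?a = "\<lambda>q. \<rho> p q *\<^sub>R u q" and ?b = "\<lambda>q. (1 - \<rho> p q) *\<^sub>R u q"
      have a: "smooth_section S UNIV ?a" by (rule smooth_section_scale[OF open_UNIV \<rho>(1) u])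
      have b: "smooth_section S UNIV ?b"
        by (rule smooth_section_scale[OF open_UNIV smooth_fun_diff[OF open_UNIV smooth_fun_const[OF open_UNIV] \<rho>(1)] u])
      have a0: "?a q = 0" if "q \<notin> L p" for q using \<rho>(5)[OF that] by simp
      have b0: "?b q = 0" if "q \<notin> K - V p" for q using that K(2) \<rho>(3) by auto
      have Kb: "compact (K - V p)" by (rule compact_diff[OF K(1) \<rho>(2)])
      have "integral\<^sup>L \<mu> (green_density ?a v) = 0"
        by (rule integral_green_density_chart[OF a v \<rho>(4) a0 c])
      moreover have "integral\<^sup>L \<mu> (green_density ?b v) = 0"
      proof (rule insert.IH[rule_format, OF b Kb])
        show "K - V p \<subseteq> (\<Union>p\<in>T. V p)" using K(3) by blast
      qed (rule b0)
      moreover have "green_density u v = (\<lambda>q. green_density ?a v q + green_density ?b v q)"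
      proof
        fix q
        have "green_density (\<lambda>q. ?a q + ?b q) v q = green_density ?a v q + green_density ?b v q"
          by (rule green_density_add[OF a b])
        moreover have "(\<lambda>q. ?a q + ?b q) = u" by (simp add: fun_eq_iff scaleR_left_diff_distrib)
        ultimately show "green_density u v q = green_density ?a v q + green_density ?b v q" by simp
      qed
      ultimately show "integral\<^sup>L \<mu> (green_density u v) = 0"
        using green_density_integrable[OF a v \<rho>(4) a0] green_density_integrable[OF b v Kb b0] by simp
    qed
  qed
  have "K \<subseteq> (\<Union>p\<in>UNIV. V p)" using L by blast
  moreover have "open (V p)" for p using L by blast
  ultimately obtain T where T: "finite T" "K \<subseteq> (\<Union>p\<in>T. V p)" using compactE_image[OF K(1), of UNIV V] by metis
  show ?thesis by (rule ind[OF T(1), rule_format, OF u K(1) _ T(2)]) (rule K(2))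
qed

theorem D_formally_selfadjoint:
  assumes v: "smooth_section S UNIV v" and u: "smooth_section S UNIV u" and K: "compact K" "\<And>q. q \<notin> K \<Longrightarrow> u q = 0"
  shows "(\<integral>q. h q (D u q) (v q) \<partial>\<mu>) = (\<integral>q. h q (u q) (D v q) \<partial>\<mu>)"
  using integral_green_density[OF v u K] Bochner_Integration.integral_diff[OF h_D_integrable[OF u v K]]
  by (simp add: green_density_def[abs_def])

end

section \<open>Causality\<close>

lemma Jplus_mono: "A \<subseteq> A' \<Longrightarrow> Jplus S A \<subseteq> Jplus S A'"
  and Jminus_mono: "A \<subseteq> A' \<Longrightarrow> Jminus S A \<subseteq> Jminus S A'"
  unfolding Jplus_def Jminus_def by blast+

text \<open>The past relation is the converse of the future relation.\<close>

lemma spacelike_sym: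
  assumes "spacelike S U U'"
  shows "spacelike S U' U"
  using assms unfolding spacelike_def Jplus_def Jminus_def rtrancl_converse by blast

text \<open>Transitivity of the causal relation: futures of points in the future of \<open>q\<close> lie in the future of
  \<open>q\<close>.\<close>

lemma Jplus_finite_cover:
  assumes "K \<subseteq> (\<Union>q\<in>T. Jplus S {q})"
  shows "Jplus S K \<subseteq> (\<Union>q\<in>T. Jplus S {q})"
  using assms unfolding Jplus_def by (blast intro: rtrancl_trans)

lemma Jminus_finite_cover:
  assumes "K \<subseteq> (\<Union>q\<in>T. Jminus S {q})"
  shows "Jminus S K \<subseteq> (\<Union>q\<in>T. Jminus S {q})"
  using assms unfolding Jminus_def by (blast intro: rtrancl_trans)

locale oriented_mfd = lorentz_mfd S
  for S :: "('m::t2_space, 'n::finite, 'z) spacetime_scheme" +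
  assumes tor: "time_oriented S"
begin

lemma torient_tangent: "torient S p \<in> tangent_space S p"
  and torient_timelike: "lmetric S p (torient S p) (torient S p) > 0"
  and torient_smooth: "c \<in> atlas S \<Longrightarrow> smooth_fun S (fst c) (\<lambda>p. torient S p c $ i)"
  using tor unfolding time_oriented_def by blast+

text \<open>The metric in coordinates, at the point with coordinates \<open>y\<close>.\<close>

definition gform :: "('m, 'n) chart \<Rightarrow> real^'n \<Rightarrow> real^'n \<Rightarrow> real^'n \<Rightarrow> real" where
  "gform c y v w = (\<Sum>i\<in>UNIV. \<Sum>j\<in>UNIV. v $ i * w $ j * gmat S c (cinv c y) $ i $ j)"

text \<open>Points and directions of timelike future directed tangent vectors, in coordinates. Timelike
  instead of causal directions make this set open.\<close>

definition future_cone :: "('m, 'n) chart \<Rightarrow> ((real^'n) \<times> (real^'n)) set" where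
  "future_cone c = {(y, v). y \<in> snd c ` fst c \<and> gform c y v v > 0 \<and> gform c y (torient S (cinv c y) c) v > 0}"

context
  fixes c assumes c: "c \<in> atlas S"
begin

lemma charts_at_cinv: "y \<in> snd c ` fst c \<Longrightarrow> c \<in> charts_at S (cinv c y)"
  unfolding charts_at_def using c cinv_mem[OF c] by simp

lemma future_cone_causal:
  assumes "(y, v) \<in> future_cone c"
  shows "future_causal S (cinv c y) (tv c (cinv c y) v)"
proof -
  let ?p = "cinv c y"
  have y: "y \<in> snd c ` fst c" and pos: "gform c y v v > 0" "gform c y (torient S ?p c) v > 0"
    using assms by (auto simp: future_cone_def)
  note cp = charts_at_cinv[OF y]
  have tau: "torient S ?p = tv c ?p (torient S ?p c)" by (rule tangent_tv[OF torient_tangent cp])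
  have 1: "lmetric S ?p (tv c ?p v) (tv c ?p v) > 0" using pos(1) unfolding lmetric_tv[OF cp] gform_def .
  have 2: "lmetric S ?p (torient S ?p) (tv c ?p v) > 0"
    using pos(2) by (subst tau) (simp only: lmetric_tv[OF cp] gform_def)
  have "v \<noteq> 0" using pos(1) by (auto simp: gform_def)
  then have "tv c ?p v c \<noteq> 0" by (simp add: tv_self[OF cp])
  then have "tv c ?p v \<noteq> (\<lambda>_. 0)" by (metis (no_types))
  then show ?thesis unfolding future_causal_def using tv_tangent[OF cp] 1 2 by simp
qed

lemma future_cone_scale:
  assumes "(y, v) \<in> future_cone c" "s > 0"
  shows "(y, s *\<^sub>R v) \<in> future_cone c"
proof -
  have "gform c y w (s *\<^sub>R v) = s * gform c y w v" "gform c y (s *\<^sub>R v) w = s * gform c y v w" for w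
    unfolding gform_def sum_distrib_left by (intro sum.cong refl; simp add: mult_ac)+
  then show ?thesis using assms unfolding future_cone_def by simp
qed

lemma torient_future_cone:
  assumes "p \<in> fst c"
  shows "(snd c p, torient S p c) \<in> future_cone c"
proof -
  have cp: "c \<in> charts_at S p" using assms c by (simp add: charts_at_def)
  have tau: "torient S p = tv c p (torient S p c)" by (rule tangent_tv[OF torient_tangent cp])
  have "lmetric S p (tv c p (torient S p c)) (tv c p (torient S p c)) > 0"
    using torient_timelike[of p] tau by simp
  then show ?thesis
    using assms by (simp add: future_cone_def cinv_coord[OF c] gform_def lmetric_tv[OF cp])
qed

lemma future_cone_open: "open (future_cone c)"
proof -
  let ?O = "snd c ` fst c"
  let ?X = "?O \<times> (UNIV :: (real^'n) set)"
  have G: "continuous_on ?O (\<lambda>y. gmat S c (cinv c y) $ i $ j)" for i j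
    using Ck_continuous[OF smooth_funD[OF gmat_smooth[OF c] c, of 0]] by simp
  have T: "continuous_on ?O (\<lambda>y. torient S (cinv c y) c $ i)" for i
    using Ck_continuous[OF smooth_funD[OF torient_smooth[OF c] c, of 0]] by simp
  have G': "continuous_on ?X (\<lambda>z. gmat S c (cinv c (fst z)) $ i $ j)" for i j
    by (rule continuous_on_compose2[OF G continuous_on_fst[OF continuous_on_id]]) auto
  have T': "continuous_on ?X (\<lambda>z. torient S (cinv c (fst z)) c $ i)" for i
    by (rule continuous_on_compose2[OF T continuous_on_fst[OF continuous_on_id]]) auto
  have X: "open ?X" by (intro open_Times chart_open_image[OF c] open_UNIV)
  have 1: "continuous_on ?X (\<lambda>z. gform c (fst z) (snd z) (snd z))"
    unfolding gform_def by (intro continuous_intros G')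
  have 2: "continuous_on ?X (\<lambda>z. gform c (fst z) (torient S (cinv c (fst z)) c) (snd z))"
    unfolding gform_def by (intro continuous_intros G' T')
  have "future_cone c = (?X \<inter> (\<lambda>z. gform c (fst z) (snd z) (snd z)) -` {0<..})
      \<inter> (?X \<inter> (\<lambda>z. gform c (fst z) (torient S (cinv c (fst z)) c) (snd z)) -` {0<..})"
    unfolding future_cone_def by auto
  then show ?thesis
    using continuous_open_preimage[OF 1 X open_greaterThan[of 0]] continuous_open_preimage[OF 2 X open_greaterThan[of 0]]
    by (simp only: open_Int)
qed

text \<open>A coordinate segment has constant velocity in coordinates, so it is a future directed causal
  curve once this velocity lies in the cones along the segment.\<close>

lemma segment_causal:
  assumes W: "open W" "convex W" and y: "y1 \<in> W" "y2 \<in> W"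
    and cone: "\<And>y. y \<in> W \<Longrightarrow> (y, y2 - y1) \<in> future_cone c"
  shows "(cinv c y1, cinv c y2) \<in> causal_rel S"
proof -
  define v where "v = y2 - y1"
  define l where "l t = y1 + t *\<^sub>R v" for t
  define I where "I = {t. l t \<in> W}"
  have WO: "W \<subseteq> snd c ` fst c" using cone unfolding future_cone_def by blast
  have lc: "continuous_on UNIV l" unfolding l_def by (intro continuous_intros)
  have l_open: "open {t. l t \<in> T}" if "open T" for T
    using open_vimage[OF that lc] by (simp add: vimage_def)
  have I: "open I" unfolding I_def by (rule l_open[OF W(1)])
  have I01: "{0..1} \<subseteq> I"
  proof
    fix t :: real assume "t \<in> {0..1}"
    then have "(1 - t) *\<^sub>R y1 + t *\<^sub>R y2 \<in> W" by (intro convexD[OF W(2) y]) auto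
    moreover have "(1 - t) *\<^sub>R y1 + t *\<^sub>R y2 = l t" by (simp add: l_def v_def algebra_simps)
    ultimately show "t \<in> I" by (simp add: I_def)
  qed
  let ?\<gamma> = "\<lambda>t. cinv c (l t)"
  have IO: "l t \<in> snd c ` fst c" if "t \<in> I" for t using that WO by (auto simp: I_def)
  have sm: "smooth_curve S I ?\<gamma>"
    unfolding smooth_curve_def smooth_on_def
  proof (intro conjI ballI allI)
    show "continuous_on I ?\<gamma>"
      by (rule continuous_on_compose2[OF cinv_continuous[OF c] continuous_on_subset[OF lc]]) (use IO in auto)
    fix d k assume d: "d \<in> atlas S"
    let ?T = "snd c ` (fst c \<inter> fst d)"
    have T: "open ?T" by (rule transition_open[OF c d])
    have Td: "l t \<in> ?T \<longleftrightarrow> l t \<in> snd c ` fst c \<and> ?\<gamma> t \<in> fst d" for t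
      using coord_image_iff[OF c, of "l t" "fst d"] by (simp add: Int_commute)
    have e: "{t \<in> I. ?\<gamma> t \<in> fst d} = I \<inter> {t. l t \<in> ?T}" using Td IO by auto
    have o: "open (I \<inter> {t. l t \<in> ?T})" by (rule open_Int[OF I l_open[OF T]])
    have "l = (\<lambda>t. y1 + t *\<^sub>R v)" by (simp add: l_def[abs_def])
    then have "Ck k (I \<inter> {t. l t \<in> ?T}) l"
      by (rule ssubst[where P="Ck k (I \<inter> {t. l t \<in> ?T})"]) (rule Ck_add[OF o Ck_const[OF o] Ck_linear[OF bounded_linear_scaleR_left o]])
    then show "Ck k {t \<in> I. ?\<gamma> t \<in> fst d} (\<lambda>t. snd d (?\<gamma> t))"
      unfolding e by (intro Ck_compose[OF o T _ transition_smooth[OF c d]]) auto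
  qed
  have vel: "velocity S ?\<gamma> t = tv c (?\<gamma> t) v" if t: "t \<in> I" for t
  proof (rule ext)
    fix d
    note cp = charts_at_cinv[OF IO[OF t]]
    show "velocity S ?\<gamma> t d = tv c (?\<gamma> t) v d"
    proof (cases "d \<in> charts_at S (?\<gamma> t)")
      case True
      have J: "((\<lambda>y. snd d (cinv c y)) has_derivative jac c d (?\<gamma> t)) (at (l t))"
        using jac_derivative[OF cp True] by (simp only: coord_cinv[OF c IO[OF t]])
      have L: "(l has_derivative (\<lambda>s. s *\<^sub>R v)) (at t)"
        unfolding l_def[abs_def] by (auto intro!: derivative_eq_intros)
      have "((\<lambda>u. snd d (?\<gamma> u)) has_derivative (\<lambda>s. jac c d (?\<gamma> t) (s *\<^sub>R v))) (at t)"
        by (rule has_derivative_compose[OF L J])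
      then have "((\<lambda>u. snd d (?\<gamma> u)) has_vector_derivative jac c d (?\<gamma> t) v) (at t)"
        unfolding has_vector_derivative_def by (simp only: linear_cmul[OF jac_linear[OF cp True]])
      then have "vector_derivative (\<lambda>u. snd d (?\<gamma> u)) (at t) = jac c d (?\<gamma> t) v"
        by (rule vector_derivative_at)
      then show ?thesis using True by (simp add: velocity_def tv_def)
    qed (simp add: velocity_def tv_def)
  qed
  have "future_causal S (?\<gamma> t) (velocity S ?\<gamma> t)" if "t \<in> {0..1}" for t
  proof -
    have t: "t \<in> I" using that I01 by blast
    have "(l t, v) \<in> future_cone c" using t cone unfolding I_def v_def by blast
    from future_cone_causal[OF this] show ?thesis unfolding vel[OF t] .
  qed
  then show ?thesis
    unfolding causal_rel_def mem_Collect_eq prod.case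
    by (intro exI[of _ ?\<gamma>] exI[of _ I] conjI I I01 sm ballI) (simp_all add: l_def v_def)
qed

end

text \<open>By openness of the cones, the directions near the time orientation at \<open>p\<close> stay future directed
  at all points near \<open>p\<close>. Starting a little to the past of \<open>p\<close> along the time orientation,
  straight segments therefore reach a neighbourhood of \<open>p\<close>; the same holds with future and past
  exchanged.\<close>

lemma causal_nbhd:
  obtains V q q' where "open V" "p \<in> V" "V \<subseteq> Jplus S {q}" "V \<subseteq> Jminus S {q'}"
proof -
  obtain c where c: "c \<in> atlas S" "p \<in> fst c" using chart_exists by blast
  define x \<tau> where "x = snd c p" and "\<tau> = torient S p c"
  obtain A A' where A: "open A" "open A'" "(x, \<tau>) \<in> A \<times> A'" "A \<times> A' \<subseteq> future_cone c"
    using open_prod_elim[OF future_cone_open[OF c(1)] torient_future_cone[OF c]] unfolding x_def \<tau>_def by blast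
  obtain e1 where e1: "e1 > 0" "ball x e1 \<subseteq> A" using A(1,3) open_contains_ball by blast
  obtain e2 where e2: "e2 > 0" "ball \<tau> e2 \<subseteq> A'" using A(2,3) open_contains_ball by blast
  \<comment> \<open>small enough for \<open>x \<plusminus> s \<tau>\<close> to stay in the ball on which the cones are controlled\<close>
  define s where "s = e1 / (norm \<tau> + 1)"
  have s: "s > 0" "norm (s *\<^sub>R \<tau>) < e1"
  proof -
    have n: "norm \<tau> + 1 > 0" using norm_ge_zero[of \<tau>] by linarith
    show "s > 0" unfolding s_def by (rule divide_pos_pos[OF e1(1) n])
    have "norm (s *\<^sub>R \<tau>) = e1 * norm \<tau> / (norm \<tau> + 1)" using e1(1) n by (simp add: s_def)
    also have "\<dots> < e1" using n e1(1) by (simp add: pos_divide_less_eq distrib_left)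
    finally show "norm (s *\<^sub>R \<tau>) < e1" .
  qed
  \<comment> \<open>the displacement is rescaled by \<open>1 / s\<close> in the direction, hence the radius \<open>s * e2\<close>\<close>
  let ?B = "ball x e1" and ?r = "min e1 (s * e2)"
  have r: "?r > 0" using e1 e2 s by simp
  have cone: "(y, s *\<^sub>R (\<tau> + (1 / s) *\<^sub>R d)) \<in> future_cone c" if "y \<in> ?B" "norm d < s * e2" for y d
  proof (rule future_cone_scale[OF c(1) _ s(1)])
    have "norm ((1 / s) *\<^sub>R d) < e2" using that(2) s(1) by (simp add: field_simps)
    then have "\<tau> + (1 / s) *\<^sub>R d \<in> ball \<tau> e2" by (simp add: dist_norm)
    then show "(y, \<tau> + (1 / s) *\<^sub>R d) \<in> future_cone c" using that(1) e1 e2 A(4) by blast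
  qed
  have sd: "s *\<^sub>R (\<tau> + (1 / s) *\<^sub>R d) = s *\<^sub>R \<tau> + d" for d using s(1) by (simp add: scaleR_add_right)
  define V where "V = fst c \<inter> snd c -` ball x ?r"
  define q q' where "q = cinv c (x - s *\<^sub>R \<tau>)" and "q' = cinv c (x + s *\<^sub>R \<tau>)"
  have pm: "x - s *\<^sub>R \<tau> \<in> ?B" "x + s *\<^sub>R \<tau> \<in> ?B" using s(2) by (simp_all add: dist_norm)
  have V: "open V" "p \<in> V"
    unfolding V_def using coord_preimage_open[OF c(1) open_ball] c(2) r by (auto simp: x_def)
  have mem: "snd c z \<in> ?B" "norm (snd c z - x) < s * e2" "norm (x - snd c z) < s * e2" "cinv c (snd c z) = z" if "z \<in> V" for z
    using that by (auto simp: V_def dist_norm norm_minus_commute cinv_coord[OF c(1)])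
  have "(q, z) \<in> causal_rel S" if z: "z \<in> V" for z
  proof -
    have "(cinv c (x - s *\<^sub>R \<tau>), cinv c (snd c z)) \<in> causal_rel S"
    proof (rule segment_causal[OF c(1) open_ball convex_ball pm(1) mem(1)[OF z]])
      fix y assume y: "y \<in> ?B"
      have e: "s *\<^sub>R \<tau> + (snd c z - x) = snd c z - (x - s *\<^sub>R \<tau>)" by simp
      show "(y, snd c z - (x - s *\<^sub>R \<tau>)) \<in> future_cone c"
        using cone[OF y mem(2)[OF z]] unfolding sd e .
    qed
    then show ?thesis by (simp only: q_def mem(4)[OF z])
  qed
  then have "V \<subseteq> Jplus S {q}" unfolding Jplus_def by blast
  moreover have "(z, q') \<in> causal_rel S" if z: "z \<in> V" for z
  proof -
    have "(cinv c (snd c z), cinv c (x + s *\<^sub>R \<tau>)) \<in> causal_rel S"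
    proof (rule segment_causal[OF c(1) open_ball convex_ball mem(1)[OF z] pm(2)])
      fix y assume y: "y \<in> ?B"
      have e: "s *\<^sub>R \<tau> + (x - snd c z) = x + s *\<^sub>R \<tau> - snd c z" by simp
      show "(y, x + s *\<^sub>R \<tau> - snd c z) \<in> future_cone c"
        using cone[OF y mem(3)[OF z]] unfolding sd e .
    qed
    then show ?thesis by (simp only: q'_def mem(4)[OF z])
  qed
  then have "V \<subseteq> Jminus S {q'}" unfolding Jminus_def by blast
  ultimately show ?thesis using that V by blast
qed

lemma compact_causal_cover:
  assumes "compact K"
  obtains T T' where "finite T" "Jplus S K \<subseteq> (\<Union>q\<in>T. Jplus S {q})" "finite T'" "Jminus S K \<subseteq> (\<Union>q\<in>T'. Jminus S {q})"
proof -
  have "\<forall>p. \<exists>V q q'. open V \<and> p \<in> V \<and> V \<subseteq> Jplus S {q} \<and> V \<subseteq> Jminus S {q'}"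
    by (metis causal_nbhd)
  from choice[OF this] obtain V where "\<forall>p. \<exists>q q'. open (V p) \<and> p \<in> V p \<and> V p \<subseteq> Jplus S {q} \<and> V p \<subseteq> Jminus S {q'}" ..
  from choice[OF this] obtain q where "\<forall>p. \<exists>q'. open (V p) \<and> p \<in> V p \<and> V p \<subseteq> Jplus S {q p} \<and> V p \<subseteq> Jminus S {q'}" ..
  from choice[OF this] obtain q' where V: "\<forall>p. open (V p) \<and> p \<in> V p \<and> V p \<subseteq> Jplus S {q p} \<and> V p \<subseteq> Jminus S {q' p}" ..
  have V1: "p \<in> V p" "open (V p)" "V p \<subseteq> Jplus S {q p}" "V p \<subseteq> Jminus S {q' p}" for p
    using spec[OF V, of p] by simp_all
  have cover: "K \<subseteq> (\<Union>p\<in>UNIV. V p)" using V1(1) by blast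
  obtain P where P: "finite P" "K \<subseteq> (\<Union>p\<in>P. V p)"
    by (rule compactE_image[OF assms V1(2) cover])
  have KP: "\<exists>p\<in>P. x \<in> V p" if "x \<in> K" for x using subsetD[OF P(2) that] by simp
  show ?thesis
  proof (rule that[of "q ` P" "q' ` P"])
    show "Jplus S K \<subseteq> (\<Union>q\<in>q ` P. Jplus S {q})"
    proof (rule Jplus_finite_cover, rule subsetI)
      fix x assume "x \<in> K"
      from KP[OF this] obtain p where "p \<in> P" "x \<in> V p" ..
      then show "x \<in> (\<Union>q\<in>q ` P. Jplus S {q})" using V1(3)[of p] by (intro UN_I[of "q p"]) auto
    qed
    show "Jminus S K \<subseteq> (\<Union>q\<in>q' ` P. Jminus S {q})"
    proof (rule Jminus_finite_cover, rule subsetI)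
      fix x assume "x \<in> K"
      from KP[OF this] obtain p where "p \<in> P" "x \<in> V p" ..
      then show "x \<in> (\<Union>q\<in>q' ` P. Jminus S {q})" using V1(4)[of p] by (intro UN_I[of "q' p"]) auto
    qed
  qed (use P(1) in auto)
qed

text \<open>Global hyperbolicity concerns diamonds of points. The future of a compact set is contained in
  the union of the futures of finitely many points, and likewise for the past, so a closed set
  between both lies in a finite union of diamonds.\<close>

lemma compact_in_diamond:
  assumes "globally_hyperbolic S" "compact K" "closed C" "C \<subseteq> Jplus S K" "C \<subseteq> Jminus S K"
  shows "compact C"
proof -
  obtain T T' where T: "finite T" "Jplus S K \<subseteq> (\<Union>q\<in>T. Jplus S {q})" "finite T'" "Jminus S K \<subseteq> (\<Union>q\<in>T'. Jminus S {q})"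
    by (rule compact_causal_cover[OF assms(2)])
  let ?D = "\<Union>q\<in>T. \<Union>q'\<in>T'. Jplus S {q} \<inter> Jminus S {q'}"
  have "compact (Jplus S {q} \<inter> Jminus S {q'})" for q q'
    using assms(1) unfolding globally_hyperbolic_def by blast
  then have D: "compact ?D" by (intro compact_UN T ballI)
  have CD: "C \<subseteq> ?D"
  proof
    fix x assume "x \<in> C"
    then obtain q q' where "q \<in> T" "x \<in> Jplus S {q}" "q' \<in> T'" "x \<in> Jminus S {q'}"
      using assms(4,5) T(2,4) by blast
    then show "x \<in> ?D" by blast
  qed
  have "C \<inter> ?D = C" using CD by blast
  then show ?thesis using closed_Int_compact[OF assms(3) D] by simp
qed

end

section \<open>The covariant pairing\<close>

lemma supp_zero: "p \<notin> supp \<phi> \<Longrightarrow> \<phi> (p, v) = 0"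
  using subsetD[OF closure_subset, of p "{p. \<exists>v. \<phi> (p, v) \<noteq> 0}"] unfolding supp_def by auto

lemma supp_subset: "closed C \<Longrightarrow> (\<And>p v. \<phi> (p, v) \<noteq> 0 \<Longrightarrow> p \<in> C) \<Longrightarrow> supp \<phi> \<subseteq> C"
  unfolding supp_def by (rule closure_minimal) auto

locale green_bundle = density_bundle S B D \<mu>
  for S :: "('m::t2_space, 'n::finite, 'f::real_vector, 'z) vbundle_scheme" and B D \<mu> +
  fixes DT Fp Fm :: "('m \<times> 'f \<Rightarrow> real) \<Rightarrow> 'm \<times> 'f \<Rightarrow> real"
  assumes ghs: "globally_hyperbolic_spacetime S" and transp: "transpose_operator S \<mu> D DT"
    and green_p: "green_operator S (Jplus S) DT Fp" and green_m: "green_operator S (Jminus S) DT Fm"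
begin

sublocale oriented_mfd S
  by unfold_locales (use ghs in \<open>simp add: globally_hyperbolic_spacetime_def\<close>)

abbreviation "F \<equiv> propagator Fp Fm"
abbreviation "\<Lambda> \<equiv> Lambda_cov S \<mu> F"

lemma Vcov_dual: "\<phi> \<in> Vcov S \<Longrightarrow> \<phi> \<in> dual_sections S" and Vcov_compact: "\<phi> \<in> Vcov S \<Longrightarrow> compact (supp \<phi>)"
  unfolding Vcov_def by auto

lemma VcovI: "\<phi> \<in> dual_sections S \<Longrightarrow> compact K \<Longrightarrow> (\<And>p v. p \<notin> K \<Longrightarrow> \<phi> (p, v) = 0) \<Longrightarrow> \<phi> \<in> Vcov S"
proof -
  assume d: "\<phi> \<in> dual_sections S" and K: "compact K" and z: "\<And>p v. p \<notin> K \<Longrightarrow> \<phi> (p, v) = 0"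
  have "supp \<phi> \<subseteq> K" by (rule supp_subset[OF compact_imp_closed[OF K]]) (use z in blast)
  moreover have "closed (supp \<phi>)" by (simp add: supp_def)
  ultimately have "compact (supp \<phi>)" using K by (metis closed_Int_compact inf.absorb1)
  with d show ?thesis by (simp add: Vcov_def)
qed

lemma Vcov_lin:
  assumes "\<phi> \<in> Vcov S" "\<psi> \<in> Vcov S"
  shows "(\<lambda>x. a * \<phi> x + \<psi> x) \<in> Vcov S"
proof (rule VcovI)
  show "(\<lambda>x. a * \<phi> x + \<psi> x) \<in> dual_sections S" by (rule dual_sections_lin) (use assms Vcov_dual in auto)
  show "compact (supp \<phi> \<union> supp \<psi>)" using assms Vcov_compact by blast
qed (simp add: supp_zero)

lemma Vcov_zero: "(\<lambda>x. 0) \<in> Vcov S"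
proof (rule VcovI[OF _ compact_empty])
  show "(\<lambda>x. 0) \<in> dual_sections S" 
    unfolding dual_sections_def using smooth_fun_const[OF frame_facts(1)]
    by (auto simp: linear_iff)
qed simp

lemma subspace_Vcov: "fs.subspace (Vcov S)"
  unfolding fs.subspace_def
proof (intro conjI ballI allI)
  show "0 \<in> Vcov S" using Vcov_zero by (simp add: zero_fun_def)
  fix u assume u: "u \<in> Vcov S"
  show "u + v \<in> Vcov S" if "v \<in> Vcov S" for v
    using Vcov_lin[OF u that, of 1] by (simp add: plus_fun_def)
  show "fscale c u \<in> Vcov S" for c using Vcov_lin[OF u Vcov_zero, of c] by simp
qed

context
  fixes J G assumes green: "green_operator S J DT G"
begin

lemma green_lin: "\<phi> \<in> Vcov S \<Longrightarrow> \<psi> \<in> Vcov S \<Longrightarrow> G (\<lambda>x. a * \<phi> x + \<psi> x) = (\<lambda>x. a * G \<phi> x + G \<psi> x)"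
  using conjunct1[OF green[unfolded green_operator_def]] by blast

lemma green_dual: "\<phi> \<in> Vcov S \<Longrightarrow> G \<phi> \<in> dual_sections S"
  using conjunct1[OF conjunct2[OF green[unfolded green_operator_def]]] by blast

lemma green_inverse: "\<phi> \<in> Vcov S \<Longrightarrow> DT (G \<phi>) = \<phi>" and green_supp: "\<phi> \<in> Vcov S \<Longrightarrow> supp (G \<phi>) \<subseteq> J (supp \<phi>)"
  using conjunct2[OF conjunct2[OF conjunct2[OF green[unfolded green_operator_def]]]] by blast+

end

lemma F_lin: "\<phi> \<in> Vcov S \<Longrightarrow> \<psi> \<in> Vcov S \<Longrightarrow> F (\<lambda>x. a * \<phi> x + \<psi> x) = (\<lambda>x. a * F \<phi> x + F \<psi> x)"
  unfolding propagator_def by (simp only: green_lin[OF green_p] green_lin[OF green_m]) (simp add: algebra_simps)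

lemma F_dual: "\<phi> \<in> Vcov S \<Longrightarrow> F \<phi> \<in> dual_sections S"
  using dual_sections_lin[OF green_dual[OF green_m] green_dual[OF green_p], of \<phi> \<phi> "-1"]
  by (simp add: propagator_def)

lemma shs_outside: "p \<notin> supp \<phi> \<Longrightarrow> shs \<phi> p = 0"
  by (rule shs_zero) (rule supp_zero)

lemma pairing_integrable:
  assumes \<alpha>: "\<alpha> \<in> dual_sections S" and s: "smooth_section S UNIV s" and K: "compact K" "\<And>p. p \<notin> K \<Longrightarrow> s p = 0"
  shows "integrable \<mu> (\<lambda>p. \<alpha> (p, s p))"
proof (rule integrable_compact_support[OF _ K(1)])
  show "smooth_fun S UNIV (\<lambda>p. \<alpha> (p, s p))"
    using h_smooth[OF open_UNIV shs_smooth[OF \<alpha>] s] by (simp only: h_shs[OF \<alpha>])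
  show "\<alpha> (p, s p) = 0" if "p \<notin> K" for p using K(2)[OF that] linear_0[OF dual_linear[OF \<alpha>]] by simp
qed

lemma \<Lambda>_eq: "\<Lambda> \<phi> \<psi> = (\<integral>p. F \<phi> (p, shs \<psi> p) \<partial>\<mu>)"
  by (simp only: Lambda_cov_def dual_metric_def shs_def)

lemma \<Lambda>_integrable:
  assumes "\<phi> \<in> Vcov S" "\<psi> \<in> Vcov S"
  shows "integrable \<mu> (\<lambda>p. F \<phi> (p, shs \<psi> p))"
  by (rule pairing_integrable[OF F_dual[OF assms(1)] shs_smooth[OF Vcov_dual[OF assms(2)]] Vcov_compact[OF assms(2)] shs_outside])

lemma \<Lambda>_lin_left:
  assumes "\<phi> \<in> Vcov S" "\<psi> \<in> Vcov S" "\<omega> \<in> Vcov S"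
  shows "\<Lambda> (\<lambda>x. a * \<phi> x + \<psi> x) \<omega> = a * \<Lambda> \<phi> \<omega> + \<Lambda> \<psi> \<omega>"
  unfolding \<Lambda>_eq F_lin[OF assms(1,2)]
  using \<Lambda>_integrable[OF assms(1,3)] \<Lambda>_integrable[OF assms(2,3)] by simp

lemma \<Lambda>_lin_right:
  assumes "\<phi> \<in> Vcov S" "\<psi> \<in> Vcov S" "\<omega> \<in> Vcov S"
  shows "\<Lambda> \<omega> (\<lambda>x. a * \<phi> x + \<psi> x) = a * \<Lambda> \<omega> \<phi> + \<Lambda> \<omega> \<psi>"
proof -
  note lin = dual_linear[OF F_dual[OF assms(3)]]
  have "F \<omega> (p, shs (\<lambda>x. a * \<phi> x + \<psi> x) p) = a * F \<omega> (p, shs \<phi> p) + F \<omega> (p, shs \<psi> p)" for p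
    unfolding shs_lin[OF Vcov_dual[OF assms(1)] Vcov_dual[OF assms(2)]]
    using linear_add[OF lin] linear_cmul[OF lin] by simp
  then show ?thesis
    unfolding \<Lambda>_eq using \<Lambda>_integrable[OF assms(3,1)] \<Lambda>_integrable[OF assms(3,2)] by simp
qed

text \<open>At every point either \<open>\<psi>\<close> or \<open>F \<phi>\<close> vanishes.\<close>

lemma \<Lambda>_spacelike:
  assumes sl: "spacelike S U U'" and \<phi>: "\<phi> \<in> Vcov S" "supp \<phi> \<subseteq> U" and \<psi>: "\<psi> \<in> Vcov S" "supp \<psi> \<subseteq> U'"
  shows "\<Lambda> \<phi> \<psi> = 0"
proof -
  have "F \<phi> (p, shs \<psi> p) = 0" for p
  proof (cases "p \<in> supp \<psi>")
    case True
    then have "p \<notin> Jplus S U" "p \<notin> Jminus S U" using \<psi>(2) sl unfolding spacelike_def by blast+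
    then have "p \<notin> supp (Fp \<phi>)" "p \<notin> supp (Fm \<phi>)"
      using green_supp[OF green_p \<phi>(1)] green_supp[OF green_m \<phi>(1)] Jplus_mono[OF \<phi>(2)] Jminus_mono[OF \<phi>(2)] by blast+
    then show ?thesis by (simp add: propagator_def supp_zero)
  next
    case False
    then show ?thesis using linear_0[OF dual_linear[OF F_dual[OF \<phi>(1)]]] by (simp add: shs_outside)
  qed
  then show ?thesis by (simp add: \<Lambda>_eq)
qed

text \<open>The potential is \<open>Fp \<phi> = Fm \<phi>\<close>, whose support lies both in the future and in the past of
  \<open>supp \<phi>\<close>.\<close>

lemma kernel_potential:
  assumes \<phi>: "\<phi> \<in> Vcov S" and ker: "F \<phi> = (\<lambda>_. 0)"
  obtains \<omega> where "\<omega> \<in> Vcov S" "DT \<omega> = \<phi>"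
proof -
  have e: "Fp \<phi> = Fm \<phi>" using ker by (simp add: propagator_def fun_eq_iff)
  have "compact (supp (Fp \<phi>))"
  proof (rule compact_in_diamond[OF _ Vcov_compact[OF \<phi>]])
    show "globally_hyperbolic S" using ghs by (simp add: globally_hyperbolic_spacetime_def)
    show "closed (supp (Fp \<phi>))" by (simp add: supp_def)
    show "supp (Fp \<phi>) \<subseteq> Jplus S (supp \<phi>)" by (rule green_supp[OF green_p \<phi>])
    show "supp (Fp \<phi>) \<subseteq> Jminus S (supp \<phi>)" unfolding e by (rule green_supp[OF green_m \<phi>])
  qed
  then have "Fp \<phi> \<in> Vcov S" using green_dual[OF green_p \<phi>] by (simp add: Vcov_def)
  then show ?thesis using that green_inverse[OF green_p \<phi>] by blast
qed

text \<open>The defining relation of the transposed operator, for sections vanishing outside of a given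
  compact set.\<close>

lemma transpose_pairing:
  assumes "\<alpha> \<in> dual_sections S" and u: "smooth_section S UNIV u" and K: "compact K" "\<And>p. p \<notin> K \<Longrightarrow> u p = 0"
  shows "(\<integral>p. DT \<alpha> (p, u p) \<partial>\<mu>) = (\<integral>p. \<alpha> (p, D u p) \<partial>\<mu>)"
proof -
  have "closure {p. u p \<noteq> 0} \<subseteq> K" by (rule closure_minimal) (use K compact_imp_closed in auto)
  then have "compact (closure {p. u p \<noteq> 0})"
    using closed_Int_compact[OF closed_closure K(1), of "{p. u p \<noteq> 0}"] by (simp only: inf.absorb1)
  then show ?thesis
    using transp assms(1) u unfolding transpose_operator_def by blast
qed

text \<open>With a potential \<open>\<omega>\<close> for \<open>\<phi>\<close>, the operator is moved to \<open>F \<psi>\<close>, where it gives \<open>\<psi> - \<psi>\<close>. As \<open>F \<psi>\<close>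
  need not have compact support, it is first multiplied with a cutoff function \<open>\<rho>\<close> equal to 1 on
  the supports of \<open>\<phi>\<close> and \<open>\<omega>\<close>; afterwards \<open>D\<close> acts on \<open>\<omega>\<^sup>\<sharp>\<close>, which is compactly supported itself,
  and \<open>\<rho>\<close> can be dropped.\<close>

lemma \<Lambda>_kernel_right:
  assumes \<phi>: "\<phi> \<in> Vcov S" and ker: "F \<phi> = (\<lambda>_. 0)" and \<psi>: "\<psi> \<in> Vcov S"
  shows "\<Lambda> \<psi> \<phi> = 0"
proof -
  obtain \<omega> where \<omega>: "\<omega> \<in> Vcov S" "DT \<omega> = \<phi>" by (rule kernel_potential[OF \<phi> ker])
  note \<omega>d = Vcov_dual[OF \<omega>(1)] and \<phi>d = Vcov_dual[OF \<phi>] and \<psi>d = Vcov_dual[OF \<psi>]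
  note \<alpha>d = F_dual[OF \<psi>]
  let ?\<alpha> = "F \<psi>" and ?u = "shs \<omega>" and ?K = "supp \<omega>"
  note us = shs_smooth[OF \<omega>d] and as = shs_smooth[OF \<alpha>d]
  have K: "compact ?K" by (rule Vcov_compact[OF \<omega>(1)])
  have u0: "?u p = 0" if "p \<notin> ?K" for p by (rule shs_outside[OF that])
  have Du0: "D ?u p = 0" if "p \<notin> ?K" for p using that by (intro D_outside[OF us as K] u0)
  have "compact (supp \<phi> \<union> ?K)" using Vcov_compact[OF \<phi>] K by blast
  then obtain \<rho> L where \<rho>: "smooth_fun S UNIV \<rho>" "\<And>q. q \<in> supp \<phi> \<union> ?K \<Longrightarrow> \<rho> q = 1" "compact L" "\<And>q. q \<notin> L \<Longrightarrow> \<rho> q = 0"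
    using smooth_cutoff_compact by blast
  let ?v = "\<lambda>p. \<rho> p *\<^sub>R shs ?\<alpha> p"
  have vs: "smooth_section S UNIV ?v" by (rule smooth_section_scale[OF open_UNIV \<rho>(1) as])
  have "\<Lambda> \<psi> \<phi> = (\<integral>p. \<phi> (p, shs ?\<alpha> p) \<partial>\<mu>)"
    unfolding \<Lambda>_eq
    by (rule Bochner_Integration.integral_cong[OF refl])
       (simp only: h_shs[OF \<alpha>d, symmetric] h_shs[OF \<phi>d, symmetric], rule h_sym)
  also have "\<dots> = (\<integral>p. DT \<omega> (p, ?v p) \<partial>\<mu>)"
  proof (rule Bochner_Integration.integral_cong[OF refl])
    fix p
    show "\<phi> (p, shs ?\<alpha> p) = DT \<omega> (p, ?v p)"
      unfolding \<omega>(2) by (cases "p \<in> supp \<phi>") (simp_all add: \<rho>(2) supp_zero)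
  qed
  also have "\<dots> = (\<integral>p. \<omega> (p, D ?v p) \<partial>\<mu>)"
    by (rule transpose_pairing[OF \<omega>d vs \<rho>(3)]) (simp add: \<rho>(4))
  also have "\<dots> = (\<integral>p. h p (?u p) (D ?v p) \<partial>\<mu>)" by (simp only: h_shs[OF \<omega>d])
  also have "\<dots> = (\<integral>p. h p (D ?u p) (?v p) \<partial>\<mu>)"
    by (rule D_formally_selfadjoint[OF vs us K u0, symmetric])
  also have "\<dots> = (\<integral>p. ?\<alpha> (p, D ?u p) \<partial>\<mu>)"
  proof (rule Bochner_Integration.integral_cong[OF refl])
    fix p
    show "h p (D ?u p) (?v p) = ?\<alpha> (p, D ?u p)"
    proof (cases "p \<in> ?K")
      case True
      then have "?v p = shs ?\<alpha> p" by (simp add: \<rho>(2))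
      then show ?thesis by (simp only: h_sym[of p "D ?u p"] h_shs[OF \<alpha>d])
    next
      case False
      then have "D ?u p = 0" by (rule Du0)
      then show ?thesis by (simp add: linear_0[OF h_linear_left] linear_0[OF dual_linear[OF \<alpha>d]])
    qed
  qed
  also have "\<dots> = (\<integral>p. Fp \<psi> (p, D ?u p) \<partial>\<mu>) - (\<integral>p. Fm \<psi> (p, D ?u p) \<partial>\<mu>)"
  proof -
    have "integrable \<mu> (\<lambda>p. \<alpha> (p, D ?u p))" if "\<alpha> \<in> dual_sections S" for \<alpha>
      by (rule pairing_integrable[OF that D_smooth[OF us] K]) (rule Du0)
    from this[OF green_dual[OF green_p \<psi>]] this[OF green_dual[OF green_m \<psi>]]
    show ?thesis unfolding propagator_def by (rule Bochner_Integration.integral_diff)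
  qed
  also have "\<dots> = (\<integral>p. \<psi> (p, ?u p) \<partial>\<mu>) - (\<integral>p. \<psi> (p, ?u p) \<partial>\<mu>)"
  proof -
    have t: "(\<integral>p. \<alpha> (p, D ?u p) \<partial>\<mu>) = (\<integral>p. DT \<alpha> (p, ?u p) \<partial>\<mu>)" if "\<alpha> \<in> dual_sections S" for \<alpha>
      by (rule transpose_pairing[OF that us K u0, symmetric])
    show ?thesis
      unfolding t[OF green_dual[OF green_p \<psi>]] t[OF green_dual[OF green_m \<psi>]]
        green_inverse[OF green_p \<psi>] green_inverse[OF green_m \<psi>] ..
  qed
  finally show ?thesis by simp
qed

definition kernel :: "('m \<times> 'f \<Rightarrow> real) set" where
  "kernel = {\<phi> \<in> Vcov S. F \<phi> = (\<lambda>_. 0)}"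

lemma subspace_kernel: "fs.subspace kernel"
  unfolding fs.subspace_def
proof (intro conjI ballI allI)
  have F0: "F (\<lambda>x. 0) = (\<lambda>_. 0)"
    using F_lin[OF Vcov_zero Vcov_zero, of "-1"] by simp
  then show "0 \<in> kernel" using Vcov_zero by (simp add: zero_fun_def kernel_def)
  fix u assume u: "u \<in> kernel"
  then have uV: "u \<in> Vcov S" and Fu: "F u = (\<lambda>_. 0)" by (auto simp: kernel_def)
  show "u + v \<in> kernel" if "v \<in> kernel" for v
  proof -
    have vV: "v \<in> Vcov S" and Fv: "F v = (\<lambda>_. 0)" using that by (auto simp: kernel_def)
    show ?thesis using F_lin[OF uV vV, of 1] Vcov_lin[OF uV vV, of 1] by (simp add: kernel_def Fu Fv plus_fun_def)
  qed
  show "fscale c u \<in> kernel" for c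
    using F_lin[OF uV Vcov_zero, of c] Vcov_lin[OF uV Vcov_zero, of c] by (simp add: kernel_def Fu F0)
qed

sublocale cov: null_space "Vcov S" \<Lambda> kernel
proof
  show "fs.subspace (Vcov S)" by (rule subspace_Vcov)
  show "kernel \<subseteq> Vcov S" by (auto simp: kernel_def)
next
  fix v w assume "v \<in> kernel" "w \<in> Vcov S"
  then show "\<Lambda> v w = 0" "\<Lambda> w v = 0"
    by (simp add: \<Lambda>_eq kernel_def, intro \<Lambda>_kernel_right) (auto simp: kernel_def)
next
  have z: "\<Lambda> (\<lambda>x. 0) w = 0" "\<Lambda> w (\<lambda>x. 0) = 0" if "w \<in> Vcov S" for w
    using \<Lambda>_lin_left[OF Vcov_zero Vcov_zero that, of "-1"] \<Lambda>_lin_right[OF Vcov_zero Vcov_zero that, of "-1"] by simp_all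
  fix u v w a assume V: "v \<in> Vcov S" "w \<in> Vcov S"
  show "\<Lambda> (u + v) w = \<Lambda> u w + \<Lambda> v w" "\<Lambda> w (u + v) = \<Lambda> w u + \<Lambda> w v" if "u \<in> Vcov S"
    using \<Lambda>_lin_left[OF that V, of 1] \<Lambda>_lin_right[OF that V, of 1] by (simp_all add: plus_fun_def)
  show "\<Lambda> (fscale a v) w = a * \<Lambda> v w" "\<Lambda> w (fscale a v) = a * \<Lambda> w v"
    using \<Lambda>_lin_left[OF V(1) Vcov_zero V(2), of a] \<Lambda>_lin_right[OF V(1) Vcov_zero V(2), of a] z[OF V(2)] by simp_all
qed

end

section \<open>The local algebras\<close>

lemma poisson_generated_mono:
  assumes "G \<subseteq> G'"
  shows "poisson_generated P G \<subseteq> poisson_generated P G'"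
proof
  fix a assume "a \<in> poisson_generated P G"
  then show "a \<in> poisson_generated P G'"
    by induction (use assms in \<open>auto intro: poisson_generated.intros\<close>)
qed

lemma star_generated_mono:
  assumes "G \<subseteq> G'"
  shows "star_generated W G \<subseteq> star_generated W G'"
proof
  fix a assume "a \<in> star_generated W G"
  then show "a \<in> star_generated W G'"
    by induction (use assms in \<open>auto intro: star_generated.intros\<close>)
qed

lemma local_cl_mono: "U \<subseteq> U' \<Longrightarrow> local_cl S \<mu> F U \<subseteq> local_cl S \<mu> F U'"
  unfolding local_cl_def pre_local_cl_def by (intro image_mono poisson_generated_mono) auto

lemma local_alg_mono: "U \<subseteq> U' \<Longrightarrow> local_alg S \<mu> F R hbar U \<subseteq> local_alg S \<mu> F R hbar U'"
  unfolding local_alg_def pre_local_def by (intro image_mono star_generated_mono) auto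

lemma weyl_algebra_simps:
  fixes V :: "('x \<Rightarrow> complex) set"
  shows "carrier (weyl_algebra V \<P> \<Lambda> R hbar) = sym_span V" "\<one>\<^bsub>weyl_algebra V \<P> \<Lambda> R hbar\<^esub> = tens []"
    "\<zero>\<^bsub>weyl_algebra V \<P> \<Lambda> R hbar\<^esub> = 0" "a \<oplus>\<^bsub>weyl_algebra V \<P> \<Lambda> R hbar\<^esub> b = a + b"
    "a \<otimes>\<^bsub>weyl_algebra V \<P> \<Lambda> R hbar\<^esub> b
       = star_series (\<lambda>k. 1 / fact k * (\<i> * complex_of_real hbar / 2) ^ k) (contraction V \<Lambda>) a b"
    "z \<odot>\<^bsub>weyl_algebra V \<P> \<Lambda> R hbar\<^esub> a = fscale z a" "invol (weyl_algebra V \<P> \<Lambda> R hbar) a = (\<lambda>xs. cnj (a xs))"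
  by (simp_all add: weyl_algebra_def sym_alg_eq_span star_series_def zero_fun_def plus_fun_def)

context green_bundle
begin

definition test_sections :: "'m set \<Rightarrow> ('m \<times> 'f \<Rightarrow> real) set" where
  "test_sections U = {\<phi> \<in> Vcov S. supp \<phi> \<subseteq> U}"

lemma test_sections_Vcov: "test_sections U \<subseteq> Vcov S"
  by (auto simp: test_sections_def)

lemma kernel_ideal_eq: "kernel_ideal S \<mu> F = sym_ideal (Vcov S) kernel"
proof -
  have "{tens [\<phi>] | \<phi>. \<phi> \<in> Vcov S \<and> F \<phi> = (\<lambda>_. 0)} = {tens [v] | v. v \<in> kernel}"
    by (simp add: kernel_def)
  then show ?thesis
    unfolding kernel_ideal_def cov_poisson_def using genideal_sym_poisson[OF cov.N_V] by simp
qed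

lemma pre_local_cl_subset: "pre_local_cl S \<mu> F U \<subseteq> sym_span (test_sections U)"
  unfolding pre_local_cl_def cov_poisson_def
  by (rule cov.poisson_generated_subset[OF test_sections_Vcov])
     (auto simp: sym_poisson_simps test_sections_def intro: tens_single_sym_span)

text \<open>The classical part of locality: the generators of both algebras are orthogonal for \<open>\<Lambda>\<close>, and the
  kernel ideal is generated by a null space of \<open>\<Lambda>\<close>.\<close>

theorem local_cl_spacelike:
  assumes "spacelike S U U'" "X \<in> local_cl S \<mu> F U" "Y \<in> local_cl S \<mu> F U'"
  shows "cov_bracket S \<mu> F X Y = \<zero>\<^bsub>cov_quot_cl S \<mu> F\<^esub>"
proof -
  let ?P = "cov_poisson S \<mu> F" and ?I = "sym_ideal (Vcov S) kernel"
  obtain a b where a: "a \<in> sym_span (test_sections U)" "X = ?I +>\<^bsub>?P\<^esub> a"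
    and b: "b \<in> sym_span (test_sections U')" "Y = ?I +>\<^bsub>?P\<^esub> b"
    using assms(2,3) pre_local_cl_subset unfolding local_cl_def kernel_ideal_eq by blast
  have "rcoset_bracket ?P ?I (?I +>\<^bsub>?P\<^esub> a) (?I +>\<^bsub>?P\<^esub> b) = ?I"
  proof (rule cov.rcoset_bracket_zero[OF test_sections_Vcov a(1) test_sections_Vcov b(1)])
    fix v w assume "v \<in> test_sections U" "w \<in> test_sections U'"
    then show "\<Lambda> v w = 0" using \<Lambda>_spacelike[OF assms(1)] by (auto simp: test_sections_def)
  qed (simp_all add: cov_poisson_def sym_poisson_simps)
  then show ?thesis
    unfolding a(2) b(2) by (simp add: cov_bracket_def kernel_ideal_eq cov_quot_cl_def FactRing_def)
qed

lemma cplx_test_sections_Vcov: "cplx ` test_sections U \<subseteq> complexify (Vcov S)"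
  using test_sections_Vcov[of U] Vcov_zero by (auto simp: complexify_def)

lemma pre_local_subset: "pre_local S \<mu> F R hbar U \<subseteq> sym_span (cplx ` test_sections U)"
proof -
  interpret cplx: null_space "complexify (Vcov S)" "complexify_form \<Lambda>" "complexify kernel"
    by (rule null_space_complexify[OF cov.null_space_axioms])
  interpret weyl_form "complexify (Vcov S)" "complexify_form \<Lambda>"
    "\<lambda>k. 1 / fact k * (\<i> * complex_of_real hbar / 2) ^ k" by unfold_locales
  show ?thesis
    unfolding pre_local_def cov_weyl_def
    by (rule star_generated_subset[OF cplx_test_sections_Vcov])
       (auto simp: weyl_algebra_simps test_sections_def intro: tens_single_sym_span)
qed

text \<open>The generators of the local algebras are real sections, so this reduces their orthogonality for
  the complexified form to the real case.\<close>

lemma complexify_form_cplx: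
  assumes "v \<in> Vcov S" "w \<in> Vcov S"
  shows "complexify_form \<Lambda> (cplx v) (cplx w) = complex_of_real (\<Lambda> v w)"
  using cov.zero_left[OF assms(2)] cov.zero_right[OF assms(1)] cov.zero_left[OF subspace_Vcov[THEN fs.subspace_0]]
  unfolding zero_fun_def by (simp add: complexify_form_def complex_eq_iff)

theorem local_alg_spacelike:
  assumes sl: "spacelike S U U'" and X: "X \<in> local_alg S \<mu> F R hbar U" and Y: "Y \<in> local_alg S \<mu> F R hbar U'"
  shows "X \<otimes>\<^bsub>cov_quot S \<mu> F R hbar\<^esub> Y \<ominus>\<^bsub>cov_quot S \<mu> F R hbar\<^esub> Y \<otimes>\<^bsub>cov_quot S \<mu> F R hbar\<^esub> X
    = \<zero>\<^bsub>cov_quot S \<mu> F R hbar\<^esub>"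
proof -
  let ?W = "cov_weyl S \<mu> F R hbar" and ?I = "sym_ideal (complexify (Vcov S)) (complexify kernel)"
  have I: "complexify (kernel_ideal S \<mu> F) = ?I"
    unfolding kernel_ideal_eq by (rule complexify_sym_ideal[OF subspace_Vcov subspace_kernel cov.N_V])
  obtain a b where a: "a \<in> sym_span (cplx ` test_sections U)" "X = ?I +>\<^bsub>?W\<^esub> a"
    and b: "b \<in> sym_span (cplx ` test_sections U')" "Y = ?I +>\<^bsub>?W\<^esub> b"
    using X Y pre_local_subset unfolding local_alg_def I by blast
  have orth: "complexify_form \<Lambda> v w = 0"
    if AB: "spacelike S A B" and vw: "v \<in> cplx ` test_sections A" "w \<in> cplx ` test_sections B" for v w A B
  proof -
    obtain \<phi> \<psi> where e: "v = cplx \<phi>" "w = cplx \<psi>" and m: "\<phi> \<in> test_sections A" "\<psi> \<in> test_sections B"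
      using vw by blast
    have "\<Lambda> \<phi> \<psi> = 0" using m \<Lambda>_spacelike[OF AB] by (auto simp: test_sections_def)
    then show ?thesis
      using complexify_form_cplx[of \<phi> \<psi>] m test_sections_Vcov unfolding e by auto
  qed
  show ?thesis
    unfolding cov_quot_def I a(2) b(2)
  proof (rule star_commute_mod_null_ideal[OF null_space_complexify[OF cov.null_space_axioms]
        cplx_test_sections_Vcov a(1) cplx_test_sections_Vcov b(1)])
    fix v w assume "v \<in> cplx ` test_sections U" "w \<in> cplx ` test_sections U'"
    then show "complexify_form \<Lambda> v w = 0" "complexify_form \<Lambda> w v = 0"
      using orth sl spacelike_sym[OF sl] by blast+
  qed (simp_all only: cov_weyl_def weyl_algebra_simps)
qed

end

theorem proposition6p16:
  fixes S :: "('m::{t2_space,second_countable_topology}, 'n::finite, 'f::real_vector) vbundle"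
    and B :: "'m \<Rightarrow> 'f \<Rightarrow> 'f"
    and D :: "('m \<Rightarrow> 'f) \<Rightarrow> 'm \<Rightarrow> 'f"
    and DT Fp Fm F :: "('m \<times> 'f \<Rightarrow> real) \<Rightarrow> 'm \<times> 'f \<Rightarrow> real"
    and \<mu> :: "'m measure"
    and R hbar :: real
    and U U' :: "'m set"
  assumes "globally_hyperbolic_spacetime S"
    and "metric_density S \<mu>"
    and "metric_vector_bundle S"
    and "selfadjoint_endo S B"
    and "dalembert_plus S B D"
    and "transpose_operator S \<mu> D DT"
    and "green_operator S (Jplus S) DT Fp"
    and "green_operator S (Jminus S) DT Fm"
    and "F = propagator Fp Fm"
    and "R \<ge> 1 / 2"
    and "open U" and "open U'"
  shows
    "(spacelike S U U' \<longrightarrow>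
        (\<forall>X\<in>local_cl S \<mu> F U. \<forall>Y\<in>local_cl S \<mu> F U'.
           cov_bracket S \<mu> F X Y = \<zero>\<^bsub>cov_quot_cl S \<mu> F\<^esub>) \<and>
        (\<forall>X\<in>local_alg S \<mu> F R hbar U. \<forall>Y\<in>local_alg S \<mu> F R hbar U'.
           X \<otimes>\<^bsub>cov_quot S \<mu> F R hbar\<^esub> Y \<ominus>\<^bsub>cov_quot S \<mu> F R hbar\<^esub> Y \<otimes>\<^bsub>cov_quot S \<mu> F R hbar\<^esub> X
             = \<zero>\<^bsub>cov_quot S \<mu> F R hbar\<^esub>)) \<and>
     (U \<subseteq> U' \<longrightarrow>
        local_cl S \<mu> F U \<subseteq> local_cl S \<mu> F U' \<and>
        local_alg S \<mu> F R hbar U \<subseteq> local_alg S \<mu> F R hbar U') \<and>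
     ((\<Union>V\<in>{V. open V}. local_cl S \<mu> F V) = local_cl S \<mu> F UNIV \<and>
        (\<Union>V\<in>{V. open V}. local_alg S \<mu> F R hbar V) = local_alg S \<mu> F R hbar UNIV)"
proof -
  have "green_bundle S B D \<mu> DT Fp Fm"
    by unfold_locales (use assms in \<open>simp_all add: globally_hyperbolic_spacetime_def\<close>)
  then interpret green_bundle S B D \<mu> DT Fp Fm .
  note F = \<open>F = propagator Fp Fm\<close>
  have 1: "\<forall>X\<in>local_cl S \<mu> F U. \<forall>Y\<in>local_cl S \<mu> F U'. cov_bracket S \<mu> F X Y = \<zero>\<^bsub>cov_quot_cl S \<mu> F\<^esub>"
    if "spacelike S U U'"
    unfolding F by (intro ballI local_cl_spacelike[OF that])
  have 2: "\<forall>X\<in>local_alg S \<mu> F R hbar U. \<forall>Y\<in>local_alg S \<mu> F R hbar U'.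
      X \<otimes>\<^bsub>cov_quot S \<mu> F R hbar\<^esub> Y \<ominus>\<^bsub>cov_quot S \<mu> F R hbar\<^esub> Y \<otimes>\<^bsub>cov_quot S \<mu> F R hbar\<^esub> X
        = \<zero>\<^bsub>cov_quot S \<mu> F R hbar\<^esub>" if "spacelike S U U'"
    unfolding F by (intro ballI local_alg_spacelike[OF that])
  have 3: "(\<Union>V\<in>{V. open V}. local_cl S \<mu> F V) = local_cl S \<mu> F UNIV"
    by (intro subset_antisym UN_least local_cl_mono subset_UNIV UN_upper) simp
  have 4: "(\<Union>V\<in>{V. open V}. local_alg S \<mu> F R hbar V) = local_alg S \<mu> F R hbar UNIV"
    by (intro subset_antisym UN_least local_alg_mono subset_UNIV UN_upper) simp
  show ?thesis
    by (intro conjI impI 1 2 3 4 local_cl_mono local_alg_mono)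
qed

end
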